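(* Let $(R,\mu)$ and $(S,\nu)$ be two (possibly different) nonatomic probability measure spaces, let $p\in(0,\infty)$ and $(b_1,b_2)\in\mathcal B_p$. Let $X(R,\mu)$ and $Y(S,\nu)$ be rearrangement-invariant quasi-Banach function spaces that are $p$-convex. The following four statements are equivalent. (i) Every $(p,b_1,b_2)$-gaussible operator $T$ is bounded from $X(R,\mu)$ to $Y(S,\nu)$. (ii) Every operator $T$ defined on $L^p(R,\mu)$ having values in $\mathcal M(S,\nu)$ that satisfies $$K(Tf,t;L^{p,b_1},L^{\infty,b_2})\lesssim K(f,t;L^p,L^\infty)\quad\text{for every } f\in L^p(R,\mu)\text{ and } t\in(0,1)$$ (with a multiplicative constant independent of $f$ and $t$) is bounded from $X(R,\mu)$ to $Y(S,\nu)$. (iii) The operators $U_{b_1,b_2,p}$ and $S_{b_1,p}$ are bounded from $X(0,1)$ to $Y(0,1)$. (iv) The operator $T_{b_1,b_2,p}$ is bounded from $\big(X_Y\big)$ to $\big(X_X\big)$, where $X_Y=\big(Y^{\frac1p}\big)'(0,1)$ and $X_X=\big(X^{\frac1p}\big)'(0,1)$.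
   Context: Functions and rearrangements. $\mathcal M(R,\mu)$ is the set of $\mu$-measurable complex-valued functions on $R$ (identified when equal a.e.); $\mathcal M_+(R,\mu)$ its nonnegative members; $(0,1)$ carries Lebesgue measure. For $f\in\mathcal M(R,\mu)$, $f^*(t)=\inf\{\lambda\in(0,\infty):\mu(\{x\in R:|f(x)|>\lambda\})\le t\}$, $t\in(0,1)$; similarly on other measure spaces. $P\lesssim Q$ means $P\le cQ$ with a constant $c>0$ independent of the appropriate quantities (here functions and $t$); $P\approx Q$ means $P\lesssim Q$ and $Q\lesssim P$. R.i. spaces. A functional $\|\cdot\|_{X(0,1)}\colon\mathcal M_+(0,1)\to[0,\infty]$ is a rearrangement-invariant (r.i.) Banach function norm if for all $f,g,f_k\in\mathcal M_+(0,1)$ and $\lambda\ge0$: (P1) $\|f\|=0$ iff $f=0$ a.e., $\|\lambda f\|=\lambda\|f\|$, $\|f+g\|\le\|f\|+\|g\|$; (P2) $f\le g$ a.e. implies $\|f\|\le\|g\|$; (P3) $f_k\nearrow f$ a.e. implies $\|f_k\|\nearrow\|f\|$; (P4) $\|1\|<\infty$; (P5) $\int_0^1 f\le C_X\|f\|$ with $C_X$ independent of $f$; (P6) $f^*=g^*$ implies $\|f\|=\|g\|$. It is an r.i. quasi-Banach function norm if it satisfies (P2), (P3), (P4), (P6) and (P1) with the triangle inequality replaced by $\|f+g\|\le C(\|f\|+\|g\|)$ for some constant $C\ge1$ ((P5) not required). Given such a functional, $\|f\|_{X(R,\mu)}=\|f^*\|_{X(0,1)}$ for $f\in\mathcal M(R,\mu)$,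 and $X(R,\mu)=\{f\in\mathcal M(R,\mu):\|f\|_{X(R,\mu)}<\infty\}$ is the corresponding r.i. (quasi-)Banach function space; $X(0,1)$ is its representation space. "Let $X(R,\mu)$ be an r.i. quasi-Banach function space" means: let $\|\cdot\|_{X(0,1)}$ be an r.i. quasi-Banach function norm and $X(R,\mu)$ the corresponding space. The associate norm is $\|f\|_{X'(0,1)}=\sup\{\int_0^1 fg: g\in\mathcal M_+(0,1),\ \|g\|_{X(0,1)}\le1\}$, with corresponding space $X'(0,1)$. $X$ is $p$-convex if $\|f\|_{X^{1/p}(0,1)}=\|f^{1/p}\|_{X(0,1)}^p$, $f\in\mathcal M_+(0,1)$, is an r.i. Banach function norm; $X^{1/p}$ denotes the corresponding space, and $(X^{1/p})'$ its associate space. Slowly varying functions. A measurable $b\colon(0,1)\to(0,\infty)$ is slowly varying if for every $\varepsilon>0$ there are a nondecreasing $b_\varepsilon$ and a nonincreasing $b_{-\varepsilon}$ with $t^\varepsilon b(t)\approx b_\varepsilon(t)$ and $t^{-\varepsilon}b(t)\approx b_{-\varepsilon}(t)$ on $(0,1)$. For $q\in(0,\infty]$, $\|g\|_{L^{q,b}(S,\nu)}=\|b(t)g^*(t)\|_{L^q(0,1)}$ and $L^{q,b}(S,\nu)$ is the set of $g\in\mathcal M(S,\nu)$ where this is finite. The class $\mathcal B_p$ consists of pairs $(b_1,b_2)$ of slowly varying functions such that: (a) $b_1,b_2$ are continuous on $(0,1)$; (b) $b_1$ is nonincreasing and $b_2$ is nondecreasing; (c) $b_1(t)\approx b_1\big(t\,b_1(t)^pb_2(t)^{-p}\big)$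 near $0^+$; (d) $\sup_{0<t<1}b_2(t)^p\int_t^1\frac{ds}{s\,b_1(s)^p}<\infty$. $\sigma\colon[0,1]\to[0,1]$ is the increasing bijection satisfying $t^p=\frac1{C_0}\int_0^{\sigma(t)^p}[b_1(s)b_2(s)^{-1}]^p\,ds$ for every $t\in[0,1]$, where $C_0=\int_0^1[b_1(s)b_2(s)^{-1}]^p\,ds$; $\sigma^{-1}$ is its inverse, $\sigma(s^{1/p})^p=(\sigma(s^{1/p}))^p$ and $\sigma^{-1}(s^{1/p})^p=(\sigma^{-1}(s^{1/p}))^p$. Operators are arbitrary maps (not necessarily linear). An operator $T$ defined on $L^p(R,\mu)$ with values in $\mathcal M(S,\nu)$ is $(p,b_1,b_2)$-gaussible if $\int_0^t[(Tf)^*(s)b_1(s)]^p\,ds\lesssim\int_0^t\big[f^*(\sigma^{-1}(s^{1/p})^p)\,b_1(s)b_2(s)^{-1}\big]^p\,ds$ for every $f\in L^p(R,\mu)$ and $t\in(0,1)$, with a constant independent of $f$ and $t$. An operator $T$ is bounded from a space $A$ to a space $B$ if there is a constant $C$ with $\|Tf\|_B\le C\|f\|_A$ for all $f\in A$. For $f\in\mathcal M(0,1)$ and $t\in(0,1)$: $U_{b_1,b_2,p}f(t)=f^*(\sigma^{-1}(t^{1/p})^p)\,b_2(t)^{-1}$; $T_{b_1,b_2,p}f(t)=\sup_{t\le s<1}\frac{f^*(\sigma(s^{1/p})^p)}{b_1(\sigma(s^{1/p})^p)^p}$; $S_{b_1,p}f(t)=\left(\int_t^1\frac{|f(s)|^p}{s\,b_1(s)^p}\,ds\right)^{1/p}$.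 The $K$-functional of a couple $(X_0,X_1)$ is $K(f,t;X_0,X_1)=\inf\{\|g\|_{X_0}+t\|h\|_{X_1}:f=g+h,\ g\in X_0,\ h\in X_1\}$ ($=\infty$ if no such decomposition exists). $K(Tf,t;L^{p,b_1},L^{\infty,b_2})$ is taken over $(S,\nu)$ and $K(f,t;L^p,L^\infty)$ over $(R,\mu)$. *)

theory Defs
  imports "HOL-Probability.Probability"
begin

text \<open>
  Equivalence classes modulo null sets are handled through representatives: elements of
  \<open>M(R,\<mu>)\<close> are measurable functions, and everything below is invariant under changing them on
  null sets.
\<close>

definition nonatomic :: "'a measure \<Rightarrow> bool" where
  "nonatomic M \<longleftrightarrow> (\<forall>A\<in>sets M. 0 < emeasure M A \<longrightarrow>
     (\<exists>B\<in>sets M. B \<subseteq> A \<and> 0 < emeasure M B \<and> emeasure M B < emeasure M A))"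

abbreviation unit_leb :: "real measure" where
  "unit_leb \<equiv> lebesgue_on {0<..<1}"

text \<open>
  Nonincreasing rearrangement; only its values at \<open>t \<in> {0<..<1}\<close> are meaningful. There, for a
  measurable function on a probability space, the infimum is over a nonempty set.
\<close>
definition rearr :: "'a measure \<Rightarrow> ('a \<Rightarrow> 'b::real_normed_vector) \<Rightarrow> real \<Rightarrow> real" where
  "rearr M f t = Inf {l. 0 < l \<and> measure M {x\<in>space M. norm (f x) > l} \<le> t}"

text \<open>Real powers on \<open>[0,\<infinity>]\<close>, for positive exponents.\<close>
definition epowr :: "ennreal \<Rightarrow> real \<Rightarrow> ennreal" where
  "epowr x a = (if x = \<infinity> then \<infinity> else ennreal (enn2real x powr a))"


section \<open>Rearrangement-invariant spaces\<close>

definition Mplus :: "(real \<Rightarrow> real) set" where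
  "Mplus = {f \<in> borel_measurable unit_leb. \<forall>t\<in>{0<..<1}. 0 \<le> f t}"

type_synonym functional = "(real \<Rightarrow> real) \<Rightarrow> ennreal"

text \<open>
  The axioms except the triangle inequality and the embedding into \<open>L\<^sup>1\<close>. A functional is only
  constrained on \<^const>\<open>Mplus\<close>; its values elsewhere are never used.
\<close>
definition ri_axioms :: "functional \<Rightarrow> bool" where
  "ri_axioms X \<longleftrightarrow>
     (\<forall>f\<in>Mplus. X f = 0 \<longleftrightarrow> (AE t in unit_leb. f t = 0)) \<and>
     (\<forall>f\<in>Mplus. \<forall>c\<ge>0. X (\<lambda>t. c * f t) = ennreal c * X f) \<and>
     (\<forall>f\<in>Mplus. \<forall>g\<in>Mplus. (AE t in unit_leb. f t \<le> g t) \<longrightarrow> X f \<le> X g) \<and>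
     (\<forall>f\<in>Mplus. \<forall>fk. (\<forall>k::nat. fk k \<in> Mplus) \<longrightarrow>
        (AE t in unit_leb. incseq (\<lambda>k. fk k t) \<and> (\<lambda>k. fk k t) \<longlonglongrightarrow> f t) \<longrightarrow>
        incseq (\<lambda>k. X (fk k)) \<and> (\<lambda>k. X (fk k)) \<longlonglongrightarrow> X f) \<and>
     X (\<lambda>t. 1) < \<infinity> \<and>
     (\<forall>f\<in>Mplus. \<forall>g\<in>Mplus. (\<forall>t\<in>{0<..<1}. rearr unit_leb f t = rearr unit_leb g t) \<longrightarrow> X f = X g)"

definition ri_banach_norm :: "functional \<Rightarrow> bool" where
  "ri_banach_norm X \<longleftrightarrow> ri_axioms X \<and>
     (\<forall>f\<in>Mplus. \<forall>g\<in>Mplus. X (\<lambda>t. f t + g t) \<le> X f + X g) \<and>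
     (\<exists>C::real. \<forall>f\<in>Mplus. (\<integral>\<^sup>+t. ennreal (f t) \<partial>unit_leb) \<le> ennreal C * X f)"

definition ri_quasi_norm :: "functional \<Rightarrow> bool" where
  "ri_quasi_norm X \<longleftrightarrow> ri_axioms X \<and>
     (\<exists>C::real. C \<ge> 1 \<and> (\<forall>f\<in>Mplus. \<forall>g\<in>Mplus. X (\<lambda>t. f t + g t) \<le> ennreal C * (X f + X g)))"

text \<open>
  A space \<open>X(R,\<mu>)\<close> is given by the functional \<open>X\<close> of its representation space; taking
  \<^term>\<open>unit_leb\<close> for \<open>M\<close> gives \<open>X(0,1)\<close>.
\<close>
definition ri_norm :: "functional \<Rightarrow> 'a measure \<Rightarrow> ('a \<Rightarrow> 'b::real_normed_vector) \<Rightarrow> ennreal" where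
  "ri_norm X M f = X (rearr M f)"

definition ri_space :: "functional \<Rightarrow> 'a measure \<Rightarrow> ('a \<Rightarrow> complex) set" where
  "ri_space X M = {f \<in> borel_measurable M. ri_norm X M f < \<infinity>}"

definition associate :: "functional \<Rightarrow> functional" where
  "associate X f = (SUP g\<in>{g\<in>Mplus. X g \<le> 1}. \<integral>\<^sup>+t. ennreal (f t * g t) \<partial>unit_leb)"

text \<open>The functional of \<open>X\<^bsup>1/p\<^esup>\<close>.\<close>
definition root_space :: "real \<Rightarrow> functional \<Rightarrow> functional" where
  "root_space p X f = epowr (X (\<lambda>t. f t powr (1/p))) p"

definition p_convex :: "real \<Rightarrow> functional \<Rightarrow> bool" where
  "p_convex p X \<longleftrightarrow> ri_banach_norm (root_space p X)"


section \<open>Slowly varying functions and the class \<open>B\<^sub>p\<close>\<close>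

definition equiv_on :: "real set \<Rightarrow> (real \<Rightarrow> real) \<Rightarrow> (real \<Rightarrow> real) \<Rightarrow> bool" where
  "equiv_on A f g \<longleftrightarrow> (\<exists>c>0. \<forall>t\<in>A. f t \<le> c * g t \<and> g t \<le> c * f t)"

definition slowly_varying :: "(real \<Rightarrow> real) \<Rightarrow> bool" where
  "slowly_varying b \<longleftrightarrow>
     b \<in> borel_measurable unit_leb \<and> (\<forall>t\<in>{0<..<1}. 0 < b t) \<and>
     (\<forall>\<epsilon>>0. \<exists>bp bm. mono_on {0<..<1} bp \<and> antimono_on {0<..<1} bm \<and>
        equiv_on {0<..<1} (\<lambda>t. t powr \<epsilon> * b t) bp \<and>
        equiv_on {0<..<1} (\<lambda>t. t powr (-\<epsilon>) * b t) bm)"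

definition class_B :: "real \<Rightarrow> ((real \<Rightarrow> real) \<times> (real \<Rightarrow> real)) set" where
  "class_B p = {(b1, b2).
     slowly_varying b1 \<and> slowly_varying b2 \<and>
     continuous_on {0<..<1} b1 \<and> continuous_on {0<..<1} b2 \<and>
     antimono_on {0<..<1} b1 \<and> mono_on {0<..<1} b2 \<and>
     (\<exists>\<delta>>0. equiv_on {0<..<\<delta>} b1 (\<lambda>t. b1 (t * b1 t powr p * b2 t powr (-p)))) \<and>
     (SUP t\<in>{0<..<1}. ennreal (b2 t powr p) *
        (\<integral>\<^sup>+s\<in>{t<..<1}. ennreal (1 / (s * b1 s powr p)) \<partial>lebesgue)) < \<infinity>}"

text \<open>
  \<^const>\<open>extensional\<close> only makes the function unique as a total function on the reals.
\<close>
definition sigma :: "real \<Rightarrow> (real \<Rightarrow> real) \<Rightarrow> (real \<Rightarrow> real) \<Rightarrow> real \<Rightarrow> real" where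
  "sigma p b1 b2 = (THE \<sigma>. \<sigma> \<in> extensional {0..1} \<and>
     strict_mono_on {0..1} \<sigma> \<and> bij_betw \<sigma> {0..1} {0..1} \<and>
     (let C0 = (LINT s:{0<..<1}|lebesgue. (b1 s / b2 s) powr p) in
      \<forall>t\<in>{0..1}. t powr p =
        (1 / C0) * (LINT s:{0<..<\<sigma> t powr p}|lebesgue. (b1 s / b2 s) powr p)))"

text \<open>\<open>\<sigma>(s\<^bsup>1/p\<^esup>)\<^sup>p\<close> and \<open>\<sigma>\<^bsup>-1\<^esup>(s\<^bsup>1/p\<^esup>)\<^sup>p\<close>.\<close>
definition sigma_pow :: "real \<Rightarrow> (real \<Rightarrow> real) \<Rightarrow> (real \<Rightarrow> real) \<Rightarrow> real \<Rightarrow> real" where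
  "sigma_pow p b1 b2 s = sigma p b1 b2 (s powr (1/p)) powr p"

definition sigma_inv_pow :: "real \<Rightarrow> (real \<Rightarrow> real) \<Rightarrow> (real \<Rightarrow> real) \<Rightarrow> real \<Rightarrow> real" where
  "sigma_inv_pow p b1 b2 s = inv_into {0..1} (sigma p b1 b2) (s powr (1/p)) powr p"


section \<open>Lebesgue-type spaces and the K-functional\<close>

definition Lq_norm :: "ennreal \<Rightarrow> 'a measure \<Rightarrow> ('a \<Rightarrow> 'b::real_normed_vector) \<Rightarrow> ennreal" where
  "Lq_norm q M f =
     (if q = \<infinity> then esssup M (\<lambda>x. ennreal (norm (f x)))
      else epowr (\<integral>\<^sup>+x. ennreal (norm (f x) powr enn2real q) \<partial>M) (1 / enn2real q))"

definition Lp_space :: "real \<Rightarrow> 'a measure \<Rightarrow> ('a \<Rightarrow> complex) set" where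
  "Lp_space p M = {f \<in> borel_measurable M. Lq_norm (ennreal p) M f < \<infinity>}"

definition Lqb_norm ::
  "ennreal \<Rightarrow> (real \<Rightarrow> real) \<Rightarrow> 'a measure \<Rightarrow> ('a \<Rightarrow> 'b::real_normed_vector) \<Rightarrow> ennreal" where
  "Lqb_norm q b M g = Lq_norm q unit_leb (\<lambda>t. b t * rearr M g t)"

text \<open>The two spaces are given by their (quasi)norms; the infimum of the empty set is \<open>\<infinity>\<close>.\<close>
definition K_functional ::
  "'a measure \<Rightarrow> ('a \<Rightarrow> complex) \<Rightarrow> real \<Rightarrow>
   (('a \<Rightarrow> complex) \<Rightarrow> ennreal) \<Rightarrow> (('a \<Rightarrow> complex) \<Rightarrow> ennreal) \<Rightarrow> ennreal" where
  "K_functional M f t N0 N1 =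
     Inf {N0 g + ennreal t * N1 h | g h.
       g \<in> borel_measurable M \<and> h \<in> borel_measurable M \<and>
       (AE x in M. f x = g x + h x) \<and> N0 g < \<infinity> \<and> N1 h < \<infinity>}"


section \<open>Operators\<close>

text \<open>
  Not necessarily linear maps from \<open>L\<^sup>p(R,\<mu>)\<close> to \<open>M(S,\<nu>)\<close>; compatibility with a.e. equality
  makes them maps between equivalence classes.
\<close>
definition operator_on_Lp ::
  "real \<Rightarrow> 'a measure \<Rightarrow> 'b measure \<Rightarrow> (('a \<Rightarrow> complex) \<Rightarrow> ('b \<Rightarrow> complex)) \<Rightarrow> bool" where
  "operator_on_Lp p M N T \<longleftrightarrow>
     (\<forall>f\<in>Lp_space p M. T f \<in> borel_measurable N) \<and>
     (\<forall>f\<in>Lp_space p M. \<forall>g\<in>Lp_space p M.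
        (AE x in M. f x = g x) \<longrightarrow> (AE y in N. T f y = T g y))"

definition gaussible ::
  "real \<Rightarrow> (real \<Rightarrow> real) \<Rightarrow> (real \<Rightarrow> real) \<Rightarrow> 'a measure \<Rightarrow> 'b measure \<Rightarrow>
   (('a \<Rightarrow> complex) \<Rightarrow> ('b \<Rightarrow> complex)) \<Rightarrow> bool" where
  "gaussible p b1 b2 M N T \<longleftrightarrow> operator_on_Lp p M N T \<and>
     (\<exists>c::real. c > 0 \<and> (\<forall>f\<in>Lp_space p M. \<forall>t\<in>{0<..<1}.
        (\<integral>\<^sup>+s\<in>{0<..<t}. ennreal ((rearr N (T f) s * b1 s) powr p) \<partial>lebesgue)
        \<le> ennreal c * (\<integral>\<^sup>+s\<in>{0<..<t}.
             ennreal ((rearr M f (sigma_inv_pow p b1 b2 s) * b1 s / b2 s) powr p) \<partial>lebesgue)))"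

definition K_dominated ::
  "real \<Rightarrow> (real \<Rightarrow> real) \<Rightarrow> (real \<Rightarrow> real) \<Rightarrow> 'a measure \<Rightarrow> 'b measure \<Rightarrow>
   (('a \<Rightarrow> complex) \<Rightarrow> ('b \<Rightarrow> complex)) \<Rightarrow> bool" where
  "K_dominated p b1 b2 M N T \<longleftrightarrow>
     (\<exists>c::real. c > 0 \<and> (\<forall>f\<in>Lp_space p M. \<forall>t\<in>{0<..<1}.
        K_functional N (T f) t (Lqb_norm (ennreal p) b1 N) (Lqb_norm \<infinity> b2 N)
        \<le> ennreal c * K_functional M f t (Lq_norm (ennreal p) M) (Lq_norm \<infinity> M)))"

definition ri_bounded ::
  "functional \<Rightarrow> 'a measure \<Rightarrow> functional \<Rightarrow> 'b measure \<Rightarrow>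
   (('a \<Rightarrow> complex) \<Rightarrow> ('b \<Rightarrow> complex)) \<Rightarrow> bool" where
  "ri_bounded X M Y N T \<longleftrightarrow>
     (\<exists>C::real. \<forall>f\<in>ri_space X M.
        T f \<in> borel_measurable N \<and> ri_norm Y N (T f) \<le> ennreal C * ri_norm X M f)"

text \<open>
  Boundedness between spaces over \<open>(0,1)\<close> for an operator whose defining formula may a priori
  take the value \<open>\<infinity>\<close>: its output has to be a.e. finite in order to lie in \<open>M(0,1)\<close>.
\<close>
definition ri_bounded_ext ::
  "functional \<Rightarrow> functional \<Rightarrow> ((real \<Rightarrow> complex) \<Rightarrow> (real \<Rightarrow> ennreal)) \<Rightarrow> bool" where
  "ri_bounded_ext X Y T \<longleftrightarrow>
     (\<exists>C::real. \<forall>f\<in>ri_space X unit_leb.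
        T f \<in> borel_measurable unit_leb \<and> (AE t in unit_leb. T f t < \<infinity>) \<and>
        ri_norm Y unit_leb (\<lambda>t. enn2real (T f t)) \<le> ennreal C * ri_norm X unit_leb f)"

definition U_op ::
  "real \<Rightarrow> (real \<Rightarrow> real) \<Rightarrow> (real \<Rightarrow> real) \<Rightarrow> (real \<Rightarrow> complex) \<Rightarrow> real \<Rightarrow> ennreal" where
  "U_op p b1 b2 f t = ennreal (rearr unit_leb f (sigma_inv_pow p b1 b2 t) / b2 t)"

definition T_op ::
  "real \<Rightarrow> (real \<Rightarrow> real) \<Rightarrow> (real \<Rightarrow> real) \<Rightarrow> (real \<Rightarrow> complex) \<Rightarrow> real \<Rightarrow> ennreal" where
  "T_op p b1 b2 f t =
     (SUP s\<in>{t..<1}. ennreal (rearr unit_leb f (sigma_pow p b1 b2 s)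
                               / b1 (sigma_pow p b1 b2 s) powr p))"

definition S_op :: "real \<Rightarrow> (real \<Rightarrow> real) \<Rightarrow> (real \<Rightarrow> complex) \<Rightarrow> real \<Rightarrow> ennreal" where
  "S_op p b1 f t =
     epowr (\<integral>\<^sup>+s\<in>{t<..<1}. ennreal (norm (f s) powr p / (s * b1 s powr p)) \<partial>lebesgue) (1/p)"

end

(*
Raise everything to the power p and write w = b1^p, v = b2^p and psi(t) = sigma^{-1}(t^{1/p})^p,
which is the normalised primitive of w/v. Substituting in the integral, T is gaussible iff
int_0^t (Tf)*^p w <= c int_0^{psi(t)} f*^p for all t. Both sides are K-functionals up to constants,
which gives the equivalence of (i) and (ii).

Put (P h)(u) = sup_{s >= u} h(psi^{-1}(s)) / w(psi^{-1}(s)), so that (iv) says that P is bounded on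
nonincreasing functions from (Y^{1/p})' to (X^{1/p})'. If it is, then for nonincreasing G and F with
int_0^t G w <= c int_0^{psi(t)} F, Hardy's lemma gives int G h <= c' int F P h, and the norm of G is
bounded by that of F because the norm is recovered from its associate norm (Lorentz-Luxemburg;
here by projecting in L^2 onto the unit ball). With G = (Tf)*^p this is (i), and with
G = (S f)^p it is the boundedness of S: condition (d) yields the required inequality.

Conversely, (i) gives the boundedness of U because the nonatomic spaces carry copies of U that are
gaussible. Finally, U bounded implies (iv): the supremum in P is removed by averaging F over the
intervals between consecutive dyadic levels of P h, which leaves int F(psi(s)) h(s)/v(s) ds.
*)
theory Submission imports Defs begin

text \<open>The obstacle in (iv) is that \<open>h / w\<close> read along \<open>Phi\<close> is not
  monotone. Hardy's lemma therefore needs the supremum, while the boundedness of \<open>U\<close>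
  says nothing about suprema. The way out is to change the test function instead of
  \<open>h\<close>. The lowest level, where \<open>HP h\<close> is at most a bound \<open>b\<close>
  for the associate norm of \<open>h\<close>, is left to the embedding of \<open>X^(1/p)\<close>
  into L^1, and this is how that embedding constant enters the final bound. The change of variables
  is controlled by comparing increments \<open>J s - J a\<close> with \<open>(s - a) * q s\<close>,
  which is where slow variation is used, and by the concavity of \<open>Psi\<close>. Neither
  separability nor order continuity is assumed of the norms, nor any standard structure of the
  measure spaces. Duality rests on a nearest point, whose existence follows from convexity and the
  Fatou property. Measure-preserving maps onto (0,1) come from a maximal chain of measurable sets
  that are comparable with the level sets of a given function.\<close>

section \<open>Lebesgue measure on the unit interval\<close>

lemma prob_space_unit_leb: "prob_space unit_leb"
  by (rule prob_spaceI) (simp add: emeasure_restrict_space)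

lemma space_unit_leb [simp]: "space unit_leb = {0<..<1}"
  by simp

lemma nn_integral_unit_leb:
  "(\<integral>\<^sup>+t. f t \<partial>unit_leb) = (\<integral>\<^sup>+t. f t * indicator {0<..<1} t \<partial>lborel)"
  by (subst nn_integral_restrict_space) (simp_all add: nn_integral_completion)

lemma nn_integral_set_unit_leb:
  assumes "t \<le> 1"
  shows "(\<integral>\<^sup>+s\<in>{0<..<t}. f s \<partial>lebesgue) = (\<integral>\<^sup>+s. f s * indicator {..<t} s \<partial>unit_leb)"
  unfolding nn_integral_unit_leb nn_integral_completion
  by (rule nn_integral_cong) (use assms in \<open>auto split: split_indicator\<close>)

lemma borel_measurable_unit_lebI:
  assumes "f \<in> borel_measurable (restrict_space borel {0<..<1})"
  shows "f \<in> borel_measurable unit_leb"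
proof -
  have "(\<lambda>x. x) \<in> unit_leb \<rightarrow>\<^sub>M restrict_space borel {0<..<1::real}"
    by (rule measurable_restrict_space3) (auto intro: measurable_completion)
  from measurable_compose[OF this assms] show ?thesis by simp
qed

lemma measurable_ident_unit_leb [measurable]: "(\<lambda>x. x) \<in> borel_measurable unit_leb"
  by (rule borel_measurable_unit_lebI) (simp add: measurable_restrict_space1)

lemma antimono_on_borel:
  fixes f :: "real \<Rightarrow> real"
  assumes "antimono_on A f"
  shows "f \<in> borel_measurable (restrict_space borel A)"
proof -
  have "mono_on A (\<lambda>x. - f x)"
    using assms by (auto simp: monotone_on_def)
  from borel_measurable_mono_on_fnc[OF this] show ?thesis
    using borel_measurable_uminus_eq by blast
qed

lemma antimono_on_unit_leb:
  fixes f :: "real \<Rightarrow> real"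
  assumes "antimono_on {0<..<1} f"
  shows "f \<in> borel_measurable unit_leb"
  by (rule borel_measurable_unit_lebI, rule antimono_on_borel, rule assms)

lemma mono_on_unit_leb:
  fixes f :: "real \<Rightarrow> real"
  assumes "mono_on {0<..<1} f"
  shows "f \<in> borel_measurable unit_leb"
  by (rule borel_measurable_unit_lebI, rule borel_measurable_mono_on_fnc, rule assms)

lemma emeasure_unit_leb_below:
  assumes "0 \<le> m" "m \<le> 1"
  shows "emeasure unit_leb {0<..<m} = ennreal m"
  using assms by (subst emeasure_restrict_space) auto

lemma measure_unit_leb_below:
  assumes "0 \<le> m" "m \<le> 1"
  shows "measure unit_leb {0<..<m} = m"
  using emeasure_unit_leb_below[OF assms] assms by (simp add: measure_def)

section \<open>The nonincreasing rearrangement\<close>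

abbreviation upper_level :: "'a measure \<Rightarrow> ('a \<Rightarrow> 'b::real_normed_vector) \<Rightarrow> real \<Rightarrow> 'a set" where
  "upper_level M f l \<equiv> {x \<in> space M. l < norm (f x)}"

lemma upper_level_sets [measurable]:
  "f \<in> borel_measurable M \<Longrightarrow> upper_level M f l \<in> sets M"
  by measurable

context
  fixes M :: "'a measure" and f :: "'a \<Rightarrow> 'b::real_normed_vector"
  assumes M: "prob_space M" and f [measurable]: "f \<in> borel_measurable M"
begin

interpretation prob_space M by (rule M)

lemma measure_upper_level_antimono:
  "l \<le> k \<Longrightarrow> measure M (upper_level M f k) \<le> measure M (upper_level M f l)"
  by (rule finite_measure_mono) auto

text \<open>The strict level sets above \<open>l\<close> exhaust the one at \<open>l\<close>, so
  continuity from below gives a slightly higher level. This right continuity of the distribution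
  function allows strict inequalities on both sides of \<open>less_rearr_iff\<close>.\<close>

lemma measure_upper_level_right_cont:
  assumes "t < measure M (upper_level M f l)"
  shows "\<exists>k>l. t < measure M (upper_level M f k)"
proof -
  have "(\<lambda>n. measure M (upper_level M f (l + 1 / real (Suc n)))) \<longlonglongrightarrow>
      measure M (\<Union>n. upper_level M f (l + 1 / real (Suc n)))"
  proof (rule finite_Lim_measure_incseq)
    show "incseq (\<lambda>n. upper_level M f (l + 1 / real (Suc n)))"
      unfolding incseq_Suc_iff by (auto intro: le_less_trans[rotated] simp: frac_le)
  qed auto
  also have "(\<Union>n. upper_level M f (l + 1 / real (Suc n))) = upper_level M f l"
  proof (intro equalityI subsetI)
    fix x assume "x \<in> upper_level M f l"
    then obtain n where "inverse (real (Suc n)) < norm (f x) - l" "x \<in> space M"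
      using reals_Archimedean[of "norm (f x) - l"] by auto
    then show "x \<in> (\<Union>n. upper_level M f (l + 1 / real (Suc n)))"
      by (auto simp: field_simps intro!: exI[of _ n])
  next
    fix x assume "x \<in> (\<Union>n. upper_level M f (l + 1 / real (Suc n)))"
    then obtain n where "x \<in> space M" and n: "l + 1 / real (Suc n) < norm (f x)" by auto
    moreover have "l < l + 1 / real (Suc n)" by simp
    ultimately show "x \<in> upper_level M f l" using less_trans by blast
  qed
  finally have "eventually (\<lambda>n. t < measure M (upper_level M f (l + 1 / real (Suc n)))) sequentially"
    using assms order_tendstoD(1) by blast
  then obtain n where "t < measure M (upper_level M f (l + 1 / real (Suc n)))"
    by (auto simp: eventually_sequentially)
  then show ?thesis by (intro exI[of _ "l + 1 / real (Suc n)"]) auto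
qed

text \<open>\<open>f\<close> is finite everywhere, so its level sets shrink to the empty set. Hence
  the infimum in \<open>rearr\<close> is taken over a nonempty set for every positive
  \<open>t\<close>.\<close>

lemma measure_upper_level_tendsto_0:
  assumes "0 < t"
  shows "\<exists>l>0. measure M (upper_level M f l) \<le> t"
proof -
  have "(\<lambda>n. measure M (upper_level M f (real (Suc n)))) \<longlonglongrightarrow>
      measure M (\<Inter>n. upper_level M f (real (Suc n)))"
    by (rule finite_Lim_measure_decseq) (auto simp: decseq_def)
  also have "(\<Inter>n. upper_level M f (real (Suc n))) = {}"
  proof -
    have "\<exists>n. norm (f x) \<le> real (Suc n)" for x
      using real_arch_simple[of "norm (f x)"] by (metis le_add_same_cancel2 of_nat_Suc order_trans zero_le_one)
    then show ?thesis by (force simp: not_less[symmetric])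
  qed
  finally have "eventually (\<lambda>n. measure M (upper_level M f (real (Suc n))) < t) sequentially"
    using assms order_tendstoD(2) by force
  then obtain n where "measure M (upper_level M f (real (Suc n))) < t"
    by (auto simp: eventually_sequentially)
  then show ?thesis by (intro exI[of _ "real (Suc n)"]) auto
qed

lemma rearr_nonneg:
  assumes "0 < t"
  shows "0 \<le> rearr M f t"
  unfolding rearr_def using measure_upper_level_tendsto_0[OF assms]
  by (intro cInf_greatest) auto

text \<open>The adjunction between rearrangement and distribution function. Later facts on
  \<open>rearr\<close> are read off from it and not from the infimum.\<close>

lemma less_rearr_iff:
  assumes "0 \<le> l" "0 < t"
  shows "l < rearr M f t \<longleftrightarrow> t < measure M (upper_level M f l)"
proof
  let ?S = "{l. 0 < l \<and> measure M (upper_level M f l) \<le> t}"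
  have ne: "?S \<noteq> {}" using measure_upper_level_tendsto_0[OF assms(2)] by auto
  have bdd: "bdd_below ?S" by (rule bdd_belowI[of _ 0]) auto
  {
    assume "t < measure M (upper_level M f l)"
    then obtain k where k: "k > l" "t < measure M (upper_level M f k)"
      using measure_upper_level_right_cont by blast
    have "k \<le> Inf ?S"
    proof (rule cInf_greatest[OF ne])
      fix x assume x: "x \<in> ?S"
      show "k \<le> x"
      proof (rule ccontr)
        assume "\<not> k \<le> x"
        then have "measure M (upper_level M f k) \<le> measure M (upper_level M f x)"
          by (intro measure_upper_level_antimono) auto
        with x k show False by auto
      qed
    qed
    with k show "l < rearr M f t" by (simp add: rearr_def)
  next
    assume l: "l < rearr M f t"
    show "t < measure M (upper_level M f l)"
    proof (rule ccontr)
      assume *: "\<not> t < measure M (upper_level M f l)"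
      have "k \<in> ?S" if "k > l" for k
        using that assms(1) * measure_upper_level_antimono[of l k] by auto
      then have "rearr M f t \<le> k" if "k > l" for k
        using that bdd unfolding rearr_def by (auto intro: cInf_lower)
      with l show False by (meson dense not_le)
    qed
  }
qed

lemma rearr_antimono: "antimono_on {0<..} (rearr M f)"
proof (rule monotone_onI)
  fix s t :: real assume st: "s \<in> {0<..}" "t \<in> {0<..}" "s \<le> t"
  show "rearr M f t \<le> rearr M f s"
  proof (rule ccontr)
    assume "\<not> rearr M f t \<le> rearr M f s"
    then have "t < measure M (upper_level M f (rearr M f s))"
      using less_rearr_iff[of "rearr M f s" t] rearr_nonneg[of s] st by auto
    then have "rearr M f s < rearr M f s"
      using less_rearr_iff[of "rearr M f s" s] rearr_nonneg[of s] st by auto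
    then show False by simp
  qed
qed

lemma rearr_antimono_unit: "antimono_on {0<..<1} (rearr M f)"
  using rearr_antimono by (auto simp: monotone_on_def)

lemma rearr_measurable [measurable]: "rearr M f \<in> borel_measurable unit_leb"
  by (rule antimono_on_unit_leb[OF rearr_antimono_unit])

lemma rearr_Mplus [simp]: "rearr M f \<in> Mplus"
  unfolding Mplus_def using rearr_nonneg rearr_measurable by auto

lemma upper_level_rearr:
  assumes "0 \<le> l"
  shows "upper_level unit_leb (rearr M f) l = {0<..<measure M (upper_level M f l)}"
  using less_rearr_iff[OF assms] rearr_nonneg prob_le_1[of "upper_level M f l"]
  by (auto simp del: prob_le_1)

lemma measure_upper_level_rearr:
  assumes "0 \<le> l"
  shows "measure unit_leb (upper_level unit_leb (rearr M f) l) = measure M (upper_level M f l)"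
  unfolding upper_level_rearr[OF assms] by (rule measure_unit_leb_below) auto

end

lemma rearr_cong_distribution:
  assumes "\<And>l. 0 < l \<Longrightarrow> measure M (upper_level M f l) = measure N (upper_level N g l)"
  shows "rearr M f = rearr N g"
  unfolding rearr_def using assms by (intro ext arg_cong[where f=Inf]) auto

lemma rearr_cong_AE:
  assumes "f \<in> borel_measurable M" "g \<in> borel_measurable M" "AE x in M. norm (f x) = norm (g x)"
  shows "rearr M f = rearr M g"
proof (rule rearr_cong_distribution)
  fix l :: real
  show "measure M (upper_level M f l) = measure M (upper_level M g l)"
    by (rule measure_eq_AE) (use assms in auto)
qed

lemma rearr_rearr:
  assumes "prob_space M" "f \<in> borel_measurable M"
  shows "rearr unit_leb (rearr M f) = rearr M f"
  by (rule rearr_cong_distribution) (simp only: measure_upper_level_rearr[OF assms] less_imp_le)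

lemma real_eqI_less:
  fixes a b :: real
  assumes "0 \<le> a" "0 \<le> b" "\<And>l. 0 \<le> l \<Longrightarrow> l < a \<longleftrightarrow> l < b"
  shows "a = b"
  using assms by (meson less_irrefl linorder_neqE)

lemma rearr_powr:
  assumes M: "prob_space M" and f [measurable]: "f \<in> borel_measurable M" and "0 < t" "0 < p"
  shows "rearr M (\<lambda>x. norm (f x) powr p) t = rearr M f t powr p"
proof (rule real_eqI_less)
  have *: "l < x powr p \<longleftrightarrow> l powr (1/p) < x" if "0 \<le> l" "0 \<le> x" for l x :: real
  proof -
    have "l < x powr p \<longleftrightarrow> (l powr (1/p)) powr p < x powr p"
      using that assms by (simp add: powr_powr)
    also have "\<dots> \<longleftrightarrow> l powr (1/p) < x"
      using that assms powr_less_mono2[of p "l powr (1/p)" x] powr_mono2[of p x "l powr (1/p)"]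
      by (auto simp: not_le[symmetric])
    finally show ?thesis .
  qed
  show "0 \<le> rearr M (\<lambda>x. norm (f x) powr p) t" by (rule rearr_nonneg) (use assms in auto)
  fix l :: real assume l: "0 \<le> l"
  have "l < rearr M (\<lambda>x. norm (f x) powr p) t \<longleftrightarrow>
      t < measure M (upper_level M (\<lambda>x. norm (f x) powr p) l)"
    by (rule less_rearr_iff) (use assms l in auto)
  also have "upper_level M (\<lambda>x. norm (f x) powr p) l = upper_level M f (l powr (1/p))"
    using * l by auto
  also have "t < measure M \<dots> \<longleftrightarrow> l powr (1/p) < rearr M f t"
    by (rule less_rearr_iff[symmetric]) (use assms l in auto)
  also have "\<dots> \<longleftrightarrow> l < rearr M f t powr p"
    using * l rearr_nonneg[OF M f] assms by auto
  finally show "l < rearr M (\<lambda>x. norm (f x) powr p) t \<longleftrightarrow> l < rearr M f t powr p" .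
qed simp

text \<open>Where the sum exceeds \<open>?a + ?b\<close>, one summand exceeds its own level, and
  each of these two events has measure at most \<open>s / 2\<close>.\<close>

lemma rearr_add_le:
  assumes M: "prob_space M" and [measurable]: "g \<in> borel_measurable M" "h \<in> borel_measurable M"
    "f \<in> borel_measurable M" and ae: "AE x in M. f x = g x + h x" and "0 < s"
  shows "rearr M f s \<le> rearr M g (s / 2) + rearr M h (s / 2)"
proof (rule ccontr)
  interpret prob_space M by fact
  let ?a = "rearr M g (s / 2)" and ?b = "rearr M h (s / 2)"
  have nn: "0 \<le> ?a" "0 \<le> ?b" using assms by (auto intro!: rearr_nonneg)
  assume "\<not> ?thesis"
  then have "s < measure M (upper_level M f (?a + ?b))"
    using less_rearr_iff[OF M, of f "?a + ?b" s] nn assms by auto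
  also have "\<dots> \<le> measure M (upper_level M g ?a \<union> upper_level M h ?b)"
  proof (rule finite_measure_mono_AE)
    have *: "?a < norm (g x) \<or> ?b < norm (h x)" if "?a + ?b < norm (g x + h x)" for x
      using that norm_triangle_ineq[of "g x" "h x"] by linarith
    show "AE x in M. x \<in> upper_level M f (?a + ?b) \<longrightarrow> x \<in> upper_level M g ?a \<union> upper_level M h ?b"
      using ae by eventually_elim (use * in auto)
  qed auto
  also have "\<dots> \<le> measure M (upper_level M g ?a) + measure M (upper_level M h ?b)"
    by (rule measure_Un_le) auto
  also have "measure M (upper_level M g ?a) \<le> s/2"
    using less_rearr_iff[OF M, of g "?a" "s/2"] nn assms by auto
  also have "measure M (upper_level M h ?b) \<le> s/2"
    using less_rearr_iff[OF M, of h "?b" "s/2"] nn assms by auto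
  finally show False by simp
qed

lemma AE_unit_leb_neq: "AE t in unit_leb. t \<noteq> s"
proof -
  have "{s} \<in> null_sets lebesgue" by auto
  then have "AE t in lebesgue. t \<noteq> s" by (rule AE_I') auto
  then show ?thesis by (auto simp: AE_restrict_space_iff elim: eventually_mono)
qed

section \<open>Layer cake formula, Hardy-Littlewood inequality and Hardy's lemma\<close>

text \<open>Fubini, after \<open>norm (H x)\<close> is written as the length of the interval from 0
  to \<open>norm (H x)\<close>.\<close>

lemma layer_cake_weighted:
  fixes H :: "'a \<Rightarrow> 'b::real_normed_vector" and u :: "'a \<Rightarrow> ennreal"
  assumes "prob_space M" and [measurable]: "u \<in> borel_measurable M" "H \<in> borel_measurable M"
  shows "(\<integral>\<^sup>+x. u x * ennreal (norm (H x)) \<partial>M) =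
    (\<integral>\<^sup>+l. (\<integral>\<^sup>+x. u x * indicator (upper_level M H l) x \<partial>M) * indicator {0..} l \<partial>lborel)"
proof -
  interpret prob_space M by fact
  interpret P: pair_sigma_finite M lborel ..
  have "(\<integral>\<^sup>+x. u x * ennreal (norm (H x)) \<partial>M) =
      (\<integral>\<^sup>+x. (\<integral>\<^sup>+l. u x * indicator {0..<norm (H x)} l \<partial>lborel) \<partial>M)"
    by (rule nn_integral_cong) (simp add: nn_integral_cmult_indicator)
  also have "\<dots> = (\<integral>\<^sup>+x. (\<integral>\<^sup>+l. u x * (if 0 \<le> l \<and> l < norm (H x) then 1 else 0) \<partial>lborel) \<partial>M)"
    by (intro nn_integral_cong) (auto split: split_indicator)
  also have "\<dots> = (\<integral>\<^sup>+l. (\<integral>\<^sup>+x. u x * (if 0 \<le> l \<and> l < norm (H x) then 1 else 0) \<partial>M) \<partial>lborel)"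
    by (rule P.Fubini'[symmetric]) measurable
  also have "\<dots> = (\<integral>\<^sup>+l. (\<integral>\<^sup>+x. u x * indicator (upper_level M H l) x \<partial>M) * indicator {0..} l \<partial>lborel)"
    by (auto intro!: nn_integral_cong split: split_indicator)
  finally show ?thesis .
qed

lemma layer_cake_mult:
  fixes f :: "'a \<Rightarrow> 'b::real_normed_vector" and g :: "'a \<Rightarrow> 'c::real_normed_vector"
  assumes M: "prob_space M" and [measurable]: "f \<in> borel_measurable M" "g \<in> borel_measurable M"
  shows "(\<integral>\<^sup>+x. ennreal (norm (f x)) * ennreal (norm (g x)) \<partial>M) =
    (\<integral>\<^sup>+l. (\<integral>\<^sup>+k. emeasure M (upper_level M f k \<inter> upper_level M g l) * indicator {0..} k \<partial>lborel)
        * indicator {0..} l \<partial>lborel)"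
proof -
  have "(\<integral>\<^sup>+x. ennreal (norm (f x)) * indicator (upper_level M g l) x \<partial>M) =
      (\<integral>\<^sup>+k. emeasure M (upper_level M f k \<inter> upper_level M g l) * indicator {0..} k \<partial>lborel)" for l
  proof -
    have "(\<integral>\<^sup>+x. indicator (upper_level M g l) x * ennreal (norm (f x)) \<partial>M) =
        (\<integral>\<^sup>+k. (\<integral>\<^sup>+x. indicator (upper_level M g l) x * indicator (upper_level M f k) x \<partial>M) * indicator {0..} k \<partial>lborel)"
      by (rule layer_cake_weighted[OF M]) auto
    also have "\<dots> = (\<integral>\<^sup>+k. emeasure M (upper_level M f k \<inter> upper_level M g l) * indicator {0..} k \<partial>lborel)"
      by (simp add: indicator_inter_arith[symmetric] Int_commute)
    finally show ?thesis by (simp add: mult.commute)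
  qed
  then show ?thesis
    by (subst layer_cake_weighted[OF M]) auto
qed

text \<open>Both integrals become double integrals over levels \<open>k\<close>, \<open>l\<close>:
  on the left of the measure of the intersection of two level sets, on the right of the minimum of
  their measures, since level sets of rearrangements are intervals starting at 0. Nested level sets
  give equality; later this is applied to two functions of one common uniformly distributed
  map.\<close>

lemma hardy_littlewood:
  fixes f :: "'a \<Rightarrow> 'b::real_normed_vector" and g :: "'a \<Rightarrow> 'c::real_normed_vector"
  assumes M: "prob_space M" and f [measurable]: "f \<in> borel_measurable M"
    and g [measurable]: "g \<in> borel_measurable M"
  shows "(\<integral>\<^sup>+x. ennreal (norm (f x)) * ennreal (norm (g x)) \<partial>M) \<le>
      (\<integral>\<^sup>+t. ennreal (rearr M f t) * ennreal (rearr M g t) \<partial>unit_leb)"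
    and "(\<And>k l. 0 \<le> k \<Longrightarrow> 0 \<le> l \<Longrightarrow> upper_level M f k \<subseteq> upper_level M g l \<or> upper_level M g l \<subseteq> upper_level M f k)
      \<Longrightarrow> (\<integral>\<^sup>+x. ennreal (norm (f x)) * ennreal (norm (g x)) \<partial>M) =
      (\<integral>\<^sup>+t. ennreal (rearr M f t) * ennreal (rearr M g t) \<partial>unit_leb)"
proof -
  interpret prob_space M by fact
  have rhs: "(\<integral>\<^sup>+t. ennreal (rearr M f t) * ennreal (rearr M g t) \<partial>unit_leb) =
    (\<integral>\<^sup>+l. (\<integral>\<^sup>+k. min (emeasure M (upper_level M f k)) (emeasure M (upper_level M g l)) * indicator {0..} k \<partial>lborel)
        * indicator {0..} l \<partial>lborel)"
  proof -
    have "(\<integral>\<^sup>+t. ennreal (rearr M f t) * ennreal (rearr M g t) \<partial>unit_leb) =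
      (\<integral>\<^sup>+t. ennreal (norm (rearr M f t)) * ennreal (norm (rearr M g t)) \<partial>unit_leb)"
      by (rule nn_integral_cong) (auto simp: rearr_nonneg[OF M f] rearr_nonneg[OF M g])
    also have "\<dots> = (\<integral>\<^sup>+l. (\<integral>\<^sup>+k. emeasure unit_leb (upper_level unit_leb (rearr M f) k \<inter>
        upper_level unit_leb (rearr M g) l) * indicator {0..} k \<partial>lborel) * indicator {0..} l \<partial>lborel)"
      by (rule layer_cake_mult[OF prob_space_unit_leb rearr_measurable[OF M f] rearr_measurable[OF M g]])
    also have "\<dots> = (\<integral>\<^sup>+l. (\<integral>\<^sup>+k. min (emeasure M (upper_level M f k)) (emeasure M (upper_level M g l)) *
        indicator {0..} k \<partial>lborel) * indicator {0..} l \<partial>lborel)"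
    proof -
      have "emeasure unit_leb (upper_level unit_leb (rearr M f) k \<inter> upper_level unit_leb (rearr M g) l) =
          min (emeasure M (upper_level M f k)) (emeasure M (upper_level M g l))" if "0 \<le> k" "0 \<le> l" for k l
      proof -
        have "upper_level unit_leb (rearr M f) k \<inter> upper_level unit_leb (rearr M g) l =
            {0<..<min (measure M (upper_level M f k)) (measure M (upper_level M g l))}"
          unfolding upper_level_rearr[OF M f that(1)] upper_level_rearr[OF M g that(2)] by auto
        moreover have "emeasure unit_leb {0<..<min (measure M (upper_level M f k)) (measure M (upper_level M g l))}
            = ennreal (min (measure M (upper_level M f k)) (measure M (upper_level M g l)))"
          by (rule emeasure_unit_leb_below) (auto simp: min_le_iff_disj)
        ultimately show ?thesis
          by (auto simp: emeasure_eq_measure min_def)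
      qed
      then show ?thesis by (auto intro!: nn_integral_cong split: split_indicator)
    qed
    finally show ?thesis .
  qed
  show "(\<integral>\<^sup>+x. ennreal (norm (f x)) * ennreal (norm (g x)) \<partial>M) \<le>
      (\<integral>\<^sup>+t. ennreal (rearr M f t) * ennreal (rearr M g t) \<partial>unit_leb)"
    unfolding rhs layer_cake_mult[OF M f g]
    by (intro nn_integral_mono mult_right_mono min.boundedI emeasure_mono) auto
  assume n: "\<And>k l. 0 \<le> k \<Longrightarrow> 0 \<le> l \<Longrightarrow> upper_level M f k \<subseteq> upper_level M g l \<or> upper_level M g l \<subseteq> upper_level M f k"
  have "emeasure M (upper_level M f k \<inter> upper_level M g l) =
      min (emeasure M (upper_level M f k)) (emeasure M (upper_level M g l))" if kl: "0 \<le> k" "0 \<le> l" for k l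
    using n[OF kl]
  proof
    assume s: "upper_level M f k \<subseteq> upper_level M g l"
    then have "emeasure M (upper_level M f k) \<le> emeasure M (upper_level M g l)" by (rule emeasure_mono) auto
    with s show ?thesis by (simp add: Int_absorb2 min_absorb1 del: Collect_mono_iff)
  next
    assume s: "upper_level M g l \<subseteq> upper_level M f k"
    then have "emeasure M (upper_level M g l) \<le> emeasure M (upper_level M f k)" by (rule emeasure_mono) auto
    with s show ?thesis by (simp add: Int_absorb1 min_absorb2 del: Collect_mono_iff)
  qed
  then show "(\<integral>\<^sup>+x. ennreal (norm (f x)) * ennreal (norm (g x)) \<partial>M) =
      (\<integral>\<^sup>+t. ennreal (rearr M f t) * ennreal (rearr M g t) \<partial>unit_leb)"
    unfolding rhs layer_cake_mult[OF M f g]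
    by (auto intro!: nn_integral_cong split: split_indicator)
qed

text \<open>The equality case of \<open>hardy_littlewood\<close> with the constant 1, whose level
  sets are the whole space or empty.\<close>

lemma nn_integral_rearr:
  fixes f :: "'a \<Rightarrow> 'b::real_normed_vector"
  assumes M: "prob_space M" and f [measurable]: "f \<in> borel_measurable M"
  shows "(\<integral>\<^sup>+x. ennreal (norm (f x)) \<partial>M) = (\<integral>\<^sup>+t. ennreal (rearr M f t) \<partial>unit_leb)"
proof -
  have r1: "rearr M (\<lambda>_. 1::real) t = 1" if "t \<in> {0<..<1}" for t
  proof (rule real_eqI_less)
    fix l :: real assume "0 \<le> l"
    then show "l < rearr M (\<lambda>_. 1::real) t \<longleftrightarrow> l < 1"
      using that less_rearr_iff[OF M, of "\<lambda>_. 1::real" l t] prob_space.prob_space[OF M]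
      by (cases "l < 1") auto
  qed (use that in \<open>auto intro: rearr_nonneg[OF M]\<close>)
  have "(\<integral>\<^sup>+x. ennreal (norm (f x)) * ennreal (norm (1::real)) \<partial>M) =
      (\<integral>\<^sup>+t. ennreal (rearr M f t) * ennreal (rearr M (\<lambda>_. 1::real) t) \<partial>unit_leb)"
    by (rule hardy_littlewood(2)[OF M f]) auto
  also have "\<dots> = (\<integral>\<^sup>+t. ennreal (rearr M f t) \<partial>unit_leb)"
    by (rule nn_integral_cong) (simp add: r1)
  finally show ?thesis by simp
qed

lemma down_closed_AE_below:
  fixes L :: "real set"
  assumes "L \<subseteq> {0<..<1}" "\<And>s t. t \<in> L \<Longrightarrow> 0 < s \<Longrightarrow> s \<le> t \<Longrightarrow> s \<in> L"
  shows "\<exists>m\<in>{0..1}. AE t in unit_leb. t \<in> L \<longleftrightarrow> t < m"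
proof (cases "L = {}")
  case True
  then show ?thesis by (intro bexI[of _ 0]) (auto intro!: AE_I2)
next
  case False
  have bdd: "bdd_above L" using assms(1) by (intro bdd_aboveI[of _ 1]) auto
  have "AE t in unit_leb. t \<in> L \<longleftrightarrow> t < Sup L"
    using AE_unit_leb_neq[of "Sup L"] AE_space
  proof eventually_elim
    case (elim t)
    show ?case
    proof
      assume "t \<in> L"
      then have "t \<le> Sup L" using bdd by (rule cSup_upper)
      with elim show "t < Sup L" by auto
    next
      assume "t < Sup L"
      then obtain s where "s \<in> L" "t < s" using False bdd less_cSup_iff by blast
      with elim assms(2)[of s t] show "t \<in> L" by auto
    qed
  qed
  moreover have "Sup L \<in> {0..1}"
    using False assms(1) by (auto intro!: cSup_least) (meson bdd cSup_upper2 greaterThanLessThan_iff less_imp_le subsetD)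
  ultimately show ?thesis by blast
qed

text \<open>Carries inequalities between initial integrals over to the endpoint 1, also for infinite
  integrals. The shift \<open>n + 2\<close> keeps the cut strictly inside the unit interval.\<close>

lemma nn_integral_unit_leb_SUP:
  assumes [measurable]: "a \<in> borel_measurable unit_leb"
  shows "(\<integral>\<^sup>+s. a s \<partial>unit_leb) = (SUP n. \<integral>\<^sup>+s. a s * indicator {..<1 - 1 / real (n + 2)} s \<partial>unit_leb)"
proof -
  have "(\<integral>\<^sup>+s. a s \<partial>unit_leb) = (\<integral>\<^sup>+s. (SUP n. a s * indicator {..<1 - 1 / real (n + 2)} s) \<partial>unit_leb)"
  proof (rule nn_integral_cong)
    fix s assume s: "s \<in> space unit_leb"
    then obtain n where "inverse (real (Suc n)) < 1 - s"
      using reals_Archimedean[of "1 - s"] by auto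
    moreover have "1 / real (n + 2) \<le> inverse (real (Suc n))" by (simp add: field_simps)
    ultimately have "s < 1 - 1 / real (n + 2)" by linarith
    then have "a s \<le> (SUP n. a s * indicator {..<1 - 1 / real (n + 2)} s)"
      by (intro SUP_upper2[of n]) auto
    moreover have "(SUP n. a s * indicator {..<1 - 1 / real (n + 2)} s) \<le> a s"
      by (rule SUP_least) (auto split: split_indicator)
    ultimately show "a s = (SUP n. a s * indicator {..<1 - 1 / real (n + 2)} s)" by simp
  qed
  also have "\<dots> = (SUP n. \<integral>\<^sup>+s. a s * indicator {..<1 - 1 / real (n + 2)} s \<partial>unit_leb)"
  proof (rule nn_integral_monotone_convergence_SUP)
    show "incseq (\<lambda>n s. a s * indicator {..<1 - 1 / real (n + 2)} s)"
    proof (intro incseq_SucI le_funI mult_left_mono)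
      fix n s
      have "1 - 1 / real (n + 2) \<le> 1 - 1 / real (Suc n + 2)" by (simp add: field_simps)
      then show "indicator {..<1 - 1 / real (n + 2)} s \<le> (indicator {..<1 - 1 / real (Suc n + 2)} s :: ennreal)"
        by (auto split: split_indicator)
    qed auto
  qed auto
  finally show ?thesis .
qed

text \<open>Layer cake in \<open>H\<close>: up to null sets its level sets are initial intervals, on
  which the hypothesis compares the two integrals. It remains to integrate over the levels.\<close>

lemma hardy_lemma:
  fixes H :: "real \<Rightarrow> real"
  assumes [measurable]: "a \<in> borel_measurable unit_leb" "b \<in> borel_measurable unit_leb"
    and ab: "\<And>t. t \<in> {0<..<1} \<Longrightarrow>
      (\<integral>\<^sup>+s. a s * indicator {..<t} s \<partial>unit_leb) \<le> (\<integral>\<^sup>+s. b s * indicator {..<t} s \<partial>unit_leb)"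
    and H: "antimono_on {0<..<1} H" "\<And>t. t \<in> {0<..<1} \<Longrightarrow> 0 \<le> H t"
  shows "(\<integral>\<^sup>+s. a s * ennreal (H s) \<partial>unit_leb) \<le> (\<integral>\<^sup>+s. b s * ennreal (H s) \<partial>unit_leb)"
proof -
  \<comment> \<open>A level set of \<open>H\<close> may be empty or the whole interval, so the
    endpoints 0 and 1 are needed as well.\<close>
  have ab': "(\<integral>\<^sup>+s. a s * indicator {..<t} s \<partial>unit_leb) \<le> (\<integral>\<^sup>+s. b s * indicator {..<t} s \<partial>unit_leb)"
    if t: "t \<in> {0..1}" for t
  proof (cases "t = 1")
    case True
    have "(\<integral>\<^sup>+s. c s * indicator {..<t} s \<partial>unit_leb) = (\<integral>\<^sup>+s. c s \<partial>unit_leb)" for c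
      unfolding True by (rule nn_integral_cong) (auto split: split_indicator)
    then show ?thesis
      by (simp only: nn_integral_unit_leb_SUP[OF assms(1)] nn_integral_unit_leb_SUP[OF assms(2)])
         (intro SUP_mono' ab, auto simp: field_simps)
  next
    case False
    show ?thesis
    proof (cases "t = 0")
      case True
      have "(\<integral>\<^sup>+s. a s * indicator {..<t} s \<partial>unit_leb) = (\<integral>\<^sup>+s. 0 \<partial>unit_leb)"
        unfolding True by (rule nn_integral_cong) (auto split: split_indicator)
      then show ?thesis by simp
    qed (use False t ab in auto)
  qed
  have [measurable]: "H \<in> borel_measurable unit_leb" using H(1) by (rule antimono_on_unit_leb)
  have eq: "(\<integral>\<^sup>+s. c s * ennreal (H s) \<partial>unit_leb) = (\<integral>\<^sup>+s. c s * ennreal (norm (H s)) \<partial>unit_leb)" for c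
    by (rule nn_integral_cong) (use H(2) in auto)
  show ?thesis
    unfolding eq layer_cake_weighted[OF prob_space_unit_leb assms(1) \<open>H \<in> _\<close>]
      layer_cake_weighted[OF prob_space_unit_leb assms(2) \<open>H \<in> _\<close>]
  proof (rule nn_integral_mono, rule mult_right_mono)
    fix l :: real
    have "\<exists>m\<in>{0..1}. AE t in unit_leb. t \<in> upper_level unit_leb H l \<longleftrightarrow> t < m"
    proof (rule down_closed_AE_below)
      fix s t assume *: "t \<in> upper_level unit_leb H l" "0 < s" "s \<le> t"
      then have "H t \<le> H s" using H(1) by (auto simp: monotone_on_def)
      with * H(2)[of t] H(2)[of s] show "s \<in> upper_level unit_leb H l" by auto
    qed auto
    then obtain m where m: "m \<in> {0..1}" "AE t in unit_leb. t \<in> upper_level unit_leb H l \<longleftrightarrow> t < m" by blast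
    have "(\<integral>\<^sup>+s. c s * indicator (upper_level unit_leb H l) s \<partial>unit_leb) = (\<integral>\<^sup>+s. c s * indicator {..<m} s \<partial>unit_leb)" for c
      by (rule nn_integral_cong_AE) (use m(2) in eventually_elim, auto split: split_indicator)
    then show "(\<integral>\<^sup>+s. a s * indicator (upper_level unit_leb H l) s \<partial>unit_leb) \<le>
        (\<integral>\<^sup>+s. b s * indicator (upper_level unit_leb H l) s \<partial>unit_leb)"
      using ab'[OF m(1)] by simp
  qed auto
qed

lemma (in prob_space) AE_subset_antisym:
  assumes "A \<in> events" "B \<in> events" "AE x in M. x \<in> A \<longrightarrow> x \<in> B" "prob B \<le> prob A"
  shows "AE x in M. x \<in> B \<longrightarrow> x \<in> A"
proof -
  have "prob A = prob (A \<inter> B)"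
    by (rule finite_measure_eq_AE) (use assms in \<open>auto elim: eventually_mono\<close>)
  moreover have "prob (B - A) = prob B - prob (A \<inter> B)"
    using finite_measure_Diff'[OF assms(2,1)] by (simp add: Int_commute)
  ultimately have "prob (B - A) = 0"
    using assms(4) measure_nonneg[of M "B - A"] by simp
  then have "AE x in M. x \<notin> B - A"
    using assms by (intro AE_not_in) (auto simp: null_sets_def emeasure_eq_measure)
  then show ?thesis by (auto elim: eventually_mono)
qed

text \<open>Inclusion of level sets together with the reverse inequality of their measures makes
  them equal up to null sets. Countably many rational levels suffice to separate two distinct
  values.\<close>

lemma AE_eqI_upper_levels:
  fixes f g :: "'a \<Rightarrow> real"
  assumes M: "prob_space M" and [measurable]: "f \<in> borel_measurable M" "g \<in> borel_measurable M"
    and nn: "\<And>x. x \<in> space M \<Longrightarrow> 0 \<le> f x" "\<And>x. x \<in> space M \<Longrightarrow> 0 \<le> g x"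
    and sub: "\<And>l. 0 \<le> l \<Longrightarrow> AE x in M. x \<in> upper_level M f l \<longrightarrow> x \<in> upper_level M g l"
    and meas: "\<And>l. 0 \<le> l \<Longrightarrow> measure M (upper_level M g l) \<le> measure M (upper_level M f l)"
  shows "AE x in M. f x = g x"
proof -
  interpret prob_space M by fact
  have "AE x in M. l < f x \<longleftrightarrow> l < g x" if l: "0 \<le> l" for l
    using AE_subset_antisym[OF _ _ sub[OF l] meas[OF l]] sub[OF l] AE_space
    by (auto simp: nn elim!: eventually_elim2)
  then have "AE x in M. \<forall>q\<in>\<rat> \<inter> {0..}. q < f x \<longleftrightarrow> q < g x"
    by (subst AE_ball_countable) (auto simp: countable_rat)
  with AE_space show ?thesis
  proof eventually_elim
    case (elim x)
    note nn = nn[OF elim(1)]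
    show ?case
    proof (rule ccontr)
      assume "f x \<noteq> g x"
      then have "min (f x) (g x) < max (f x) (g x)" by linarith
      then obtain q where q: "q \<in> \<rat>" "min (f x) (g x) < q" "q < max (f x) (g x)"
        using Rats_dense_in_real by blast
      with nn have "q \<in> \<rat> \<inter> {0..}" by auto
      with elim have "q < f x \<longleftrightarrow> q < g x" by blast
      with q show False by auto
    qed
  qed
qed

text \<open>Equality can fail at jumps, where \<open>rearr\<close> takes the limit from the right;
  elsewhere the level sets agree because those of \<open>g\<close> are initial intervals.\<close>

lemma rearr_antimono_on_AE:
  fixes g :: "real \<Rightarrow> real"
  assumes g: "antimono_on {0<..<1} g" "\<And>t. t \<in> {0<..<1} \<Longrightarrow> 0 \<le> g t"
  shows "AE t in unit_leb. rearr unit_leb g t = g t"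
proof -
  have gm [measurable]: "g \<in> borel_measurable unit_leb" by (rule antimono_on_unit_leb[OF g(1)])
  note M = prob_space_unit_leb
  show ?thesis
  proof (rule AE_eqI_upper_levels[OF M])
    show "rearr unit_leb g \<in> borel_measurable unit_leb" by (rule rearr_measurable[OF M gm])
    show "measure unit_leb (upper_level unit_leb g l) \<le> measure unit_leb (upper_level unit_leb (rearr unit_leb g) l)"
      if "0 \<le> l" for l
      by (simp only: measure_upper_level_rearr[OF M gm that])
    show "AE t in unit_leb. t \<in> upper_level unit_leb (rearr unit_leb g) l \<longrightarrow> t \<in> upper_level unit_leb g l"
      if l: "0 \<le> l" for l
    proof (intro AE_I2 impI)
      fix t assume "t \<in> upper_level unit_leb (rearr unit_leb g) l"
      then have t: "t \<in> {0<..<1}" and "t \<in> {0<..<measure unit_leb (upper_level unit_leb g l)}"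
        by (simp, simp only: upper_level_rearr[OF M gm l])
      then have t: "t \<in> {0<..<1}" "t < measure unit_leb (upper_level unit_leb g l)"
        by (simp_all only: greaterThanLessThan_iff)
      show "t \<in> upper_level unit_leb g l"
      proof (rule ccontr)
        assume "t \<notin> upper_level unit_leb g l"
        then have "g t \<le> l" using t g(2) by auto
        have "s < t" if "s \<in> {0<..<1}" "l < g s" for s
          using monotone_onD[OF g(1) t(1) that(1)] \<open>g t \<le> l\<close> that(2) by force
        then have "upper_level unit_leb g l \<subseteq> {0<..<t}"
          using g(2) by auto
        then have "measure unit_leb (upper_level unit_leb g l) \<le> measure unit_leb {0<..<t}"
          using t by (intro finite_measure.finite_measure_mono prob_space.finite_measure[OF M]) (auto simp: sets_restrict_space)
        with t show False by (simp add: measure_unit_leb_below)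
      qed
    qed
  qed (use g(2) rearr_nonneg[OF M gm] in auto)
qed

section \<open>Uniformly distributed maps on nonatomic spaces\<close>

text \<open>An uncountable union need not be measurable, so it is replaced by a sequence whose
  probabilities approach the supremum. Comparability keeps the probability of the union from
  exceeding that of all members.\<close>

lemma (in prob_space) AE_chain_Union:
  assumes S: "S \<subseteq> events" "S \<noteq> {}"
    and chain: "\<forall>A\<in>S. \<forall>B\<in>S. (AE x in M. x \<in> A \<longrightarrow> x \<in> B) \<or> (AE x in M. x \<in> B \<longrightarrow> x \<in> A)"
  shows "\<exists>X :: nat \<Rightarrow> 'a set. range X \<subseteq> S \<and> (\<forall>B\<in>S. AE x in M. x \<in> B \<longrightarrow> x \<in> (\<Union>n. X n)) \<and>
    (\<forall>c. (\<forall>B\<in>S. prob B \<le> c) \<longrightarrow> prob (\<Union>n. X n) \<le> c)"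
proof -
  define s where "s = Sup (prob ` S)"
  have bdd: "bdd_above (prob ` S)" by (rule bdd_aboveI[of _ 1]) auto
  have "\<exists>B\<in>S. s - 1 / real (Suc n) < prob B" for n
  proof -
    have "s - 1 / real (Suc n) < s" by simp
    then show ?thesis unfolding s_def using less_cSup_iff[of "prob ` S"] S(2) bdd by blast
  qed
  then obtain X where X: "\<And>n. X n \<in> S" "\<And>n. s - 1 / real (Suc n) < prob (X n)" by metis
  have ev [measurable]: "X n \<in> events" for n using X S by auto
  have sup: "B \<in> S \<Longrightarrow> prob B \<le> s" for B unfolding s_def by (intro cSup_upper bdd) auto
  \<comment> \<open>In a chain every finite union is, up to a null set, one of its members.\<close>
  have fin: "\<exists>j. AE x in M. x \<in> (\<Union>i\<le>n. X i) \<longrightarrow> x \<in> X j" for n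
  proof (induction n)
    case 0 then show ?case by (intro exI[of _ 0]) auto
  next
    case (Suc n)
    then obtain j where j: "AE x in M. x \<in> (\<Union>i\<le>n. X i) \<longrightarrow> x \<in> X j" by blast
    have "(AE x in M. x \<in> X j \<longrightarrow> x \<in> X (Suc n)) \<or> (AE x in M. x \<in> X (Suc n) \<longrightarrow> x \<in> X j)"
      using chain X by blast
    then show ?case
    proof
      assume "AE x in M. x \<in> X j \<longrightarrow> x \<in> X (Suc n)"
      with j have "AE x in M. x \<in> (\<Union>i\<le>Suc n. X i) \<longrightarrow> x \<in> X (Suc n)"
        by eventually_elim (auto simp: atMost_Suc)
      then show ?case by blast
    next
      assume "AE x in M. x \<in> X (Suc n) \<longrightarrow> x \<in> X j"
      with j have "AE x in M. x \<in> (\<Union>i\<le>Suc n. X i) \<longrightarrow> x \<in> X j"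
        by eventually_elim (auto simp: atMost_Suc)
      then show ?case by blast
    qed
  qed
  have le: "prob (\<Union>n. X n) \<le> c" if c: "\<forall>B\<in>S. prob B \<le> c" for c
  proof -
    have "(\<lambda>n. prob (\<Union>i\<le>n. X i)) \<longlonglongrightarrow> prob (\<Union>n. \<Union>i\<le>n. X i)"
      by (rule finite_Lim_measure_incseq) (auto simp: incseq_def, force)
    moreover have "prob (\<Union>i\<le>n. X i) \<le> c" for n
    proof -
      obtain j where "AE x in M. x \<in> (\<Union>i\<le>n. X i) \<longrightarrow> x \<in> X j" using fin by blast
      then have "prob (\<Union>i\<le>n. X i) \<le> prob (X j)" by (rule finite_measure_mono_AE) auto
      also have "\<dots> \<le> c" using c X by blast
      finally show ?thesis .
    qed
    ultimately have "prob (\<Union>n. \<Union>i\<le>n. X i) \<le> c" by (intro LIMSEQ_le_const2) auto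
    also have "(\<Union>n. \<Union>i\<le>n. X i) = (\<Union>n. X n)" by blast
    finally show ?thesis .
  qed
  have ge: "s \<le> prob (\<Union>n. X n)"
  proof (rule field_le_epsilon)
    fix e :: real assume "0 < e"
    then obtain n where "inverse (real (Suc n)) < e" using reals_Archimedean by blast
    moreover have "prob (X n) \<le> prob (\<Union>n. X n)" by (rule finite_measure_mono) auto
    ultimately show "s \<le> prob (\<Union>n. X n) + e" using X(2)[of n] by (simp add: inverse_eq_divide)
  qed
  \<comment> \<open>If no \<open>X n\<close> contains \<open>B\<close>, then \<open>B\<close>
    contains all of them and hence their union. That union has probability at least
    \<open>s\<close>, hence at least that of \<open>B\<close>, so the two agree almost
    everywhere.\<close>
  have "AE x in M. x \<in> B \<longrightarrow> x \<in> (\<Union>n. X n)" if B: "B \<in> S" for B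
  proof (cases "\<exists>n. AE x in M. x \<in> B \<longrightarrow> x \<in> X n")
    case True
    then obtain n where "AE x in M. x \<in> B \<longrightarrow> x \<in> X n" by blast
    then show ?thesis by eventually_elim auto
  next
    case False
    then have "AE x in M. x \<in> X n \<longrightarrow> x \<in> B" for n using chain B X(1) by blast
    then have "AE x in M. \<forall>n. x \<in> X n \<longrightarrow> x \<in> B" by (subst AE_all_countable) auto
    then have "AE x in M. x \<in> (\<Union>n. X n) \<longrightarrow> x \<in> B" by eventually_elim auto
    then show ?thesis
      by (rule AE_subset_antisym[rotated 2]) (use B S ge sup[OF B] in auto)
  qed
  then show ?thesis using X(1) le by (intro exI[of _ X] conjI) auto
qed

text \<open>The previous lemma applied to complements.\<close>

lemma (in prob_space) AE_chain_Inter: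
  assumes S: "S \<subseteq> events" "S \<noteq> {}"
    and chain: "\<forall>A\<in>S. \<forall>B\<in>S. (AE x in M. x \<in> A \<longrightarrow> x \<in> B) \<or> (AE x in M. x \<in> B \<longrightarrow> x \<in> A)"
  shows "\<exists>X :: nat \<Rightarrow> 'a set. range X \<subseteq> S \<and> (\<forall>B\<in>S. AE x in M. x \<in> (\<Inter>n. X n) \<longrightarrow> x \<in> B) \<and>
    (\<forall>c. (\<forall>B\<in>S. c \<le> prob B) \<longrightarrow> c \<le> prob (\<Inter>n. X n))"
proof -
  let ?S = "(\<lambda>B. space M - B) ` S"
  have "(AE x in M. x \<in> A \<longrightarrow> x \<in> B) \<or> (AE x in M. x \<in> B \<longrightarrow> x \<in> A)" if AB: "A \<in> ?S" "B \<in> ?S" for A B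
  proof -
    obtain A' B' where *: "A' \<in> S" "B' \<in> S" "A = space M - A'" "B = space M - B'" using AB by blast
    from chain *(1,2) consider "AE x in M. x \<in> A' \<longrightarrow> x \<in> B'" | "AE x in M. x \<in> B' \<longrightarrow> x \<in> A'" by blast
    then show ?thesis
    proof cases
      case 1
      then have "AE x in M. x \<in> B \<longrightarrow> x \<in> A" by eventually_elim (auto simp: *)
      then show ?thesis by blast
    next
      case 2
      then have "AE x in M. x \<in> A \<longrightarrow> x \<in> B" by eventually_elim (auto simp: *)
      then show ?thesis by blast
    qed
  qed
  then have *: "\<forall>A\<in>?S. \<forall>B\<in>?S. (AE x in M. x \<in> A \<longrightarrow> x \<in> B) \<or> (AE x in M. x \<in> B \<longrightarrow> x \<in> A)" by blast
  have S': "?S \<subseteq> events" "?S \<noteq> {}" using S by auto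
  obtain X :: "nat \<Rightarrow> 'a set" where X: "range X \<subseteq> ?S" "\<forall>B\<in>?S. AE x in M. x \<in> B \<longrightarrow> x \<in> (\<Union>n. X n)"
     "\<forall>c. (\<forall>B\<in>?S. prob B \<le> c) \<longrightarrow> prob (\<Union>n. X n) \<le> c"
    using AE_chain_Union[OF S' *] by blast
  have XS: "X n \<in> ?S" for n using X(1) by (rule subsetD) (rule rangeI)
  define Y where "Y n = space M - X n" for n
  have Y: "Y n \<in> S" for n
  proof -
    obtain B where "B \<in> S" "X n = space M - B" using XS[of n] by blast
    moreover have "B \<subseteq> space M" using S(1) \<open>B \<in> S\<close> sets.sets_into_space by blast
    ultimately show ?thesis by (simp add: Y_def double_diff)
  qed
  have ev [measurable]: "X n \<in> events" "Y n \<in> events" for n using XS[of n] S(1) S'(1) Y[of n] by blast+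
  have eq: "(\<Inter>n. Y n) = space M - (\<Union>n. X n)" unfolding Y_def by (auto simp: Y_def)
  show ?thesis
  proof (intro exI[of _ Y] conjI ballI allI impI)
    fix B assume B: "B \<in> S"
    with X(2) have "AE x in M. x \<in> space M - B \<longrightarrow> x \<in> (\<Union>n. X n)" by blast
    with AE_space show "AE x in M. x \<in> (\<Inter>n. Y n) \<longrightarrow> x \<in> B"
      unfolding eq by eventually_elim auto
  next
    fix c assume c: "\<forall>B\<in>S. c \<le> prob B"
    have "prob (\<Union>n. X n) \<le> 1 - c"
      by (rule X(3)[rule_format]) (use c S(1) in \<open>auto simp: prob_compl\<close>)
    then show "c \<le> prob (\<Inter>n. Y n)" unfolding eq by (simp add: prob_compl)
  qed (use Y in auto)
qed

text \<open>
  A chain, maximal with respect to inclusion modulo null sets together with strict growth of the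
  probability, omits no probability: a gap could be filled using nonatomicity.
\<close>
lemma (in prob_space) nonatomic_nested_family:
  fixes L :: "'i \<Rightarrow> 'a set"
  assumes na: "nonatomic M" and L: "\<And>i. L i \<in> events"
    and Lc: "\<And>i j. (AE x in M. x \<in> L i \<longrightarrow> x \<in> L j) \<or> (AE x in M. x \<in> L j \<longrightarrow> x \<in> L i)"
  obtains A :: "real \<Rightarrow> 'a set" where
    "\<And>c. c \<in> {0..1} \<Longrightarrow> A c \<in> events" "\<And>c. c \<in> {0..1} \<Longrightarrow> prob (A c) = c"
    "\<And>c d. 0 \<le> c \<Longrightarrow> c \<le> d \<Longrightarrow> d \<le> 1 \<Longrightarrow> AE x in M. x \<in> A c \<longrightarrow> x \<in> A d"
    "\<And>c i. c \<in> {0..1} \<Longrightarrow> (AE x in M. x \<in> A c \<longrightarrow> x \<in> L i) \<or> (AE x in M. x \<in> L i \<longrightarrow> x \<in> A c)"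
proof -
  define le (infix "\<preceq>" 50) where "A \<preceq> B \<longleftrightarrow> (AE x in M. x \<in> A \<longrightarrow> x \<in> B)" for A B
  define P where "P A B \<longleftrightarrow> A \<preceq> B \<and> prob A < prob B" for A B
  define \<A> where "\<A> = {A\<in>events. \<forall>i. A \<preceq> L i \<or> L i \<preceq> A}"
  have trans: "A \<preceq> B \<Longrightarrow> B \<preceq> D \<Longrightarrow> A \<preceq> D" for A B D
    unfolding le_def by (auto elim: eventually_elim2)
  have sub: "A \<subseteq> B \<Longrightarrow> A \<preceq> B" for A B unfolding le_def by auto
  obtain C where C: "pred_on.maxchain \<A> P C" using pred_on.Hausdorff by blast
  have CA: "C \<subseteq> \<A>" and
    C1: "\<And>A B. A \<in> C \<Longrightarrow> B \<in> C \<Longrightarrow> A = B \<or> P A B \<or> P B A"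
    using C unfolding pred_on.maxchain_def pred_on.chain_def by auto
  have Cev: "A \<in> C \<Longrightarrow> A \<in> events" for A using CA by (auto simp: \<A>_def)
  have C2: False if A: "A \<in> \<A>" "\<And>B. B \<in> C \<Longrightarrow> P A B \<or> P B A" for A
  proof -
    have "A \<notin> C" using A(2) unfolding P_def by blast
    moreover have "pred_on.chain \<A> P (insert A C)"
      using C A unfolding pred_on.maxchain_def pred_on.chain_def by auto
    ultimately show False using C unfolding pred_on.maxchain_def by blast
  qed
  have cmp: "A \<preceq> B \<or> B \<preceq> A" if "A \<in> C" "B \<in> C" for A B
    using C1[OF that] sub[of A A] by (auto simp: P_def)
  have ex: "\<exists>A\<in>C. prob A = c" if c: "c \<in> {0..1}" for c
  proof (rule ccontr)
    assume none: "\<not> ?thesis"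
    \<comment> \<open>A gap at \<open>c\<close> splits the chain into a lower and an upper part. The
      empty set and the whole space keep both parts nonempty. \<open>A\<close> and \<open>D\<close>
      below are their least upper and greatest lower bounds modulo null sets.\<close>
    define lo where "lo = insert {} {B\<in>C. prob B < c}"
    define up where "up = insert (space M) {B\<in>C. c < prob B}"
    have lo_up: "B \<in> lo \<or> B \<in> up" if "B \<in> C" for B
      using that none by (auto simp: lo_def up_def)
    have A1: "{} \<in> \<A>" "space M \<in> \<A>"
      using sets.sets_into_space[OF L] by (auto simp: \<A>_def intro!: sub)
    have loup: "lo \<subseteq> \<A>" "up \<subseteq> \<A>" using A1 CA by (auto simp: lo_def up_def)
    have ev: "\<A> \<subseteq> events" by (auto simp: \<A>_def)
    have top: "A \<preceq> space M" if "A \<in> events" for A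
      using sets.sets_into_space[OF that] by (rule sub)
    have lo: "\<forall>A\<in>lo. \<forall>B\<in>lo. A \<preceq> B \<or> B \<preceq> A"
      using cmp sub[of "{}"] by (auto simp: lo_def)
    have lo': "lo \<subseteq> events" "lo \<noteq> {}" using loup ev by (auto simp: lo_def)
    obtain X :: "nat \<Rightarrow> 'a set" where X: "range X \<subseteq> lo" "\<forall>B\<in>lo. B \<preceq> (\<Union>n. X n)"
        "\<forall>c. (\<forall>B\<in>lo. prob B \<le> c) \<longrightarrow> prob (\<Union>n. X n) \<le> c"
      using AE_chain_Union[OF lo' lo[unfolded le_def], folded le_def] by blast
    have up: "\<forall>A\<in>up. \<forall>B\<in>up. A \<preceq> B \<or> B \<preceq> A"
      using cmp top Cev by (auto simp: up_def)
    have up': "up \<subseteq> events" "up \<noteq> {}" using loup ev by (auto simp: up_def)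
    obtain Y :: "nat \<Rightarrow> 'a set" where Y: "range Y \<subseteq> up" "\<forall>B\<in>up. (\<Inter>n. Y n) \<preceq> B"
        "\<forall>c. (\<forall>B\<in>up. c \<le> prob B) \<longrightarrow> c \<le> prob (\<Inter>n. Y n)"
      using AE_chain_Inter[OF up' up[unfolded le_def], folded le_def] by blast
    define A where "A = (\<Union>n. X n)"
    define D where "D = (\<Inter>n. Y n)"
    have [measurable]: "A \<in> events" "D \<in> events"
      unfolding A_def D_def using X(1) Y(1) lo'(1) up'(1)
      by (intro sets.countable_UN sets.countable_INT; blast)+
    have Ac: "prob A \<le> c" unfolding A_def by (rule X(3)[rule_format]) (use c in \<open>auto simp: lo_def\<close>)
    have Dc: "c \<le> prob D" unfolding D_def by (rule Y(3)[rule_format]) (use c in \<open>auto simp: up_def prob_space\<close>)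
    have UnI: "A \<preceq> B" if "\<And>n. X n \<preceq> B" for B
    proof -
      have "AE x in M. \<forall>n. x \<in> X n \<longrightarrow> x \<in> B" using that by (subst AE_all_countable) (auto simp: le_def)
      then show ?thesis unfolding le_def A_def by eventually_elim auto
    qed
    have IntI: "B \<preceq> D" if "\<And>n. B \<preceq> Y n" for B
    proof -
      have "AE x in M. \<forall>n. x \<in> B \<longrightarrow> x \<in> Y n" using that by (subst AE_all_countable) (auto simp: le_def)
      then show ?thesis unfolding le_def D_def by eventually_elim auto
    qed
    have lu: "B \<preceq> B'" if "B \<in> lo" "B' \<in> up" for B B'
    proof -
      have "B = {} \<or> B' = space M \<or> (B \<in> C \<and> B' \<in> C \<and> prob B < prob B')"
        using that by (auto simp: lo_def up_def)
      then show ?thesis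
        using sub[of "{}" B'] top[of B] that loup ev C1[of B B'] by (auto simp: P_def)
    qed
    have A_up: "A \<preceq> B" if "B \<in> up" for B using UnI lu X(1) that by blast
    have lo_D: "B \<preceq> D" if "B \<in> lo" for B using IntI lu Y(1) that by blast
    have AD: "A \<preceq> D" using IntI A_up Y(1) by blast
    have lo_A: "B \<preceq> A" if "B \<in> lo" for B using X(2) that by (simp add: A_def)
    have D_up: "D \<preceq> B" if "B \<in> up" for B using Y(2) that by (simp add: D_def)
    have prob_le: "prob B \<le> prob B'" if "B \<preceq> B'" "B' \<in> events" for B B'
      using that unfolding le_def by (rule finite_measure_mono_AE)
    have cmpA: "A \<preceq> L i \<or> L i \<preceq> A" for i
    proof (cases "\<forall>n. X n \<preceq> L i")
      case False
      then obtain n where "\<not> X n \<preceq> L i" by blast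
      then have "L i \<preceq> X n" using X(1) loup by (auto simp: \<A>_def)
      moreover have "X n \<preceq> A" by (rule sub) (auto simp: A_def)
      ultimately show ?thesis using trans by blast
    qed (use UnI in blast)
    have cmpD: "D \<preceq> L i \<or> L i \<preceq> D" for i
    proof (cases "\<forall>n. L i \<preceq> Y n")
      case False
      then obtain n where "\<not> L i \<preceq> Y n" by blast
      then have "Y n \<preceq> L i" using Y(1) loup by (auto simp: \<A>_def)
      moreover have "D \<preceq> Y n" by (rule sub) (auto simp: D_def)
      ultimately show ?thesis using trans by blast
    qed (use IntI in blast)
    \<comment> \<open>Any admissible set between \<open>A\<close> and \<open>D\<close> whose
      probability is strictly separated from those of the chain could be inserted, against
      maximality.\<close>
    have btw: False if F: "F \<in> \<A>" "A \<preceq> F" "F \<preceq> D"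
      "\<And>B. B \<in> C \<Longrightarrow> prob B < c \<Longrightarrow> prob B < prob F" "\<And>B. B \<in> C \<Longrightarrow> c < prob B \<Longrightarrow> prob F < prob B" for F
    proof (rule C2[OF F(1)])
      fix B assume B: "B \<in> C"
      then consider "prob B < c" | "c < prob B" using none by force
      then show "P F B \<or> P B F"
      proof cases
        case 1
        then have "B \<preceq> F" using lo_A[of B] B trans F(2) by (auto simp: lo_def)
        then show ?thesis using F(4)[OF B 1] by (simp add: P_def)
      next
        case 2
        then have "F \<preceq> B" using D_up[of B] B trans F(3) by (auto simp: up_def)
        then show ?thesis using F(5)[OF B 2] by (simp add: P_def)
      qed
    qed
    have pA: "prob B \<le> prob A" if "B \<in> C" "prob B < c" for B
      using prob_le[OF lo_A[of B]] that by (auto simp: lo_def)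
    have pD: "prob D \<le> prob B" if "B \<in> C" "c < prob B" for B
      using prob_le[OF D_up[of B]] that Cev by (auto simp: up_def)
    have "A \<in> \<A>" "D \<in> \<A>" using cmpA cmpD by (auto simp: \<A>_def)
    \<comment> \<open>With probability exactly \<open>c\<close>, the sets \<open>A\<close> and
      \<open>D\<close> could themselves be inserted.\<close>
    have "prob A \<noteq> c" using btw[OF \<open>A \<in> \<A>\<close> sub AD] by fastforce
    have "prob D \<noteq> c" using btw[OF \<open>D \<in> \<A>\<close> AD sub] by fastforce
    then have AcD: "prob A < c" "c < prob D" using Ac Dc \<open>prob A \<noteq> c\<close> by auto
    have DA: "prob (D - A) = prob D - prob A"
    proof -
      have "prob (A \<inter> D) = prob A"
        by (rule finite_measure_eq_AE) (use AD in \<open>auto simp: le_def elim: eventually_mono\<close>)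
      then show ?thesis using finite_measure_Diff'[of D A] by (simp add: Int_commute)
    qed
    then have "0 < emeasure M (D - A)" "D - A \<in> events"
      using AcD by (auto simp: emeasure_eq_measure)
    then obtain E where "E \<in> events" "E \<subseteq> D - A" "0 < emeasure M E" "emeasure M E < emeasure M (D - A)"
      using na unfolding nonatomic_def by blast
    then have E: "E \<in> events" "E \<subseteq> D - A" "0 < prob E" "prob E < prob (D - A)"
      by (auto simp: emeasure_eq_measure ennreal_less_iff)
    \<comment> \<open>Nonatomicity yields a piece \<open>E\<close> of \<open>D - A\<close> of
      intermediate probability, so \<open>F\<close> fills the gap once it is known to be comparable
      with every \<open>L i\<close>.\<close>
    define F where "F = A \<union> E"
    have [measurable]: "F \<in> events" using E by (simp add: F_def)
    have pF: "prob F = prob A + prob E"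
      unfolding F_def using E by (intro finite_measure_Union) auto
    have AF: "A \<preceq> F" by (rule sub) (simp add: F_def)
    have FD: "F \<preceq> D" using AD unfolding le_def F_def by eventually_elim (use E(2) in auto)
    \<comment> \<open>An \<open>L i\<close> not comparable with \<open>F\<close> would lie between
      \<open>A\<close> and \<open>D\<close> with strictly intermediate probability. Being comparable
      with all other \<open>L j\<close>, it could be inserted itself.\<close>
    have "F \<preceq> L i \<or> L i \<preceq> F" for i
    proof (rule ccontr)
      assume *: "\<not> ?thesis"
      then have "\<not> L i \<preceq> A" "\<not> D \<preceq> L i" using trans AF FD by blast+
      then have AL: "A \<preceq> L i" and LD: "L i \<preceq> D" using cmpA cmpD by blast+
      have "prob A < prob (L i)"
        using AE_subset_antisym[OF \<open>A \<in> events\<close> L] AL \<open>\<not> L i \<preceq> A\<close> by (force simp: le_def not_le[symmetric])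
      moreover have "prob (L i) < prob D"
        using AE_subset_antisym[OF L \<open>D \<in> events\<close>] LD \<open>\<not> D \<preceq> L i\<close> by (force simp: le_def not_le[symmetric])
      moreover have "L i \<in> \<A>" using Lc L by (auto simp: \<A>_def le_def)
      ultimately show False using btw[OF _ AL LD] pA pD by force
    qed
    then have "F \<in> \<A>" by (simp add: \<A>_def)
    then show False using btw[OF _ AF FD] pA pD pF E DA by force
  qed
  then obtain A where A: "\<And>c. c \<in> {0..1} \<Longrightarrow> A c \<in> C" "\<And>c. c \<in> {0..1} \<Longrightarrow> prob (A c) = c"
    by metis
  show ?thesis
  proof
    fix c d :: real assume cd: "0 \<le> c" "c \<le> d" "d \<le> 1"
    then have "A c = A d \<or> P (A c) (A d) \<or> P (A d) (A c)" using C1 A(1) by auto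
    then have "A c \<preceq> A d"
    proof (elim disjE)
      assume "P (A d) (A c)"
      then show ?thesis using A(2)[of c] A(2)[of d] cd by (simp add: P_def)
    qed (simp_all add: P_def sub)
    then show "AE x in M. x \<in> A c \<longrightarrow> x \<in> A d" by (simp add: le_def)
  qed (use A CA in \<open>auto simp: \<A>_def le_def\<close>)
qed

text \<open>The law of \<open>U\<close> is Lebesgue measure on the unit interval. Values in the open
  interval are required everywhere, so that a rearrangement can be composed with \<open>U\<close>
  without exceptional points.\<close>

definition uniform_map :: "'a measure \<Rightarrow> ('a \<Rightarrow> real) \<Rightarrow> bool" where
  "uniform_map M U \<longleftrightarrow> U \<in> borel_measurable M \<and> (\<forall>x\<in>space M. U x \<in> {0<..<1}) \<and>
     (\<forall>t\<in>{0<..<1}. measure M {x\<in>space M. U x < t} = t)"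

text \<open>Ryff's factorisation of the modulus of \<open>f\<close> through its rearrangement. Up to
  a null set \<open>U x\<close> is the smallest \<open>c\<close> with \<open>x\<close> in
  \<open>A c\<close>, for a nested family \<open>A\<close> with one set of each probability that is
  comparable with the level sets of \<open>f\<close>; this forces the modulus of \<open>f\<close> to
  be a decreasing function of \<open>U\<close>.\<close>

lemma nonatomic_uniform_map:
  fixes f :: "'a \<Rightarrow> 'b::real_normed_vector"
  assumes M: "prob_space M" and na: "nonatomic M" and f [measurable]: "f \<in> borel_measurable M"
  obtains U where "uniform_map M U" "AE x in M. rearr M f (U x) = norm (f x)"
proof -
  interpret prob_space M by fact
  have lc: "(AE x in M. x \<in> upper_level M f i \<longrightarrow> x \<in> upper_level M f j) \<or>
      (AE x in M. x \<in> upper_level M f j \<longrightarrow> x \<in> upper_level M f i)" for i j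
    by (cases "i \<le> j") (auto intro!: AE_I2)
  obtain A :: "real \<Rightarrow> 'a set" where
    Aev: "\<And>c. c \<in> {0..1} \<Longrightarrow> A c \<in> events" and Ap: "\<And>c. c \<in> {0..1} \<Longrightarrow> prob (A c) = c" and
    Amono: "\<And>c d. 0 \<le> c \<Longrightarrow> c \<le> d \<Longrightarrow> d \<le> 1 \<Longrightarrow> AE x in M. x \<in> A c \<longrightarrow> x \<in> A d" and
    AL: "\<And>c i. c \<in> {0..1} \<Longrightarrow> (AE x in M. x \<in> A c \<longrightarrow> x \<in> upper_level M f i) \<or>
      (AE x in M. x \<in> upper_level M f i \<longrightarrow> x \<in> A c)"
    by (rule nonatomic_nested_family[OF na upper_level_sets[OF f], of "\<lambda>i. i"]) (rule lc, blast)
  \<comment> \<open>Rational indices make the sublevel sets of \<open>V\<close> countable unions,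
    hence measurable. The inclusions in the family hold only almost everywhere, so only countably
    many may be used at once.\<close>
  define Q where "Q = (\<rat> \<inter> {0<..<1} :: real set)"
  have Q: "countable Q" "Q \<subseteq> {0<..<1}" by (auto simp: Q_def countable_rat)
  have Qev [measurable]: "q \<in> Q \<Longrightarrow> A q \<in> events" for q using Aev Q by auto
  \<comment> \<open>The inserted 1 is the value at points that lie in no \<open>A q\<close>.\<close>
  define V where "V x = Inf (insert 1 {q\<in>Q. x \<in> A q})" for x
  have bdd: "bdd_below (insert 1 {q\<in>Q. x \<in> A q})" for x
    using Q by (intro bdd_belowI[of _ 0]) auto
  have Vless: "V x < t \<longleftrightarrow> 1 < t \<or> (\<exists>q\<in>Q. q < t \<and> x \<in> A q)" for x t
    unfolding V_def by (subst cInf_less_iff[OF _ bdd]) auto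
  have Vset: "{x\<in>space M. V x < t} = (\<Union>q\<in>{q\<in>Q. q < t}. A q)" if "t \<le> 1" for t
    unfolding Vless using that sets.sets_into_space[OF Qev] by auto
  have Vm [measurable]: "V \<in> borel_measurable M"
  proof (rule borel_measurableI_less)
    fix t :: real
    have "{x\<in>space M. V x < t} \<in> sets M" if "t \<le> 1"
      unfolding Vset[OF that] using Q by (intro sets.countable_UN') (auto intro: countable_subset)
    moreover have "{x\<in>space M. V x < t} = space M" if "1 < t"
      unfolding Vless using that by auto
    ultimately show "{x\<in>space M. V x < t} \<in> sets M" by (cases "t \<le> 1") auto
  qed
  have Vle: "AE x in M. x \<in> {x\<in>space M. V x < t} \<longrightarrow> x \<in> A t" if t: "t \<in> {0..1}" for t
  proof -
    have "AE x in M. \<forall>q\<in>{q\<in>Q. q < t}. x \<in> A q \<longrightarrow> x \<in> A t"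
      using Q t by (subst AE_ball_countable) (auto intro: countable_subset intro!: Amono)
    then show ?thesis
      unfolding Vset[OF t[THEN conjunct2[OF iffD1[OF atLeastAtMost_iff]]]] by eventually_elim auto
  qed
  have Vp: "prob {x\<in>space M. V x < t} = t" if t: "t \<in> {0..1}" for t
  proof (rule antisym)
    have "prob {x\<in>space M. V x < t} \<le> prob (A t)"
      by (rule finite_measure_mono_AE[OF Vle[OF t] Aev[OF t]])
    then show "prob {x\<in>space M. V x < t} \<le> t" using Ap t by simp
    show "t \<le> prob {x\<in>space M. V x < t}"
    proof (rule dense_le)
      fix s assume "s < t"
      show "s \<le> prob {x\<in>space M. V x < t}"
      proof (cases "s < 0")
        case False
        with \<open>s < t\<close> obtain q where q: "q \<in> \<rat>" "s < q" "q < t" using Rats_dense_in_real by blast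
        then have "q \<in> Q" using False t by (auto simp: Q_def)
        then have "prob (A q) \<le> prob {x\<in>space M. V x < t}"
          using q t sets.sets_into_space[OF Qev]
          by (intro finite_measure_mono borel_measurable_less Vm borel_measurable_const) (auto simp: Vless)
        then show ?thesis using Ap[of q] q False t by auto
      qed (use measure_nonneg[of M] in \<open>auto intro: order_trans less_imp_le\<close>)
    qed
  qed
  have V1: "AE x in M. V x < 1"
    using Vp[of 1] by (intro AE_prob_1[THEN eventually_mono]) auto
  have V0: "AE x in M. 0 < V x"
  proof -
    have nn: "0 \<le> V x" for x unfolding V_def using Q by (intro cInf_greatest) auto
    have "prob {x\<in>space M. V x \<le> 0} \<le> 0"
    proof (rule field_le_epsilon)
      fix e :: real assume e: "0 < e"
      have "prob {x\<in>space M. V x \<le> 0} \<le> prob {x\<in>space M. V x < min e 1}"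
        using e by (intro finite_measure_mono) auto
      also have "\<dots> \<le> e" using e by (subst Vp) auto
      finally show "prob {x\<in>space M. V x \<le> 0} \<le> 0 + e" by simp
    qed
    then have "emeasure M {x\<in>space M. V x \<le> 0} = 0"
      by (simp add: emeasure_eq_measure antisym)
    then show ?thesis by (subst AE_iff_measurable[OF _ refl]) (auto simp: not_less)
  qed
  \<comment> \<open>\<open>V\<close> is corrected on a null set to take values in the open interval;
    1/2 is arbitrary.\<close>
  define U where "U x = (if 0 < V x \<and> V x < 1 then V x else 1/2)" for x
  have [measurable]: "U \<in> borel_measurable M" unfolding U_def by measurable
  have UV: "AE x in M. U x = V x" using V0 V1 by eventually_elim (auto simp: U_def)
  have U01: "U x \<in> {0<..<1}" for x by (auto simp: U_def)
  have Up: "prob {x\<in>space M. U x < t} = t" if "t \<in> {0..1}" for t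
  proof -
    have "prob {x\<in>space M. U x < t} = prob {x\<in>space M. V x < t}"
      by (rule finite_measure_eq_AE) (use UV in \<open>auto elim: eventually_mono\<close>)
    then show ?thesis using Vp that by simp
  qed
  have um: "uniform_map M U" using U01 Up by (auto simp: uniform_map_def)
  have rm [measurable]: "(\<lambda>x. rearr M f (U x)) \<in> borel_measurable M"
  proof -
    have "U \<in> M \<rightarrow>\<^sub>M restrict_space borel {0<..<1}" using U01 by (intro measurable_restrict_space2) auto
    from measurable_compose[OF this antimono_on_borel[OF rearr_antimono_unit[OF M f]]] show ?thesis .
  qed
  have lev: "upper_level M (\<lambda>x. rearr M f (U x)) l = {x\<in>space M. U x < prob (upper_level M f l)}"
    if "0 \<le> l" for l
    using less_rearr_iff[OF M f that] rearr_nonneg[OF M f] U01 by auto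
  have "AE x in M. rearr M f (U x) = norm (f x)"
  proof (rule AE_eqI_upper_levels[OF M rm])
    fix l :: real assume l: "0 \<le> l"
    let ?m = "prob (upper_level M f l)"
    \<comment> \<open>The level set is too large to be contained in \<open>A q\<close>, so
      comparability gives the opposite inclusion.\<close>
    have "AE x in M. x \<in> A q \<longrightarrow> x \<in> upper_level M f l" if q: "q \<in> {q\<in>Q. q < ?m}" for q
    proof -
      have q01: "q \<in> {0..1}" using q Q by auto
      have "\<not> (AE x in M. x \<in> upper_level M f l \<longrightarrow> x \<in> A q)"
      proof
        assume "AE x in M. x \<in> upper_level M f l \<longrightarrow> x \<in> A q"
        then have "?m \<le> prob (A q)" by (rule finite_measure_mono_AE) (use Aev q01 in auto)
        then show False using Ap[OF q01] q by auto
      qed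
      with AL[OF q01] show ?thesis by blast
    qed
    then have "AE x in M. \<forall>q\<in>{q\<in>Q. q < ?m}. x \<in> A q \<longrightarrow> x \<in> upper_level M f l"
      using Q by (subst AE_ball_countable) (auto intro: countable_subset)
    then show "AE x in M. x \<in> upper_level M (\<lambda>x. rearr M f (U x)) l \<longrightarrow> x \<in> upper_level M (\<lambda>x. norm (f x)) l"
      using UV AE_space
    proof eventually_elim
      case (elim x)
      show ?case
      proof
        assume "x \<in> upper_level M (\<lambda>x. rearr M f (U x)) l"
        then have "V x < ?m" using elim(2) by (simp only: lev[OF l]) auto
        then have "\<exists>q\<in>{q\<in>Q. q < ?m}. x \<in> A q" using Vless[of x ?m] prob_le_1[of "upper_level M f l"] by auto
        with elim show "x \<in> upper_level M (\<lambda>x. norm (f x)) l" by auto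
      qed
    qed
    show "prob (upper_level M (\<lambda>x. norm (f x)) l) \<le> prob (upper_level M (\<lambda>x. rearr M f (U x)) l)"
      unfolding lev[OF l] by (subst Up) auto
  qed (use rearr_nonneg[OF M f] U01 in auto)
  with um that show ?thesis by blast
qed

text \<open>The interval is cut into \<open>n\<close> pieces shorter than the measure of
  \<open>A\<close>. Some piece meets \<open>A\<close> in positive measure, and none can contain
  almost all of it.\<close>

lemma nonatomic_unit_leb: "nonatomic unit_leb"
  unfolding nonatomic_def
proof (intro ballI impI)
  interpret U: prob_space unit_leb by (rule prob_space_unit_leb)
  fix A assume A: "A \<in> sets unit_leb" and pos: "0 < emeasure unit_leb A"
  let ?m = "measure unit_leb A"
  have m: "0 < ?m" using pos by (simp add: U.emeasure_eq_measure)
  obtain n :: nat where n: "1 / ?m < real n" "0 < n"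
    by (metis gr0I less_numeral_extra(3) of_nat_0 reals_Archimedean2 zero_less_divide_1_iff m less_trans)
  have nm: "1 / real n < ?m" using n m by (simp add: field_simps)
  let ?I = "\<lambda>i. {real i / real n<..real (Suc i) / real n} \<inter> {0<..<1}"
  have Ie [measurable]: "?I i \<in> sets unit_leb" for i by (auto simp: sets_restrict_space)
  have "measure unit_leb (?I i) \<le> 1 / real n" for i
  proof -
    have "emeasure unit_leb (?I i) = emeasure lebesgue (?I i)" by (subst emeasure_restrict_space) auto
    also have "\<dots> \<le> emeasure lebesgue {real i / real n<..real (Suc i) / real n}" by (rule emeasure_mono) auto
    also have "\<dots> = ennreal (real (Suc i) / real n - real i / real n)"
      by (simp add: divide_right_mono)
    also have "real (Suc i) / real n - real i / real n = 1 / real n"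
      by (simp add: diff_divide_distrib[symmetric])
    finally show ?thesis by (simp add: U.emeasure_eq_measure)
  qed
  then have small: "measure unit_leb (A \<inter> ?I i) < ?m" for i
    using nm U.finite_measure_mono[of "A \<inter> ?I i" "?I i"] A by (smt (verit) Ie Int_lower2)
  have "A \<subseteq> (\<Union>i<n. A \<inter> ?I i)"
  proof
    fix x assume x: "x \<in> A"
    then have x01: "x \<in> {0<..<1}" using sets.sets_into_space[OF A] by auto
    let ?i = "nat (\<lceil>x * real n\<rceil> - 1)"
    have "0 < \<lceil>x * real n\<rceil>" using x01 n by (simp add: less_ceiling_iff)
    moreover have "\<lceil>x * real n\<rceil> \<le> int n" using x01 n by (simp add: ceiling_le_iff)
    ultimately have "?i < n" "real ?i = of_int \<lceil>x * real n\<rceil> - 1" by (auto simp: nat_less_iff)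
    moreover from this have "real ?i < x * real n" "x * real n \<le> real (Suc ?i)" by linarith+
    ultimately show "x \<in> (\<Union>i<n. A \<inter> ?I i)" using x x01 n by (auto simp: field_simps intro!: bexI[of _ ?i])
  qed
  then have "?m \<le> measure unit_leb (\<Union>i<n. A \<inter> ?I i)" using A by (intro U.finite_measure_mono) auto
  also have "\<dots> \<le> (\<Sum>i<n. measure unit_leb (A \<inter> ?I i))" using A by (intro measure_UNION_le) auto
  finally have "0 < (\<Sum>i<n. measure unit_leb (A \<inter> ?I i))" using m by linarith
  then obtain i where "0 < measure unit_leb (A \<inter> ?I i)"
    using sum_nonpos[of "{..<n}" "\<lambda>i. measure unit_leb (A \<inter> ?I i)"] by (meson not_less)
  with small A show "\<exists>B\<in>sets unit_leb. B \<subseteq> A \<and> 0 < emeasure unit_leb B \<and> emeasure unit_leb B < emeasure unit_leb A"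
    by (intro bexI[of _ "A \<inter> ?I i"]) (auto simp: U.emeasure_eq_measure ennreal_less_iff)
qed

lemma uniform_map_measure:
  assumes M: "prob_space M" and U: "uniform_map M U" and t: "t \<in> {0..1}"
  shows "measure M {x\<in>space M. U x < t} = t"
proof -
  consider "t = 0" | "t = 1" | "t \<in> {0<..<1}" using t by fastforce
  then show ?thesis
  proof cases
    case 1
    then have "{x\<in>space M. U x < t} = {}" using U by (force simp: uniform_map_def)
    then show ?thesis using 1 by (metis measure_empty)
  next
    case 2
    then have "{x\<in>space M. U x < t} = space M" using U by (force simp: uniform_map_def)
    then show ?thesis using 2 prob_space.prob_space[OF M] by metis
  qed (use U in \<open>simp add: uniform_map_def\<close>)
qed

lemma uniform_map_compose:
  assumes "uniform_map M U" and "f \<in> borel_measurable (restrict_space borel {0<..<1})"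
  shows "(\<lambda>x. f (U x)) \<in> borel_measurable M"
proof -
  have "U \<in> M \<rightarrow>\<^sub>M restrict_space borel {0<..<1}"
    using assms(1) unfolding uniform_map_def by (intro measurable_restrict_space2) auto
  from measurable_compose[OF this assms(2)] show ?thesis .
qed

lemma upper_level_rearr_uniform:
  assumes "prob_space N" "f \<in> borel_measurable N" and U: "uniform_map M U" and l: "0 \<le> l"
  shows "upper_level M (\<lambda>x. rearr N f (U x)) l = {x\<in>space M. U x < measure N (upper_level N f l)}"
  using less_rearr_iff[OF assms(1,2) l] rearr_nonneg[OF assms(1,2)] U
  by (auto simp: uniform_map_def)

lemma rearr_uniform_map:
  assumes "prob_space N" "f \<in> borel_measurable N" "prob_space M" "uniform_map M U"
  shows "rearr M (\<lambda>x. rearr N f (U x)) = rearr N f"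
proof (rule rearr_cong_distribution)
  fix l :: real assume "0 < l"
  then show "measure M (upper_level M (\<lambda>x. rearr N f (U x)) l) = measure N (upper_level N f l)"
    using upper_level_rearr_uniform[OF assms(1,2,4), of l] uniform_map_measure[OF assms(3,4)]
      prob_space.prob_le_1[OF assms(1), of "upper_level N f l"]
    by simp
qed

lemma rearr_uniform_map_measurable:
  assumes "prob_space N" "f \<in> borel_measurable N" "uniform_map M U"
  shows "(\<lambda>x. rearr N f (U x)) \<in> borel_measurable M"
  by (rule uniform_map_compose[OF assms(3)], rule antimono_on_borel, rule rearr_antimono_unit, fact+)

section \<open>Nonnegative functions on the unit interval and the associate functional\<close>

lemma MplusI: "f \<in> borel_measurable unit_leb \<Longrightarrow> (\<And>t. t \<in> {0<..<1} \<Longrightarrow> 0 \<le> f t) \<Longrightarrow> f \<in> Mplus"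
  by (simp add: Mplus_def)

lemma Mplus_measurable [measurable_dest]: "f \<in> Mplus \<Longrightarrow> f \<in> borel_measurable unit_leb"
  by (simp add: Mplus_def)

lemma Mplus_nonneg: "f \<in> Mplus \<Longrightarrow> t \<in> {0<..<1} \<Longrightarrow> 0 \<le> f t"
  by (simp add: Mplus_def)

lemma Mplus_cmult: "f \<in> Mplus \<Longrightarrow> 0 \<le> c \<Longrightarrow> (\<lambda>t. c * f t) \<in> Mplus"
  by (rule MplusI) (simp_all add: Mplus_measurable Mplus_nonneg)

lemma AE_unit_leb_I: "(\<And>t. t \<in> {0<..<1} \<Longrightarrow> P t) \<Longrightarrow> AE t in unit_leb. P t"
  by (rule AE_I2) simp

lemma nn_integral_unit_leb_cong:
  "(\<And>t. t \<in> {0<..<1} \<Longrightarrow> f t = g t) \<Longrightarrow> (\<integral>\<^sup>+t. f t \<partial>unit_leb) = (\<integral>\<^sup>+t. g t \<partial>unit_leb)"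
  by (rule nn_integral_cong) simp

lemma nn_integral_unit_leb_mono:
  "(\<And>t. t \<in> {0<..<1} \<Longrightarrow> f t \<le> g t) \<Longrightarrow> (\<integral>\<^sup>+t. f t \<partial>unit_leb) \<le> (\<integral>\<^sup>+t. g t \<partial>unit_leb)"
  by (rule nn_integral_mono) simp

lemma nn_integral_mult_truncate_le:
  assumes [measurable]: "h \<in> Mplus" "g \<in> Mplus"
    and B: "\<And>m::nat. (\<integral>\<^sup>+t. ennreal (h t * min (g t) (real m)) \<partial>unit_leb) \<le> B"
  shows "(\<integral>\<^sup>+t. ennreal (h t * g t) \<partial>unit_leb) \<le> B"
proof -
  have "(\<integral>\<^sup>+t. ennreal (h t * g t) \<partial>unit_leb) \<le> (\<integral>\<^sup>+t. (SUP m. ennreal (h t * min (g t) (real m))) \<partial>unit_leb)"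
  proof (rule nn_integral_unit_leb_mono)
    fix t :: real
    obtain m :: nat where "g t \<le> real m" using real_arch_simple by blast
    then show "ennreal (h t * g t) \<le> (SUP m. ennreal (h t * min (g t) (real m)))"
      by (intro SUP_upper2[of m]) auto
  qed
  \<comment> \<open>\<open>h\<close> is known to be nonnegative only on the open interval, whereas
    monotone convergence asks for monotonicity at every real; hence \<open>max 0\<close>.\<close>
  also have "\<dots> = (\<integral>\<^sup>+t. (SUP m. ennreal (max 0 (h t) * min (g t) (real m))) \<partial>unit_leb)"
    by (rule nn_integral_unit_leb_cong) (simp add: Mplus_nonneg[OF assms(1)] max_absorb2)
  also have "\<dots> = (SUP m. \<integral>\<^sup>+t. ennreal (max 0 (h t) * min (g t) (real m)) \<partial>unit_leb)"
    by (rule nn_integral_monotone_convergence_SUP)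
       (auto simp: incseq_def le_fun_def intro!: ennreal_leI mult_left_mono)
  also have "\<dots> = (SUP m. \<integral>\<^sup>+t. ennreal (h t * min (g t) (real m)) \<partial>unit_leb)"
    by (intro SUP_cong refl nn_integral_unit_leb_cong) (simp add: Mplus_nonneg[OF assms(1)] max_absorb2)
  also have "\<dots> \<le> B" by (rule SUP_least) (rule B)
  finally show ?thesis .
qed

lemma associate_cong_AE:
  assumes "AE t in unit_leb. f t = g t"
  shows "associate Z f = associate Z g"
  unfolding associate_def
  by (intro SUP_cong refl nn_integral_cong_AE) (use assms in eventually_elim, simp)

lemma associate_ge:
  assumes "g \<in> Mplus" "Z g \<le> 1"
  shows "(\<integral>\<^sup>+t. ennreal (f t * g t) \<partial>unit_leb) \<le> associate Z f"
  unfolding associate_def by (rule SUP_upper) (use assms in auto)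

section \<open>Duality for rearrangement-invariant norms\<close>

locale ri_banach =
  fixes Z :: functional
  assumes Z: "ri_banach_norm Z"
begin

lemma Z_zero_iff: "f \<in> Mplus \<Longrightarrow> Z f = 0 \<longleftrightarrow> (AE t in unit_leb. f t = 0)"
  using Z unfolding ri_banach_norm_def ri_axioms_def by blast

lemma Z_scale: "f \<in> Mplus \<Longrightarrow> 0 \<le> c \<Longrightarrow> Z (\<lambda>t. c * f t) = ennreal c * Z f"
  using Z unfolding ri_banach_norm_def ri_axioms_def by blast

lemma Z_mono_AE: "f \<in> Mplus \<Longrightarrow> g \<in> Mplus \<Longrightarrow> (AE t in unit_leb. f t \<le> g t) \<Longrightarrow> Z f \<le> Z g"
  using Z unfolding ri_banach_norm_def ri_axioms_def by blast

lemma Z_mono: "f \<in> Mplus \<Longrightarrow> g \<in> Mplus \<Longrightarrow> (\<And>t. t \<in> {0<..<1} \<Longrightarrow> f t \<le> g t) \<Longrightarrow> Z f \<le> Z g"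
  by (intro Z_mono_AE AE_unit_leb_I)

lemma Z_cong_AE: "f \<in> Mplus \<Longrightarrow> g \<in> Mplus \<Longrightarrow> (AE t in unit_leb. f t = g t) \<Longrightarrow> Z f = Z g"
  by (intro antisym Z_mono_AE) (auto elim: eventually_mono)

lemma Z_tendsto:
  assumes "f \<in> Mplus" "\<And>k. fk k \<in> Mplus" "AE t in unit_leb. incseq (\<lambda>k. fk k t) \<and> (\<lambda>k. fk k t) \<longlonglongrightarrow> f t"
  shows "(\<lambda>k. Z (fk k)) \<longlonglongrightarrow> Z f"
  using Z assms unfolding ri_banach_norm_def ri_axioms_def by blast

lemma Z_one: "Z (\<lambda>t. 1) < \<infinity>"
  using Z unfolding ri_banach_norm_def ri_axioms_def by blast

lemma Z_rearr_cong:
  "f \<in> Mplus \<Longrightarrow> g \<in> Mplus \<Longrightarrow> (\<And>t. t \<in> {0<..<1} \<Longrightarrow> rearr unit_leb f t = rearr unit_leb g t) \<Longrightarrow> Z f = Z g"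
  using Z unfolding ri_banach_norm_def ri_axioms_def by blast

lemma Z_add: "f \<in> Mplus \<Longrightarrow> g \<in> Mplus \<Longrightarrow> Z (\<lambda>t. f t + g t) \<le> Z f + Z g"
  using Z unfolding ri_banach_norm_def by blast

lemma Z_L1: "\<exists>C>0. \<forall>f\<in>Mplus. (\<integral>\<^sup>+t. ennreal (f t) \<partial>unit_leb) \<le> ennreal C * Z f"
proof -
  obtain C where C: "\<And>f. f \<in> Mplus \<Longrightarrow> (\<integral>\<^sup>+t. ennreal (f t) \<partial>unit_leb) \<le> ennreal C * Z f"
    using Z unfolding ri_banach_norm_def by blast
  have "ennreal C * Z f \<le> ennreal (max C 1) * Z f" for f
    by (intro mult_right_mono ennreal_leI) auto
  then show ?thesis using C by (intro exI[of _ "max C 1"]) (auto intro: order_trans)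
qed

text \<open>The infima \<open>m k\<close> of the tails increase to the limit, so (P3) applies to
  them. This closes the unit ball under almost everywhere convergence.\<close>

lemma Z_fatou:
  assumes gk: "\<And>k::nat. gk k \<in> Mplus" "\<And>k. Z (gk k) \<le> B" and g: "g \<in> Mplus"
    and lim: "AE t in unit_leb. (\<lambda>k. gk k t) \<longlonglongrightarrow> g t"
  shows "Z g \<le> B"
proof -
  define m where "m k t = (INF j\<in>{k..}. gk j t)" for k t
  have bdd: "bdd_below ((\<lambda>j. gk j t) ` {k..})" if "t \<in> {0<..<1}" for t and k :: nat
    using Mplus_nonneg[OF gk(1) that] by (intro bdd_belowI[of _ 0]) auto
  have [measurable]: "gk k \<in> borel_measurable unit_leb" for k using gk(1) by (rule Mplus_measurable)
  have mM: "m k \<in> Mplus" for k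
  proof (rule MplusI)
    show "m k \<in> borel_measurable unit_leb" unfolding m_def
      by (rule borel_measurable_cINF) (auto intro: bdd)
    show "0 \<le> m k t" if "t \<in> {0<..<1}" for t
      unfolding m_def using Mplus_nonneg[OF gk(1) that] by (intro cINF_greatest) auto
  qed
  have mle: "m k t \<le> gk j t" if "t \<in> {0<..<1}" "k \<le> j" for k j t
    unfolding m_def using bdd[OF that(1)] that(2) by (intro cINF_lower) auto
  have "(\<lambda>k. Z (m k)) \<longlonglongrightarrow> Z g"
  proof (rule Z_tendsto[OF g mM])
    show "AE t in unit_leb. incseq (\<lambda>k. m k t) \<and> (\<lambda>k. m k t) \<longlonglongrightarrow> g t"
      using lim AE_space
    proof eventually_elim
      case (elim t)
      then have t: "t \<in> {0<..<1}" by simp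
      have "incseq (\<lambda>k. m k t)"
        unfolding incseq_def m_def using bdd[OF t] by (auto intro!: cINF_superset_mono)
      moreover have "(\<lambda>k. m k t) \<longlonglongrightarrow> g t"
      proof (rule LIMSEQ_I)
        fix r :: real assume r: "0 < r"
        obtain K where K: "\<And>j. j \<ge> K \<Longrightarrow> \<bar>gk j t - g t\<bar> < r / 2"
          using LIMSEQ_D[OF elim(1), of "r / 2"] r by auto
        have "norm (m k t - g t) < r" if "k \<ge> K" for k
        proof -
          have "g t - r / 2 \<le> m k t"
            unfolding m_def using K that by (intro cINF_greatest) (auto simp: abs_less_iff, smt (verit) K order_trans)
          moreover have "m k t \<le> gk k t" using mle[OF t] by simp
          ultimately show ?thesis using K[OF that] r unfolding real_norm_def abs_less_iff by linarith
        qed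
        then show "\<exists>no. \<forall>n\<ge>no. norm (m n t - g t) < r" by blast
      qed
      ultimately show ?case by blast
    qed
  qed
  moreover have "Z (m k) \<le> B" for k
    using Z_mono[OF mM gk(1)[of k], of k] mle[of _ k k] gk(2)[of k] by (auto intro: order_trans)
  ultimately show ?thesis by (intro LIMSEQ_le_const2) auto
qed

text \<open>Normalising \<open>f\<close> reduces this to the definition of the associate functional.
  If \<open>Z f\<close> is 0, both sides vanish, since 0 times infinity is 0 in
  \<open>ennreal\<close>.\<close>

lemma holder:
  assumes f: "f \<in> Mplus" and h: "h \<in> Mplus" and fin: "Z f < \<infinity>"
  shows "(\<integral>\<^sup>+t. ennreal (f t) * ennreal (h t) \<partial>unit_leb) \<le> Z f * associate Z h"
proof (cases "Z f = 0")
  case True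
  then have "AE t in unit_leb. f t = 0" using Z_zero_iff f by blast
  then have "(\<integral>\<^sup>+t. ennreal (f t) * ennreal (h t) \<partial>unit_leb) = (\<integral>\<^sup>+t. 0 \<partial>unit_leb)"
    by (intro nn_integral_cong_AE) (auto elim: eventually_mono)
  then show ?thesis by simp
next
  case False
  define c where "c = enn2real (Z f)"
  have c: "0 < c" "Z f = ennreal c"
    using False fin by (auto simp: c_def enn2real_positive_iff zero_less_iff_neq_zero less_top[symmetric])
  define g where "g t = (1 / c) * f t" for t
  have gM: "g \<in> Mplus" unfolding g_def using f c by (intro Mplus_cmult) auto
  have "Z g = ennreal (1 / c) * ennreal c"
    unfolding g_def using Z_scale[OF f, of "1 / c"] c by simp
  then have "Z g = 1" using c by (simp add: ennreal_mult[symmetric])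
  have [measurable]: "h \<in> borel_measurable unit_leb" "g \<in> borel_measurable unit_leb" using h gM by auto
  have "(\<integral>\<^sup>+t. ennreal (f t) * ennreal (h t) \<partial>unit_leb) = (\<integral>\<^sup>+t. ennreal c * ennreal (h t * g t) \<partial>unit_leb)"
    by (rule nn_integral_unit_leb_cong)
       (use c Mplus_nonneg[OF f] Mplus_nonneg[OF h] in \<open>auto simp: g_def ennreal_mult[symmetric]\<close>)
  also have "\<dots> = ennreal c * (\<integral>\<^sup>+t. ennreal (h t * g t) \<partial>unit_leb)"
    by (rule nn_integral_cmult) measurable
  also have "\<dots> \<le> ennreal c * associate Z h"
    by (intro mult_left_mono associate_ge gM) (simp_all add: \<open>Z g = 1\<close>)
  finally show ?thesis using c by simp
qed

lemma unit_ball_convex: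
  assumes "f \<in> Mplus" "g \<in> Mplus" "Z f \<le> 1" "Z g \<le> 1" "0 \<le> \<theta>" "\<theta> \<le> 1"
  shows "Z (\<lambda>t. (1 - \<theta>) * f t + \<theta> * g t) \<le> 1"
proof -
  have "Z (\<lambda>t. (1 - \<theta>) * f t + \<theta> * g t) \<le> Z (\<lambda>t. (1 - \<theta>) * f t) + Z (\<lambda>t. \<theta> * g t)"
    by (rule Z_add) (use assms in \<open>auto simp: Mplus_def\<close>)
  also have "\<dots> = ennreal (1 - \<theta>) * Z f + ennreal \<theta> * Z g"
    using assms by (simp add: Z_scale)
  also have "\<dots> \<le> ennreal (1 - \<theta>) * 1 + ennreal \<theta> * 1"
    by (intro add_mono mult_left_mono assms) auto
  also have "\<dots> = 1" using assms by (simp add: ennreal_plus[symmetric] del: ennreal_plus)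
  finally show ?thesis .
qed

section \<open>Separation from the unit ball in L^2\<close>

text \<open>
  A bounded function outside the unit ball is separated from it by its difference to the
  \<open>L\<^sup>2\<close>-projection onto the part of the ball below it.
\<close>
lemma projection:
  assumes G: "G \<in> Mplus" and Gn: "\<And>t. t \<in> {0<..<1} \<Longrightarrow> G t \<le> n"
  obtains g0 where "g0 \<in> Mplus" "Z g0 \<le> 1" "\<And>t. t \<in> {0<..<1} \<Longrightarrow> g0 t \<le> G t"
    "\<And>g m. g \<in> Mplus \<Longrightarrow> Z g \<le> 1 \<Longrightarrow> (\<And>t. t \<in> {0<..<1} \<Longrightarrow> g t \<le> m) \<Longrightarrow>
      (LINT t|unit_leb. (G t - g0 t)\<^sup>2) \<le> (LINT t|unit_leb. (G t - g t)\<^sup>2)"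
proof -
  interpret U: prob_space unit_leb by (rule prob_space_unit_leb)
  \<comment> \<open>The restriction to functions below \<open>G\<close> bounds all of them by
    \<open>n\<close>, which makes every square integrable and provides the dominating function for
    the limit.\<close>
  define B where "B = {g\<in>Mplus. Z g \<le> 1 \<and> (\<forall>t\<in>{0<..<1}. g t \<le> G t)}"
  define Q where "Q g = (LINT t|unit_leb. (G t - g t)\<^sup>2)" for g
  have [measurable]: "G \<in> borel_measurable unit_leb" using G by auto
  have int: "integrable unit_leb f" if "f \<in> borel_measurable unit_leb" "\<And>t. t \<in> {0<..<1} \<Longrightarrow> \<bar>f t\<bar> \<le> c" for f and c :: real
    by (rule U.integrable_const_bound[of _ c]) (use that in auto)
  have Bm [measurable_dest]: "g \<in> borel_measurable unit_leb" if "g \<in> B" for g using that by (auto simp: B_def)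
  have Bb: "0 \<le> g t \<and> g t \<le> G t" if "g \<in> B" "t \<in> {0<..<1}" for g t
    using that by (auto simp: B_def Mplus_def)
  have B0: "(\<lambda>_. 0) \<in> B" using G Z_zero_iff[of "\<lambda>_. 0"] by (auto simp: B_def Mplus_def)
  have n0: "0 \<le> n" using Gn[of "1/2"] Mplus_nonneg[OF G, of "1/2"] by auto
  have sqn: "(G t - g t)\<^sup>2 \<le> n\<^sup>2" if "g \<in> B" "t \<in> {0<..<1}" for g t
    using Bb[OF that] Gn[OF that(2)] by (intro power_mono) auto
  have intQ: "integrable unit_leb (\<lambda>t. (G t - g t)\<^sup>2)" if "g \<in> B" for g
    by (rule int[of _ "n\<^sup>2"]) (use sqn[OF that] Bm[OF that] in auto)
  define d where "d = Inf (Q ` B)"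
  have bdd: "bdd_below (Q ` B)"
    by (rule bdd_belowI[of _ 0]) (auto simp: Q_def)
  have dle: "d \<le> Q g" if "g \<in> B" for g unfolding d_def using bdd that by (intro cInf_lower) auto
  have "\<exists>g\<in>B. Q g < d + 1 / real (Suc k)" for k
  proof -
    have "Inf (Q ` B) < d + 1 / real (Suc k)" by (simp add: d_def)
    then show ?thesis using cInf_lessD[of "Q ` B"] B0 by blast
  qed
  then obtain gk where gk: "\<And>k. gk k \<in> B" "\<And>k. Q (gk k) < d + 1 / real (Suc k)" by metis
  have mid: "(\<lambda>t. (1/2) * f t + (1/2) * g t) \<in> B" if "f \<in> B" "g \<in> B" for f g
    using unit_ball_convex[of f g "1/2"] that Bb[OF that(1)] Bb[OF that(2)]
    by (auto simp: B_def Mplus_def intro!: add_nonneg_nonneg) (smt (verit) field_sum_of_halves)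
  \<comment> \<open>Parallelogram identity: the midpoint stays in \<open>B\<close> by convexity, so
    its squared distance to \<open>G\<close> is at least \<open>d\<close>. Minimising sequences are
    therefore Cauchy.\<close>
  have sq: "(LINT t|unit_leb. (gk i t - gk j t)\<^sup>2) \<le> 2 / real (Suc i) + 2 / real (Suc j)" for i j
  proof -
    let ?m = "\<lambda>t. (1/2) * gk i t + (1/2) * gk j t"
    have m: "?m \<in> B" using mid gk by blast
    have "(LINT t|unit_leb. (gk i t - gk j t)\<^sup>2) =
        (LINT t|unit_leb. 2 * (G t - gk i t)\<^sup>2 + 2 * (G t - gk j t)\<^sup>2 - 4 * (G t - ?m t)\<^sup>2)"
      by (rule arg_cong[where f="integral\<^sup>L unit_leb"]) (auto simp: fun_eq_iff power2_eq_square algebra_simps)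
    also have "\<dots> = 2 * Q (gk i) + 2 * Q (gk j) - 4 * Q ?m"
      unfolding Q_def using intQ[OF gk(1)[of i]] intQ[OF gk(1)[of j]] intQ[OF m] by simp
    also have "\<dots> \<le> 2 / real (Suc i) + 2 / real (Suc j)"
    proof -
      have "2 / real (Suc k) = 2 * (1 / real (Suc k))" for k by simp
      then show ?thesis using gk(2)[of i] gk(2)[of j] dle[OF m] by linarith
    qed
    finally show ?thesis .
  qed
  have intd: "integrable unit_leb (\<lambda>t. (gk i t - gk j t)\<^sup>2)" "integrable unit_leb (\<lambda>t. \<bar>gk i t - gk j t\<bar>)" for i j
  proof -
    have ab: "\<bar>gk i t - gk j t\<bar> \<le> n" if "t \<in> {0<..<1}" for t
      using Bb[OF gk(1)[of i] that] Bb[OF gk(1)[of j] that] Gn[OF that] by (auto simp: abs_le_iff)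
    show "integrable unit_leb (\<lambda>t. \<bar>gk i t - gk j t\<bar>)"
      by (rule int[of _ n]) (use Bm[OF gk(1)] ab in auto)
    have "\<bar>(gk i t - gk j t)\<^sup>2\<bar> \<le> n\<^sup>2" if "t \<in> {0<..<1}" for t
      using power_mono[OF ab[OF that], of 2] by simp
    then show "integrable unit_leb (\<lambda>t. (gk i t - gk j t)\<^sup>2)"
      by (intro int[of _ "n\<^sup>2"]) (use Bm[OF gk(1)] in auto)
  qed
  \<comment> \<open>Cauchy in mean square implies Cauchy in mean, by the inequality between
    \<open>2 * e * \<bar>x\<bar>\<close> and \<open>e * e + x * x\<close>. Mean convergence is the
    form from which an almost everywhere convergent subsequence is extracted.\<close>
  have l1: "\<exists>N. \<forall>i\<ge>N. \<forall>j\<ge>N. (LINT t|unit_leb. norm (gk i t - gk j t)) < e" if e: "0 < e" for e :: real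
  proof -
    obtain N :: nat where "4 / e\<^sup>2 < real N" using reals_Archimedean2 by blast
    then have N: "4 / real (Suc N) < e\<^sup>2" using e by (simp add: field_simps) (smt (verit) e zero_less_power)
    have "(LINT t|unit_leb. norm (gk i t - gk j t)) < e" if ij: "i \<ge> N" "j \<ge> N" for i j
    proof -
      have pt: "\<bar>x\<bar> \<le> e / 2 + x\<^sup>2 / (2 * e)" for x :: real
      proof -
        have "0 \<le> (\<bar>x\<bar> - e)\<^sup>2" by simp
        then have "2 * e * \<bar>x\<bar> \<le> e * e + x * x" by (simp add: power2_eq_square algebra_simps abs_mult_self_eq)
        then show ?thesis using e by (simp add: field_simps power2_eq_square)
      qed
      have "(LINT t|unit_leb. norm (gk i t - gk j t)) \<le> (LINT t|unit_leb. e / 2 + (gk i t - gk j t)\<^sup>2 / (2 * e))"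
        by (rule integral_mono) (use intd pt in auto)
      also have "\<dots> = e / 2 + (LINT t|unit_leb. (gk i t - gk j t)\<^sup>2) / (2 * e)"
        using intd U.prob_space by simp
      also have "\<dots> \<le> e / 2 + (2 / real (Suc i) + 2 / real (Suc j)) / (2 * e)"
        using sq[of i j] e by (intro add_left_mono divide_right_mono) auto
      also have "\<dots> \<le> e / 2 + (4 / real (Suc N)) / (2 * e)"
      proof -
        have "2 / real (Suc i) \<le> 2 / real (Suc N)" "2 / real (Suc j) \<le> 2 / real (Suc N)"
          using ij by (auto intro!: divide_left_mono)
        then show ?thesis using e by (intro add_left_mono divide_right_mono) auto
      qed
      also have "\<dots> < e / 2 + e\<^sup>2 / (2 * e)"
        using N e by (intro add_strict_left_mono divide_strict_right_mono) auto
      also have "\<dots> = e" using e by (simp add: power2_eq_square field_simps)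
      finally show ?thesis .
    qed
    then show ?thesis by blast
  qed
  have igk: "integrable unit_leb (gk k)" for k
  proof (rule int[of _ n])
    show "\<bar>gk k t\<bar> \<le> n" if "t \<in> {0<..<1}" for t
      using Bb[OF gk(1)[of k] that] Gn[OF that] by simp
  qed (rule Bm[OF gk(1)])
  obtain r where r: "strict_mono r" "AE t in unit_leb. Cauchy (\<lambda>k. gk (r k) t)"
    by (rule cauchy_L1_AE_cauchy_subseq[OF igk l1])
  \<comment> \<open>The cut-offs do nothing where the limit exists; elsewhere they force the bounds
    by 0 and \<open>G\<close>.\<close>
  define g0 where "g0 t = min (G t) (max 0 (lim (\<lambda>k. gk (r k) t)))" for t
  have [measurable]: "gk k \<in> borel_measurable unit_leb" for k using gk(1) by (rule Bm)
  have [measurable]: "g0 \<in> borel_measurable unit_leb" unfolding g0_def by measurable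
  have g0M: "g0 \<in> Mplus" using Mplus_nonneg[OF G] by (auto simp: Mplus_def g0_def)
  have lim: "AE t in unit_leb. (\<lambda>k. gk (r k) t) \<longlonglongrightarrow> g0 t"
    using r(2) AE_space
  proof eventually_elim
    case (elim t)
    then have t: "t \<in> {0<..<1}" by simp
    from elim have l: "(\<lambda>k. gk (r k) t) \<longlonglongrightarrow> lim (\<lambda>k. gk (r k) t)"
      by (simp add: Cauchy_convergent_iff convergent_LIMSEQ_iff)
    have "0 \<le> lim (\<lambda>k. gk (r k) t)" "lim (\<lambda>k. gk (r k) t) \<le> G t"
      using l Bb[OF gk(1) t] by (auto intro: LIMSEQ_le_const LIMSEQ_le_const2)
    then show ?case using l by (simp add: g0_def)
  qed
  have g0B: "g0 \<in> B"
    using g0M Z_fatou[of "\<lambda>k. gk (r k)" 1, OF _ _ g0M lim] gk(1)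
    by (auto simp: B_def) (simp add: g0_def)
  have "(\<lambda>k. Q (gk (r k))) \<longlonglongrightarrow> Q g0"
    unfolding Q_def
  proof (rule integral_dominated_convergence[where w="\<lambda>_. n\<^sup>2"])
    show "AE t in unit_leb. (\<lambda>k. (G t - gk (r k) t)\<^sup>2) \<longlonglongrightarrow> (G t - g0 t)\<^sup>2"
      using lim by eventually_elim (intro tendsto_intros)
    show "AE t in unit_leb. norm ((G t - gk (r k) t)\<^sup>2) \<le> n\<^sup>2" for k
      by (rule AE_unit_leb_I) (use sqn[OF gk(1)] in simp)
  qed auto
  moreover have "(\<lambda>k. d + 1 / real (Suc (r k))) \<longlonglongrightarrow> d + 0"
    by (intro tendsto_add tendsto_const LIMSEQ_subseq_LIMSEQ[OF _ r(1), unfolded o_def] lim_1_over_n LIMSEQ_Suc)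
  ultimately have "Q g0 \<le> d + 0"
    by (rule LIMSEQ_le) (use gk(2) in \<open>auto intro!: exI[of _ 0] less_imp_le\<close>)
  then have Qd: "Q g0 \<le> d" by simp
  show ?thesis
  proof (rule that[OF g0M])
    show "Z g0 \<le> 1" "\<And>t. t \<in> {0<..<1} \<Longrightarrow> g0 t \<le> G t" using g0B by (auto simp: B_def)
    fix g and m :: real assume g: "g \<in> Mplus" "Z g \<le> 1" and gm: "\<And>t. t \<in> {0<..<1} \<Longrightarrow> g t \<le> m"
    have [measurable]: "g \<in> borel_measurable unit_leb" using g by auto
    \<comment> \<open>Cutting a competitor down to \<open>G\<close> keeps it in the ball and brings
      it pointwise closer to \<open>G\<close>, so minimality within \<open>B\<close> is
      enough.\<close>
    let ?g = "\<lambda>t. min (g t) (G t)"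
    have gM: "?g \<in> Mplus" using g G by (auto simp: Mplus_def)
    have gB: "?g \<in> B" using gM Z_mono[OF gM g(1)] g by (auto simp: B_def intro: order_trans)
    have "Q ?g \<le> Q g"
      unfolding Q_def
    proof (rule integral_mono[OF intQ[OF gB]])
      show "integrable unit_leb (\<lambda>t. (G t - g t)\<^sup>2)"
      proof (rule int[of _ "(n + \<bar>m\<bar>)\<^sup>2"])
        fix t :: real assume t: "t \<in> {0<..<1}"
        have "\<bar>G t - g t\<bar> \<le> n + \<bar>m\<bar>"
          using Mplus_nonneg[OF g(1) t] Mplus_nonneg[OF G t] gm[OF t] Gn[OF t] by (auto simp: abs_le_iff)
        from power_mono[OF this, of 2] show "\<bar>(G t - g t)\<^sup>2\<bar> \<le> (n + \<bar>m\<bar>)\<^sup>2" by simp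
      qed auto
      show "(G t - min (g t) (G t))\<^sup>2 \<le> (G t - g t)\<^sup>2" for t by (auto simp: min_def)
    qed
    then show "(LINT t|unit_leb. (G t - g0 t)\<^sup>2) \<le> (LINT t|unit_leb. (G t - g t)\<^sup>2)"
      using Qd dle[OF gB] by (simp add: Q_def)
  qed
qed

text \<open>The difference \<open>h\<close> of \<open>G\<close> and its projection \<open>g0\<close>
  is an outer normal to the ball at \<open>g0\<close>, so \<open>s\<close>, the integral of
  \<open>h * g0\<close>, bounds the integrals of \<open>h * g\<close> over the ball. Against
  \<open>G\<close> the function \<open>h\<close> integrates to \<open>d + s\<close> with
  \<open>d > 0\<close>, the squared norm of \<open>h\<close>. The separating function is
  \<open>h / s\<close>.\<close>

lemma separation:
  assumes G: "G \<in> Mplus" and Gn: "\<And>t. t \<in> {0<..<1} \<Longrightarrow> G t \<le> n" and G1: "1 < Z G"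
  obtains h where "h \<in> Mplus" "associate Z h \<le> 1" "1 < (\<integral>\<^sup>+t. ennreal (G t * h t) \<partial>unit_leb)"
proof -
  interpret U: prob_space unit_leb by (rule prob_space_unit_leb)
  obtain g0 where g0: "g0 \<in> Mplus" "Z g0 \<le> 1" "\<And>t. t \<in> {0<..<1} \<Longrightarrow> g0 t \<le> G t"
    and min: "\<And>g m. g \<in> Mplus \<Longrightarrow> Z g \<le> 1 \<Longrightarrow> (\<And>t. t \<in> {0<..<1} \<Longrightarrow> g t \<le> m) \<Longrightarrow>
      (LINT t|unit_leb. (G t - g0 t)\<^sup>2) \<le> (LINT t|unit_leb. (G t - g t)\<^sup>2)"
    by (rule projection[OF G Gn]) blast+
  have [measurable]: "G \<in> borel_measurable unit_leb" "g0 \<in> borel_measurable unit_leb" using G g0 by auto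
  define h where "h t = G t - g0 t" for t
  have [measurable]: "h \<in> borel_measurable unit_leb" unfolding h_def by measurable
  have g0b: "0 \<le> g0 t" "g0 t \<le> n" if "t \<in> {0<..<1}" for t
    using g0(3)[OF that] Gn[OF that] Mplus_nonneg[OF g0(1) that] by auto
  have hb: "0 \<le> h t" "h t \<le> n" if "t \<in> {0<..<1}" for t
    using g0(3)[OF that] Gn[OF that] Mplus_nonneg[OF g0(1) that] by (auto simp: h_def)
  have hM: "h \<in> Mplus" using hb by (auto simp: Mplus_def)
  have n0: "0 \<le> n" using g0b[of "1/2"] by simp
  have int: "integrable unit_leb (\<lambda>t. f t * g t)"
    if "f \<in> borel_measurable unit_leb" "g \<in> borel_measurable unit_leb"
      "\<And>t. t \<in> {0<..<1} \<Longrightarrow> \<bar>f t\<bar> \<le> c" "\<And>t. t \<in> {0<..<1} \<Longrightarrow> \<bar>g t\<bar> \<le> c'" for f g and c c' :: real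
  proof (rule U.integrable_const_bound[of _ "c * c'"])
    have "0 \<le> c" using that(3)[of "1/2"] by simp
    then show "AE t in unit_leb. norm (f t * g t) \<le> c * c'"
      using that by (intro AE_unit_leb_I) (auto simp: abs_mult intro!: mult_mono)
  qed (use that in measurable)
  define s where "s = (LINT t|unit_leb. h t * g0 t)"
  define d where "d = (LINT t|unit_leb. h t * h t)"
  \<comment> \<open>First variation: if \<open>g\<close> did better than \<open>g0\<close>, a short
    step from \<open>g0\<close> towards \<open>g\<close> would come closer to \<open>G\<close>. The
    step \<theta> changes the squared distance by
    \<open>\<theta> * \<theta> * b - 2 * \<theta> * a\<close>.\<close>
  have var: "(LINT t|unit_leb. h t * g t) \<le> s" if g: "g \<in> Mplus" "Z g \<le> 1" and gm: "\<And>t. t \<in> {0<..<1} \<Longrightarrow> g t \<le> m" for g and m :: real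
  proof (rule ccontr)
    assume "\<not> ?thesis"
    have [measurable]: "g \<in> borel_measurable unit_leb" using g by auto
    have gb: "\<bar>g t\<bar> \<le> m" if "t \<in> {0<..<1}" for t using gm[OF that] Mplus_nonneg[OF g(1) that] by simp
    have "0 \<le> m" using gb[of "1/2"] by simp
    define k where "k t = g t - g0 t" for t
    have [measurable]: "k \<in> borel_measurable unit_leb" unfolding k_def by measurable
    have kb: "\<bar>k t\<bar> \<le> m + n" if "t \<in> {0<..<1}" for t
      unfolding k_def using gb[OF that] g0b[OF that] by linarith
    have hb': "\<bar>h t\<bar> \<le> n" if "t \<in> {0<..<1}" for t using hb[OF that] by simp
    have g0b': "\<bar>g0 t\<bar> \<le> n" if "t \<in> {0<..<1}" for t using g0b[OF that] by simp
    have i1: "integrable unit_leb (\<lambda>t. h t * g t)" by (rule int[OF _ _ hb' gb]) auto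
    have i2: "integrable unit_leb (\<lambda>t. h t * g0 t)" by (rule int[OF _ _ hb' g0b']) auto
    have i3: "integrable unit_leb (\<lambda>t. k t * k t)" by (rule int[OF _ _ kb kb]) auto
    have i4: "integrable unit_leb (\<lambda>t. h t * h t)" by (rule int[OF _ _ hb' hb']) auto
    have i5: "integrable unit_leb (\<lambda>t. h t * k t)" by (rule int[OF _ _ hb' kb]) auto
    define a where "a = (LINT t|unit_leb. h t * k t)"
    define b where "b = (LINT t|unit_leb. k t * k t)"
    have "a = (LINT t|unit_leb. h t * g t) - s"
      unfolding a_def s_def k_def using i1 i2 by (simp add: right_diff_distrib)
    with \<open>\<not> ?thesis\<close> have a: "0 < a" by simp
    have "2 * a \<le> \<theta> * b" if th: "0 < \<theta>" "\<theta> \<le> 1" for \<theta>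
    proof -
      let ?g = "\<lambda>t. (1 - \<theta>) * g0 t + \<theta> * g t"
      have "d \<le> (LINT t|unit_leb. (G t - ?g t)\<^sup>2)"
        unfolding d_def h_def power2_eq_square[symmetric]
      proof (rule min)
        show "?g \<in> Mplus" using g0 g th by (auto simp: Mplus_def)
        show "Z ?g \<le> 1" by (rule unit_ball_convex) (use g0 g th in auto)
        show "?g t \<le> (1 - \<theta>) * n + \<theta> * m" if "t \<in> {0<..<1}" for t
          using g0b[OF that] gm[OF that] th by (intro add_mono mult_left_mono) auto
      qed
      also have "\<dots> = (LINT t|unit_leb. h t * h t - 2 * \<theta> * (h t * k t) + \<theta> * \<theta> * (k t * k t))"
        by (rule arg_cong[where f="integral\<^sup>L unit_leb"])
           (auto simp: fun_eq_iff power2_eq_square algebra_simps h_def k_def)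
      also have "\<dots> = d - 2 * \<theta> * a + \<theta> * \<theta> * b"
        unfolding d_def a_def b_def using i3 i4 i5 by simp
      finally have "\<theta> * (2 * a) \<le> \<theta> * (\<theta> * b)" by (simp add: algebra_simps)
      then show ?thesis using th by simp
    qed
    note ineq = this
    have "0 < b" using ineq[of 1] a by simp
    \<comment> \<open>This step length makes the quadratic term at most half as large as the linear
      gain; \<open>min 1\<close> keeps the point on the segment.\<close>
    have "2 * a \<le> min 1 (a / b) * b" by (rule ineq) (use a \<open>0 < b\<close> in auto)
    also have "\<dots> \<le> a / b * b" using \<open>0 < b\<close> by (intro mult_right_mono) auto
    finally show False using a \<open>0 < b\<close> by simp
  qed
  have nnh: "(\<integral>\<^sup>+t. ennreal (h t * g t) \<partial>unit_leb) \<le> ennreal s" if g: "g \<in> Mplus" "Z g \<le> 1" for g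
  proof (rule nn_integral_mult_truncate_le[OF hM g(1)])
    fix m :: nat
    have [measurable]: "g \<in> borel_measurable unit_leb" using g by auto
    have M: "(\<lambda>t. min (g t) (real m)) \<in> Mplus" using g by (auto simp: Mplus_def)
    have "Z (\<lambda>t. min (g t) (real m)) \<le> Z g" by (rule Z_mono[OF M g(1)]) auto
    with g(2) have "Z (\<lambda>t. min (g t) (real m)) \<le> 1" by (rule order_trans[rotated])
    from var[OF M this, of "real m"] have v: "(LINT t|unit_leb. h t * min (g t) (real m)) \<le> s" by simp
    have "(\<integral>\<^sup>+t. ennreal (h t * min (g t) (real m)) \<partial>unit_leb) = ennreal (LINT t|unit_leb. h t * min (g t) (real m))"
    proof (rule nn_integral_eq_integral)
      show "integrable unit_leb (\<lambda>t. h t * min (g t) (real m))"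
        by (rule int[of _ _ n "real m"]) (use hb Mplus_nonneg[OF g(1)] in auto)
      show "AE t in unit_leb. 0 \<le> h t * min (g t) (real m)"
        by (rule AE_unit_leb_I) (use hb Mplus_nonneg[OF g(1)] in auto)
    qed
    with v show "(\<integral>\<^sup>+t. ennreal (h t * min (g t) (real m)) \<partial>unit_leb) \<le> ennreal s"
      by (simp add: ennreal_leI)
  qed
  have ih: "integrable unit_leb (\<lambda>t. h t * h t)" "integrable unit_leb (\<lambda>t. h t * g0 t)"
    by (rule int[of _ _ n n]; use hb g0b in auto)+
  have "d \<noteq> 0"
  proof
    assume "d = 0"
    then have "AE t in unit_leb. h t * h t = 0"
      unfolding d_def by (subst (asm) integral_nonneg_eq_0_iff_AE) (use ih in auto)
    then have "AE t in unit_leb. g0 t = G t" by eventually_elim (simp add: h_def)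
    then have "Z g0 = Z G" using Z_cong_AE g0 G by blast
    with g0(2) G1 show False by simp
  qed
  moreover have "0 \<le> d" unfolding d_def by (rule integral_nonneg_AE) auto
  ultimately have d: "0 < d" by simp
  \<comment> \<open>A small constant \<open>c\<close> lies in the ball by (P4), and \<open>h\<close>
    has positive integral because \<open>d\<close> is at most \<open>n\<close> times that
    integral.\<close>
  have s: "0 < s"
  proof -
    define c where "c = 1 / (1 + enn2real (Z (\<lambda>_. 1)))"
    have c: "0 < c" using enn2real_nonneg[of "Z (\<lambda>_. 1)"] by (simp add: c_def add_pos_nonneg)
    have one: "(\<lambda>_. 1) \<in> Mplus" by (simp add: Mplus_def)
    have "Z (\<lambda>_. c * 1) = ennreal c * Z (\<lambda>_. 1)" by (rule Z_scale[OF one]) (use c in simp)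
    also have "\<dots> = ennreal (c * enn2real (Z (\<lambda>_. 1)))"
      using c Z_one by (simp add: ennreal_mult)
    also have "\<dots> \<le> 1"
    proof -
      have "x / (1 + x) \<le> 1" if "0 \<le> x" for x :: real using that by simp
      from this[OF enn2real_nonneg] show ?thesis by (simp add: c_def)
    qed
    finally have "(LINT t|unit_leb. h t * c) \<le> s"
      by (intro var[of "\<lambda>_. c" c]) (use c in \<open>auto simp: Mplus_def\<close>)
    moreover have "0 < (LINT t|unit_leb. h t * c)"
    proof -
      have i: "integrable unit_leb h" by (rule U.integrable_const_bound[of _ n]) (use hb in auto)
      have "d \<le> (LINT t|unit_leb. n * h t)" unfolding d_def
        by (rule integral_mono_AE) (use ih i hb in \<open>auto intro!: mult_right_mono\<close>)
      also have "\<dots> = n * (LINT t|unit_leb. h t)" by simp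
      finally have "0 < n * (LINT t|unit_leb. h t)" using d by simp
      then have "0 < (LINT t|unit_leb. h t)" using n0 by (simp add: zero_less_mult_iff)
      then show ?thesis using c by simp
    qed
    ultimately show ?thesis by simp
  qed
  define k where "k t = h t / s" for t
  show ?thesis
  proof
    have "k \<in> borel_measurable unit_leb" unfolding k_def by measurable
    then show kM: "k \<in> Mplus" using hb s by (auto simp: Mplus_def k_def)
    show "associate Z k \<le> 1"
      unfolding associate_def
    proof (rule SUP_least)
      fix g assume "g \<in> {g \<in> Mplus. Z g \<le> 1}"
      then have g: "g \<in> Mplus" "Z g \<le> 1" by auto
      have [measurable]: "g \<in> borel_measurable unit_leb" using g by auto
      have "(\<integral>\<^sup>+t. ennreal (k t * g t) \<partial>unit_leb) = (\<integral>\<^sup>+t. ennreal (1 / s) * ennreal (h t * g t) \<partial>unit_leb)"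
        by (rule nn_integral_unit_leb_cong)
           (use s hb Mplus_nonneg[OF g(1)] in \<open>auto simp: k_def ennreal_mult[symmetric]\<close>)
      also have "\<dots> = ennreal (1 / s) * (\<integral>\<^sup>+t. ennreal (h t * g t) \<partial>unit_leb)"
        by (rule nn_integral_cmult) measurable
      also have "\<dots> \<le> ennreal (1 / s) * ennreal s" by (intro mult_left_mono nnh g) auto
      also have "\<dots> = 1" using s by (simp add: ennreal_mult[symmetric])
      finally show "(\<integral>\<^sup>+t. ennreal (k t * g t) \<partial>unit_leb) \<le> 1" .
    qed
    have "(\<integral>\<^sup>+t. ennreal (G t * k t) \<partial>unit_leb) = ennreal (LINT t|unit_leb. G t * k t)"
    proof (rule nn_integral_eq_integral)
      have "integrable unit_leb (\<lambda>t. G t * h t)"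
        by (rule int[of _ _ n n]) (use hb Gn Mplus_nonneg[OF G] in auto)
      then show "integrable unit_leb (\<lambda>t. G t * k t)" by (simp add: k_def)
      show "AE t in unit_leb. 0 \<le> G t * k t"
        by (rule AE_unit_leb_I) (use hb Mplus_nonneg[OF G] s in \<open>auto simp: k_def\<close>)
    qed
    also have "(LINT t|unit_leb. G t * k t) = (LINT t|unit_leb. (h t * h t + h t * g0 t) / s)"
      by (rule arg_cong[where f="integral\<^sup>L unit_leb"]) (auto simp: fun_eq_iff k_def h_def algebra_simps)
    also have "\<dots> = (d + s) / s" unfolding d_def s_def using ih by simp
    also have "1 < ennreal ((d + s) / s)" using d s by (simp add: field_simps)
    finally show "1 < (\<integral>\<^sup>+t. ennreal (G t * k t) \<partial>unit_leb)" .
  qed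
qed

text \<open>Scaling by a number strictly between \<open>B\<close> and \<open>Z F\<close> puts
  \<open>F\<close> outside the unit ball, and (P3) keeps some truncation of it outside. Separating
  this bounded function contradicts the bound \<open>B\<close>.\<close>

theorem lorentz_luxemburg:
  assumes F: "F \<in> Mplus"
    and B: "\<And>h. h \<in> Mplus \<Longrightarrow> associate Z h \<le> 1 \<Longrightarrow> (\<integral>\<^sup>+t. ennreal (F t) * ennreal (h t) \<partial>unit_leb) \<le> B"
  shows "Z F \<le> B"
proof (rule ccontr)
  assume "\<not> Z F \<le> B"
  then obtain b' where b': "B < b'" "b' < Z F" using dense not_le by metis
  then obtain b where b: "b' = ennreal b" "0 < b"
    by (cases b') (auto simp: ennreal_zero_less_top dest: le_less_trans[OF zero_le])
  have [measurable]: "F \<in> borel_measurable unit_leb" using F by auto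
  define E where "E t = (1 / b) * F t" for t
  have EM: "E \<in> Mplus" unfolding E_def using F b by (intro Mplus_cmult) auto
  have [measurable]: "E \<in> borel_measurable unit_leb" using EM by auto
  have "1 = ennreal (1 / b) * ennreal b" using b by (simp add: ennreal_mult[symmetric])
  also have "\<dots> < ennreal (1 / b) * Z F"
    using b b' by (intro ennreal_mult_strict_left_mono) auto
  also have "\<dots> = Z E" unfolding E_def using Z_scale[OF F, of "1 / b"] b by simp
  finally have E1: "1 < Z E" .
  have Em: "(\<lambda>t. min (E t) (real m)) \<in> Mplus" for m using EM by (auto simp: Mplus_def)
  have "(\<lambda>m. Z (\<lambda>t. min (E t) (real m))) \<longlonglongrightarrow> Z E"
  proof (rule Z_tendsto[OF EM Em], rule AE_unit_leb_I)
    fix t :: real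
    obtain m0 :: nat where m0: "E t \<le> real m0" using real_arch_simple by blast
    have "eventually (\<lambda>m. min (E t) (real m) = E t) sequentially"
      using eventually_ge_at_top[of m0] by eventually_elim (use m0 in auto)
    then have "(\<lambda>m. min (E t) (real m)) \<longlonglongrightarrow> E t" by (rule tendsto_eventually)
    moreover have "incseq (\<lambda>m. min (E t) (real m))" by (auto simp: incseq_def)
    ultimately show "incseq (\<lambda>m. min (E t) (real m)) \<and> (\<lambda>m. min (E t) (real m)) \<longlonglongrightarrow> E t" by blast
  qed
  from order_tendstoD(1)[OF this E1] obtain m where m: "1 < Z (\<lambda>t. min (E t) (real m))"
    by (auto simp: eventually_sequentially)
  obtain h where h: "h \<in> Mplus" "associate Z h \<le> 1"
      "1 < (\<integral>\<^sup>+t. ennreal (min (E t) (real m) * h t) \<partial>unit_leb)"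
    by (rule separation[OF Em _ m, of "real m"]) auto
  have [measurable]: "h \<in> borel_measurable unit_leb" using h by auto
  have "(\<integral>\<^sup>+t. ennreal (min (E t) (real m) * h t) \<partial>unit_leb) \<le> (\<integral>\<^sup>+t. ennreal (1 / b) * (ennreal (F t) * ennreal (h t)) \<partial>unit_leb)"
  proof (rule nn_integral_unit_leb_mono)
    fix t :: real assume t: "t \<in> {0<..<1}"
    have "ennreal (min (E t) (real m) * h t) \<le> ennreal (E t * h t)"
      using Mplus_nonneg[OF h(1) t] by (intro ennreal_leI mult_right_mono) auto
    also have "\<dots> = ennreal (1 / b) * (ennreal (F t) * ennreal (h t))"
      using Mplus_nonneg[OF h(1) t] Mplus_nonneg[OF F t] b by (simp add: E_def ennreal_mult[symmetric])
    finally show "ennreal (min (E t) (real m) * h t) \<le> \<dots>" .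
  qed
  also have "\<dots> = ennreal (1 / b) * (\<integral>\<^sup>+t. ennreal (F t) * ennreal (h t) \<partial>unit_leb)"
    by (rule nn_integral_cmult) measurable
  also have "\<dots> \<le> ennreal (1 / b) * ennreal b"
    using B[OF h(1,2)] b b' by (intro mult_left_mono) auto
  also have "\<dots> = 1" using b by (simp add: ennreal_mult[symmetric])
  finally show False using h(3) by simp
qed

text \<open>With \<open>U\<close> chosen so that \<open>h\<close> is its rearrangement composed with
  \<open>U\<close>, a test function \<open>g\<close> is replaced by \<open>k\<close>, the
  rearrangement of \<open>g\<close> composed with the same \<open>U\<close>. By (P6)
  \<open>k\<close> has the norm of \<open>g\<close>, and the common map makes all level sets nested,
  so Hardy-Littlewood is an equality for \<open>h\<close> and \<open>k\<close>.\<close>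

lemma associate_rearr_le:
  assumes h: "h \<in> Mplus"
  shows "associate Z (rearr unit_leb h) \<le> associate Z h"
  unfolding associate_def[of Z "rearr unit_leb h"]
proof (rule SUP_least)
  note P = prob_space_unit_leb
  fix g assume "g \<in> {g \<in> Mplus. Z g \<le> 1}"
  then have g: "g \<in> Mplus" "Z g \<le> 1" by auto
  have hm [measurable]: "h \<in> borel_measurable unit_leb" and gm [measurable]: "g \<in> borel_measurable unit_leb"
    using g h by auto
  have rnn: "0 \<le> rearr unit_leb h t" "0 \<le> rearr unit_leb g t" if "t \<in> {0<..<1}" for t
    using that rearr_nonneg[OF P hm] rearr_nonneg[OF P gm] by auto
  obtain U where U: "uniform_map unit_leb U" "AE x in unit_leb. rearr unit_leb h (U x) = norm (h x)"
    by (rule nonatomic_uniform_map[OF P nonatomic_unit_leb hm])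
  have U01: "U t \<in> {0<..<1}" if "t \<in> {0<..<1}" for t using U(1) that by (auto simp: uniform_map_def)
  define h' where "h' t = rearr unit_leb h (U t)" for t
  define k where "k t = rearr unit_leb g (U t)" for t
  have h'm [measurable]: "h' \<in> borel_measurable unit_leb" and km [measurable]: "k \<in> borel_measurable unit_leb"
    unfolding h'_def k_def using rearr_uniform_map_measurable[OF P hm U(1)] rearr_uniform_map_measurable[OF P gm U(1)] by auto
  have kM: "k \<in> Mplus" using km U01 rnn(2) by (auto simp: Mplus_def k_def)
  have rk: "rearr unit_leb k = rearr unit_leb g"
    unfolding k_def by (rule rearr_uniform_map[OF P gm P U(1)])
  have rh: "rearr unit_leb h' = rearr unit_leb h"
    unfolding h'_def by (rule rearr_uniform_map[OF P hm P U(1)])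
  have Zk: "Z k \<le> 1" using Z_rearr_cong[OF kM g(1)] rk g(2) by simp
  have "(\<integral>\<^sup>+t. ennreal (rearr unit_leb h t * g t) \<partial>unit_leb) =
      (\<integral>\<^sup>+t. ennreal (norm (rearr unit_leb h t)) * ennreal (norm (g t)) \<partial>unit_leb)"
    by (rule nn_integral_unit_leb_cong) (use rnn Mplus_nonneg[OF g(1)] in \<open>auto simp: ennreal_mult\<close>)
  also have "\<dots> \<le> (\<integral>\<^sup>+t. ennreal (rearr unit_leb (rearr unit_leb h) t) * ennreal (rearr unit_leb g t) \<partial>unit_leb)"
    by (rule hardy_littlewood(1)[OF P rearr_measurable[OF P hm] gm])
  also have "\<dots> = (\<integral>\<^sup>+t. ennreal (rearr unit_leb h' t) * ennreal (rearr unit_leb k t) \<partial>unit_leb)"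
    by (simp only: rearr_rearr[OF P hm] rh rk)
  also have "\<dots> = (\<integral>\<^sup>+t. ennreal (norm (h' t)) * ennreal (norm (k t)) \<partial>unit_leb)"
  proof (rule hardy_littlewood(2)[OF P h'm km, symmetric])
    fix a b :: real assume ab: "0 \<le> a" "0 \<le> b"
    show "upper_level unit_leb h' a \<subseteq> upper_level unit_leb k b \<or> upper_level unit_leb k b \<subseteq> upper_level unit_leb h' a"
      unfolding h'_def k_def upper_level_rearr_uniform[OF P hm U(1) ab(1)] upper_level_rearr_uniform[OF P gm U(1) ab(2)]
      by (cases "measure unit_leb (upper_level unit_leb h a) \<le> measure unit_leb (upper_level unit_leb g b)") auto
  qed
  also have "\<dots> = (\<integral>\<^sup>+t. ennreal (h t * k t) \<partial>unit_leb)"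
  proof (rule nn_integral_cong_AE)
    show "AE t in unit_leb. ennreal (norm (h' t)) * ennreal (norm (k t)) = ennreal (h t * k t)"
      using U(2) AE_space
      by eventually_elim (use Mplus_nonneg[OF h] Mplus_nonneg[OF kM] in \<open>auto simp: h'_def ennreal_mult\<close>)
  qed
  also have "\<dots> \<le> associate Z h" by (rule associate_ge[where Z=Z and g=k, OF kM Zk])
  finally show "(\<integral>\<^sup>+t. ennreal (rearr unit_leb h t * g t) \<partial>unit_leb) \<le> associate Z h" .
qed

text \<open>For nonincreasing \<open>F\<close> it suffices to test against rearrangements: passing
  from \<open>h\<close> to its rearrangement raises the pairing and not the associate norm. Hardy's
  lemma can then be applied to the test function.\<close>

lemma norm_le_dual:
  assumes F: "antimono_on {0<..<1} F" "\<And>t. t \<in> {0<..<1} \<Longrightarrow> 0 \<le> F t"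
    and B: "\<And>h. h \<in> Mplus \<Longrightarrow> associate Z (rearr unit_leb h) \<le> 1 \<Longrightarrow>
      (\<integral>\<^sup>+t. ennreal (F t) * ennreal (rearr unit_leb h t) \<partial>unit_leb) \<le> B"
  shows "Z F \<le> B"
proof (rule lorentz_luxemburg)
  note P = prob_space_unit_leb
  have Fm: "F \<in> borel_measurable unit_leb" using F(1) by (rule antimono_on_unit_leb)
  then show FM: "F \<in> Mplus" using F by (auto simp: Mplus_def)
  fix h assume h: "h \<in> Mplus" "associate Z h \<le> 1"
  then have hm: "h \<in> borel_measurable unit_leb" by auto
  have "(\<integral>\<^sup>+t. ennreal (F t) * ennreal (h t) \<partial>unit_leb) = (\<integral>\<^sup>+t. ennreal (norm (F t)) * ennreal (norm (h t)) \<partial>unit_leb)"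
    by (rule nn_integral_unit_leb_cong) (use F(2) Mplus_nonneg[OF h(1)] in auto)
  also have "\<dots> \<le> (\<integral>\<^sup>+t. ennreal (rearr unit_leb F t) * ennreal (rearr unit_leb h t) \<partial>unit_leb)"
    by (rule hardy_littlewood(1)[OF P Fm hm])
  also have "\<dots> = (\<integral>\<^sup>+t. ennreal (F t) * ennreal (rearr unit_leb h t) \<partial>unit_leb)"
    by (rule nn_integral_cong_AE) (use rearr_antimono_on_AE[OF F] in \<open>auto elim: eventually_mono\<close>)
  also have "\<dots> \<le> B"
    by (rule B[OF h(1)]) (use associate_rearr_le[OF h(1)] h(2) in auto)
  finally show "(\<integral>\<^sup>+t. ennreal (F t) * ennreal (h t) \<partial>unit_leb) \<le> B" .
qed

text \<open>The Hardy-Littlewood-Polya principle: each nonincreasing test function respects the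
  comparison of initial integrals, by Hardy's lemma.\<close>

lemma norm_mono_majorization:
  assumes F: "antimono_on {0<..<1} F" "\<And>t. t \<in> {0<..<1} \<Longrightarrow> 0 \<le> F t"
    and G: "G \<in> Mplus" "Z G < \<infinity>"
    and maj: "\<And>t. t \<in> {0<..<1} \<Longrightarrow> (\<integral>\<^sup>+s. ennreal (F s) * indicator {..<t} s \<partial>unit_leb) \<le>
       (\<integral>\<^sup>+s. ennreal (G s) * indicator {..<t} s \<partial>unit_leb)"
  shows "Z F \<le> Z G"
proof (rule norm_le_dual[OF F])
  note P = prob_space_unit_leb
  have [measurable]: "F \<in> borel_measurable unit_leb" using F(1) by (rule antimono_on_unit_leb)
  have [measurable]: "G \<in> borel_measurable unit_leb" using G by auto
  fix h assume h: "h \<in> Mplus" "associate Z (rearr unit_leb h) \<le> 1"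
  then have hm: "h \<in> borel_measurable unit_leb" by auto
  have "(\<integral>\<^sup>+t. ennreal (F t) * ennreal (rearr unit_leb h t) \<partial>unit_leb) \<le>
      (\<integral>\<^sup>+t. ennreal (G t) * ennreal (rearr unit_leb h t) \<partial>unit_leb)"
    by (rule hardy_lemma[OF _ _ maj rearr_antimono_unit[OF P hm]]) (auto intro: rearr_nonneg[OF P hm])
  also have "\<dots> \<le> Z G * associate Z (rearr unit_leb h)"
    by (rule holder[OF G(1) rearr_Mplus[OF P hm] G(2)])
  also have "\<dots> \<le> Z G * 1" by (intro mult_left_mono h) auto
  finally show "(\<integral>\<^sup>+t. ennreal (F t) * ennreal (rearr unit_leb h t) \<partial>unit_leb) \<le> Z G" by simp
qed

end

section \<open>The weights and the change of variables\<close>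

lemma nn_integral_inverse_sqrt:
  assumes "0 \<le> a" "a \<le> t" "t \<le> 1"
  shows "(\<integral>\<^sup>+r. ennreal (r powr (-1/2)) * indicator {a..<t} r \<partial>unit_leb) = ennreal (2 * (sqrt t - sqrt a))"
proof -
  have "((\<lambda>r. r powr (-1/2)) has_integral (2 * sqrt t - 2 * sqrt a)) {a..t}"
  proof (rule fundamental_theorem_of_calculus_interior[OF assms(2)])
    show "continuous_on {a..t} (\<lambda>r. 2 * sqrt r)" by (intro continuous_intros)
    fix r assume "r \<in> {a<..<t}"
    then have r: "0 < r" using assms by auto
    have "((\<lambda>r. 2 * sqrt r) has_real_derivative r powr (-1/2)) (at r)"
      using r by (auto intro!: derivative_eq_intros simp: powr_minus powr_half_sqrt field_simps)
    then show "((\<lambda>r. 2 * sqrt r) has_vector_derivative r powr (-1/2)) (at r)"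
      by (simp add: has_real_derivative_iff_has_vector_derivative)
  qed
  then have "(\<integral>\<^sup>+r. ennreal (indicator {a..t} r * r powr (-1/2)) \<partial>lborel) = ennreal (2 * sqrt t - 2 * sqrt a)"
    by (intro nn_integral_has_integral_lebesgue) auto
  moreover have "(\<integral>\<^sup>+r. ennreal (r powr (-1/2)) * indicator {a..<t} r \<partial>unit_leb) =
      (\<integral>\<^sup>+r. ennreal (indicator {a..t} r * r powr (-1/2)) \<partial>lborel)"
    unfolding nn_integral_unit_leb
  proof (rule nn_integral_cong_AE)
    show "AE r in lborel. ennreal (r powr (-1/2)) * indicator {a..<t} r * indicator {0<..<1} r =
        ennreal (indicator {a..t} r * r powr (-1/2))"
      using AE_lborel_singleton[of t] AE_lborel_singleton[of 0]
      by eventually_elim (use assms in \<open>auto split: split_indicator\<close>)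
  qed
  ultimately show ?thesis by (simp add: algebra_simps)
qed

lemma emeasure_unit_leb_interval:
  assumes "0 \<le> a" "a \<le> t" "t \<le> 1"
  shows "(\<integral>\<^sup>+r. indicator {a..<t} r \<partial>unit_leb) = ennreal (t - a)"
proof -
  have "(\<integral>\<^sup>+r. indicator {a..<t} r \<partial>unit_leb) = (\<integral>\<^sup>+r. indicator {a..<t} r \<partial>lborel)"
    unfolding nn_integral_unit_leb
  proof (rule nn_integral_cong_AE)
    show "AE r in lborel. indicator {a..<t} r * indicator {0<..<1} r = (indicator {a..<t} r :: ennreal)"
      using AE_lborel_singleton[of 0]
      by eventually_elim (use assms in \<open>auto split: split_indicator\<close>)
  qed
  also have "\<dots> = ennreal (t - a)" using assms by simp
  finally show ?thesis .
qed

text \<open>Of slow variation only these Potter-type bounds are kept. The exponent 1/4 for each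
  weight gives the quotient \<open>q\<close> growth of order at most 1/2 near 0, which is
  integrable. The locale is also instantiated with both weights 1, where it describes the couple of
  L^p and L^\<infinity>.\<close>

locale gauss_weights =
  fixes p :: real and b1 b2 :: "real \<Rightarrow> real" and C :: real
  assumes p: "0 < p" and C: "1 \<le> C"
    and b1_pos: "\<And>s. s \<in> {0<..<1} \<Longrightarrow> 0 < b1 s" and b2_pos: "\<And>s. s \<in> {0<..<1} \<Longrightarrow> 0 < b2 s"
    and b1_anti: "antimono_on {0<..<1} b1" and b2_mono: "mono_on {0<..<1} b2"
    and b1_slow: "\<And>r s. 0 < r \<Longrightarrow> r \<le> s \<Longrightarrow> s < 1 \<Longrightarrow> b1 r powr p \<le> C * (s / r) powr (1/4) * b1 s powr p"
    and b2_slow: "\<And>r s. 0 < r \<Longrightarrow> r \<le> s \<Longrightarrow> s < 1 \<Longrightarrow> b2 s powr p \<le> C * (s / r) powr (1/4) * b2 r powr p"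
begin

definition w :: "real \<Rightarrow> real" where "w s = b1 s powr p"
definition v :: "real \<Rightarrow> real" where "v s = b2 s powr p"
definition q :: "real \<Rightarrow> real" where "q s = w s / v s"

text \<open>The primitive of the weight that defines \<open>\<sigma>\<close>; its normalisation is \<open>\<sigma>\<^bsup>-1\<^esup>(s\<^bsup>1/p\<^esup>)\<^sup>p\<close>.\<close>
definition J :: "real \<Rightarrow> real" where
  "J t = enn2real (\<integral>\<^sup>+s. ennreal (q s) * indicator {..<t} s \<partial>unit_leb)"
definition Psi :: "real \<Rightarrow> real" where "Psi t = J t / J 1"
definition Phi :: "real \<Rightarrow> real" where "Phi = inv_into {0..1} Psi"
text \<open>The square of \<open>C\<close> is the constant of \<open>q_slow\<close>; the factor 2
  comes from integrating \<open>r powr (-1/2)\<close>.\<close>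

definition K :: real where "K = 2 * C\<^sup>2"

lemma w_pos: "s \<in> {0<..<1} \<Longrightarrow> 0 < w s" and v_pos: "s \<in> {0<..<1} \<Longrightarrow> 0 < v s"
  unfolding w_def v_def using b1_pos[of s] b2_pos[of s] by auto

lemma q_pos: "s \<in> {0<..<1} \<Longrightarrow> 0 < q s"
  unfolding q_def using w_pos v_pos by simp

lemma w_anti: "antimono_on {0<..<1} w"
proof (rule monotone_onI)
  fix r s :: real assume rs: "r \<in> {0<..<1}" "s \<in> {0<..<1}" "r \<le> s"
  have "b1 s \<le> b1 r" using monotone_onD[OF b1_anti rs] .
  then show "w s \<le> w r" unfolding w_def using p b1_pos[OF rs(2)] by (intro powr_mono2) auto
qed

lemma v_mono: "mono_on {0<..<1} v"
proof (rule monotone_onI)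
  fix r s :: real assume rs: "r \<in> {0<..<1}" "s \<in> {0<..<1}" "r \<le> s"
  have "b2 r \<le> b2 s" using monotone_onD[OF b2_mono rs] .
  then show "v r \<le> v s" unfolding v_def using p b2_pos[OF rs(1)] by (intro powr_mono2) auto
qed

lemma q_anti: "antimono_on {0<..<1} q"
proof (rule monotone_onI)
  fix r s :: real assume rs: "r \<in> {0<..<1}" "s \<in> {0<..<1}" "r \<le> s"
  show "q s \<le> q r"
    unfolding q_def
    using monotone_onD[OF w_anti rs] monotone_onD[OF v_mono rs] w_pos[OF rs(2)] v_pos[OF rs(1)]
    by (intro frac_le) auto
qed

lemma w_measurable [measurable]: "w \<in> borel_measurable unit_leb"
  by (rule antimono_on_unit_leb[OF w_anti])
lemma v_measurable [measurable]: "v \<in> borel_measurable unit_leb"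
  by (rule mono_on_unit_leb[OF v_mono])
lemma q_measurable [measurable]: "q \<in> borel_measurable unit_leb"
  by (rule antimono_on_unit_leb[OF q_anti])

lemma K_pos: "0 < K"
proof -
  have "1 \<le> C\<^sup>2" using C by (simp add: one_le_power)
  then show ?thesis unfolding K_def by linarith
qed

lemma q_slow:
  assumes "0 < r" "r \<le> s" "s < 1"
  shows "q r \<le> C\<^sup>2 * sqrt s * q s * r powr (-1/2)"
proof -
  have rs: "r \<in> {0<..<1}" "s \<in> {0<..<1}" using assms by auto
  let ?y = "(s / r) powr (1/4)"
  have "q r = w r / v r" by (simp add: q_def)
  also have "\<dots> \<le> (C * ?y * w s) / (v s / (C * ?y))"
  proof (rule frac_le)
    show "w r \<le> C * ?y * w s" using b1_slow[OF assms] by (simp add: w_def)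
    show "v s / (C * ?y) \<le> v r"
      using b2_slow[OF assms] C assms by (simp add: v_def divide_le_eq mult.commute)
    show "0 \<le> C * ?y * w s" "0 < v s / (C * ?y)" using C assms w_pos[OF rs(2)] v_pos[OF rs(2)] by auto
  qed
  also have "\<dots> = C\<^sup>2 * (?y * ?y) * q s" by (simp add: q_def power2_eq_square)
  also have "?y * ?y = (s / r) powr (1/2)" by (simp add: powr_add[symmetric])
  also have "\<dots> = sqrt s * r powr (-1/2)"
    using assms by (simp add: powr_divide powr_half_sqrt powr_minus_divide)
  finally show ?thesis by (simp add: mult_ac)
qed

lemma w_slow:
  assumes "0 < r" "r \<le> s" "s < 1"
  shows "w r \<le> C\<^sup>2 * sqrt s * w s * r powr (-1/2)"
proof -
  have rs: "r \<in> {0<..<1}" "s \<in> {0<..<1}" using assms by auto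
  have "w r \<le> C * (s / r) powr (1/4) * w s" using b1_slow[OF assms] by (simp add: w_def)
  also have "\<dots> \<le> C\<^sup>2 * (s / r) powr (1/2) * w s"
    using C w_pos[OF rs(2)] assms by (intro mult_right_mono mult_mono powr_mono) (auto simp: power2_eq_square)
  also have "(s / r) powr (1/2) = sqrt s * r powr (-1/2)"
    using assms by (simp add: powr_divide powr_half_sqrt powr_minus_divide)
  finally show ?thesis by (simp add: mult_ac)
qed

text \<open>As \<open>s / r\<close> is at least 1, the exponent 1/4 may be enlarged to 1.\<close>

lemma w_times_almost_mono:
  assumes "0 < r" "r \<le> s" "s < 1"
  shows "r * w r \<le> C * (s * w s)"
proof -
  have rs: "r \<in> {0<..<1}" "s \<in> {0<..<1}" using assms by auto
  have "w r \<le> C * (s / r) powr (1/4) * w s" using b1_slow[OF assms] by (simp add: w_def)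
  also have "\<dots> \<le> C * (s / r) powr 1 * w s"
    using C w_pos[OF rs(2)] assms by (intro mult_right_mono mult_left_mono powr_mono) auto
  finally show ?thesis using assms by (simp add: field_simps)
qed

lemma w_lower_bound:
  assumes "0 < r" "r \<le> s" "s < 1"
  shows "r * w r / C \<le> w s"
proof -
  have rs: "s \<in> {0<..<1}" using assms by auto
  have "r * w r \<le> C * (s * w s)" by (rule w_times_almost_mono[OF assms])
  also have "\<dots> \<le> C * (1 * w s)" using C w_pos[OF rs] assms by (intro mult_left_mono mult_right_mono) auto
  finally show ?thesis using C by (simp add: divide_le_eq mult.commute)
qed

lemma nn_integral_slow_le:
  assumes as: "0 \<le> a" "a \<le> s" "s < 1" and D: "0 \<le> D"
    and f: "\<And>r. 0 < r \<Longrightarrow> r < s \<Longrightarrow> f r \<le> D * sqrt s * r powr (-1/2)"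
  shows "(\<integral>\<^sup>+r. ennreal (f r) * indicator {a..<s} r \<partial>unit_leb) \<le> ennreal (2 * D * (s - a))"
proof -
  have "(\<integral>\<^sup>+r. ennreal (f r) * indicator {a..<s} r \<partial>unit_leb) \<le>
      (\<integral>\<^sup>+r. ennreal (D * sqrt s) * (ennreal (r powr (-1/2)) * indicator {a..<s} r) \<partial>unit_leb)"
    by (rule nn_integral_unit_leb_mono)
       (use f D as in \<open>auto split: split_indicator intro!: ennreal_leI simp: ennreal_mult[symmetric]\<close>)
  also have "\<dots> = ennreal (D * sqrt s) * (\<integral>\<^sup>+r. ennreal (r powr (-1/2)) * indicator {a..<s} r \<partial>unit_leb)"
    by (rule nn_integral_cmult) measurable
  also have "\<dots> = ennreal (D * sqrt s * (2 * (sqrt s - sqrt a)))"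
    using as D by (subst nn_integral_inverse_sqrt) (auto simp: ennreal_mult)
  also have "\<dots> \<le> ennreal (2 * D * (s - a))"
  proof (rule ennreal_leI)
    \<comment> \<open>This keeps the bound proportional to the length \<open>s - a\<close> and not
      merely to \<open>s\<close>; averages over short intervals need it in that form.\<close>
    have "sqrt a * sqrt a \<le> sqrt s * sqrt a" using as by (intro mult_right_mono) auto
    then have "sqrt s * (sqrt s - sqrt a) \<le> s - a" using as by (simp add: algebra_simps)
    then have "(2 * D) * (sqrt s * (sqrt s - sqrt a)) \<le> (2 * D) * (s - a)"
      using D by (intro mult_left_mono) auto
    then show "D * sqrt s * (2 * (sqrt s - sqrt a)) \<le> 2 * D * (s - a)" by (simp only: mult_ac)
  qed
  finally show ?thesis .
qed

lemma nn_integral_q_le: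
  assumes "0 \<le> a" "a \<le> s" "0 < s" "s < 1"
  shows "(\<integral>\<^sup>+r. ennreal (q r) * indicator {a..<s} r \<partial>unit_leb) \<le> ennreal (K * (s - a) * q s)"
proof -
  have "(\<integral>\<^sup>+r. ennreal (q r) * indicator {a..<s} r \<partial>unit_leb) \<le> ennreal (2 * (C\<^sup>2 * q s) * (s - a))"
    by (rule nn_integral_slow_le) (use assms q_slow[of _ s] q_pos[of s] in \<open>auto simp: mult_ac less_imp_le\<close>)
  then show ?thesis by (simp add: K_def mult_ac)
qed

lemma nn_integral_w_le:
  assumes "0 < s" "s < 1"
  shows "(\<integral>\<^sup>+r. ennreal (w r) * indicator {..<s} r \<partial>unit_leb) \<le> ennreal (K * s * w s)"
proof -
  have "(\<integral>\<^sup>+r. ennreal (w r) * indicator {..<s} r \<partial>unit_leb) = (\<integral>\<^sup>+r. ennreal (w r) * indicator {0..<s} r \<partial>unit_leb)"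
    by (rule nn_integral_unit_leb_cong) (auto split: split_indicator)
  also have "\<dots> \<le> ennreal (2 * (C\<^sup>2 * w s) * (s - 0))"
    by (rule nn_integral_slow_le) (use assms w_slow[of _ s] w_pos[of s] in \<open>auto simp: mult_ac less_imp_le\<close>)
  finally show ?thesis by (simp add: K_def mult_ac)
qed

text \<open>\<open>q_slow\<close> stops short of \<open>s = 1\<close>, so a fixed reference point
  1/2 is used on the whole interval. The result gives finiteness of \<open>J\<close> and its
  continuity up to both endpoints.\<close>

lemma nn_integral_q_bound:
  assumes "0 \<le> a" "a \<le> t" "t \<le> 1"
  shows "(\<integral>\<^sup>+r. ennreal (q r) * indicator {a..<t} r \<partial>unit_leb) \<le> ennreal (2 * (C\<^sup>2 * q (1/2)) * (sqrt t - sqrt a))"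
proof -
  let ?D = "C\<^sup>2 * q (1/2)"
  have D: "0 < ?D" using C q_pos[of "1/2"] by simp
  have qb: "q r \<le> ?D * r powr (-1/2)" if r: "r \<in> {0<..<1}" for r
  proof (cases "r \<le> 1/2")
    case True
    have "q r \<le> C\<^sup>2 * sqrt (1/2) * q (1/2) * r powr (-1/2)" by (rule q_slow) (use True r in auto)
    also have "\<dots> \<le> C\<^sup>2 * 1 * q (1/2) * r powr (-1/2)"
      using q_pos[of "1/2"] by (intro mult_right_mono mult_left_mono) auto
    finally show ?thesis by simp
  next
    case False
    have "q r \<le> q (1/2)" using monotone_onD[OF q_anti, of "1/2" r] False r by auto
    also have "\<dots> \<le> ?D * r powr (-1/2)"
    proof -
      have "1 powr (-1/2) \<le> r powr (-1/2)" by (rule powr_mono2') (use r in auto)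
      then have "1 \<le> r powr (-1/2)" by simp
      moreover have "1 \<le> C\<^sup>2" using C by simp
      ultimately have "1 * 1 \<le> C\<^sup>2 * r powr (-1/2)" by (intro mult_mono) auto
      then have "q (1/2) * 1 \<le> q (1/2) * (C\<^sup>2 * r powr (-1/2))"
        using q_pos[of "1/2"] by (intro mult_left_mono) auto
      then show ?thesis by (simp add: mult_ac)
    qed
    finally show ?thesis .
  qed
  have "(\<integral>\<^sup>+r. ennreal (q r) * indicator {a..<t} r \<partial>unit_leb) \<le>
      (\<integral>\<^sup>+r. ennreal ?D * (ennreal (r powr (-1/2)) * indicator {a..<t} r) \<partial>unit_leb)"
    by (rule nn_integral_unit_leb_mono)
       (use qb D in \<open>auto split: split_indicator intro!: ennreal_leI simp: ennreal_mult[symmetric]\<close>)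
  also have "\<dots> = ennreal ?D * (\<integral>\<^sup>+r. ennreal (r powr (-1/2)) * indicator {a..<t} r \<partial>unit_leb)"
    by (rule nn_integral_cmult) measurable
  also have "\<dots> = ennreal (2 * ?D * (sqrt t - sqrt a))"
    using assms D by (subst nn_integral_inverse_sqrt) (auto simp: ennreal_mult[symmetric] algebra_simps)
  finally show ?thesis .
qed

lemma nn_integral_q_J:
  assumes "0 \<le> t" "t \<le> 1"
  shows "(\<integral>\<^sup>+r. ennreal (q r) * indicator {..<t} r \<partial>unit_leb) = ennreal (J t)"
proof -
  have "(\<integral>\<^sup>+r. ennreal (q r) * indicator {..<t} r \<partial>unit_leb) = (\<integral>\<^sup>+r. ennreal (q r) * indicator {0..<t} r \<partial>unit_leb)"
    by (rule nn_integral_unit_leb_cong) (auto split: split_indicator)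
  also have "\<dots> < \<infinity>" using nn_integral_q_bound[of 0 t] assms by (auto intro: le_less_trans)
  finally show ?thesis unfolding J_def by (simp add: less_top[symmetric])
qed

lemma J_nonneg: "0 \<le> J t" by (simp add: J_def)

lemma nn_integral_q_J_diff:
  assumes "0 \<le> a" "a \<le> t" "t \<le> 1"
  shows "(\<integral>\<^sup>+r. ennreal (q r) * indicator {a..<t} r \<partial>unit_leb) = ennreal (J t - J a)"
    and "J a \<le> J t"
proof -
  let ?I = "\<integral>\<^sup>+r. ennreal (q r) * indicator {a..<t} r \<partial>unit_leb"
  have "(\<integral>\<^sup>+r. ennreal (q r) * indicator {..<t} r \<partial>unit_leb) =
      (\<integral>\<^sup>+r. ennreal (q r) * indicator {..<a} r + ennreal (q r) * indicator {a..<t} r \<partial>unit_leb)"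
    by (rule nn_integral_unit_leb_cong) (use assms in \<open>auto split: split_indicator\<close>)
  also have "\<dots> = (\<integral>\<^sup>+r. ennreal (q r) * indicator {..<a} r \<partial>unit_leb) + ?I"
    by (rule nn_integral_add) measurable
  finally have eq: "ennreal (J t) = ennreal (J a) + ?I"
    using assms by (simp add: nn_integral_q_J)
  then have "ennreal (J a) \<le> ennreal (J t)" by simp
  then show le: "J a \<le> J t" using J_nonneg by (simp add: ennreal_le_iff)
  have "ennreal (J t - J a) = ennreal (J t) - ennreal (J a)" by (rule ennreal_minus[symmetric]) (rule J_nonneg)
  then show "?I = ennreal (J t - J a)" using eq by (simp add: ennreal_add_diff_cancel_left)
qed

lemma J_diff_le:
  assumes "0 \<le> a" "a \<le> s" "0 < s" "s < 1"
  shows "J s - J a \<le> K * (s - a) * q s"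
  using nn_integral_q_le[OF assms] nn_integral_q_J_diff[of a s] assms q_pos[of s] K_pos
  by (simp add: ennreal_le_iff)

lemma J_diff_ge:
  assumes "0 \<le> a" "a \<le> s" "0 < s" "s < 1"
  shows "(s - a) * q s \<le> J s - J a"
proof -
  have "ennreal ((s - a) * q s) = ennreal (q s) * (\<integral>\<^sup>+r. indicator {a..<s} r \<partial>unit_leb)"
    using assms q_pos[of s] by (subst emeasure_unit_leb_interval) (auto simp: ennreal_mult[symmetric] mult.commute)
  also have "\<dots> = (\<integral>\<^sup>+r. ennreal (q s) * indicator {a..<s} r \<partial>unit_leb)"
    by (rule nn_integral_cmult[symmetric]) measurable
  also have "\<dots> \<le> (\<integral>\<^sup>+r. ennreal (q r) * indicator {a..<s} r \<partial>unit_leb)"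
    by (rule nn_integral_unit_leb_mono)
       (use assms monotone_onD[OF q_anti] in \<open>auto split: split_indicator intro!: ennreal_leI\<close>)
  also have "\<dots> = ennreal (J s - J a)" using assms by (simp add: nn_integral_q_J_diff)
  finally show ?thesis using nn_integral_q_J_diff(2)[of a s] assms by (simp add: ennreal_le_iff)
qed

lemma J_0: "J 0 = 0"
proof -
  have "(\<integral>\<^sup>+s. ennreal (q s) * indicator {..<0} s \<partial>unit_leb) = (\<integral>\<^sup>+s. 0 \<partial>unit_leb)"
    by (rule nn_integral_unit_leb_cong) (auto split: split_indicator)
  then show ?thesis by (simp add: J_def)
qed

lemma J_strict_mono: "0 \<le> a \<Longrightarrow> a < t \<Longrightarrow> t \<le> 1 \<Longrightarrow> J a < J t"
proof -
  assume at: "0 \<le> a" "a < t" "t \<le> 1"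
  define s where "s = (a + t) / 2"
  have s: "a < s" "s < t" "0 < s" "s < 1" using at by (auto simp: s_def)
  have "0 < (s - a) * q s" using s q_pos[of s] by simp
  also have "\<dots> \<le> J s - J a" using J_diff_ge[of a s] s at by simp
  finally show ?thesis using nn_integral_q_J_diff(2)[of s t] s at by simp
qed

lemma J1_pos: "0 < J 1" using J_strict_mono[of 0 1] J_0 by simp

lemma J_continuous: "continuous_on {0..1} J"
proof -
  let ?D = "2 * (C\<^sup>2 * q (1/2))"
  have D: "0 < ?D" using C q_pos[of "1/2"] by simp
  have b: "\<bar>J t - J a\<bar> \<le> ?D * \<bar>sqrt t - sqrt a\<bar>" if "a \<in> {0..1}" "t \<in> {0..1}" for a t
  proof -
    have *: "\<bar>J t - J a\<bar> \<le> ?D * \<bar>sqrt t - sqrt a\<bar>" if "0 \<le> a" "a \<le> t" "t \<le> 1" for a t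
    proof -
      have "ennreal (J t - J a) \<le> ennreal (?D * (sqrt t - sqrt a))"
        using nn_integral_q_bound[OF that] nn_integral_q_J_diff(1)[OF that] by simp
      moreover have "0 \<le> ?D * (sqrt t - sqrt a)" using D that by simp
      ultimately have "J t - J a \<le> ?D * (sqrt t - sqrt a)" by (simp add: ennreal_le_iff)
      then show ?thesis using nn_integral_q_J_diff(2)[OF that] that by simp
    qed
    show ?thesis
      using *[of a t] *[of t a] that by (cases "a \<le> t") (auto simp: abs_minus_commute)
  qed
  show ?thesis
    unfolding continuous_on_def
  proof
    fix a :: real assume a: "a \<in> {0..1}"
    have "((\<lambda>t. ?D * \<bar>sqrt t - sqrt a\<bar>) \<longlongrightarrow> ?D * \<bar>sqrt a - sqrt a\<bar>) (at a within {0..1})"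
      by (intro tendsto_intros)
    then have "((\<lambda>t. ?D * \<bar>sqrt t - sqrt a\<bar>) \<longlongrightarrow> 0) (at a within {0..1})" by simp
    moreover have "eventually (\<lambda>t. norm (J t - J a) \<le> ?D * \<bar>sqrt t - sqrt a\<bar>) (at a within {0..1})"
      unfolding eventually_at_filter using b[OF a] by (intro always_eventually) auto
    ultimately have "((\<lambda>t. J t - J a) \<longlongrightarrow> 0) (at a within {0..1})"
      by (rule Lim_null_comparison[rotated])
    then show "(J \<longlongrightarrow> J a) (at a within {0..1})" by (rule LIM_zero_cancel)
  qed
qed

lemma Psi_0: "Psi 0 = 0" and Psi_1: "Psi 1 = 1"
  using J_0 J1_pos by (auto simp: Psi_def)

lemma Psi_less: "0 \<le> a \<Longrightarrow> a < t \<Longrightarrow> t \<le> 1 \<Longrightarrow> Psi a < Psi t"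
  unfolding Psi_def using J_strict_mono J1_pos by (simp add: divide_strict_right_mono)

lemma Psi_less_iff: "a \<in> {0..1} \<Longrightarrow> t \<in> {0..1} \<Longrightarrow> Psi a < Psi t \<longleftrightarrow> a < t"
  using Psi_less[of a t] Psi_less[of t a] by (cases a t rule: linorder_cases) auto

lemma Psi_le_iff: "a \<in> {0..1} \<Longrightarrow> t \<in> {0..1} \<Longrightarrow> Psi a \<le> Psi t \<longleftrightarrow> a \<le> t"
  using Psi_less_iff[of t a] by (auto simp: not_less[symmetric])

lemma Psi_continuous: "continuous_on {0..1} Psi"
  unfolding Psi_def using J1_pos by (intro continuous_intros J_continuous) auto

lemma Psi_bij: "bij_betw Psi {0..1} {0..1}"
  unfolding bij_betw_def
proof
  show "inj_on Psi {0..1}"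
    by (rule inj_onI) (metis Psi_less_iff less_irrefl linorder_neqE)
  show "Psi ` {0..1} = {0..1}"
  proof (intro equalityI subsetI)
    fix y assume "y \<in> Psi ` {0..1}"
    then show "y \<in> {0..1}" using Psi_le_iff[of 0] Psi_le_iff[of _ 1] by (auto simp: Psi_0 Psi_1)
  next
    fix y :: real assume "y \<in> {0..1}"
    then obtain x where "0 \<le> x" "x \<le> 1" "Psi x = y"
      using IVT'[of Psi 0 y 1] Psi_continuous by (auto simp: Psi_0 Psi_1)
    then show "y \<in> Psi ` {0..1}" by force
  qed
qed

lemma Psi_range: "t \<in> {0..1} \<Longrightarrow> Psi t \<in> {0..1}"
  using Psi_bij by (auto simp: bij_betw_def)

lemma Phi_range: "u \<in> {0..1} \<Longrightarrow> Phi u \<in> {0..1}"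
  unfolding Phi_def using Psi_bij by (metis bij_betw_def inv_into_into)

lemma Psi_Phi: "u \<in> {0..1} \<Longrightarrow> Psi (Phi u) = u"
  unfolding Phi_def using Psi_bij by (metis bij_betw_def f_inv_into_f)

lemma Phi_Psi: "t \<in> {0..1} \<Longrightarrow> Phi (Psi t) = t"
  unfolding Phi_def using Psi_bij by (metis bij_betw_def inv_into_f_f)

lemma Phi_less_iff: "a \<in> {0..1} \<Longrightarrow> t \<in> {0..1} \<Longrightarrow> Phi a < Phi t \<longleftrightarrow> a < t"
  using Psi_less_iff[of "Phi a" "Phi t"] Phi_range Psi_Phi by simp

lemma Phi_le_iff: "a \<in> {0..1} \<Longrightarrow> t \<in> {0..1} \<Longrightarrow> Phi a \<le> Phi t \<longleftrightarrow> a \<le> t"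
  using Phi_less_iff[of t a] by (auto simp: not_less[symmetric])

lemma Psi_open: "t \<in> {0<..<1} \<Longrightarrow> Psi t \<in> {0<..<1}"
  using Psi_less[of 0 t] Psi_less[of t 1] by (auto simp: Psi_0 Psi_1)

lemma Phi_open: "u \<in> {0<..<1} \<Longrightarrow> Phi u \<in> {0<..<1}"
  using Phi_less_iff[of 0 u] Phi_less_iff[of u 1] Phi_Psi[of 0] Phi_Psi[of 1] by (auto simp: Psi_0 Psi_1)

text \<open>\<open>q\<close> is nonincreasing, so \<open>Psi\<close> is concave and lies above its
  chord from (0,0) to (1,1).\<close>

lemma Psi_ge:
  assumes "t \<in> {0<..<1}"
  shows "t \<le> Psi t"
proof -
  have 1: "t * q t \<le> J t" using J_diff_ge[of 0 t] assms J_0 by simp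
  have "J 1 - J t \<le> (1 - t) * q t"
  proof -
    have "ennreal (J 1 - J t) = (\<integral>\<^sup>+r. ennreal (q r) * indicator {t..<1} r \<partial>unit_leb)"
      using assms by (simp add: nn_integral_q_J_diff)
    also have "\<dots> \<le> (\<integral>\<^sup>+r. ennreal (q t) * indicator {t..<1} r \<partial>unit_leb)"
      by (rule nn_integral_unit_leb_mono)
         (use assms monotone_onD[OF q_anti] in \<open>auto split: split_indicator intro!: ennreal_leI\<close>)
    also have "\<dots> = ennreal (q t) * (\<integral>\<^sup>+r. indicator {t..<1} r \<partial>unit_leb)"
      by (rule nn_integral_cmult) measurable
    also have "\<dots> = ennreal ((1 - t) * q t)"
      using assms q_pos[of t] by (subst emeasure_unit_leb_interval) (auto simp: ennreal_mult[symmetric] mult.commute)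
    finally show ?thesis using assms q_pos[of t] by (simp add: ennreal_le_iff)
  qed
  then have "t * (J 1 - J t) \<le> t * ((1 - t) * q t)" using assms by (intro mult_left_mono) auto
  also have "\<dots> = (1 - t) * (t * q t)" by simp
  also have "\<dots> \<le> (1 - t) * J t" using assms 1 by (intro mult_left_mono) auto
  finally have "t * J 1 \<le> J t" by (simp add: algebra_simps)
  then show ?thesis using J1_pos by (simp add: Psi_def field_simps)
qed

lemma Psi_lower: "s \<in> {0<..<1} \<Longrightarrow> s * q s \<le> J 1 * Psi s"
  using J_diff_ge[of 0 s] J_0 J1_pos by (simp add: Psi_def)

lemma Psi_upper: "s \<in> {0<..<1} \<Longrightarrow> J 1 * Psi s \<le> K * s * q s"
  using J_diff_le[of 0 s] J_0 J1_pos by (simp add: Psi_def)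

lemma Psi_mono: "mono_on {0<..<1} Psi"
  by (rule monotone_onI) (simp add: Psi_le_iff)

lemma antimono_on_compose_Psi:
  "antimono_on {0<..<1} F \<Longrightarrow> antimono_on {0<..<1} (\<lambda>s. F (Psi s))"
  using Psi_open by (auto simp: monotone_on_def Psi_le_iff)

lemma antimono_on_compose_Phi:
  "antimono_on {0<..<1} F \<Longrightarrow> antimono_on {0<..<1} (\<lambda>s. F (Phi s))"
  using Phi_open by (auto simp: monotone_on_def Phi_le_iff)

section \<open>The change of variables and the identification of \<sigma>\<close>

text \<open>\<open>Psi\<close> is the distribution function of the probability density
  \<open>q / J 1\<close>, hence maps that law to Lebesgue measure. The argument compares the two
  image measures on half-lines, so \<open>Psi\<close> need not be differentiated.\<close>

lemma nn_integral_substitution_Psi: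
  assumes g: "g \<in> borel_measurable (restrict_space borel {0<..<1})"
  shows "(\<integral>\<^sup>+s. ennreal (g (Psi s)) * ennreal (q s) \<partial>unit_leb) = ennreal (J 1) * (\<integral>\<^sup>+u. ennreal (g u) \<partial>unit_leb)"
proof -
  interpret U: prob_space unit_leb by (rule prob_space_unit_leb)
  have [measurable]: "Psi \<in> borel_measurable unit_leb" by (rule mono_on_unit_leb[OF Psi_mono])
  define D where "D = density unit_leb (\<lambda>s. ennreal (q s / J 1))"
  have D_em: "emeasure D ({..<t} \<inter> {0<..<1}) = ennreal (Psi t)" if "t \<in> {0..1}" for t
  proof -
    have "emeasure D ({..<t} \<inter> {0<..<1}) = (\<integral>\<^sup>+s. ennreal (q s / J 1) * indicator ({..<t} \<inter> {0<..<1}) s \<partial>unit_leb)"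
      unfolding D_def by (rule emeasure_density) (auto simp: sets_restrict_space)
    also have "\<dots> = (\<integral>\<^sup>+s. ennreal (1 / J 1) * (ennreal (q s) * indicator {..<t} s) \<partial>unit_leb)"
    proof (rule nn_integral_unit_leb_cong)
      fix s :: real assume "s \<in> {0<..<1}"
      then show "ennreal (q s / J 1) * indicator ({..<t} \<inter> {0<..<1}) s = ennreal (1 / J 1) * (ennreal (q s) * indicator {..<t} s)"
        using q_pos[of s] J1_pos by (auto simp: ennreal_mult[symmetric] split: split_indicator)
    qed
    also have "\<dots> = ennreal (1 / J 1) * (\<integral>\<^sup>+s. ennreal (q s) * indicator {..<t} s \<partial>unit_leb)"
      by (rule nn_integral_cmult) measurable
    also have "\<dots> = ennreal (Psi t)"
      using that J1_pos J_nonneg[of t] by (simp add: nn_integral_q_J ennreal_mult[symmetric] Psi_def)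
    finally show ?thesis .
  qed
  have "emeasure D (space D) = 1"
  proof -
    have "space D = {..<1} \<inter> {0<..<1}" by (auto simp: D_def)
    then show ?thesis using D_em[of 1] by (simp add: Psi_1)
  qed
  then interpret D: prob_space D by (rule prob_spaceI)
  have [measurable_cong]: "sets D = sets unit_leb" by (simp add: D_def)
  define X where "X = distr D borel Psi"
  define Y where "Y = distr unit_leb borel (\<lambda>x::real. x)"
  interpret X: real_distribution X unfolding X_def by (rule D.real_distribution_distr) measurable
  interpret Y: real_distribution Y unfolding Y_def by (rule U.real_distribution_distr) measurable
  have sp: "space D = {0<..<1}" by (simp add: D_def)
  have Ps: "Psi -` {..<t} \<inter> space D = {..<Phi t} \<inter> {0<..<1}" if "t \<in> {0..1}" for t
  proof -
    have "Psi s < t \<longleftrightarrow> s < Phi t" if s: "s \<in> {0<..<1}" for s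
      using Psi_less_iff[of s "Phi t"] Psi_Phi[of t] Phi_range[of t] \<open>t \<in> {0..1}\<close> s by auto
    then show ?thesis unfolding sp by auto
  qed
  have X_em: "emeasure X {..<t} = ennreal t" if t: "t \<in> {0..1}" for t
    unfolding X_def by (subst emeasure_distr) (use t Phi_range[OF t] Psi_Phi[OF t] in \<open>auto simp only: Ps D_em, auto\<close>)
  have Y_em: "emeasure Y {..<t} = ennreal t" if t: "t \<in> {0..1}" for t
  proof -
    have "emeasure Y {..<t} = emeasure unit_leb ({..<t} \<inter> {0<..<1})"
      unfolding Y_def by (subst emeasure_distr) auto
    also have "{..<t} \<inter> {0<..<1} = {0<..<t}" using t by auto
    finally show ?thesis using t by (simp add: emeasure_unit_leb_below)
  qed
  have out: "emeasure X {..<t} = emeasure Y {..<t}" for t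
  proof -
    consider "t < 0" | "t \<in> {0..1}" | "1 < t" by fastforce
    then show ?thesis
    proof cases
      case 1
      then have "{..<t} \<subseteq> {..<0}" by auto
      then have "emeasure X {..<t} \<le> emeasure X {..<0}" "emeasure Y {..<t} \<le> emeasure Y {..<0}"
        by (auto intro!: emeasure_mono)
      then show ?thesis using X_em[of 0] Y_em[of 0] by simp
    next
      case 3
      then have "{..<1} \<subseteq> {..<t}" by auto
      then have "emeasure X {..<1} \<le> emeasure X {..<t}" "emeasure Y {..<1} \<le> emeasure Y {..<t}"
        by (auto intro!: emeasure_mono)
      then have "emeasure X {..<t} = 1" "emeasure Y {..<t} = 1"
        using X_em[of 1] Y_em[of 1] X.emeasure_le_1[of "{..<t}"] Y.emeasure_le_1[of "{..<t}"] by (auto intro!: antisym)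
      then show ?thesis by simp
    qed (simp add: X_em Y_em)
  qed
  have XY: "X = Y"
  \<comment> \<open>The criterion wants open right half-lines; they are complements of closed left
    half-lines, which are decreasing limits of the open ones already compared.\<close>
  proof (rule measure_eqI_lessThan)
    show "emeasure X {x<..} = emeasure Y {x<..}" for x
    proof -
      have "emeasure X {..x} = emeasure Y {..x}"
      proof -
        have "(\<Inter>n. {..<x + 1 / real (Suc n)}) = {..x}"
        proof (intro equalityI subsetI)
          fix y assume y: "y \<in> (\<Inter>n. {..<x + 1 / real (Suc n)})"
          have "y \<le> x + e" if "0 < e" for e
          proof -
            obtain n where "inverse (real (Suc n)) < e" using reals_Archimedean \<open>0 < e\<close> by blast
            moreover have "y < x + 1 / real (Suc n)" using y by blast
            ultimately show ?thesis by (simp add: inverse_eq_divide)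
          qed
          then show "y \<in> {..x}" by (simp add: field_le_epsilon)
        next
          fix y assume "y \<in> {..x}"
          moreover have "x < x + 1 / real (Suc n)" for n by simp
          ultimately show "y \<in> (\<Inter>n. {..<x + 1 / real (Suc n)})" by (auto intro: le_less_trans simp del: of_nat_Suc)
        qed
        moreover have dec: "decseq (\<lambda>n. {..<x + 1 / real (Suc n)})"
          by (auto simp: decseq_Suc_iff lessThan_subset_iff frac_le intro!: add_left_mono)
        moreover have "range (\<lambda>n. {..<x + 1 / real (Suc n)}) \<subseteq> sets X" "range (\<lambda>n. {..<x + 1 / real (Suc n)}) \<subseteq> sets Y"
          by auto
        ultimately have "(\<lambda>n. emeasure X {..<x + 1 / real (Suc n)}) \<longlonglongrightarrow> emeasure X {..x}"
            "(\<lambda>n. emeasure Y {..<x + 1 / real (Suc n)}) \<longlonglongrightarrow> emeasure Y {..x}"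
          using Lim_emeasure_decseq[OF _ dec, of X] Lim_emeasure_decseq[OF _ dec, of Y] by simp_all
        then show ?thesis unfolding out by (rule LIMSEQ_unique)
      qed
      moreover have "{x<..} = UNIV - {..x}" by auto
      ultimately show ?thesis
        using emeasure_compl[of "{..x}" X] emeasure_compl[of "{..x}" Y] X.emeasure_space_1 Y.emeasure_space_1 by simp
    qed
    show "emeasure X {x<..} < \<infinity>" for x using X.emeasure_finite by (simp add: less_top[symmetric])
  qed simp_all
  define g' where "g' u = ennreal (g u) * indicator {0<..<1} u" for u
  have [measurable]: "g' \<in> borel_measurable borel"
  proof -
    have "(\<lambda>u. ennreal (g u)) \<in> borel_measurable (restrict_space borel {0<..<1})"
      using g by measurable
    then show ?thesis unfolding g'_def by (subst (asm) borel_measurable_restrict_space_iff_ennreal) auto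
  qed
  have "(\<integral>\<^sup>+s. ennreal (g (Psi s)) * ennreal (q s) \<partial>unit_leb) =
      (\<integral>\<^sup>+s. ennreal (J 1) * (ennreal (q s / J 1) * g' (Psi s)) \<partial>unit_leb)"
  proof (rule nn_integral_unit_leb_cong)
    fix s :: real assume s: "s \<in> {0<..<1}"
    have "ennreal (q s) = ennreal (J 1) * ennreal (q s / J 1)"
      using q_pos[OF s] J1_pos by (simp add: ennreal_mult[symmetric])
    then show "ennreal (g (Psi s)) * ennreal (q s) = ennreal (J 1) * (ennreal (q s / J 1) * g' (Psi s))"
      using Psi_open[OF s] by (simp add: g'_def mult_ac)
  qed
  also have "\<dots> = ennreal (J 1) * (\<integral>\<^sup>+s. ennreal (q s / J 1) * g' (Psi s) \<partial>unit_leb)"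
    by (rule nn_integral_cmult) measurable
  also have "(\<integral>\<^sup>+s. ennreal (q s / J 1) * g' (Psi s) \<partial>unit_leb) = (\<integral>\<^sup>+s. g' (Psi s) \<partial>D)"
    unfolding D_def by (rule nn_integral_density[symmetric]) measurable
  also have "\<dots> = (\<integral>\<^sup>+u. g' u \<partial>X)"
  proof -
    have "Psi \<in> borel_measurable D" unfolding D_def by simp
    from nn_integral_distr[OF this, of g'] show ?thesis by (simp add: X_def)
  qed
  also have "\<dots> = (\<integral>\<^sup>+u. g' u \<partial>unit_leb)" unfolding XY Y_def using nn_integral_distr[OF measurable_ident_unit_leb, of g'] by simp
  also have "\<dots> = (\<integral>\<^sup>+u. ennreal (g u) \<partial>unit_leb)"
    by (rule nn_integral_unit_leb_cong) (simp add: g'_def)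
  finally show ?thesis .
qed

lemma LINT_q:
  assumes "0 \<le> t" "t \<le> 1"
  shows "(LINT s:{0<..<t}|lebesgue. (b1 s / b2 s) powr p) = J t"
proof -
  have qe: "(b1 s / b2 s) powr p = q s" if "s \<in> {0<..<1}" for s
    using b1_pos[OF that] b2_pos[OF that] by (simp add: q_def w_def v_def powr_divide)
  have "(LINT s:{0<..<t}|lebesgue. (b1 s / b2 s) powr p) = (LINT s|lebesgue. indicator {0<..<1} s *\<^sub>R (indicator {..<t} s * q s))"
    unfolding set_lebesgue_integral_def
    by (rule arg_cong[where f="integral\<^sup>L lebesgue"]) (use assms qe in \<open>auto simp: fun_eq_iff split: split_indicator\<close>)
  also have "\<dots> = (LINT s|unit_leb. indicator {..<t} s * q s)"
    by (rule integral_restrict_space[symmetric]) auto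
  also have "\<dots> = enn2real (\<integral>\<^sup>+s. ennreal (indicator {..<t} s * q s) \<partial>unit_leb)"
    by (rule integral_eq_nn_integral) (measurable, rule AE_unit_leb_I, use q_pos in \<open>simp add: less_imp_le split: split_indicator\<close>)
  also have "(\<integral>\<^sup>+s. ennreal (indicator {..<t} s * q s) \<partial>unit_leb) = (\<integral>\<^sup>+s. ennreal (q s) * indicator {..<t} s \<partial>unit_leb)"
    by (rule nn_integral_unit_leb_cong) (auto split: split_indicator)
  finally show ?thesis by (simp add: J_def)
qed

lemma powr_bij_unit: "s \<in> {0..1} \<Longrightarrow> 0 < a \<Longrightarrow> s powr a \<in> {0..1::real}"
  using powr_mono2[of a s 1] by auto

text \<open>In the variables \<open>t powr p\<close> and \<open>\<sigma> t powr p\<close> the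
  defining equation reads \<open>t powr p = Psi (\<sigma> t powr p)\<close>. As \<open>Psi\<close>
  is a bijection, this gives existence and uniqueness at once.\<close>

lemma sigma_eq: "sigma p b1 b2 = restrict (\<lambda>t. Phi (t powr p) powr (1/p)) {0..1}" (is "_ = ?\<sigma>")
  unfolding sigma_def
proof (rule the_equality)
  have C0: "(LINT s:{0<..<1}|lebesgue. (b1 s / b2 s) powr p) = J 1" by (rule LINT_q) auto
  have pow: "(x powr (1/p)) powr p = x" "(x powr p) powr (1/p) = x" if "0 \<le> x" for x
    using p that by (auto simp: powr_powr)
  have r: "t powr p \<in> {0..1}" "Phi (t powr p) \<in> {0..1}" "?\<sigma> t \<in> {0..1}" "?\<sigma> t powr p = Phi (t powr p)"
    if t: "t \<in> {0..1}" for t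
  proof -
    show 1: "t powr p \<in> {0..1}" using powr_bij_unit[OF t p] .
    show 2: "Phi (t powr p) \<in> {0..1}" by (rule Phi_range[OF 1])
    show "?\<sigma> t \<in> {0..1}" using powr_bij_unit[OF 2, of "1/p"] p t by simp
    show "?\<sigma> t powr p = Phi (t powr p)" using 2 t pow by simp
  qed
  have sm: "strict_mono_on {0..1} ?\<sigma>"
  proof (rule strict_mono_onI)
    fix s t :: real assume st: "s \<in> {0..1}" "t \<in> {0..1}" "s < t"
    have "s powr p < t powr p" using st p by (intro powr_less_mono2) auto
    then have "Phi (s powr p) < Phi (t powr p)" using r st by (simp add: Phi_less_iff)
    then show "?\<sigma> s < ?\<sigma> t" using r(2)[OF st(1)] st p by (auto intro!: powr_less_mono2)
  qed
  have "bij_betw ?\<sigma> {0..1} {0..1}"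
    unfolding bij_betw_def
  proof
    show "inj_on ?\<sigma> {0..1}" using sm by (rule strict_mono_on_imp_inj_on)
    show "?\<sigma> ` {0..1} = {0..1}"
    proof (intro equalityI subsetI)
      fix y assume "y \<in> ?\<sigma> ` {0..1}" then show "y \<in> {0..1}" using r(3) by blast
    next
      fix y :: real assume y: "y \<in> {0..1}"
      let ?t = "Psi (y powr p) powr (1/p)"
      have yp: "y powr p \<in> {0..1}" using powr_bij_unit[OF y p] .
      have t: "?t \<in> {0..1}" using powr_bij_unit[OF Psi_range[OF yp], of "1/p"] p by simp
      have "?\<sigma> ?t = y" using t Psi_range[OF yp] pow y Phi_Psi[OF yp] by auto
      then show "y \<in> ?\<sigma> ` {0..1}" using t by (metis imageI)
    qed
  qed
  moreover have "t powr p = (1 / J 1) * (LINT s:{0<..<?\<sigma> t powr p}|lebesgue. (b1 s / b2 s) powr p)"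
    if t: "t \<in> {0..1}" for t
    unfolding r(4)[OF t] using LINT_q[of "Phi (t powr p)"] r(2)[OF t] Psi_Phi[OF r(1)[OF t]] by (simp add: Psi_def)
  ultimately show "?\<sigma> \<in> extensional {0..1} \<and> strict_mono_on {0..1} ?\<sigma> \<and> bij_betw ?\<sigma> {0..1} {0..1} \<and>
     (let C0 = (LINT s:{0<..<1}|lebesgue. (b1 s / b2 s) powr p) in
      \<forall>t\<in>{0..1}. t powr p = (1 / C0) * (LINT s:{0<..<?\<sigma> t powr p}|lebesgue. (b1 s / b2 s) powr p))"
    unfolding C0 Let_def using sm by blast
  fix \<sigma> assume *: "\<sigma> \<in> extensional {0..1} \<and> strict_mono_on {0..1} \<sigma> \<and> bij_betw \<sigma> {0..1} {0..1} \<and>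
     (let C0 = (LINT s:{0<..<1}|lebesgue. (b1 s / b2 s) powr p) in
      \<forall>t\<in>{0..1}. t powr p = (1 / C0) * (LINT s:{0<..<\<sigma> t powr p}|lebesgue. (b1 s / b2 s) powr p))"
  show "\<sigma> = ?\<sigma>"
  proof (rule extensionalityI[of _ "{0..1}"])
    show "\<sigma> \<in> extensional {0..1}" using * by blast
    fix t :: real assume t: "t \<in> {0..1}"
    have st: "\<sigma> t \<in> {0..1}" using * t unfolding bij_betw_def by blast
    then have stp: "\<sigma> t powr p \<in> {0..1}" using powr_bij_unit p by blast
    have "t powr p = (1 / J 1) * (LINT s:{0<..<\<sigma> t powr p}|lebesgue. (b1 s / b2 s) powr p)"
      using * t unfolding C0 Let_def by blast
    also have "\<dots> = Psi (\<sigma> t powr p)" using stp LINT_q[of "\<sigma> t powr p"] by (simp add: Psi_def)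
    finally have "Phi (t powr p) = \<sigma> t powr p" using Phi_Psi[OF stp] by simp
    then show "\<sigma> t = ?\<sigma> t" using t st pow(2)[of "\<sigma> t"] by simp
  qed simp
qed

lemma sigma_pow_eq: "s \<in> {0..1} \<Longrightarrow> sigma_pow p b1 b2 s = Phi s"
proof -
  assume s: "s \<in> {0..1}"
  have s1: "s powr (1/p) \<in> {0..1}" by (rule powr_bij_unit[OF s]) (use p in simp)
  then show ?thesis
    unfolding sigma_pow_def sigma_eq using s p Phi_range[OF s] by (simp add: powr_powr)
qed

lemma sigma_inv_pow_eq: "s \<in> {0..1} \<Longrightarrow> sigma_inv_pow p b1 b2 s = Psi s"
proof -
  assume s: "s \<in> {0..1}"
  let ?\<sigma> = "restrict (\<lambda>t. Phi (t powr p) powr (1/p)) {0..1}"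
  let ?t = "Psi s powr (1/p)"
  have t: "?t \<in> {0..1}" by (rule powr_bij_unit[OF Psi_range[OF s]]) (use p in simp)
  have "?\<sigma> ?t = s powr (1/p)" using t p Psi_range[OF s] Phi_Psi[OF s] by (simp add: powr_powr)
  moreover have "inj_on ?\<sigma> {0..1}"
  proof (rule inj_onI)
    fix x y :: real assume xy: "x \<in> {0..1}" "y \<in> {0..1}" "?\<sigma> x = ?\<sigma> y"
    have "(Phi (x powr p) powr (1/p)) powr p = (Phi (y powr p) powr (1/p)) powr p" using xy by simp
    then have "Phi (x powr p) = Phi (y powr p)"
      using p Phi_range[OF powr_bij_unit[OF xy(1) p]] Phi_range[OF powr_bij_unit[OF xy(2) p]] by (simp add: powr_powr)
    then have "x powr p = y powr p" using Psi_Phi powr_bij_unit[OF xy(1) p] powr_bij_unit[OF xy(2) p] by metis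
    then have "(x powr p) powr (1/p) = (y powr p) powr (1/p)" by simp
    then show "x = y" using p xy by (simp add: powr_powr)
  qed
  ultimately have "inv_into {0..1} ?\<sigma> (s powr (1/p)) = ?t" using inv_into_f_f[of ?\<sigma> "{0..1}" ?t] t by simp
  then show ?thesis
    unfolding sigma_inv_pow_def sigma_eq using p Psi_range[OF s] by (simp add: powr_powr)
qed

end

section \<open>Gaussible operators and K-functionals\<close>

lemma epowr_ennreal: "0 \<le> x \<Longrightarrow> epowr (ennreal x) a = ennreal (x powr a)"
  by (simp add: epowr_def)

lemma epowr_top [simp]: "epowr top a = top"
  by (simp add: epowr_def)

lemma epowr_mono: "x \<le> y \<Longrightarrow> 0 < a \<Longrightarrow> epowr x a \<le> epowr y a"
  by (cases x; cases y) (auto simp: epowr_ennreal intro!: ennreal_leI powr_mono2 simp: top_unique)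

lemma epowr_epowr: "0 < a \<Longrightarrow> epowr (epowr x a) b = epowr x (a * b)"
  by (cases x) (auto simp: epowr_ennreal powr_powr)

lemma epowr_1 [simp]: "epowr x 1 = x"
  by (cases x) (auto simp: epowr_ennreal)

lemma epowr_inverse [simp]: "0 < p \<Longrightarrow> epowr (epowr x p) (1/p) = x" "0 < p \<Longrightarrow> epowr (epowr x (1/p)) p = x"
  by (simp_all add: epowr_epowr)

lemma epowr_less_top [simp]: "epowr x a < top \<longleftrightarrow> x < top"
  by (cases x) (auto simp: epowr_ennreal)

lemma epowr_cmult: "0 < a \<Longrightarrow> 0 < c \<Longrightarrow> epowr (ennreal c * x) a = ennreal (c powr a) * epowr x a"
  by (cases x) (auto simp: epowr_ennreal ennreal_mult[symmetric] powr_mult ennreal_mult_top)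

lemma powr_add_le:
  fixes x y p :: real
  assumes "0 \<le> x" "0 \<le> y" "0 < p"
  shows "(x + y) powr p \<le> 2 powr p * (x powr p + y powr p)"
proof -
  have "(x + y) powr p \<le> (2 * max x y) powr p" using assms by (intro powr_mono2) auto
  also have "\<dots> = 2 powr p * max x y powr p" using assms by (simp add: powr_mult)
  also have "max x y powr p \<le> x powr p + y powr p" by (auto simp: max_def)
  finally show ?thesis by simp
qed

lemma epowr_add_ge:
  assumes "0 < p"
  shows "epowr x p + epowr y p \<le> 2 * epowr (x + y) p"
proof -
  have "epowr x p \<le> epowr (x + y) p" "epowr y p \<le> epowr (x + y) p"
    using assms by (auto intro!: epowr_mono)
  from add_mono[OF this] show ?thesis by (simp add: mult_2)
qed

lemma rearr_mono:
  assumes M: "prob_space M" and [measurable]: "f \<in> borel_measurable M" "g \<in> borel_measurable M"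
    and le: "\<And>x. x \<in> space M \<Longrightarrow> norm (f x) \<le> norm (g x)" and t: "0 < t"
  shows "rearr M f t \<le> rearr M g t"
proof (rule ccontr)
  interpret prob_space M by fact
  assume "\<not> ?thesis"
  then have "t < measure M (upper_level M f (rearr M g t))"
    using less_rearr_iff[OF M, of f "rearr M g t" t] rearr_nonneg[OF M, of g t] t by simp
  also have "\<dots> \<le> measure M (upper_level M g (rearr M g t))"
    by (rule finite_measure_mono) (use le in \<open>auto intro: less_le_trans\<close>)
  also have "\<dots> \<le> t"
    using less_rearr_iff[OF M, of g "rearr M g t" t] rearr_nonneg[OF M, of g t] t by auto
  finally show False by simp
qed

text \<open>Both sides of the gaussible inequality take this form, the right one with weight 1 after
  the substitution. At \<open>t = 1\<close> it is the p-th power of the norm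
  \<open>Lqb_norm\<close>.\<close>

definition wint :: "real \<Rightarrow> (real \<Rightarrow> real) \<Rightarrow> 'a measure \<Rightarrow> ('a \<Rightarrow> 'b::real_normed_vector) \<Rightarrow> real \<Rightarrow> ennreal" where
  "wint p b N f t = (\<integral>\<^sup>+s. ennreal ((rearr N f s * b s) powr p) * indicator {..<t} s \<partial>unit_leb)"

lemma nn_integral_dilation_le:
  fixes \<theta> :: "real \<Rightarrow> real"
  assumes "antimono_on {0<..<1} \<theta>" and t: "t \<le> 1"
  shows "(\<integral>\<^sup>+s. ennreal (\<theta> (s/2)) * indicator {..<t} s \<partial>unit_leb) \<le>
    2 * (\<integral>\<^sup>+s. ennreal (\<theta> s) * indicator {..<t} s \<partial>unit_leb)"
proof -
  define k where "k s = ennreal (\<theta> s) * indicator {0<..<1} s" for s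
  have [measurable]: "k \<in> borel_measurable borel"
  proof -
    have "(\<lambda>u. ennreal (\<theta> u)) \<in> borel_measurable (restrict_space borel {0<..<1})"
      using antimono_on_borel[OF assms(1)] by measurable
    then show ?thesis unfolding k_def by (subst (asm) borel_measurable_restrict_space_iff_ennreal) auto
  qed
  define m where "m s = k (s/2) * indicator {..<t} s * indicator {0<..<1} s" for s
  have [measurable]: "m \<in> borel_measurable borel" unfolding m_def by measurable
  have "(\<integral>\<^sup>+s. ennreal (\<theta> (s/2)) * indicator {..<t} s \<partial>unit_leb) = (\<integral>\<^sup>+s. m s \<partial>lborel)"
    unfolding nn_integral_unit_leb m_def k_def by (rule nn_integral_cong) (auto split: split_indicator)
  also have "\<dots> = ennreal \<bar>2\<bar> * (\<integral>\<^sup>+s. m (0 + 2 * s) \<partial>lborel)"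
    by (rule nn_integral_real_affine) auto
  also have "\<dots> \<le> ennreal \<bar>2\<bar> * (\<integral>\<^sup>+s. ennreal (\<theta> s) * indicator {..<t} s * indicator {0<..<1} s \<partial>lborel)"
    by (intro mult_left_mono nn_integral_mono) (use t in \<open>auto simp: m_def k_def split: split_indicator\<close>)
  also have "\<dots> = 2 * (\<integral>\<^sup>+s. ennreal (\<theta> s) * indicator {..<t} s \<partial>unit_leb)"
    by (simp add: nn_integral_unit_leb)
  finally show ?thesis .
qed

lemma Lqb_norm_powr:
  assumes N: "prob_space N" "g \<in> borel_measurable N" and p: "0 < p"
    and b: "\<And>s. s \<in> {0<..<1} \<Longrightarrow> 0 < b s"
  shows "epowr (Lqb_norm (ennreal p) b N g) p = wint p b N g 1"
proof -
  have "Lqb_norm (ennreal p) b N g = epowr (\<integral>\<^sup>+t. ennreal (norm (b t * rearr N g t) powr p) \<partial>unit_leb) (1/p)"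
    using p by (simp add: Lqb_norm_def Lq_norm_def)
  also have "(\<integral>\<^sup>+t. ennreal (norm (b t * rearr N g t) powr p) \<partial>unit_leb) = wint p b N g 1"
    unfolding wint_def
    by (rule nn_integral_unit_leb_cong) (use rearr_nonneg[OF N] b in \<open>auto simp: abs_mult mult.commute less_imp_le\<close>)
  finally show ?thesis using p by simp
qed

lemma prob_AE_norm_le_iff:
  assumes "prob_space M" and [measurable]: "f \<in> borel_measurable M"
  shows "(AE x in M. norm (f x) \<le> l) \<longleftrightarrow> measure M (upper_level M f l) = 0"
proof -
  interpret prob_space M by fact
  show ?thesis
    by (subst AE_iff_measurable[of "upper_level M f l"]) (auto simp: emeasure_eq_measure not_le)
qed

text \<open>A function and its rearrangement have the same essential upper bounds. With
  \<open>Lq_norm_eq\<close> this turns the unweighted couple into the weighted one with weights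
  1.\<close>

lemma Lq_norm_infinity_eq:
  assumes M: "prob_space M" and f [measurable]: "f \<in> borel_measurable M"
  shows "Lq_norm \<infinity> M f = Lqb_norm \<infinity> (\<lambda>_. 1) M f"
proof -
  note P = prob_space_unit_leb
  have [measurable]: "rearr M f \<in> borel_measurable unit_leb" by (rule rearr_measurable[OF M f])
  have "(AE x in M. ennreal (norm (f x)) \<le> z) \<longleftrightarrow> (AE t in unit_leb. ennreal (norm (1 * rearr M f t)) \<le> z)" for z
  proof (cases z)
    case (real l)
    have "(AE x in M. ennreal (norm (f x)) \<le> z) \<longleftrightarrow> (AE x in M. norm (f x) \<le> l)"
      using real by (simp add: ennreal_le_iff)
    also have "\<dots> \<longleftrightarrow> measure M (upper_level M f l) = 0" by (rule prob_AE_norm_le_iff[OF M f])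
    also have "\<dots> \<longleftrightarrow> measure unit_leb (upper_level unit_leb (rearr M f) l) = 0"
      using measure_upper_level_rearr[OF M f, of l] real by simp
    also have "\<dots> \<longleftrightarrow> (AE t in unit_leb. norm (rearr M f t) \<le> l)"
      by (rule prob_AE_norm_le_iff[OF P, symmetric]) measurable
    also have "\<dots> \<longleftrightarrow> (AE t in unit_leb. ennreal (norm (1 * rearr M f t)) \<le> z)"
      using real by (simp add: ennreal_le_iff)
    finally show ?thesis .
  qed simp
  then show ?thesis
    unfolding Lqb_norm_def Lq_norm_def by (subst (1 2) if_P, simp, simp, subst (1 2) esssup_eq_AE) auto
qed

lemma nn_integral_norm_powr_rearr:
  assumes M: "prob_space M" and f [measurable]: "f \<in> borel_measurable M" and p: "0 < p"
  shows "(\<integral>\<^sup>+x. ennreal (norm (f x) powr p) \<partial>M) = wint p (\<lambda>_. 1) M f 1"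
proof -
  have "(\<integral>\<^sup>+x. ennreal (norm (f x) powr p) \<partial>M) = (\<integral>\<^sup>+x. ennreal (norm (norm (f x) powr p)) \<partial>M)" by simp
  also have "\<dots> = (\<integral>\<^sup>+t. ennreal (rearr M (\<lambda>x. norm (f x) powr p) t) \<partial>unit_leb)"
    by (rule nn_integral_rearr[OF M]) measurable
  also have "\<dots> = wint p (\<lambda>_. 1) M f 1"
    unfolding wint_def by (rule nn_integral_unit_leb_cong) (use rearr_powr[OF M f _ p] in auto)
  finally show ?thesis .
qed

lemma Lq_norm_eq:
  assumes M: "prob_space M" and f: "f \<in> borel_measurable M" and p: "0 < p"
  shows "Lq_norm (ennreal p) M f = Lqb_norm (ennreal p) (\<lambda>_. 1) M f"
proof -
  have "Lqb_norm (ennreal p) (\<lambda>_. 1) M f = epowr (wint p (\<lambda>_. 1) M f 1) (1/p)"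
    using Lqb_norm_powr[OF M f p, of "\<lambda>_. 1"] p by (metis epowr_inverse(1) zero_less_one)
  then show ?thesis
    using p nn_integral_norm_powr_rearr[OF M f p] by (simp add: Lq_norm_def)
qed

lemma K_functional_cong:
  assumes "\<And>g. g \<in> borel_measurable M \<Longrightarrow> N0 g = N0' g" "\<And>g. g \<in> borel_measurable M \<Longrightarrow> N1 g = N1' g"
  shows "K_functional M f t N0 N1 = K_functional M f t N0' N1'"
proof -
  have "(x = N0 g + ennreal t * N1 h \<and> g \<in> borel_measurable M \<and> h \<in> borel_measurable M \<and>
      (AE x in M. f x = g x + h x) \<and> N0 g < \<infinity> \<and> N1 h < \<infinity>) \<longleftrightarrow>
    (x = N0' g + ennreal t * N1' h \<and> g \<in> borel_measurable M \<and> h \<in> borel_measurable M \<and>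
      (AE x in M. f x = g x + h x) \<and> N0' g < \<infinity> \<and> N1' h < \<infinity>)" for x g h
    using assms(1)[of g] assms(2)[of h] by (cases "g \<in> borel_measurable M"; cases "h \<in> borel_measurable M") auto
  then show ?thesis unfolding K_functional_def by presburger
qed

context gauss_weights
begin

lemma weighted_powr:
  assumes "0 \<le> x" "s \<in> {0<..<1}"
  shows "(x * b1 s) powr p = x powr p * w s" "(b2 s * x) powr p = v s * x powr p"
  using assms b1_pos[of s] b2_pos[of s] by (auto simp: powr_mult w_def v_def)

lemma rearr_b1_antimono:
  assumes N: "prob_space N" "g \<in> borel_measurable N"
  shows "antimono_on {0<..<1} (\<lambda>s. (rearr N g s * b1 s) powr p)"
proof (rule monotone_onI)
  fix r s :: real assume rs: "r \<in> {0<..<1}" "s \<in> {0<..<1}" "r \<le> s"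
  have "rearr N g s \<le> rearr N g r" using monotone_onD[OF rearr_antimono_unit[OF N] rs] .
  moreover have "b1 s \<le> b1 r" using monotone_onD[OF b1_anti rs] .
  ultimately show "(rearr N g s * b1 s) powr p \<le> (rearr N g r * b1 r) powr p"
    using p b1_pos[OF rs(2)] b1_pos[OF rs(1)] rearr_nonneg[OF N, of s] rearr_nonneg[OF N, of r] rs
    by (intro powr_mono2 mult_mono) auto
qed

text \<open>The value of \<open>f\<close> at \<open>s\<close> is split into values of
  \<open>g\<close> and \<open>h\<close> at \<open>s / 2\<close>, and \<open>b1\<close> only grows
  when \<open>s\<close> is halved. The factor \<open>2 powr p\<close> comes from the power of a sum,
  the factor 2 from undoing the dilation.\<close>

lemma wint_add_le:
  assumes N: "prob_space N" and [measurable]: "f \<in> borel_measurable N" "g \<in> borel_measurable N" "h \<in> borel_measurable N"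
    and ae: "AE x in N. f x = g x + h x" and t: "t \<le> 1"
  shows "wint p b1 N f t \<le> ennreal (2 powr p * 2) * (wint p b1 N g t + wint p b1 N h t)"
proof -
  define A where "A g s = (rearr N g s * b1 s) powr p" for g :: "'a \<Rightarrow> 'b" and s
  have mono: "antimono_on {0<..<1} (A g)" "antimono_on {0<..<1} (A h)"
    unfolding A_def by (rule rearr_b1_antimono[OF N]; measurable)+
  have half: "antimono_on {0<..<1} (\<lambda>s. B (s/2))" if "antimono_on {0<..<1} B" for B :: "real \<Rightarrow> real"
    using that by (auto simp: monotone_on_def)
  have [measurable]: "(\<lambda>s. A g (s/2)) \<in> borel_measurable unit_leb" "(\<lambda>s. A h (s/2)) \<in> borel_measurable unit_leb"
    using antimono_on_unit_leb[OF half[OF mono(1)]] antimono_on_unit_leb[OF half[OF mono(2)]] by auto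
  have "wint p b1 N f t \<le> (\<integral>\<^sup>+s. ennreal (2 powr p) * (ennreal (A g (s/2)) * indicator {..<t} s +
      ennreal (A h (s/2)) * indicator {..<t} s) \<partial>unit_leb)"
    unfolding wint_def
  proof (rule nn_integral_unit_leb_mono)
    fix s :: real assume s: "s \<in> {0<..<1}"
    then have s2: "s/2 \<in> {0<..<1}" "s/2 \<le> s" by auto
    have nn: "0 \<le> rearr N f s" "0 \<le> rearr N g (s/2)" "0 \<le> rearr N h (s/2)"
      using s by (auto intro!: rearr_nonneg[OF N])
    have "rearr N f s \<le> rearr N g (s/2) + rearr N h (s/2)"
      by (rule rearr_add_le[OF N _ _ _ ae]) (use s in auto)
    moreover have "b1 s \<le> b1 (s/2)" using monotone_onD[OF b1_anti s2(1) s s2(2)] .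
    ultimately have "rearr N f s * b1 s \<le> (rearr N g (s/2) + rearr N h (s/2)) * b1 (s/2)"
      using nn b1_pos[OF s] by (intro mult_mono) auto
    then have "(rearr N f s * b1 s) powr p \<le> (rearr N g (s/2) * b1 (s/2) + rearr N h (s/2) * b1 (s/2)) powr p"
      using nn p b1_pos[OF s] by (intro powr_mono2) (auto simp: algebra_simps)
    also have "\<dots> \<le> 2 powr p * (A g (s/2) + A h (s/2))"
      unfolding A_def using nn b1_pos[OF s2(1)] p by (intro powr_add_le) auto
    finally have "ennreal ((rearr N f s * b1 s) powr p) \<le> ennreal (2 powr p) * (ennreal (A g (s/2)) + ennreal (A h (s/2)))"
      by (simp add: ennreal_mult[symmetric] ennreal_plus[symmetric] A_def del: ennreal_plus)
    then show "ennreal ((rearr N f s * b1 s) powr p) * indicator {..<t} s \<le>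
        ennreal (2 powr p) * (ennreal (A g (s/2)) * indicator {..<t} s + ennreal (A h (s/2)) * indicator {..<t} s)"
      by (auto split: split_indicator)
  qed
  also have "\<dots> = ennreal (2 powr p) * ((\<integral>\<^sup>+s. ennreal (A g (s/2)) * indicator {..<t} s \<partial>unit_leb) +
      (\<integral>\<^sup>+s. ennreal (A h (s/2)) * indicator {..<t} s \<partial>unit_leb))"
    by (subst nn_integral_cmult, measurable, subst nn_integral_add) auto
  also have "\<dots> \<le> ennreal (2 powr p) * (2 * wint p b1 N g t + 2 * wint p b1 N h t)"
    unfolding wint_def A_def[symmetric]
    by (intro mult_left_mono add_mono nn_integral_dilation_le mono t) auto
  also have "\<dots> = ennreal (2 powr p * 2) * (wint p b1 N g t + wint p b1 N h t)"
    by (simp add: ennreal_mult distrib_left mult_ac)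
  finally show ?thesis .
qed

lemma wint_mono: "t \<le> t' \<Longrightarrow> wint p b N f t \<le> wint p b N f t'"
  unfolding wint_def by (intro nn_integral_mono mult_left_mono) (auto split: split_indicator)

lemma b2_rearr_measurable:
  assumes N: "prob_space N" "h \<in> borel_measurable N"
  shows "(\<lambda>t. ennreal (norm (b2 t * rearr N h t))) \<in> borel_measurable unit_leb"
proof -
  have [measurable]: "b2 \<in> borel_measurable unit_leb" by (rule mono_on_unit_leb[OF b2_mono])
  have [measurable]: "rearr N h \<in> borel_measurable unit_leb" by (rule rearr_measurable[OF N])
  show ?thesis by measurable
qed

text \<open>Moving the weight from \<open>b1\<close> to \<open>b2\<close> costs exactly the factor
  \<open>q\<close>, whose integral up to \<open>t\<close> is \<open>J t\<close>. This makes
  \<open>Psi t powr (1/p)\<close> the K-functional parameter that belongs to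
  \<open>t\<close>.\<close>

lemma wint_le_Lqb_infinity:
  assumes N: "prob_space N" "h \<in> borel_measurable N" and t: "t \<in> {0..1}"
  shows "wint p b1 N h t \<le> epowr (Lqb_norm \<infinity> b2 N h) p * ennreal (J t)"
proof -
  let ?E = "Lqb_norm \<infinity> b2 N h"
  have "AE s in unit_leb. ennreal (norm (b2 s * rearr N h s)) \<le> ?E"
    unfolding Lqb_norm_def Lq_norm_def by (simp only: if_P refl) (rule esssup_AE)
  then have "AE s in unit_leb. ennreal ((rearr N h s * b1 s) powr p) \<le> epowr ?E p * ennreal (q s)"
    using AE_space
  proof eventually_elim
    case (elim s)
    then have s: "s \<in> {0<..<1}" by simp
    have nn: "0 \<le> rearr N h s" using s rearr_nonneg[OF N] by auto
    have "(rearr N h s * b1 s) powr p = (b2 s * rearr N h s) powr p * q s"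
      using weighted_powr[OF nn s] v_pos[OF s] by (simp add: q_def)
    then have "ennreal ((rearr N h s * b1 s) powr p) = ennreal ((b2 s * rearr N h s) powr p) * ennreal (q s)"
      using q_pos[OF s] by (simp add: ennreal_mult)
    also have "ennreal ((b2 s * rearr N h s) powr p) = epowr (ennreal (norm (b2 s * rearr N h s))) p"
      using nn b2_pos[OF s] by (simp add: epowr_ennreal abs_mult)
    also have "\<dots> \<le> epowr ?E p" using elim(1) p by (rule epowr_mono)
    finally show ?case by (simp add: mult_right_mono)
  qed
  then have "wint p b1 N h t \<le> (\<integral>\<^sup>+s. epowr ?E p * (ennreal (q s) * indicator {..<t} s) \<partial>unit_leb)"
    unfolding wint_def
    by (intro nn_integral_mono_AE) (auto elim!: eventually_mono split: split_indicator)
  also have "\<dots> = epowr ?E p * ennreal (J t)"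
    using t by (subst nn_integral_cmult) (auto simp: nn_integral_q_J)
  finally show ?thesis .
qed

text \<open>Every decomposition bounds the integral. In the constant, \<open>2 powr p * 2\<close> is
  that of \<open>wint_add_le\<close>, \<open>max 1 (J 1)\<close> absorbs the normalisation of
  \<open>J\<close>, and the last 2 merges two p-th powers into the power of a sum.\<close>

lemma wint_le_K_functional:
  assumes N: "prob_space N" and f: "f \<in> borel_measurable N" and t: "t \<in> {0<..<1}"
  shows "wint p b1 N f t \<le> ennreal (2 powr p * 2 * max 1 (J 1) * 2) *
    epowr (K_functional N f (Psi t powr (1/p)) (Lqb_norm (ennreal p) b1 N) (Lqb_norm \<infinity> b2 N)) p"
proof -
  let ?N0 = "Lqb_norm (ennreal p) b1 N :: ('a \<Rightarrow> complex) \<Rightarrow> ennreal"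
  let ?N1 = "Lqb_norm \<infinity> b2 N :: ('a \<Rightarrow> complex) \<Rightarrow> ennreal"
  let ?m = "max 1 (J 1)"
  let ?c = "2 powr p * 2 * ?m * 2"
  let ?\<tau> = "Psi t powr (1/p)"
  have c: "0 < ?c" by (simp add: max_def)
  have Pt: "0 < Psi t" using Psi_open[OF t] by simp
  have t01: "t \<in> {0..1}" using t by auto
  have *: "wint p b1 N f t \<le> ennreal ?c * epowr (?N0 g + ennreal ?\<tau> * ?N1 h) p"
    if [measurable]: "g \<in> borel_measurable N" "h \<in> borel_measurable N" and ae: "AE x in N. f x = g x + h x" for g h
  proof -
    have "wint p b1 N f t \<le> ennreal (2 powr p * 2) * (wint p b1 N g t + wint p b1 N h t)"
      by (rule wint_add_le[OF N f _ _ ae]) (use t in auto)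
    also have "\<dots> \<le> ennreal (2 powr p * 2) * (epowr (?N0 g) p + epowr (?N1 h) p * ennreal (J t))"
    proof (intro mult_left_mono add_mono)
      show "wint p b1 N g t \<le> epowr (?N0 g) p"
        using Lqb_norm_powr[OF N _ p b1_pos, of g] wint_mono[of t 1] t by auto
      show "wint p b1 N h t \<le> epowr (?N1 h) p * ennreal (J t)"
        by (rule wint_le_Lqb_infinity[OF N _ t01]) measurable
    qed auto
    also have "\<dots> \<le> ennreal (2 powr p * 2) * (ennreal ?m * (epowr (?N0 g) p + epowr (?N1 h) p * ennreal (Psi t)))"
    proof (rule mult_left_mono)
      have "1 * epowr (?N0 g) p \<le> ennreal ?m * epowr (?N0 g) p"
        by (intro mult_right_mono) (auto simp: ennreal_1[symmetric] simp del: ennreal_1)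
      moreover have "epowr (?N1 h) p * ennreal (J t) \<le> ennreal ?m * (epowr (?N1 h) p * ennreal (Psi t))"
      proof -
        have "J t = J 1 * Psi t" using J1_pos by (simp add: Psi_def)
        also have "\<dots> \<le> ?m * Psi t" using Pt by (intro mult_right_mono) auto
        finally have "ennreal (J t) \<le> ennreal ?m * ennreal (Psi t)"
          using Pt by (simp add: ennreal_mult[symmetric] ennreal_leI)
        then show ?thesis by (metis mult.left_commute mult_left_mono zero_le)
      qed
      ultimately show "epowr (?N0 g) p + epowr (?N1 h) p * ennreal (J t) \<le>
          ennreal ?m * (epowr (?N0 g) p + epowr (?N1 h) p * ennreal (Psi t))"
        by (simp add: distrib_left add_mono)
    qed auto
    also have "epowr (?N1 h) p * ennreal (Psi t) = epowr (ennreal ?\<tau> * ?N1 h) p"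
      using p Pt by (subst epowr_cmult) (auto simp: powr_powr mult.commute)
    also have "ennreal (2 powr p * 2) * (ennreal ?m * (epowr (?N0 g) p + epowr (ennreal ?\<tau> * ?N1 h) p)) \<le>
        ennreal (2 powr p * 2) * (ennreal ?m * (2 * epowr (?N0 g + ennreal ?\<tau> * ?N1 h) p))"
      by (intro mult_left_mono epowr_add_ge p) auto
    also have "\<dots> = ennreal ?c * epowr (?N0 g + ennreal ?\<tau> * ?N1 h) p"
      by (simp add: ennreal_mult mult_ac max_def)
    finally show ?thesis .
  qed
  \<comment> \<open>The constant and the power are moved to the left, so that what remains is a
    lower bound for the very sums over which the infimum is taken.\<close>
  have "epowr (ennreal (1/?c) * wint p b1 N f t) (1/p) \<le> K_functional N f ?\<tau> ?N0 ?N1"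
    unfolding K_functional_def
  proof (rule Inf_greatest)
    fix x assume "x \<in> {?N0 g + ennreal ?\<tau> * ?N1 h | g h. g \<in> borel_measurable N \<and> h \<in> borel_measurable N \<and>
       (AE x in N. f x = g x + h x) \<and> ?N0 g < \<infinity> \<and> ?N1 h < \<infinity>}"
    then obtain g h where x: "x = ?N0 g + ennreal ?\<tau> * ?N1 h" "g \<in> borel_measurable N" "h \<in> borel_measurable N"
      "AE x in N. f x = g x + h x" by blast
    have "ennreal (1/?c) * wint p b1 N f t \<le> ennreal (1/?c) * (ennreal ?c * epowr x p)"
      unfolding x(1) by (rule mult_left_mono[OF *[OF x(2-4)]]) simp
    also have "\<dots> = epowr x p" using c by (simp add: mult.assoc[symmetric] ennreal_mult[symmetric])
    finally have "epowr (ennreal (1/?c) * wint p b1 N f t) (1/p) \<le> epowr (epowr x p) (1/p)"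
      using p by (intro epowr_mono) auto
    then show "epowr (ennreal (1/?c) * wint p b1 N f t) (1/p) \<le> x" using p by simp
  qed
  then have "epowr (epowr (ennreal (1/?c) * wint p b1 N f t) (1/p)) p \<le> epowr (K_functional N f ?\<tau> ?N0 ?N1) p"
    using p by (rule epowr_mono)
  then have "ennreal ?c * (ennreal (1/?c) * wint p b1 N f t) \<le> ennreal ?c * epowr (K_functional N f ?\<tau> ?N0 ?N1) p"
    using p by (intro mult_left_mono) auto
  moreover have "ennreal ?c * (ennreal (1/?c) * wint p b1 N f t) = wint p b1 N f t"
    using c by (simp add: mult.assoc[symmetric] ennreal_mult[symmetric])
  ultimately show ?thesis by simp
qed

text \<open>\<open>f\<close> is truncated in modulus at its rearranged value \<open>l\<close> at
  \<open>s0\<close>. The excess \<open>g\<close> has a rearrangement vanishing from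
  \<open>s0\<close> on. The bounded part \<open>h\<close> satisfies the weighted bound
  \<open>S\<close> by hypothesis after \<open>s0\<close>, and before it because its rearrangement is
  at most \<open>l\<close> and \<open>b2\<close> is nondecreasing.\<close>

lemma K_functional_le:
  fixes f :: "'a \<Rightarrow> complex"
  assumes N: "prob_space N" and f [measurable]: "f \<in> borel_measurable N" and s0: "s0 \<in> {0<..<1}"
    and fin: "wint p b1 N f s0 < \<infinity>" and \<tau>: "0 \<le> \<tau>"
    and S: "\<And>s. s0 \<le> s \<Longrightarrow> s < 1 \<Longrightarrow> b2 s * rearr N f s \<le> S"
  shows "K_functional N f \<tau> (Lqb_norm (ennreal p) b1 N) (Lqb_norm \<infinity> b2 N) \<le>
     epowr (wint p b1 N f s0) (1/p) + ennreal (\<tau> * S)"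
proof -
  interpret prob_space N by fact
  define l where "l = rearr N f s0"
  have l0: "0 \<le> l" unfolding l_def using s0 rearr_nonneg[OF N f] by auto
  define h where "h x = (if norm (f x) \<le> l then f x else complex_of_real (l / norm (f x)) * f x)" for x
  define g where "g x = f x - h x" for x
  have [measurable]: "h \<in> borel_measurable N" "g \<in> borel_measurable N"
    unfolding g_def h_def by measurable
  have nh: "norm (h x) = min (norm (f x)) l" for x
    using l0 by (auto simp: h_def norm_mult norm_divide)
  have gx: "g x = (if norm (f x) \<le> l then 0 else complex_of_real (1 - l / norm (f x)) * f x)" for x
    by (auto simp: g_def h_def algebra_simps)
  have ng: "norm (g x) = max 0 (norm (f x) - l)" for x
  proof (cases "norm (f x) \<le> l")
    case False
    then have nf: "0 < norm (f x)" using l0 by linarith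
    then have nf: "0 < norm (f x)" "l / norm (f x) \<le> 1" using False by (simp_all add: divide_le_eq_1)
    have "norm (g x) = norm (complex_of_real (1 - l / norm (f x)) * f x)"
      using False by (simp only: gx if_False)
    also have "\<dots> = \<bar>1 - l / norm (f x)\<bar> * norm (f x)" by (simp only: norm_mult norm_of_real)
    also have "\<bar>1 - l / norm (f x)\<bar> = 1 - l / norm (f x)" using nf(2) by (intro abs_of_nonneg) linarith
    also have "(1 - l / norm (f x)) * norm (f x) = norm (f x) - l / norm (f x) * norm (f x)"
      by (simp only: left_diff_distrib mult_1)
    also have "l / norm (f x) * norm (f x) = l" using nf(1) by (intro nonzero_eq_divide_eq[THEN iffD1]) auto
    also have "norm (f x) - l = max 0 (norm (f x) - l)" using False by (intro max_absorb2[symmetric]) linarith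
    finally show ?thesis .
  next
    case True
    then have "norm (g x) = 0" by (simp only: gx if_True norm_zero)
    then show ?thesis using True by (simp only: max_absorb1 diff_le_0_iff_le)
  qed
  have g0: "rearr N g s = 0" if "s0 \<le> s" "s < 1" for s
  proof -
    have "upper_level N g 0 = upper_level N f l" using l0 by (auto simp: ng)
    moreover have "\<not> s0 < prob (upper_level N f l)"
      using less_rearr_iff[OF N f l0, of s0] s0 by (simp add: l_def)
    ultimately have "\<not> 0 < rearr N g s"
      using less_rearr_iff[OF N, of g 0 s] that s0 by auto
    then show ?thesis using rearr_nonneg[OF N, of g s] that s0 by auto
  qed
  have gle: "rearr N g s \<le> rearr N f s" if "0 < s" for s
    by (rule rearr_mono[OF N]) (use that l0 in \<open>auto simp: ng\<close>)
  have hle: "rearr N h s \<le> rearr N f s" if "0 < s" for s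
    by (rule rearr_mono[OF N]) (use that l0 in \<open>auto simp: nh\<close>)
  have hl: "rearr N h s \<le> l" if "0 < s" for s
  proof -
    have "upper_level N h l = {}" by (auto simp: nh)
    then have "prob (upper_level N h l) = 0" by (simp only: measure_empty)
    then have "\<not> s < prob (upper_level N h l)" using that by linarith
    then show ?thesis using less_rearr_iff[OF N, of h l s] l0 that by auto
  qed
  have Ng: "wint p b1 N g 1 \<le> wint p b1 N f s0"
    unfolding wint_def
  proof (rule nn_integral_unit_leb_mono)
    fix s :: real assume s: "s \<in> {0<..<1}"
    show "ennreal ((rearr N g s * b1 s) powr p) * indicator {..<1} s \<le> ennreal ((rearr N f s * b1 s) powr p) * indicator {..<s0} s"
    proof (cases "s < s0")
      case True
      have "(rearr N g s * b1 s) powr p \<le> (rearr N f s * b1 s) powr p"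
        using gle[of s] s b1_pos[OF s] rearr_nonneg[OF N, of g s] p by (intro powr_mono2 mult_right_mono) auto
      then show ?thesis using True s by (simp add: ennreal_leI)
    qed (use g0 s p in auto)
  qed
  have N0: "Lqb_norm (ennreal p) b1 N g \<le> epowr (wint p b1 N f s0) (1/p)"
  proof -
    have "Lqb_norm (ennreal p) b1 N g = epowr (wint p b1 N g 1) (1/p)"
      using Lqb_norm_powr[OF N _ p b1_pos, of g] p epowr_inverse(1)[OF p, of "Lqb_norm (ennreal p) b1 N g"] by simp
    also have "\<dots> \<le> epowr (wint p b1 N f s0) (1/p)" using Ng p by (intro epowr_mono) auto
    finally show ?thesis .
  qed
  have bh: "b2 s * rearr N h s \<le> S" if s: "s \<in> {0<..<1}" for s
  proof (cases "s0 \<le> s")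
    case True
    have "b2 s * rearr N h s \<le> b2 s * rearr N f s" using hle[of s] s b2_pos[OF s] by simp
    also have "\<dots> \<le> S" using S True s by simp
    finally show ?thesis .
  next
    case False
    have "b2 s * rearr N h s \<le> b2 s0 * l"
      using hl[of s] s s0 b2_pos[OF s] b2_pos[OF s0] monotone_onD[OF b2_mono s s0] False rearr_nonneg[OF N, of h s]
      by (intro mult_mono) auto
    also have "\<dots> \<le> S" using S[of s0] s0 by (simp add: l_def)
    finally show ?thesis .
  qed
  have S0: "0 \<le> S"
    using S[of s0] s0 b2_pos[OF s0] l0 by (auto simp: l_def intro: order_trans[rotated])
  have N1: "Lqb_norm \<infinity> b2 N h \<le> ennreal S"
    unfolding Lqb_norm_def Lq_norm_def
  proof (simp only: if_P refl, rule esssup_I)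
    show "(\<lambda>t. ennreal (norm (b2 t * rearr N h t))) \<in> borel_measurable unit_leb"
      by (rule b2_rearr_measurable[OF N]) measurable
    show "AE t in unit_leb. ennreal (norm (b2 t * rearr N h t)) \<le> ennreal S"
    proof (rule AE_unit_leb_I)
      fix t :: real assume t: "t \<in> {0<..<1}"
      have "0 \<le> b2 t * rearr N h t" using b2_pos[OF t] rearr_nonneg[OF N, of h t] t by auto
      then show "ennreal (norm (b2 t * rearr N h t)) \<le> ennreal S" using bh[OF t] by (simp add: ennreal_leI)
    qed
  qed
  have "K_functional N f \<tau> (Lqb_norm (ennreal p) b1 N) (Lqb_norm \<infinity> b2 N) \<le>
      Lqb_norm (ennreal p) b1 N g + ennreal \<tau> * Lqb_norm \<infinity> b2 N h"
    unfolding K_functional_def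
  proof (rule Inf_lower, rule CollectI, intro exI conjI)
    show "Lqb_norm (ennreal p) b1 N g < \<infinity>"
      by (rule le_less_trans[OF N0]) (use fin in simp)
    show "Lqb_norm \<infinity> b2 N h < \<infinity>" by (rule le_less_trans[OF N1]) simp
    show "AE x in N. f x = g x + h x" by (simp add: g_def)
  qed (simp, measurable)
  also have "\<dots> \<le> epowr (wint p b1 N f s0) (1/p) + ennreal \<tau> * ennreal S"
    by (intro add_mono mult_left_mono N0 N1) auto
  also have "ennreal \<tau> * ennreal S = ennreal (\<tau> * S)" using \<tau> S0 by (simp add: ennreal_mult)
  finally show ?thesis .
qed

end

text \<open>The unweighted couple as an instance; there \<open>Psi\<close> is the identity on the
  unit interval.\<close>

lemma gauss_weights_one: "0 < p \<Longrightarrow> gauss_weights p (\<lambda>_. 1) (\<lambda>_. 1) 1"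
  by unfold_locales (auto simp: monotone_on_def intro!: ge_one_powr_ge_zero)

lemma gauss_weights_one_J:
  assumes "0 < p" "0 \<le> t" "t \<le> 1"
  shows "gauss_weights.J p (\<lambda>_. 1) (\<lambda>_. 1) t = t" "gauss_weights.Psi p (\<lambda>_. 1) (\<lambda>_. 1) t = t"
proof -
  interpret u: gauss_weights p "\<lambda>_. 1" "\<lambda>_. 1" 1 by (rule gauss_weights_one[OF assms(1)])
  have J: "u.J t = t" if "0 \<le> t" "t \<le> 1" for t
  proof -
    have "ennreal (u.J t) = (\<integral>\<^sup>+s. indicator {0..<t} s \<partial>unit_leb)"
      unfolding u.nn_integral_q_J[OF that, symmetric]
      by (rule nn_integral_unit_leb_cong) (auto simp: u.q_def u.w_def u.v_def split: split_indicator)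
    also have "\<dots> = ennreal t" using that by (subst emeasure_unit_leb_interval) auto
    finally show ?thesis using that u.J_nonneg by simp
  qed
  show "u.J t = t" "u.Psi t = t" using J assms by (auto simp: u.Psi_def)
qed

context gauss_weights
begin

section \<open>Gaussible means dominated in the K-functional\<close>

lemma wint_Psi:
  assumes M: "prob_space M" and f: "f \<in> borel_measurable M" and t: "t \<in> {0<..<1}"
  shows "(\<integral>\<^sup>+s\<in>{0<..<t}. ennreal ((rearr M f (sigma_inv_pow p b1 b2 s) * b1 s / b2 s) powr p) \<partial>lebesgue) =
    ennreal (J 1) * wint p (\<lambda>_. 1) M f (Psi t)"
proof -
  have anti: "antimono_on {0<..<1} (\<lambda>u. rearr M f u powr p * indicator {..<Psi t} u)"
  proof (rule monotone_onI)
    fix r s :: real assume rs: "r \<in> {0<..<1}" "s \<in> {0<..<1}" "r \<le> s"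
    have "rearr M f s powr p \<le> rearr M f r powr p"
      using monotone_onD[OF rearr_antimono_unit[OF M f] rs] rearr_nonneg[OF M f, of s] rs p by (intro powr_mono2) auto
    then show "rearr M f s powr p * indicator {..<Psi t} s \<le> rearr M f r powr p * indicator {..<Psi t} r"
      using rs by (auto split: split_indicator)
  qed
  have "(\<integral>\<^sup>+s\<in>{0<..<t}. ennreal ((rearr M f (sigma_inv_pow p b1 b2 s) * b1 s / b2 s) powr p) \<partial>lebesgue) =
      (\<integral>\<^sup>+s. ennreal ((rearr M f (sigma_inv_pow p b1 b2 s) * b1 s / b2 s) powr p) * indicator {..<t} s \<partial>unit_leb)"
    using t by (intro nn_integral_set_unit_leb) auto
  also have "\<dots> = (\<integral>\<^sup>+s. ennreal (rearr M f (Psi s) powr p * indicator {..<Psi t} (Psi s)) * ennreal (q s) \<partial>unit_leb)"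
  proof (rule nn_integral_unit_leb_cong)
    fix s :: real assume s: "s \<in> {0<..<1}"
    have nn: "0 \<le> rearr M f (Psi s)" using Psi_open[OF s] rearr_nonneg[OF M f] by auto
    have "(rearr M f (Psi s) * b1 s / b2 s) powr p = rearr M f (Psi s) powr p * q s"
      using nn b1_pos[OF s] b2_pos[OF s] by (simp add: powr_mult powr_divide q_def w_def v_def)
    moreover have "Psi s < Psi t \<longleftrightarrow> s < t" using s t by (simp add: Psi_less_iff)
    ultimately show "ennreal ((rearr M f (sigma_inv_pow p b1 b2 s) * b1 s / b2 s) powr p) * indicator {..<t} s =
        ennreal (rearr M f (Psi s) powr p * indicator {..<Psi t} (Psi s)) * ennreal (q s)"
      using s q_pos[OF s] by (auto simp: sigma_inv_pow_eq ennreal_mult split: split_indicator)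
  qed
  also have "\<dots> = ennreal (J 1) * (\<integral>\<^sup>+u. ennreal (rearr M f u powr p * indicator {..<Psi t} u) \<partial>unit_leb)"
    by (rule nn_integral_substitution_Psi[OF antimono_on_borel[OF anti]])
  also have "(\<integral>\<^sup>+u. ennreal (rearr M f u powr p * indicator {..<Psi t} u) \<partial>unit_leb) = wint p (\<lambda>_. 1) M f (Psi t)"
    unfolding wint_def by (rule nn_integral_unit_leb_cong) (auto split: split_indicator)
  finally show ?thesis .
qed

lemma gaussible_iff_wint:
  assumes M: "prob_space M"
  shows "gaussible p b1 b2 M N T \<longleftrightarrow> operator_on_Lp p M N T \<and>
    (\<exists>c>0. \<forall>f\<in>Lp_space p M. \<forall>t\<in>{0<..<1}. wint p b1 N (T f) t \<le> ennreal c * wint p (\<lambda>_. 1) M f (Psi t))"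
    (is "?L \<longleftrightarrow> ?O \<and> ?R")
proof -
  have *: "((\<integral>\<^sup>+s\<in>{0<..<t}. ennreal ((rearr N (T f) s * b1 s) powr p) \<partial>lebesgue)
        \<le> ennreal c * (\<integral>\<^sup>+s\<in>{0<..<t}.
             ennreal ((rearr M f (sigma_inv_pow p b1 b2 s) * b1 s / b2 s) powr p) \<partial>lebesgue)) \<longleftrightarrow>
      wint p b1 N (T f) t \<le> ennreal (c * J 1) * wint p (\<lambda>_. 1) M f (Psi t)"
    if "f \<in> Lp_space p M" "t \<in> {0<..<1}" "0 < c" for f t c
  proof -
    have f: "f \<in> borel_measurable M" using that by (simp add: Lp_space_def)
    have "(\<integral>\<^sup>+s\<in>{0<..<t}. ennreal ((rearr N (T f) s * b1 s) powr p) \<partial>lebesgue) = wint p b1 N (T f) t"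
      unfolding wint_def using that by (intro nn_integral_set_unit_leb) auto
    then show ?thesis using that J1_pos by (simp add: wint_Psi[OF M f] ennreal_mult mult.assoc)
  qed
  have "?L \<longleftrightarrow> ?O \<and> (\<exists>c>0. \<forall>f\<in>Lp_space p M. \<forall>t\<in>{0<..<1}.
      wint p b1 N (T f) t \<le> ennreal (c * J 1) * wint p (\<lambda>_. 1) M f (Psi t))"
    unfolding gaussible_def using * by auto
  also have "\<dots> \<longleftrightarrow> ?O \<and> ?R"
  proof (intro conj_cong refl iffI)
    assume "\<exists>c>0. \<forall>f\<in>Lp_space p M. \<forall>t\<in>{0<..<1}. wint p b1 N (T f) t \<le> ennreal (c * J 1) * wint p (\<lambda>_. 1) M f (Psi t)"
    then show ?R using J1_pos by (metis mult_pos_pos)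
  next
    assume ?R
    then obtain c where c: "0 < c" "\<forall>f\<in>Lp_space p M. \<forall>t\<in>{0<..<1}. wint p b1 N (T f) t \<le> ennreal c * wint p (\<lambda>_. 1) M f (Psi t)"
      by blast
    then show "\<exists>c>0. \<forall>f\<in>Lp_space p M. \<forall>t\<in>{0<..<1}. wint p b1 N (T f) t \<le> ennreal (c * J 1) * wint p (\<lambda>_. 1) M f (Psi t)"
      using J1_pos by (intro exI[of _ "c / J 1"]) auto
  qed
  finally show ?thesis .
qed

lemma wint_point_le:
  assumes N: "prob_space N" and g: "g \<in> borel_measurable N" and s: "s \<in> {0<..<1}"
  shows "ennreal (s * (rearr N g s powr p * w s)) \<le> wint p b1 N g s"
proof -
  have nn: "0 \<le> rearr N g s" using s rearr_nonneg[OF N g] by auto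
  have "ennreal (s * (rearr N g s powr p * w s)) = ennreal ((rearr N g s * b1 s) powr p) * (\<integral>\<^sup>+r. indicator {0..<s} r \<partial>unit_leb)"
    using s w_pos[OF s] unfolding weighted_powr(1)[OF nn s]
    by (subst emeasure_unit_leb_interval) (auto simp: ennreal_mult mult.commute)
  also have "\<dots> = (\<integral>\<^sup>+r. ennreal ((rearr N g s * b1 s) powr p) * indicator {0..<s} r \<partial>unit_leb)"
    by (rule nn_integral_cmult[symmetric]) measurable
  also have "\<dots> \<le> wint p b1 N g s"
    unfolding wint_def
    by (rule nn_integral_unit_leb_mono)
       (use s monotone_onD[OF rearr_b1_antimono[OF N g]] in \<open>auto split: split_indicator intro!: ennreal_leI\<close>)
  finally show ?thesis .
qed

text \<open>Averages of a nonincreasing function decrease. The inequality is cross-multiplied to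
  stay free of division in \<open>ennreal\<close>.\<close>

lemma wint_average_antimono:
  assumes M: "prob_space M" and f: "f \<in> borel_measurable M" and tu: "0 < t" "t \<le> u" "u < 1"
  shows "ennreal t * wint p (\<lambda>_. 1) M f u \<le> ennreal u * wint p (\<lambda>_. 1) M f t"
proof -
  interpret u: gauss_weights p "\<lambda>_. 1" "\<lambda>_. 1" 1 by (rule gauss_weights_one[OF p])
  let ?F = "\<lambda>s. (rearr M f s * 1) powr p"
  have anti: "antimono_on {0<..<1} ?F" by (rule u.rearr_b1_antimono[OF M f])
  have [measurable]: "?F \<in> borel_measurable unit_leb" by (rule antimono_on_unit_leb[OF anti])
  have t01: "t \<in> {0<..<1}" using tu by auto
  have split: "wint p (\<lambda>_. 1) M f u = wint p (\<lambda>_. 1) M f t + (\<integral>\<^sup>+s. ennreal (?F s) * indicator {t..<u} s \<partial>unit_leb)"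
  proof -
    have "wint p (\<lambda>_. 1) M f u = (\<integral>\<^sup>+s. ennreal (?F s) * indicator {..<t} s + ennreal (?F s) * indicator {t..<u} s \<partial>unit_leb)"
      unfolding wint_def by (rule nn_integral_unit_leb_cong) (use tu in \<open>auto split: split_indicator\<close>)
    also have "\<dots> = wint p (\<lambda>_. 1) M f t + (\<integral>\<^sup>+s. ennreal (?F s) * indicator {t..<u} s \<partial>unit_leb)"
      unfolding wint_def by (rule nn_integral_add) measurable
    finally show ?thesis .
  qed
  have tail: "(\<integral>\<^sup>+s. ennreal (?F s) * indicator {t..<u} s \<partial>unit_leb) \<le> ennreal ((u - t) * ?F t)"
  proof -
    have "(\<integral>\<^sup>+s. ennreal (?F s) * indicator {t..<u} s \<partial>unit_leb) \<le> (\<integral>\<^sup>+s. ennreal (?F t) * indicator {t..<u} s \<partial>unit_leb)"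
      by (rule nn_integral_unit_leb_mono)
         (use tu monotone_onD[OF anti] in \<open>auto split: split_indicator intro!: ennreal_leI\<close>)
    also have "\<dots> = ennreal (?F t) * (\<integral>\<^sup>+s. indicator {t..<u} s \<partial>unit_leb)" by (rule nn_integral_cmult) measurable
    also have "\<dots> = ennreal ((u - t) * ?F t)"
      using tu by (subst emeasure_unit_leb_interval) (auto simp: ennreal_mult[symmetric] mult.commute)
    finally show ?thesis .
  qed
  have pt: "ennreal (t * ?F t) \<le> wint p (\<lambda>_. 1) M f t"
    using u.wint_point_le[OF M f t01] by (simp add: u.w_def)
  have "ennreal t * wint p (\<lambda>_. 1) M f u \<le> ennreal t * wint p (\<lambda>_. 1) M f t + ennreal t * ennreal ((u - t) * ?F t)"
    unfolding split distrib_left by (intro add_mono mult_left_mono tail) auto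
  also have "ennreal t * ennreal ((u - t) * ?F t) = ennreal (u - t) * ennreal (t * ?F t)"
    using tu by (simp add: ennreal_mult[symmetric] mult_ac)
  also have "\<dots> \<le> ennreal (u - t) * wint p (\<lambda>_. 1) M f t" by (intro mult_left_mono pt) auto
  also have "ennreal t * wint p (\<lambda>_. 1) M f t + ennreal (u - t) * wint p (\<lambda>_. 1) M f t = ennreal u * wint p (\<lambda>_. 1) M f t"
    using tu by (simp add: distrib_right[symmetric] ennreal_plus[symmetric] del: ennreal_plus)
  finally show ?thesis by (simp add: add_left_mono)
qed

lemma Lp_space_wint:
  assumes M: "prob_space M" and f: "f \<in> borel_measurable M"
  shows "f \<in> Lp_space p M \<longleftrightarrow> wint p (\<lambda>_. 1) M f 1 < \<infinity>"
  unfolding Lp_space_def Lq_norm_def using f p nn_integral_norm_powr_rearr[OF M f p] by simp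

text \<open>The lower estimate of the K-functional holds for every function. The upper one for
  \<open>T f\<close> also needs a bound for the weighted rearrangement beyond \<open>s0\<close>,
  which the integral up to \<open>s0\<close> does not give; it follows from the gaussible inequality
  at all later points.\<close>

lemma gaussible_iff_K_dominated:
  assumes M: "prob_space M" and N: "prob_space N"
  shows "gaussible p b1 b2 M N T \<longleftrightarrow> operator_on_Lp p M N T \<and> K_dominated p b1 b2 M N T"
proof -
  interpret u: gauss_weights p "\<lambda>_. 1" "\<lambda>_. 1" 1 by (rule gauss_weights_one[OF p])
  let ?KN = "\<lambda>g t. K_functional N g t (Lqb_norm (ennreal p) b1 N) (Lqb_norm \<infinity> b2 N)"
  let ?KM = "\<lambda>f t. K_functional M f t (Lqb_norm (ennreal p) (\<lambda>_. 1) M) (Lqb_norm \<infinity> (\<lambda>_. 1) M)"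
  let ?A1 = "wint p (\<lambda>_. 1) M"
  have KM: "K_functional M f t (Lq_norm (ennreal p) M) (Lq_norm \<infinity> M) = ?KM f t" for f t
    by (rule K_functional_cong) (simp_all only: Lq_norm_eq[OF M _ p] Lq_norm_infinity_eq[OF M])
  have fin: "?A1 f t < \<infinity>" if "f \<in> Lp_space p M" "t \<le> 1" for f t
    using wint_mono[OF that(2), of "\<lambda>_. 1" M f] that Lp_space_wint[OF M, of f] by (auto simp: Lp_space_def intro: le_less_trans)
  define cL where "cL = 2 powr p * 2 * max 1 (J 1) * 2"
  define cM where "cM = 2 powr p * 2 * max 1 (u.J 1) * 2"
  have cpos: "0 < cL" "0 < cM" by (auto simp: cL_def cM_def max_def)
  have lowN: "wint p b1 N g t \<le> ennreal cL * epowr (?KN g (Psi t powr (1/p))) p" if "g \<in> borel_measurable N" "t \<in> {0<..<1}" for g t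
    unfolding cL_def by (rule wint_le_K_functional[OF N that])
  have lowM: "?A1 f t \<le> ennreal cM * epowr (?KM f (t powr (1/p))) p" if "f \<in> borel_measurable M" "t \<in> {0<..<1}" for f t
    using u.wint_le_K_functional[OF M that] gauss_weights_one_J(2)[OF p, of t] that by (simp add: cM_def)
  have "(\<exists>c>0. \<forall>f\<in>Lp_space p M. \<forall>t\<in>{0<..<1}. wint p b1 N (T f) t \<le> ennreal c * ?A1 f (Psi t)) \<longleftrightarrow>
      K_dominated p b1 b2 M N T" (is "?G \<longleftrightarrow> ?K") if T: "operator_on_Lp p M N T"
  proof
    assume ?G
    then obtain c where c: "0 < c" and G: "\<And>f t. f \<in> Lp_space p M \<Longrightarrow> t \<in> {0<..<1} \<Longrightarrow>
        wint p b1 N (T f) t \<le> ennreal c * ?A1 f (Psi t)" by blast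
    \<comment> \<open>One summand for each part of the decomposition of \<open>T f\<close>;
      \<open>cM\<close> returns from the integral of \<open>f\<close> to its K-functional.\<close>
    define d where "d = (c powr (1/p) + (c * K / J 1) powr (1/p)) * cM powr (1/p)"
    have d: "0 < d" unfolding d_def using c cpos by (intro mult_pos_pos add_pos_nonneg) auto
    show ?K
      unfolding K_dominated_def
    proof (intro exI[of _ d] conjI d ballI)
      fix f and \<tau> :: real assume f: "f \<in> Lp_space p M" and \<tau>: "\<tau> \<in> {0<..<1}"
      have fm: "f \<in> borel_measurable M" using f by (simp add: Lp_space_def)
      have Tm: "T f \<in> borel_measurable N" using f T by (simp add: operator_on_Lp_def)
      define t0 where "t0 = \<tau> powr p"
      have t0: "t0 \<in> {0<..<1}" using \<tau> p powr_less_mono2[of p \<tau> 1] by (auto simp: t0_def)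
      have \<tau>t: "\<tau> = t0 powr (1/p)" using \<tau> p by (simp add: t0_def powr_powr)
      define s0 where "s0 = Phi t0"
      have s0: "s0 \<in> {0<..<1}" "Psi s0 = t0" using Phi_open[OF t0] Psi_Phi[of t0] t0 by (auto simp: s0_def)
      obtain a where a: "0 \<le> a" "?A1 f t0 = ennreal a"
        using fin[OF f, of t0] t0 by (cases "?A1 f t0") auto
      \<comment> \<open>Up to constants the p-th root of the average of the p-th power of the
        rearranged \<open>f\<close> over an interval of length \<open>t0\<close>. The factor \<tau>
        in front cancels the division by \<open>t0\<close>.\<close>
      define S where "S = (c * K / J 1 * a / t0) powr (1/p)"
      have wle: "wint p b1 N (T f) s0 \<le> ennreal (c * a)"
        using G[OF f s0(1)] a c s0(2) by (simp add: ennreal_mult)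
      have S: "b2 s * rearr N (T f) s \<le> S" if s: "s0 \<le> s" "s < 1" for s
      proof -
        have s01: "s \<in> {0<..<1}" using s s0 by auto
        let ?G = "rearr N (T f) s powr p"
        have nn: "0 \<le> rearr N (T f) s" using rearr_nonneg[OF N Tm] s01 by auto
        have Ps: "t0 \<le> Psi s" "Psi s < 1" "0 < Psi s"
          using Psi_le_iff[of s0 s] s s0 Psi_open[OF s01] by auto
        \<comment> \<open>Gaussibility at \<open>s\<close>, and then the average of \<open>f\<close>
          at \<open>Psi s\<close> is replaced by the larger one at \<open>t0\<close>. Finally
          \<open>Psi s\<close> is at most a multiple of \<open>s * q s\<close>, in which
          \<open>w\<close> cancels and leaves \<open>1 / v s\<close>.\<close>
        have "ennreal t0 * ennreal (s * (?G * w s)) \<le> ennreal t0 * (ennreal c * ?A1 f (Psi s))"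
          by (intro mult_left_mono order_trans[OF wint_point_le[OF N Tm s01] G[OF f s01]]) auto
        also have "\<dots> = ennreal c * (ennreal t0 * ?A1 f (Psi s))" by (simp add: mult_ac)
        also have "\<dots> \<le> ennreal c * (ennreal (Psi s) * ennreal a)"
          unfolding a(2)[symmetric] using t0 Ps by (intro mult_left_mono wint_average_antimono[OF M fm]) auto
        also have "\<dots> = ennreal (c * (Psi s * a))" using c Ps a by (simp add: ennreal_mult)
        also have "ennreal t0 * ennreal (s * (?G * w s)) = ennreal (t0 * (s * (?G * w s)))"
          using t0 s01 w_pos[OF s01] by (intro ennreal_mult[symmetric] mult_nonneg_nonneg) auto
        finally have "t0 * (s * (?G * w s)) \<le> c * (Psi s * a)"
          using c Ps a by (subst (asm) ennreal_le_iff) auto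
        also have "\<dots> \<le> c * (K * s * q s / J 1 * a)"
          using Psi_upper[OF s01] J1_pos c a
          by (intro mult_left_mono mult_right_mono) (auto simp: le_divide_eq mult.commute)
        also have "\<dots> = (s * w s) * (c * K / J 1 * a / v s)"
          by (simp only: q_def times_divide_eq_left times_divide_eq_right divide_divide_eq_left mult_ac)
        finally have "(s * w s) * (t0 * ?G) \<le> (s * w s) * (c * K / J 1 * a / v s)" by (simp add: mult_ac)
        then have "t0 * ?G \<le> c * K / J 1 * a / v s"
        proof (rule mult_left_le_imp_le)
          show "0 < s * w s" using s01 w_pos[OF s01] by (intro mult_pos_pos) auto
        qed
        then have "t0 * ?G * v s \<le> c * K / J 1 * a"
          using pos_le_divide_eq[OF v_pos[OF s01]] by blast
        then have "v s * ?G * t0 \<le> c * K / J 1 * a" by (simp only: mult_ac)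
        then have "v s * ?G \<le> c * K / J 1 * a / t0"
          using pos_le_divide_eq[of t0] t0 by (meson greaterThanLessThan_iff)
        then have "((b2 s * rearr N (T f) s) powr p) powr (1/p) \<le> S"
          unfolding S_def weighted_powr(2)[OF nn s01] using v_pos[OF s01] p by (intro powr_mono2) auto
        then show ?thesis using p nn b2_pos[OF s01] by (simp add: powr_powr)
      qed
      have "?KN (T f) \<tau> \<le> epowr (wint p b1 N (T f) s0) (1/p) + ennreal (\<tau> * S)"
        by (rule K_functional_le[OF N Tm s0(1) _ _ S])
           (use wle \<tau> in \<open>auto intro: le_less_trans\<close>)
      also have "\<dots> \<le> epowr (ennreal (c * a)) (1/p) + ennreal (\<tau> * S)"
        using wle p by (intro add_right_mono epowr_mono) auto
      also have "epowr (ennreal (c * a)) (1/p) = ennreal (c powr (1/p) * a powr (1/p))"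
        using c a by (simp add: epowr_ennreal powr_mult)
      also have "\<tau> * S = (c * K / J 1) powr (1/p) * a powr (1/p)"
      proof -
        have "\<tau> * S = (t0 * (c * K / J 1 * a / t0)) powr (1/p)"
          unfolding S_def \<tau>t using t0 c a K_pos J1_pos by (intro powr_mult[symmetric])
        also have "t0 * (c * K / J 1 * a / t0) = (c * K / J 1) * a" using t0 by simp
        also have "\<dots> powr (1/p) = (c * K / J 1) powr (1/p) * a powr (1/p)"
          using c a K_pos J1_pos by (intro powr_mult)
        finally show ?thesis .
      qed
      also have "ennreal (c powr (1/p) * a powr (1/p)) + ennreal ((c * K / J 1) powr (1/p) * a powr (1/p)) =
          ennreal (c powr (1/p) + (c * K / J 1) powr (1/p)) * ennreal (a powr (1/p))"
        by (simp add: ennreal_plus[symmetric] ennreal_mult[symmetric] distrib_right del: ennreal_plus)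
      also have "ennreal (a powr (1/p)) \<le> ennreal (cM powr (1/p)) * ?KM f \<tau>"
      proof -
        have "ennreal (a powr (1/p)) = epowr (?A1 f t0) (1/p)" using a by (simp add: epowr_ennreal)
        also have "\<dots> \<le> epowr (ennreal cM * epowr (?KM f \<tau>) p) (1/p)"
          unfolding \<tau>t using p by (intro epowr_mono lowM[OF fm t0]) auto
        also have "\<dots> = ennreal (cM powr (1/p)) * ?KM f \<tau>"
          using p cpos by (simp add: epowr_cmult)
        finally show ?thesis .
      qed
      finally show "?KN (T f) \<tau> \<le> ennreal d * K_functional M f \<tau> (Lq_norm (ennreal p) M) (Lq_norm \<infinity> M)"
        unfolding KM d_def by (simp add: mult_left_mono ennreal_mult mult.assoc)
    qed
  next
    assume ?K
    then obtain c where c: "0 < c" and G: "\<And>f \<tau>. f \<in> Lp_space p M \<Longrightarrow> \<tau> \<in> {0<..<1} \<Longrightarrow>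
        ?KN (T f) \<tau> \<le> ennreal c * ?KM f \<tau>" unfolding K_dominated_def KM by blast
    \<comment> \<open>The 2 stems from the truncation of \<open>f\<close>, whose two parts are both
      bounded by the same root of the integral.\<close>
    define d where "d = cL * (c * 2) powr p"
    have d: "0 < d" unfolding d_def using c cpos by simp
    show ?G
    proof (intro exI[of _ d] conjI d ballI)
      fix f and t :: real assume f: "f \<in> Lp_space p M" and t: "t \<in> {0<..<1}"
      have fm: "f \<in> borel_measurable M" using f by (simp add: Lp_space_def)
      have Tm: "T f \<in> borel_measurable N" using f T by (simp add: operator_on_Lp_def)
      let ?u = "Psi t" let ?\<tau> = "?u powr (1/p)"
      have u: "?u \<in> {0<..<1}" by (rule Psi_open[OF t])
      have \<tau>: "?\<tau> \<in> {0<..<1}" using u p powr_less_mono2[of "1/p" ?u 1] by auto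
      have nn: "0 \<le> rearr M f ?u" using u rearr_nonneg[OF M fm] by auto
      have "?KM f ?\<tau> \<le> epowr (?A1 f ?u) (1/p) + ennreal (?\<tau> * rearr M f ?u)"
      proof (rule u.K_functional_le[OF M fm u])
        show "?A1 f ?u < \<infinity>" using fin[OF f, of ?u] u by simp
        show "1 * rearr M f s \<le> rearr M f ?u" if "?u \<le> s" "s < 1" for s
          using monotone_onD[OF rearr_antimono_unit[OF M fm], of ?u s] that u by auto
      qed (use \<tau> in auto)
      also have "ennreal (?\<tau> * rearr M f ?u) \<le> epowr (?A1 f ?u) (1/p)"
      proof -
        have "ennreal (?\<tau> * rearr M f ?u) = epowr (ennreal (?u * rearr M f ?u powr p)) (1/p)"
          using u nn p by (simp add: epowr_ennreal powr_mult powr_powr)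
        also have "\<dots> \<le> epowr (?A1 f ?u) (1/p)"
          using u.wint_point_le[OF M fm u] p by (intro epowr_mono) (auto simp: u.w_def)
        finally show ?thesis .
      qed
      finally have KMle: "?KM f ?\<tau> \<le> 2 * epowr (?A1 f ?u) (1/p)" by (simp add: mult_2 add_left_mono)
      have "wint p b1 N (T f) t \<le> ennreal cL * epowr (?KN (T f) ?\<tau>) p" by (rule lowN[OF Tm t])
      also have "\<dots> \<le> ennreal cL * epowr (ennreal c * (2 * epowr (?A1 f ?u) (1/p))) p"
        using p by (intro mult_left_mono epowr_mono order_trans[OF G[OF f \<tau>]] KMle) auto
      also have "ennreal c * (2 * epowr (?A1 f ?u) (1/p)) = ennreal (c * 2) * epowr (?A1 f ?u) (1/p)"
        using c by (simp add: ennreal_mult mult.assoc)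
      also have "epowr \<dots> p = ennreal ((c * 2) powr p) * ?A1 f ?u" using c p by (subst epowr_cmult) auto
      also have "ennreal cL * \<dots> = ennreal d * ?A1 f ?u"
        unfolding d_def using c cpos by (simp add: ennreal_mult mult.assoc)
      finally show "wint p b1 N (T f) t \<le> ennreal d * ?A1 f ?u" .
    qed
  qed
  then show ?thesis unfolding gaussible_iff_wint[OF M] by blast
qed

end

section \<open>The dual estimate\<close>

lemma ri_axioms_cong_AE:
  assumes X: "ri_axioms X" and "f \<in> Mplus" "g \<in> Mplus" "AE t in unit_leb. f t = g t"
  shows "X f = X g"
proof -
  have le: "f \<in> Mplus \<Longrightarrow> g \<in> Mplus \<Longrightarrow> AE t in unit_leb. f t \<le> g t \<Longrightarrow> X f \<le> X g" for f g
    using X unfolding ri_axioms_def by blast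
  show ?thesis using assms by (intro antisym le) (auto elim: eventually_mono)
qed

lemma Mplus_powr: "f \<in> Mplus \<Longrightarrow> (\<lambda>t. f t powr a) \<in> Mplus"
proof (rule MplusI)
  assume "f \<in> Mplus"
  then have [measurable]: "f \<in> borel_measurable unit_leb" by auto
  show "(\<lambda>t. f t powr a) \<in> borel_measurable unit_leb" by measurable
qed simp

lemma root_space_powr:
  assumes X: "ri_axioms X" and p: "0 < p" and f: "f \<in> Mplus"
  shows "root_space p X (\<lambda>t. f t powr p) = epowr (X f) p"
proof -
  have "X (\<lambda>t. (f t powr p) powr (1/p)) = X f"
  proof (rule ri_axioms_cong_AE[OF X _ f])
    show "(\<lambda>t. (f t powr p) powr (1/p)) \<in> Mplus" by (intro Mplus_powr f)
    show "AE t in unit_leb. (f t powr p) powr (1/p) = f t"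
      by (rule AE_unit_leb_I) (use p Mplus_nonneg[OF f] in \<open>simp add: powr_powr\<close>)
  qed
  then show ?thesis by (simp add: root_space_def)
qed

lemma antimono_powr:
  fixes F :: "real \<Rightarrow> real"
  assumes "antimono_on {0<..<1} F" "\<And>t. t \<in> {0<..<1} \<Longrightarrow> 0 \<le> F t" "0 < a"
  shows "antimono_on {0<..<1} (\<lambda>t. F t powr a)"
proof (rule monotone_onI)
  fix s t :: real assume "s \<in> {0<..<1}" "t \<in> {0<..<1}" "s \<le> t"
  then show "F t powr a \<le> F s powr a"
    using assms monotone_onD[OF assms(1)] by (intro powr_mono2) auto
qed

lemma nn_integral_nat_partition:
  fixes N :: "'a \<Rightarrow> nat"
  assumes [measurable]: "f \<in> borel_measurable M" "N \<in> measurable M (count_space UNIV)"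
  shows "(\<integral>\<^sup>+x. f x \<partial>M) = (\<Sum>k. \<integral>\<^sup>+x. f x * indicator {x. N x = k} x \<partial>M)"
proof -
  have "(\<integral>\<^sup>+x. f x \<partial>M) = (\<integral>\<^sup>+x. (\<Sum>k. f x * indicator {x. N x = k} x) \<partial>M)"
  proof (rule nn_integral_cong)
    fix x
    have "(\<lambda>k. f x * indicator {x. N x = k} x) = (\<lambda>k. if k = N x then f x else 0)"
      by (auto simp: fun_eq_iff)
    then show "f x = (\<Sum>k. f x * indicator {x. N x = k} x)"
      using sums_single[of "N x" "\<lambda>_. f x"] by (simp add: sums_unique[symmetric])
  qed
  also have "\<dots> = (\<Sum>k. \<integral>\<^sup>+x. f x * indicator {x. N x = k} x \<partial>M)"
    by (rule nn_integral_suminf) measurable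
  finally show ?thesis .
qed

locale two_spaces = gauss_weights +
  fixes X Y :: functional
  assumes X: "ri_axioms X" and Y: "ri_axioms Y"
    and Zx: "ri_banach_norm (root_space p X)" and Zy: "ri_banach_norm (root_space p Y)"
begin

abbreviation "ZX \<equiv> root_space p X"
abbreviation "ZY \<equiv> root_space p Y"

sublocale zx: ri_banach ZX by unfold_locales (rule Zx)
sublocale zy: ri_banach ZY by unfold_locales (rule Zy)

definition kap :: "(real \<Rightarrow> real) \<Rightarrow> real \<Rightarrow> real" where
  "kap h u = h (Phi u) / w (Phi u)"
text \<open>The real-valued form of \<open>T_op\<close> on nonincreasing functions; by
  \<open>kap_bound\<close> the supremum is over a bounded set. On the unit interval it is the least
  nonincreasing majorant of \<open>kap h\<close>.\<close>

definition HP :: "(real \<Rightarrow> real) \<Rightarrow> real \<Rightarrow> real" where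
  "HP h u = (SUP s\<in>{u..<1}. kap h s)"

definition decreasing :: "(real \<Rightarrow> real) \<Rightarrow> bool" where
  "decreasing h \<longleftrightarrow> antimono_on {0<..<1} h \<and> (\<forall>t\<in>{0<..<1}. 0 \<le> h t)"

lemma decreasing_nonneg: "decreasing h \<Longrightarrow> t \<in> {0<..<1} \<Longrightarrow> 0 \<le> h t"
  by (simp add: decreasing_def)

lemma decreasing_D: "decreasing h \<Longrightarrow> s \<in> {0<..<1} \<Longrightarrow> t \<in> {0<..<1} \<Longrightarrow> s \<le> t \<Longrightarrow> h t \<le> h s"
  by (auto simp: decreasing_def monotone_on_def)

lemma decreasing_Mplus: "decreasing h \<Longrightarrow> h \<in> Mplus"
  by (auto simp: decreasing_def intro!: MplusI antimono_on_unit_leb)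

lemma decreasing_measurable: "decreasing h \<Longrightarrow> h \<in> borel_measurable unit_leb"
  by (rule Mplus_measurable) (rule decreasing_Mplus)

lemma decreasing_rearr: "prob_space M \<Longrightarrow> f \<in> borel_measurable M \<Longrightarrow> decreasing (rearr M f)"
  unfolding decreasing_def using rearr_antimono_unit rearr_nonneg by auto

lemma decreasing_powr: "decreasing h \<Longrightarrow> 0 < a \<Longrightarrow> decreasing (\<lambda>t. h t powr a)"
  unfolding decreasing_def using antimono_powr[of h a] by auto

lemma decreasing_rearr_AE: "decreasing h \<Longrightarrow> AE t in unit_leb. rearr unit_leb h t = h t"
  by (rule rearr_antimono_on_AE) (auto simp: decreasing_def)

lemma kap_nonneg: "decreasing h \<Longrightarrow> u \<in> {0<..<1} \<Longrightarrow> 0 \<le> kap h u"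
  unfolding kap_def using Phi_open[of u] w_pos[of "Phi u"] decreasing_nonneg[of h "Phi u"] by simp

text \<open>\<open>w\<close> may become small towards 1, but slow variation keeps it above a
  multiple of \<open>Phi u * w (Phi u)\<close> to the right of \<open>Phi u\<close>.\<close>

lemma kap_bound:
  assumes h: "decreasing h" and u: "u \<in> {0<..<1}" "u \<le> s" "s < 1"
  shows "kap h s \<le> h (Phi u) * C / (Phi u * w (Phi u))"
proof -
  have s: "s \<in> {0<..<1}" using u by auto
  note P = Phi_open[OF u(1)] Phi_open[OF s]
  have le: "Phi u \<le> Phi s" using u s by (simp add: Phi_le_iff)
  have lb: "Phi u * w (Phi u) / C \<le> w (Phi s)" using w_lower_bound[of "Phi u" "Phi s"] P le by simp
  have pos: "0 < Phi u * w (Phi u) / C" using P w_pos[OF P(1)] C by simp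
  have "kap h s \<le> h (Phi u) / (Phi u * w (Phi u) / C)"
    unfolding kap_def using decreasing_D[OF h P le] decreasing_nonneg[OF h P(1)] lb pos by (intro frac_le) auto
  then show ?thesis by simp
qed

lemma kap_bdd: "decreasing h \<Longrightarrow> u \<in> {0<..<1} \<Longrightarrow> bdd_above (kap h ` {u..<1})"
  using kap_bound[of h u] by (intro bdd_aboveI2) auto

lemma kap_le_HP: "decreasing h \<Longrightarrow> u \<in> {0<..<1} \<Longrightarrow> u \<le> s \<Longrightarrow> s < 1 \<Longrightarrow> kap h s \<le> HP h u"
  unfolding HP_def by (intro cSUP_upper kap_bdd) auto

lemma decreasing_HP: "decreasing h \<Longrightarrow> decreasing (HP h)"
  unfolding decreasing_def[of "HP h"]
proof (intro conjI monotone_onI ballI)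
  assume h: "decreasing h"
  fix s t :: real assume st: "s \<in> {0<..<1}" "t \<in> {0<..<1}" "s \<le> t"
  show "HP h t \<le> HP h s"
    unfolding HP_def using st by (intro cSUP_subset_mono kap_bdd h) auto
next
  assume h: "decreasing h"
  fix t :: real assume t: "t \<in> {0<..<1}"
  have "0 \<le> kap h t" by (rule kap_nonneg[OF h t])
  also have "\<dots> \<le> HP h t" using kap_le_HP[OF h t] t by auto
  finally show "0 \<le> HP h t" .
qed

lemma T_op_eq:
  assumes f: "f \<in> borel_measurable unit_leb" and t: "t \<in> {0<..<1}"
  shows "T_op p b1 b2 f t = ennreal (HP (rearr unit_leb f) t)"
proof -
  let ?h = "rearr unit_leb f"
  have h: "decreasing ?h" by (rule decreasing_rearr[OF prob_space_unit_leb f])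
  have "T_op p b1 b2 f t = (SUP s\<in>{t..<1}. ennreal (kap ?h s))"
    unfolding T_op_def kap_def w_def using t by (intro SUP_cong refl) (auto simp: sigma_pow_eq)
  also have "\<dots> = ennreal (HP ?h t)"
    unfolding HP_def
  proof (rule ennreal_SUP[symmetric])
    have "(SUP s\<in>{t..<1}. ennreal (kap ?h s)) \<le> ennreal (?h (Phi t) * C / (Phi t * w (Phi t)))"
      using kap_bound[OF h t] by (intro SUP_least ennreal_leI) auto
    from le_less_trans[OF this ennreal_less_top]
    show "(SUP s\<in>{t..<1}. ennreal (kap ?h s)) \<noteq> top" by (rule less_imp_neq)
  qed (use t in auto)
  finally show ?thesis .
qed

lemma kap_borel:
  assumes h: "decreasing h"
  shows "kap h \<in> borel_measurable (restrict_space borel {0<..<1})"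
proof -
  have [measurable]: "(\<lambda>u. h (Phi u)) \<in> borel_measurable (restrict_space borel {0<..<1})"
    "(\<lambda>u. w (Phi u)) \<in> borel_measurable (restrict_space borel {0<..<1})"
    using h by (auto intro!: antimono_on_borel antimono_on_compose_Phi w_anti simp: decreasing_def)
  show ?thesis unfolding kap_def[abs_def] by measurable
qed

text \<open>Under \<open>u = Psi s\<close> the factor \<open>1 / w\<close> of \<open>kap h\<close>
  cancels against the numerator of \<open>q\<close>, and only \<open>1 / v\<close> survives, which
  is the weight in the p-th power of \<open>U\<close>.\<close>

lemma substitution_kap:
  assumes h: "decreasing h" and g: "g \<in> borel_measurable (restrict_space borel {0<..<1})"
    and gn: "\<And>u. u \<in> {0<..<1} \<Longrightarrow> 0 \<le> g u"
  shows "ennreal (J 1) * (\<integral>\<^sup>+u. ennreal (g u) * ennreal (kap h u) \<partial>unit_leb) =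
    (\<integral>\<^sup>+s. ennreal (g (Psi s)) * ennreal (h s / v s) \<partial>unit_leb)"
proof -
  note kap_borel[OF h, measurable] and g[measurable]
  have "(\<integral>\<^sup>+s. ennreal (g (Psi s) * kap h (Psi s)) * ennreal (q s) \<partial>unit_leb) =
      ennreal (J 1) * (\<integral>\<^sup>+u. ennreal (g u * kap h u) \<partial>unit_leb)"
    by (rule nn_integral_substitution_Psi) measurable
  also have "(\<integral>\<^sup>+u. ennreal (g u * kap h u) \<partial>unit_leb) = (\<integral>\<^sup>+u. ennreal (g u) * ennreal (kap h u) \<partial>unit_leb)"
    by (rule nn_integral_unit_leb_cong) (simp add: ennreal_mult gn kap_nonneg[OF h])
  finally have "ennreal (J 1) * (\<integral>\<^sup>+u. ennreal (g u) * ennreal (kap h u) \<partial>unit_leb) =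
      (\<integral>\<^sup>+s. ennreal (g (Psi s) * kap h (Psi s)) * ennreal (q s) \<partial>unit_leb)" by simp
  also have "\<dots> = (\<integral>\<^sup>+s. ennreal (g (Psi s)) * ennreal (h s / v s) \<partial>unit_leb)"
  proof (rule nn_integral_unit_leb_cong)
    fix s :: real assume s: "s \<in> {0<..<1}"
    have g0: "0 \<le> g (Psi s)" by (rule gn[OF Psi_open[OF s]])
    have k0: "0 \<le> kap h (Psi s)" by (rule kap_nonneg[OF h Psi_open[OF s]])
    have "kap h (Psi s) * q s = h s / v s"
      using Phi_Psi[of s] s w_pos[OF s] by (simp add: kap_def q_def)
    moreover have "ennreal (g (Psi s) * kap h (Psi s)) * ennreal (q s) = ennreal (g (Psi s)) * ennreal (kap h (Psi s) * q s)"
      using g0 k0 q_pos[OF s] by (simp add: ennreal_mult mult.assoc)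
    ultimately show "ennreal (g (Psi s) * kap h (Psi s)) * ennreal (q s) = ennreal (g (Psi s)) * ennreal (h s / v s)"
      by simp
  qed
  finally show ?thesis .
qed

lemma decreasing_borel: "decreasing h \<Longrightarrow> h \<in> borel_measurable (restrict_space borel {0<..<1})"
  by (auto simp: decreasing_def intro!: antimono_on_borel)

text \<open>
  The function \<open>kap h\<close> need not be monotone; but \<open>h / v\<close>, which is what it becomes under the
  substitution \<open>u = Psi s\<close>, is nonincreasing.
\<close>
lemma kap_average_ge:
  assumes h: "decreasing h" and u: "u \<in> {0<..<1}" and \<alpha>: "0 \<le> \<alpha>" "\<alpha> \<le> u"
  shows "ennreal (kap h u * (u - \<alpha>)) \<le> ennreal K * (\<integral>\<^sup>+r. ennreal (kap h r) * indicator {\<alpha>..<u} r \<partial>unit_leb)"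
proof -
  define s where "s = Phi u"
  have s: "s \<in> {0<..<1}" "Psi s = u" using Phi_open[OF u] Psi_Phi[of u] u by (auto simp: s_def)
  define a where "a = Phi \<alpha>"
  have a: "a \<in> {0..1}" "Psi a = \<alpha>" "a \<le> s"
    using Phi_range[of \<alpha>] Psi_Phi[of \<alpha>] Phi_le_iff[of \<alpha> u] u \<alpha> by (auto simp: a_def s_def)
  have hs: "0 \<le> h s" by (rule decreasing_nonneg[OF h s(1)])
  have "ennreal (J 1) * ennreal (kap h u * (u - \<alpha>)) = ennreal (kap h u * (J s - J a))"
  proof -
    have "J 1 * (u - \<alpha>) = J s - J a" using s a J1_pos by (simp add: Psi_def field_simps)
    then have "J 1 * (kap h u * (u - \<alpha>)) = kap h u * (J s - J a)" by (simp add: mult.left_commute)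
    then show ?thesis by (simp only: ennreal_mult'[OF less_imp_le[OF J1_pos], symmetric])
  qed
  also have "\<dots> \<le> ennreal (K * (h s / v s * (s - a)))"
  proof (rule ennreal_leI)
    \<comment> \<open>The length \<open>u - \<alpha>\<close> corresponds to
      \<open>J s - J a\<close>. The bound linear in \<open>s - a\<close> is what later becomes an
      integral of the constant \<open>h s / v s\<close>.\<close>
    have "kap h u * (J s - J a) \<le> kap h u * (K * (s - a) * q s)"
      using J_diff_le[of a s] a s kap_nonneg[OF h u] by (intro mult_left_mono) auto
    also have "\<dots> = K * (h s / v s * (s - a))"
      using w_pos[OF s(1)] by (simp add: kap_def s_def[symmetric] q_def)
    finally show "kap h u * (J s - J a) \<le> K * (h s / v s * (s - a))" .
  qed
  also have "\<dots> = ennreal K * (ennreal (h s / v s) * (\<integral>\<^sup>+r. indicator {a..<s} r \<partial>unit_leb))"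
  proof -
    have e: "(\<integral>\<^sup>+r. indicator {a..<s} r \<partial>unit_leb) = ennreal (s - a)"
      by (rule emeasure_unit_leb_interval) (use a s in auto)
    have "0 \<le> h s / v s" using hs v_pos[OF s(1)] by simp
    then show ?thesis by (simp only: e ennreal_mult'[OF less_imp_le[OF K_pos]] ennreal_mult')
  qed
  also have "\<dots> = ennreal K * (\<integral>\<^sup>+r. ennreal (h s / v s) * indicator {a..<s} r \<partial>unit_leb)"
    by (subst nn_integral_cmult) auto
  also have "\<dots> \<le> ennreal K * (\<integral>\<^sup>+r. ennreal (indicator {\<alpha>..<u} (Psi r)) * ennreal (h r / v r) \<partial>unit_leb)"
  proof (intro mult_left_mono nn_integral_unit_leb_mono)
    fix r :: real assume r: "r \<in> {0<..<1}"
    show "ennreal (h s / v s) * indicator {a..<s} r \<le> ennreal (indicator {\<alpha>..<u} (Psi r)) * ennreal (h r / v r)"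
    proof (cases "a \<le> r \<and> r < s")
      case True
      then have "Psi r \<in> {\<alpha>..<u}" using a s r Psi_le_iff[of a r] Psi_less_iff[of r s] by auto
      moreover have "h s / v s \<le> h r / v r"
        using True decreasing_D[OF h r s(1)] monotone_onD[OF v_mono r s(1)] v_pos[OF r] v_pos[OF s(1)] decreasing_nonneg[OF h r]
        by (intro frac_le) auto
      ultimately show ?thesis using True by (simp add: ennreal_leI)
    qed simp
  qed auto
  also have "(\<integral>\<^sup>+r. ennreal (indicator {\<alpha>..<u} (Psi r)) * ennreal (h r / v r) \<partial>unit_leb) =
      ennreal (J 1) * (\<integral>\<^sup>+r. ennreal (indicator {\<alpha>..<u} r) * ennreal (kap h r) \<partial>unit_leb)"
    by (rule substitution_kap[OF h, symmetric], rule measurable_restrict_space1, rule borel_measurable_indicator, simp_all)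
  also have "(\<integral>\<^sup>+r. ennreal (indicator {\<alpha>..<u} r) * ennreal (kap h r) \<partial>unit_leb) =
      (\<integral>\<^sup>+r. ennreal (kap h r) * indicator {\<alpha>..<u} r \<partial>unit_leb)"
    by (rule nn_integral_unit_leb_cong) (auto split: split_indicator)
  finally have "ennreal (J 1) * ennreal (kap h u * (u - \<alpha>)) \<le>
      ennreal (J 1) * (ennreal K * (\<integral>\<^sup>+r. ennreal (kap h r) * indicator {\<alpha>..<u} r \<partial>unit_leb))"
    by (simp add: mult.left_commute)
  then show ?thesis using J1_pos by (subst (asm) ennreal_mult_le_mult_iff) auto
qed

end

section \<open>Averaging over level blocks and the dual bound\<close>

definition avg :: "(real \<Rightarrow> real) \<Rightarrow> real \<Rightarrow> real \<Rightarrow> real" where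
  "avg F \<alpha> \<beta> = enn2real (\<integral>\<^sup>+r. ennreal (F r) * indicator {\<alpha>..<\<beta>} r \<partial>unit_leb) / (\<beta> - \<alpha>)"

lemma avg_nonneg: "\<alpha> \<le> \<beta> \<Longrightarrow> 0 \<le> avg F \<alpha> \<beta>"
  by (simp add: avg_def)

lemma nn_integral_unit_leb_const:
  assumes "0 \<le> a" "a \<le> t" "t \<le> 1" "0 \<le> c"
  shows "(\<integral>\<^sup>+r. ennreal c * indicator {a..<t} r \<partial>unit_leb) = ennreal (c * (t - a))"
  using assms by (subst nn_integral_cmult) (auto simp: emeasure_unit_leb_interval ennreal_mult)

context
  fixes F :: "real \<Rightarrow> real" and \<alpha> \<beta> :: real
  assumes F: "antimono_on {0<..<1} F" "\<And>t. t \<in> {0<..<1} \<Longrightarrow> 0 \<le> F t"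
    and fin: "(\<integral>\<^sup>+r. ennreal (F r) \<partial>unit_leb) < \<infinity>"
    and ab: "0 \<le> \<alpha>" "\<alpha> < \<beta>" "\<beta> \<le> 1"
begin

lemma avg_integral:
  "ennreal (avg F \<alpha> \<beta> * (\<beta> - \<alpha>)) = (\<integral>\<^sup>+r. ennreal (F r) * indicator {\<alpha>..<\<beta>} r \<partial>unit_leb)"
proof -
  have "(\<integral>\<^sup>+r. ennreal (F r) * indicator {\<alpha>..<\<beta>} r \<partial>unit_leb) \<le> (\<integral>\<^sup>+r. ennreal (F r) \<partial>unit_leb)"
    by (rule nn_integral_mono) (auto split: split_indicator)
  then have "(\<integral>\<^sup>+r. ennreal (F r) * indicator {\<alpha>..<\<beta>} r \<partial>unit_leb) < top" using fin by (auto intro: le_less_trans)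
  then show ?thesis using ab by (simp add: avg_def)
qed

lemma avg_ge:
  assumes "\<And>r. r \<in> {0<..<1} \<Longrightarrow> \<alpha> \<le> r \<Longrightarrow> r < \<beta> \<Longrightarrow> m \<le> F r" "0 \<le> m"
  shows "m \<le> avg F \<alpha> \<beta>"
proof -
  have "ennreal (m * (\<beta> - \<alpha>)) \<le> ennreal (avg F \<alpha> \<beta> * (\<beta> - \<alpha>))"
    unfolding avg_integral using ab assms
    by (subst nn_integral_unit_leb_const[symmetric])
       (auto intro!: nn_integral_unit_leb_mono ennreal_leI split: split_indicator)
  then show ?thesis using ab avg_nonneg[of \<alpha> \<beta> F] assms(2) by (auto simp: ennreal_le_iff)
qed

lemma avg_le:
  assumes "\<And>r. r \<in> {0<..<1} \<Longrightarrow> \<alpha> \<le> r \<Longrightarrow> r < \<beta> \<Longrightarrow> F r \<le> m" "0 \<le> m"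
  shows "avg F \<alpha> \<beta> \<le> m"
proof -
  have "ennreal (avg F \<alpha> \<beta> * (\<beta> - \<alpha>)) \<le> ennreal (m * (\<beta> - \<alpha>))"
    unfolding avg_integral using ab assms
    by (subst nn_integral_unit_leb_const[symmetric])
       (auto intro!: nn_integral_unit_leb_mono ennreal_leI split: split_indicator)
  then show ?thesis using ab assms(2) by (auto simp: ennreal_le_iff)
qed

text \<open>Only \<open>t\<close> inside the block matters: there the mean of a nonincreasing
  function over the initial piece is at least its mean over the whole block.\<close>

lemma avg_initial_le:
  assumes t: "t \<in> {0<..<1}"
  shows "(\<integral>\<^sup>+r. ennreal (avg F \<alpha> \<beta>) * indicator {\<alpha>..<\<beta>} r * indicator {..<t} r \<partial>unit_leb) \<le>
    (\<integral>\<^sup>+r. ennreal (F r) * indicator {\<alpha>..<\<beta>} r * indicator {..<t} r \<partial>unit_leb)"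
proof -
  have [measurable]: "F \<in> borel_measurable unit_leb" by (rule antimono_on_unit_leb[OF F(1)])
  let ?c = "avg F \<alpha> \<beta>"
  have c: "0 \<le> ?c" using ab by (intro avg_nonneg) auto
  consider "t \<le> \<alpha>" | "\<beta> \<le> t" | "\<alpha> < t" "t < \<beta>" by linarith
  then show ?thesis
  proof cases
    case 1
    have "(\<integral>\<^sup>+r. ennreal ?c * indicator {\<alpha>..<\<beta>} r * indicator {..<t} r \<partial>unit_leb) = (\<integral>\<^sup>+r. 0 \<partial>unit_leb)"
      by (rule nn_integral_unit_leb_cong) (use 1 in \<open>auto split: split_indicator\<close>)
    then show ?thesis by simp
  next
    case 2
    have e: "(\<integral>\<^sup>+r. f r * indicator {\<alpha>..<\<beta>} r * indicator {..<t} r \<partial>unit_leb) = (\<integral>\<^sup>+r. f r * indicator {\<alpha>..<\<beta>} r \<partial>unit_leb)"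
      for f :: "real \<Rightarrow> ennreal"
      by (rule nn_integral_unit_leb_cong) (use 2 in \<open>auto split: split_indicator\<close>)
    show ?thesis unfolding e avg_integral[symmetric] using ab c by (subst nn_integral_unit_leb_const) auto
  next
    case 3
    have e: "(\<integral>\<^sup>+r. f r * indicator {\<alpha>..<\<beta>} r * indicator {..<t} r \<partial>unit_leb) = (\<integral>\<^sup>+r. f r * indicator {\<alpha>..<t} r \<partial>unit_leb)"
      for f :: "real \<Rightarrow> ennreal"
      by (rule nn_integral_unit_leb_cong) (use 3 in \<open>auto split: split_indicator\<close>)
    let ?I1 = "\<integral>\<^sup>+r. ennreal (F r) * indicator {\<alpha>..<t} r \<partial>unit_leb"
    let ?I2 = "\<integral>\<^sup>+r. ennreal (F r) * indicator {t..<\<beta>} r \<partial>unit_leb"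
    have sum: "ennreal (?c * (\<beta> - \<alpha>)) = ?I1 + ?I2"
    proof -
      have "ennreal (?c * (\<beta> - \<alpha>)) = (\<integral>\<^sup>+r. ennreal (F r) * indicator {\<alpha>..<t} r + ennreal (F r) * indicator {t..<\<beta>} r \<partial>unit_leb)"
        unfolding avg_integral by (rule nn_integral_unit_leb_cong) (use 3 in \<open>auto split: split_indicator\<close>)
      also have "\<dots> = ?I1 + ?I2" by (rule nn_integral_add) measurable
      finally show ?thesis .
    qed
    have I1: "ennreal (F t * (t - \<alpha>)) \<le> ?I1"
      using ab t 3 F monotone_onD[OF F(1)]
      by (subst nn_integral_unit_leb_const[symmetric])
         (auto intro!: nn_integral_unit_leb_mono ennreal_leI split: split_indicator)
    have I2: "?I2 \<le> ennreal (F t * (\<beta> - t))"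
      using ab t 3 F monotone_onD[OF F(1)]
      by (subst nn_integral_unit_leb_const[symmetric])
         (auto intro!: nn_integral_unit_leb_mono ennreal_leI split: split_indicator)
    have "?I1 < top" "?I2 < top" using sum by (auto simp: less_top[symmetric] top_add)
    then obtain x y where xy: "?I1 = ennreal x" "?I2 = ennreal y" "0 \<le> x" "0 \<le> y"
      by (elim less_top_ennreal[THEN iffD1, THEN exE]) auto
    have cxy: "?c * (\<beta> - \<alpha>) = x + y"
      using sum xy c ab by (simp add: ennreal_plus[symmetric] del: ennreal_plus)
    have x: "F t * (t - \<alpha>) \<le> x" using I1 xy by (simp add: ennreal_le_iff)
    have y: "y \<le> F t * (\<beta> - t)" using I2 xy F(2)[OF t] 3 by (simp add: ennreal_le_iff)
    have "(t - \<alpha>) * y \<le> (t - \<alpha>) * (F t * (\<beta> - t))" using y 3 by (intro mult_left_mono) auto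
    also have "\<dots> = (\<beta> - t) * (F t * (t - \<alpha>))" by simp
    also have "\<dots> \<le> (\<beta> - t) * x" using x 3 by (intro mult_left_mono) auto
    finally have "(t - \<alpha>) * (x + y) \<le> (\<beta> - \<alpha>) * x" by (simp add: algebra_simps)
    then have "(\<beta> - \<alpha>) * (?c * (t - \<alpha>)) \<le> (\<beta> - \<alpha>) * x" unfolding cxy[symmetric] by (simp add: mult_ac)
    then have "?c * (t - \<alpha>) \<le> x" using ab by simp
    then show ?thesis
      unfolding e xy(1) using ab 3 c t by (subst nn_integral_unit_leb_const) (auto intro: ennreal_leI)
  qed
qed

end

context two_spaces
begin

text \<open>
  The set where \<open>HP h\<close> lies between \<open>2 ^ j * b\<close> and \<open>2 ^ (j + 1) * b\<close> is an interval. Replacing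
  \<open>F\<close> by its average \<open>Ft\<close> over each of these intervals does not increase the norm, and turns
  \<open>HP h\<close> into \<open>kap h\<close>, since the average of \<open>kap h\<close> over such an interval reaches
  its level there up to a constant. The substitution \<open>u = Psi s\<close> then brings in the hypothesis on \<open>v\<close>.
\<close>
lemma averaging_estimate:
  assumes h: "decreasing h" and b: "0 < b" and hb: "associate ZY h \<le> ennreal b"
    and F: "decreasing F" and ZF: "ZX F < \<infinity>"
    and c: "0 \<le> c" and U: "\<And>F. F \<in> Mplus \<Longrightarrow> ZX F < \<infinity> \<Longrightarrow>
      ZY (\<lambda>s. rearr unit_leb F (Psi s) / v s) \<le> ennreal c * ZX F"
    and CL: "0 \<le> CL" "\<And>f. f \<in> Mplus \<Longrightarrow> (\<integral>\<^sup>+t. ennreal (f t) \<partial>unit_leb) \<le> ennreal CL * ZX f"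
  shows "(\<integral>\<^sup>+u. ennreal (F u) * ennreal (HP h u) \<partial>unit_leb) \<le> ennreal (b * (CL + 2 * K * c / J 1)) * ZX F"
proof -
  note P = prob_space_unit_leb
  have Fan: "antimono_on {0<..<1} F" and Fnn: "\<And>t. t \<in> {0<..<1} \<Longrightarrow> 0 \<le> F t"
    using F by (auto simp: decreasing_def)
  have Fint: "(\<integral>\<^sup>+r. ennreal (F r) \<partial>unit_leb) < \<infinity>"
    by (rule le_less_trans[OF CL(2)[OF decreasing_Mplus[OF F]]]) (use ZF in \<open>simp add: ennreal_mult_less_top\<close>)
  have [measurable]: "F \<in> borel_measurable unit_leb" "HP h \<in> borel_measurable unit_leb"
    "kap h \<in> borel_measurable unit_leb"
    using decreasing_measurable[OF F] decreasing_measurable[OF decreasing_HP[OF h]]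
      borel_measurable_unit_lebI[OF kap_borel[OF h]] by auto
  define E where "E j = {u\<in>{0<..<1}. 2 ^ j * b < kap h u}" for j :: nat
  \<comment> \<open>Up to one point the set where \<open>HP h\<close> exceeds level \<open>j\<close>
    is the interval from 0 to \<open>a j\<close>. The inserted 0 serves empty levels.\<close>
  define a where "a j = Sup (insert 0 (E j))" for j
  have bdd: "bdd_above (insert 0 (E j))" for j by (rule bdd_aboveI[of _ 1]) (auto simp: E_def)
  have a01: "0 \<le> a j" "a j \<le> 1" for j
    unfolding a_def using bdd[of j] by (auto intro!: cSup_upper cSup_least simp: E_def)
  have Ea: "u \<in> E j \<Longrightarrow> u \<le> a j" for u j unfolding a_def using bdd by (intro cSup_upper) auto
  have a_dec: "a j \<le> a i" if "i \<le> j" for i j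
    unfolding a_def
  proof (rule cSup_subset_mono)
    have "2 ^ i * b \<le> 2 ^ j * b" using that b by simp
    then show "insert 0 (E j) \<subseteq> insert 0 (E i)" by (auto simp: E_def)
  qed (use bdd in auto)
  have HP_le: "HP h u \<le> 2 ^ j * b" if u: "u \<in> {0<..<1}" "a j < u" for u j
    unfolding HP_def
  proof (rule cSUP_least)
    fix s assume s: "s \<in> {u..<1}"
    then have "s \<notin> E j" using Ea[of s j] u by auto
    then show "kap h s \<le> 2 ^ j * b" using s u by (auto simp: E_def not_less)
  qed (use u in auto)
  \<comment> \<open>\<open>kap h\<close> is bounded to the right of \<open>u\<close>, so it exceeds
    only finitely many levels there.\<close>
  have a_lim: "\<exists>j. a j \<le> u" if u: "u \<in> {0<..<1}" for u
  proof -
    obtain j where j: "h (Phi u) * C / (Phi u * w (Phi u)) / b < 2 ^ j"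
      using real_arch_pow[of 2] by auto
    have "e \<le> u" if e: "e \<in> insert 0 (E j)" for e
    proof (rule ccontr)
      assume "\<not> e \<le> u"
      then have e': "e \<in> {0<..<1}" "2 ^ j * b < kap h e" "u \<le> e" using e u by (auto simp: E_def)
      have "kap h e \<le> h (Phi u) * C / (Phi u * w (Phi u))" using kap_bound[OF h u e'(3)] e' by auto
      then have "kap h e / b \<le> h (Phi u) * C / (Phi u * w (Phi u)) / b" using b by (intro divide_right_mono) auto
      with j have "kap h e / b < 2 ^ j" by linarith
      then show False using e'(2) b by (simp add: pos_divide_less_eq)
    qed
    then have "a j \<le> u" unfolding a_def by (intro cSup_least) auto
    then show ?thesis by blast
  qed
  \<comment> \<open>The index of the block containing \<open>u\<close>: almost everywhere
    \<open>HP h u\<close> is at most \<open>2 ^ N u * b\<close>, and index 0 collects the points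
    where it is at most \<open>b\<close>.\<close>
  define N where "N u = (LEAST j. a j \<le> u)" for u
  have Nm [measurable]: "N \<in> measurable unit_leb (count_space UNIV)" unfolding N_def by measurable
  have [measurable]: "(\<lambda>x. ennreal (b * 2 ^ N x)) \<in> borel_measurable unit_leb"
    by (rule measurable_compose[OF Nm]) simp
  have aN: "a (N u) \<le> u" if "u \<in> {0<..<1}" for u
    unfolding N_def using a_lim[OF that] by (rule LeastI_ex)
  have N_le: "N u \<le> j" if "a j \<le> u" for u j unfolding N_def using that by (rule Least_le)
  have N_anti: "N t \<le> N s" if "s \<in> {0<..<1}" "s \<le> t" for s t
    using N_le[of "N s" t] aN[OF that(1)] that(2) by simp
  have NS: "N u = Suc j \<longleftrightarrow> a (Suc j) \<le> u \<and> u < a j" if u: "u \<in> {0<..<1}" for u j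
  proof
    assume N: "N u = Suc j"
    then show "a (Suc j) \<le> u \<and> u < a j" using aN[OF u] N_le[of j u] by (auto simp: not_le[symmetric])
  next
    assume *: "a (Suc j) \<le> u \<and> u < a j"
    then have "N u \<le> Suc j" using N_le by blast
    moreover have "\<not> N u \<le> j" using a_dec[of "N u" j] aN[OF u] * by auto
    ultimately show "N u = Suc j" by simp
  qed
  have Ncases: "(\<exists>j. N u = Suc j \<and> a (Suc j) < a j \<and> a (Suc j) \<le> u \<and> u < a j) \<or> (N u = 0 \<and> a 0 \<le> u)"
    if "u \<in> {0<..<1}" for u
    using NS[OF that] aN[OF that] by (cases "N u") (auto intro: le_less_trans)
  \<comment> \<open>On index 0 nothing is averaged; that part is controlled without
    \<open>kap h\<close>.\<close>
  define Ft where "Ft u = (case N u of 0 \<Rightarrow> F u | Suc j \<Rightarrow> avg F (a (Suc j)) (a j))" for u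
  have Ft0: "Ft u = F u" if "N u = 0" for u using that by (simp add: Ft_def)
  have FtS: "Ft u = avg F (a (Suc j)) (a j)" if "N u = Suc j" for u j using that by (simp add: Ft_def)
  note av = avg_ge[OF Fan Fnn Fint a01(1) _ a01(2)] avg_le[OF Fan Fnn Fint a01(1) _ a01(2)]
  have Ftdec: "decreasing Ft"
    unfolding decreasing_def
  proof (intro conjI monotone_onI ballI)
    fix t :: real assume t: "t \<in> {0<..<1}"
    show "0 \<le> Ft t"
      using Ncases[OF t] Fnn[OF t] a_dec[of _ "Suc _"] by (auto simp: Ft0 FtS intro!: avg_nonneg)
  next
    fix s t :: real assume st: "s \<in> {0<..<1}" "t \<in> {0<..<1}" "s \<le> t"
    consider "N t = N s" | "N t < N s" using N_anti[OF st(1,3)] by linarith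
    then show "Ft t \<le> Ft s"
    proof cases
      case 1
      then show ?thesis
        using decreasing_D[OF F st] by (cases "N s") (auto simp: Ft0 FtS)
    next
      case 2
      then obtain j where j: "N s = Suc j" by (cases "N s") auto
      then have bj: "a (Suc j) \<le> s" "s < a j" using NS[OF st(1)] by auto
      show ?thesis
        unfolding FtS[OF j]
      proof (rule av(1))
        show "a (Suc j) < a j" using bj by simp
        show "0 \<le> Ft t" using Ncases[OF st(2)] Fnn[OF st(2)] by (auto simp: Ft0 FtS intro!: avg_nonneg)
        fix r assume r: "r \<in> {0<..<1}" "a (Suc j) \<le> r" "r < a j"
        show "Ft t \<le> F r"
        proof (cases "N t")
          case 0
          then have "a j \<le> t" using aN[OF st(2)] a_dec[of 0 j] by auto
          then show ?thesis using decreasing_D[OF F r(1) st(2)] r 0 by (simp add: Ft0)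
        next
          case (Suc i)
          then have bi: "a (Suc i) \<le> t" "t < a i" using NS[OF st(2)] by auto
          have bij: "Suc i \<le> j" using Suc 2 j by simp
          show ?thesis
            unfolding FtS[OF Suc]
          proof (rule av(2))
            show "a (Suc i) < a i" using bi by simp
            show "0 \<le> F r" by (rule Fnn[OF r(1)])
            fix r' assume "r' \<in> {0<..<1}" "a (Suc i) \<le> r'" "r' < a i"
            moreover have "a j \<le> a (Suc i)" by (rule a_dec[OF bij])
            ultimately show "F r' \<le> F r" using decreasing_D[OF F r(1), of r'] r by simp
          qed
        qed
      qed
    qed
  qed
  have [measurable]: "Ft \<in> borel_measurable unit_leb" by (rule decreasing_measurable[OF Ftdec])
  have ind: "indicator {u. N u = Suc j} r = (indicator {a (Suc j)..<a j} r :: ennreal)" if "r \<in> {0<..<1}" for r j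
    using NS[OF that] by (auto split: split_indicator)
  have ZFt: "ZX Ft \<le> ZX F"
  proof (rule zx.norm_mono_majorization[OF _ _ decreasing_Mplus[OF F] ZF])
    fix t :: real assume t: "t \<in> {0<..<1}"
    have "(\<integral>\<^sup>+s. ennreal (Ft s) * indicator {..<t} s \<partial>unit_leb) =
        (\<Sum>k. \<integral>\<^sup>+s. ennreal (Ft s) * indicator {..<t} s * indicator {x. N x = k} s \<partial>unit_leb)"
      by (rule nn_integral_nat_partition) measurable
    also have "\<dots> \<le> (\<Sum>k. \<integral>\<^sup>+s. ennreal (F s) * indicator {..<t} s * indicator {x. N x = k} s \<partial>unit_leb)"
    proof (rule suminf_le)
      fix k
      show "(\<integral>\<^sup>+s. ennreal (Ft s) * indicator {..<t} s * indicator {x. N x = k} s \<partial>unit_leb) \<le>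
          (\<integral>\<^sup>+s. ennreal (F s) * indicator {..<t} s * indicator {x. N x = k} s \<partial>unit_leb)"
      proof (cases k)
        case 0
        then show ?thesis by (intro nn_integral_mono) (auto simp: Ft0 split: split_indicator)
      next
        case (Suc j)
        show ?thesis
        proof (cases "a (Suc j) < a j")
          case True
          have "(\<integral>\<^sup>+s. ennreal (Ft s) * indicator {..<t} s * indicator {x. N x = k} s \<partial>unit_leb) =
              (\<integral>\<^sup>+s. ennreal (avg F (a (Suc j)) (a j)) * indicator {a (Suc j)..<a j} s * indicator {..<t} s \<partial>unit_leb)"
            by (rule nn_integral_unit_leb_cong) (auto simp: Suc ind[symmetric] FtS split: split_indicator)
          also have "\<dots> \<le> (\<integral>\<^sup>+s. ennreal (F s) * indicator {a (Suc j)..<a j} s * indicator {..<t} s \<partial>unit_leb)"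
            by (rule avg_initial_le[OF Fan Fnn Fint a01(1) True a01(2) t])
          also have "\<dots> = (\<integral>\<^sup>+s. ennreal (F s) * indicator {..<t} s * indicator {x. N x = k} s \<partial>unit_leb)"
            by (rule nn_integral_unit_leb_cong) (auto simp: Suc ind[symmetric] split: split_indicator)
          finally show ?thesis .
        next
          case False
          have "(\<integral>\<^sup>+s. ennreal (Ft s) * indicator {..<t} s * indicator {x. N x = k} s \<partial>unit_leb) = (\<integral>\<^sup>+s. 0 \<partial>unit_leb)"
            by (rule nn_integral_unit_leb_cong) (use False in \<open>auto simp: Suc ind split: split_indicator\<close>)
          then show ?thesis by simp
        qed
      qed
    qed simp_all
    also have "\<dots> = (\<integral>\<^sup>+s. ennreal (F s) * indicator {..<t} s \<partial>unit_leb)"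
      by (rule nn_integral_nat_partition[symmetric]) measurable
    finally show "(\<integral>\<^sup>+s. ennreal (Ft s) * indicator {..<t} s \<partial>unit_leb) \<le> (\<integral>\<^sup>+s. ennreal (F s) * indicator {..<t} s \<partial>unit_leb)" .
  qed (use Ftdec in \<open>auto simp: decreasing_def\<close>)
  \<comment> \<open>At a point \<open>u\<close> of \<open>E j\<close> the value
    \<open>kap h u\<close> exceeds the level, so \<open>kap_average_ge\<close> bounds
    \<open>u - \<alpha>\<close>. The bound passes to the supremum \<open>a j\<close>, which need not
    belong to \<open>E j\<close>.\<close>
  have blk: "ennreal (2 ^ j * b * (a j - \<alpha>)) \<le> ennreal K * (\<integral>\<^sup>+r. ennreal (kap h r) * indicator {\<alpha>..<a j} r \<partial>unit_leb)"
    (is "_ \<le> ?R") if \<alpha>: "0 \<le> \<alpha>" "\<alpha> < a j" for j \<alpha>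
  proof (cases "?R = top")
    case False
    then obtain r where r: "?R = ennreal r" "0 \<le> r" by (cases ?R) auto
    have bj: "0 < 2 ^ j * b" using b by simp
    have "u \<le> \<alpha> + r / (2 ^ j * b)" if u: "u \<in> insert 0 (E j)" for u
    proof (cases "u \<le> \<alpha>")
      case False
      then have u': "u \<in> {0<..<1}" "2 ^ j * b < kap h u" "u \<in> E j" using u \<alpha> by (auto simp: E_def)
      have "ennreal (2 ^ j * b * (u - \<alpha>)) \<le> ennreal (kap h u * (u - \<alpha>))"
        using u' False by (intro ennreal_leI mult_right_mono) auto
      also have "\<dots> \<le> ennreal K * (\<integral>\<^sup>+r. ennreal (kap h r) * indicator {\<alpha>..<u} r \<partial>unit_leb)"
        using False \<alpha> by (intro kap_average_ge[OF h u'(1)]) auto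
      also have "\<dots> \<le> ?R"
        using Ea[OF u'(3)] by (intro mult_left_mono nn_integral_mono) (auto split: split_indicator)
      finally have "2 ^ j * b * (u - \<alpha>) \<le> r" using r by (simp add: ennreal_le_iff)
      then have "u - \<alpha> \<le> r / (2 ^ j * b)" using bj by (simp add: pos_le_divide_eq mult.commute)
      then show ?thesis by linarith
    next
      case True
      have "0 \<le> r / (2 ^ j * b)" using r bj by (intro divide_nonneg_pos) auto
      with True show ?thesis by linarith
    qed
    then have "a j \<le> \<alpha> + r / (2 ^ j * b)" unfolding a_def by (intro cSup_least) auto
    then have "a j - \<alpha> \<le> r / (2 ^ j * b)" by linarith
    then have "2 ^ j * b * (a j - \<alpha>) \<le> r" using bj by (simp add: pos_le_divide_eq mult.commute)
    then show ?thesis unfolding r(1) by (rule ennreal_leI)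
  qed simp
  \<comment> \<open>\<open>HP_le\<close> requires \<open>a j < u\<close> strictly, so the countably
    many endpoints are discarded.\<close>
  have "AE u in unit_leb. \<forall>j. u \<noteq> a j" by (subst AE_all_countable) (auto intro: AE_unit_leb_neq)
  then have HN: "AE u in unit_leb. HP h u \<le> b * 2 ^ N u"
    using AE_space
  proof eventually_elim
    case (elim u)
    then have u: "u \<in> {0<..<1}" by simp
    have "a (N u) < u" using aN[OF u] elim(1) by (metis less_le)
    from HP_le[OF u this] show ?case by (simp add: mult.commute)
  qed
  have "(\<integral>\<^sup>+u. ennreal (F u) * ennreal (HP h u) \<partial>unit_leb) \<le> (\<integral>\<^sup>+u. ennreal (F u) * ennreal (b * 2 ^ N u) \<partial>unit_leb)"
    by (rule nn_integral_mono_AE) (use HN in eventually_elim, auto intro!: mult_left_mono ennreal_leI)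
  also have "\<dots> = (\<Sum>k. \<integral>\<^sup>+u. ennreal (F u) * ennreal (b * 2 ^ N u) * indicator {x. N x = k} u \<partial>unit_leb)"
    by (rule nn_integral_nat_partition) measurable
  \<comment> \<open>On index 0 the integrand is \<open>b * F\<close>. On the block of index
    \<open>Suc j\<close> the integral of \<open>F\<close> is its average times the length, and level
    times length is bounded by the integral of \<open>kap h\<close> through \<open>blk\<close>; the
    2 is the ratio of consecutive levels.\<close>
  also have "\<dots> \<le> (\<Sum>k. \<integral>\<^sup>+u. (ennreal b * ennreal (F u) + ennreal (2 * K) * (ennreal (Ft u) * ennreal (kap h u))) *
      indicator {x. N x = k} u \<partial>unit_leb)"
  proof (rule suminf_le)
    fix k
    let ?R = "\<lambda>u. ennreal b * ennreal (F u) + ennreal (2 * K) * (ennreal (Ft u) * ennreal (kap h u))"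
    show "(\<integral>\<^sup>+u. ennreal (F u) * ennreal (b * 2 ^ N u) * indicator {x. N x = k} u \<partial>unit_leb) \<le>
        (\<integral>\<^sup>+u. ?R u * indicator {x. N x = k} u \<partial>unit_leb)"
    proof (cases k)
      case 0
      then show ?thesis by (intro nn_integral_mono) (auto simp: mult.commute split: split_indicator)
    next
      case (Suc j)
      let ?I = "indicator {a (Suc j)..<a j} :: real \<Rightarrow> ennreal"
      let ?av = "avg F (a (Suc j)) (a j)"
      show ?thesis
      proof (cases "a (Suc j) < a j")
        case False
        have "(\<integral>\<^sup>+u. ennreal (F u) * ennreal (b * 2 ^ N u) * indicator {x. N x = k} u \<partial>unit_leb) = (\<integral>\<^sup>+s. 0 \<partial>unit_leb)"
          by (rule nn_integral_unit_leb_cong) (use False in \<open>auto simp: Suc ind split: split_indicator\<close>)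
        then show ?thesis by simp
      next
        case True
        have av0: "0 \<le> ?av" using True by (intro avg_nonneg) auto
        have "(\<integral>\<^sup>+u. ennreal (F u) * ennreal (b * 2 ^ N u) * indicator {x. N x = k} u \<partial>unit_leb) =
            (\<integral>\<^sup>+u. ennreal (b * 2 ^ Suc j) * (ennreal (F u) * ?I u) \<partial>unit_leb)"
          by (rule nn_integral_unit_leb_cong) (auto simp: Suc ind[symmetric] mult.commute split: split_indicator)
        also have "\<dots> = ennreal (b * 2 ^ Suc j) * (\<integral>\<^sup>+u. ennreal (F u) * ?I u \<partial>unit_leb)"
          by (rule nn_integral_cmult) measurable
        also have "(\<integral>\<^sup>+u. ennreal (F u) * ?I u \<partial>unit_leb) = ennreal (?av * (a j - a (Suc j)))"
          by (rule avg_integral[symmetric]) (use Fan Fnn Fint a01 True in auto)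
        also have "ennreal (b * 2 ^ Suc j) * \<dots> = ennreal (2 * ?av) * ennreal (2 ^ j * b * (a j - a (Suc j)))"
          using b av0 True by (subst (1 2) ennreal_mult[symmetric]) (auto simp: mult_ac)
        also have "\<dots> \<le> ennreal (2 * ?av) * (ennreal K * (\<integral>\<^sup>+r. ennreal (kap h r) * ?I r \<partial>unit_leb))"
          by (intro mult_left_mono blk a01 True) auto
        also have "\<dots> = ennreal (2 * K * ?av) * (\<integral>\<^sup>+r. ennreal (kap h r) * ?I r \<partial>unit_leb)"
          using K_pos av0 by (simp add: ennreal_mult[symmetric] mult.assoc[symmetric]) (simp add: mult_ac)
        also have "\<dots> = (\<integral>\<^sup>+r. ennreal (2 * K * ?av) * (ennreal (kap h r) * ?I r) \<partial>unit_leb)"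
          by (rule nn_integral_cmult[symmetric]) measurable
        also have "\<dots> \<le> (\<integral>\<^sup>+u. ?R u * indicator {x. N x = k} u \<partial>unit_leb)"
        proof (rule nn_integral_unit_leb_mono)
          fix u :: real assume u: "u \<in> {0<..<1}"
          show "ennreal (2 * K * ?av) * (ennreal (kap h u) * ?I u) \<le> ?R u * indicator {x. N x = k} u"
          proof (cases "N u = Suc j")
            case True
            then have "ennreal (2 * K * ?av) * ennreal (kap h u) = ennreal (2 * K) * (ennreal (Ft u) * ennreal (kap h u))"
              using K_pos av0 by (simp add: FtS ennreal_mult mult.assoc)
            then show ?thesis using True u ind[OF u, of j] by (simp add: Suc)
          next
            case False
            then have "?I u = 0" using ind[OF u, of j] by simp
            then show ?thesis by simp
          qed
        qed
        finally show ?thesis .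
      qed
    qed
  qed simp_all
  also have "\<dots> = (\<integral>\<^sup>+u. ennreal b * ennreal (F u) + ennreal (2 * K) * (ennreal (Ft u) * ennreal (kap h u)) \<partial>unit_leb)"
    by (rule nn_integral_nat_partition[symmetric]) measurable
  also have "\<dots> = ennreal b * (\<integral>\<^sup>+u. ennreal (F u) \<partial>unit_leb) +
      ennreal (2 * K) * (\<integral>\<^sup>+u. ennreal (Ft u) * ennreal (kap h u) \<partial>unit_leb)"
    by (subst nn_integral_add, measurable, subst (1 2) nn_integral_cmult) measurable
  also have "\<dots> \<le> ennreal b * (ennreal CL * ZX F) + ennreal (2 * K) * (ennreal (c * b / J 1) * ZX F)"
  proof (intro add_mono mult_left_mono CL decreasing_Mplus F)
    \<comment> \<open>\<open>?F\<close> agrees with \<open>Ft\<close> almost everywhere and has the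
      rearranged form in which the hypothesis \<open>U\<close> is stated.\<close>
    let ?F = "rearr unit_leb Ft"
    have FtM: "Ft \<in> Mplus" by (rule decreasing_Mplus[OF Ftdec])
    have Fm: "Ft \<in> borel_measurable unit_leb" by measurable
    have dF: "decreasing ?F" by (rule decreasing_rearr[OF P Fm])
    have ZFt': "ZX Ft < \<infinity>" using ZFt ZF by (rule le_less_trans)
    let ?G = "\<lambda>s. ?F (Psi s) / v s"
    have GM: "?G \<in> Mplus"
    proof (rule MplusI)
      have "antimono_on {0<..<1} (\<lambda>s. ?F (Psi s))" using dF by (intro antimono_on_compose_Psi) (simp add: decreasing_def)
      then have [measurable]: "(\<lambda>s. ?F (Psi s)) \<in> borel_measurable unit_leb" by (rule antimono_on_unit_leb)
      show "?G \<in> borel_measurable unit_leb" by measurable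
      show "0 \<le> ?G t" if "t \<in> {0<..<1}" for t
        using decreasing_nonneg[OF dF Psi_open[OF that]] v_pos[OF that] by simp
    qed
    have ZG: "ZY ?G \<le> ennreal c * ZX F"
      using U[OF FtM ZFt'] mult_left_mono[OF ZFt, of "ennreal c"] by (auto intro: order_trans)
    have ZG': "ZY ?G < \<infinity>"
      by (rule le_less_trans[OF ZG]) (use ZF in \<open>simp add: ennreal_mult_less_top\<close>)
    have "ennreal (J 1) * (\<integral>\<^sup>+u. ennreal (Ft u) * ennreal (kap h u) \<partial>unit_leb) =
        ennreal (J 1) * (\<integral>\<^sup>+u. ennreal (?F u) * ennreal (kap h u) \<partial>unit_leb)"
      by (intro arg_cong2[where f=times] refl nn_integral_cong_AE)
         (use decreasing_rearr_AE[OF Ftdec] in eventually_elim, simp)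
    also have "\<dots> = (\<integral>\<^sup>+s. ennreal (?F (Psi s)) * ennreal (h s / v s) \<partial>unit_leb)"
      by (rule substitution_kap[OF h decreasing_borel[OF dF] decreasing_nonneg[OF dF]])
    also have "\<dots> = (\<integral>\<^sup>+s. ennreal (?G s) * ennreal (h s) \<partial>unit_leb)"
    proof (rule nn_integral_unit_leb_cong)
      fix s :: real assume s: "s \<in> {0<..<1}"
      show "ennreal (?F (Psi s)) * ennreal (h s / v s) = ennreal (?G s) * ennreal (h s)"
        using decreasing_nonneg[OF dF Psi_open[OF s]] v_pos[OF s] decreasing_nonneg[OF h s]
        by (simp add: ennreal_mult[symmetric])
    qed
    also have "\<dots> \<le> ZY ?G * associate ZY h" by (rule zy.holder[OF GM decreasing_Mplus[OF h] ZG'])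
    also have "\<dots> \<le> (ennreal c * ZX F) * ennreal b" by (intro mult_mono ZG hb) auto
    also have "\<dots> = ennreal (J 1) * (ennreal (c * b / J 1) * ZX F)"
    proof -
      have "ennreal (J 1) * ennreal (c * b / J 1) = ennreal c * ennreal b"
        using J1_pos b c by (simp add: ennreal_mult[symmetric])
      then show ?thesis by (metis mult.assoc mult.commute)
    qed
    finally show "(\<integral>\<^sup>+u. ennreal (Ft u) * ennreal (kap h u) \<partial>unit_leb) \<le> ennreal (c * b / J 1) * ZX F"
      using J1_pos by (subst (asm) ennreal_mult_le_mult_iff) auto
  qed auto
  also have "\<dots> = ennreal (b * (CL + 2 * K * c / J 1)) * ZX F"
  proof -
    have "ennreal b * (ennreal CL * ZX F) = ennreal (b * CL) * ZX F"
      using b CL by (simp add: ennreal_mult mult.assoc)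
    moreover have "ennreal (2 * K) * (ennreal (c * b / J 1) * ZX F) = ennreal (2 * K * (c * b / J 1)) * ZX F"
      using K_pos c b J1_pos by (subst ennreal_mult) (auto simp: mult.assoc)
    moreover have "ennreal (b * CL) + ennreal (2 * K * (c * b / J 1)) = ennreal (b * CL + 2 * K * (c * b / J 1))"
      using b CL K_pos c J1_pos by (intro ennreal_plus[symmetric]) auto
    moreover have "b * CL + 2 * K * (c * b / J 1) = b * (CL + 2 * K * c / J 1)" by (simp add: algebra_simps)
    ultimately show ?thesis by (simp only: distrib_right[symmetric])
  qed
  finally show ?thesis .
qed

text \<open>As \<open>HP h\<close> is nonincreasing, Hardy-Littlewood allows the test functions to
  be rearranged. The averaging estimate needs a positive \<open>b\<close>, so \<open>b\<close> is
  taken slightly above the associate norm and the excess tends to 0, which includes the case of norm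
  0.\<close>

lemma dual_bound:
  assumes c: "0 \<le> c" and U: "\<And>F. F \<in> Mplus \<Longrightarrow> ZX F < \<infinity> \<Longrightarrow>
      ZY (\<lambda>s. rearr unit_leb F (Psi s) / v s) \<le> ennreal c * ZX F"
  shows "\<exists>d>0. \<forall>h. decreasing h \<longrightarrow> associate ZY h < \<infinity> \<longrightarrow> associate ZX (HP h) \<le> ennreal d * associate ZY h"
proof -
  note P = prob_space_unit_leb
  obtain CL where CL: "0 < CL" "\<And>f. f \<in> Mplus \<Longrightarrow> (\<integral>\<^sup>+t. ennreal (f t) \<partial>unit_leb) \<le> ennreal CL * ZX f"
    using zx.Z_L1 by blast
  define d where "d = CL + 2 * K * c / J 1"
  have d: "0 < d" unfolding d_def using CL(1) K_pos c J1_pos by (intro add_pos_nonneg) auto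
  have "associate ZX (HP h) \<le> ennreal d * associate ZY h" if h: "decreasing h" and fin: "associate ZY h < \<infinity>" for h
  proof -
    have dH: "decreasing (HP h)" by (rule decreasing_HP[OF h])
    have Hm: "HP h \<in> borel_measurable unit_leb" by (rule decreasing_measurable[OF dH])
    have *: "associate ZX (HP h) \<le> ennreal (b * d)" if b: "0 < b" and hb: "associate ZY h \<le> ennreal b" for b
      unfolding associate_def[of ZX]
    proof (rule SUP_least)
      fix g assume "g \<in> {g \<in> Mplus. ZX g \<le> 1}"
      then have g: "g \<in> Mplus" "ZX g \<le> 1" by auto
      have gm: "g \<in> borel_measurable unit_leb" using g by auto
      have dg: "decreasing (rearr unit_leb g)" by (rule decreasing_rearr[OF P gm])
      have Zg: "ZX (rearr unit_leb g) = ZX g"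
        by (rule zx.Z_rearr_cong[OF rearr_Mplus[OF P gm] g(1)]) (simp only: rearr_rearr[OF P gm])
      have "(\<integral>\<^sup>+t. ennreal (HP h t * g t) \<partial>unit_leb) = (\<integral>\<^sup>+t. ennreal (norm (HP h t)) * ennreal (norm (g t)) \<partial>unit_leb)"
        by (rule nn_integral_unit_leb_cong) (use decreasing_nonneg[OF dH] Mplus_nonneg[OF g(1)] in \<open>auto simp: ennreal_mult\<close>)
      also have "\<dots> \<le> (\<integral>\<^sup>+t. ennreal (rearr unit_leb (HP h) t) * ennreal (rearr unit_leb g t) \<partial>unit_leb)"
        by (rule hardy_littlewood(1)[OF P Hm gm])
      also have "\<dots> = (\<integral>\<^sup>+t. ennreal (rearr unit_leb g t) * ennreal (HP h t) \<partial>unit_leb)"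
        by (rule nn_integral_cong_AE) (use decreasing_rearr_AE[OF dH] in eventually_elim, simp add: mult.commute)
      also have "\<dots> \<le> ennreal (b * (CL + 2 * K * c / J 1)) * ZX (rearr unit_leb g)"
        by (rule averaging_estimate[OF h b hb dg _ c U _ CL(2)])
           (use Zg g(2) CL(1) in \<open>auto intro: le_less_trans\<close>)
      also have "\<dots> \<le> ennreal (b * (CL + 2 * K * c / J 1)) * 1"
        unfolding Zg by (intro mult_left_mono g) auto
      finally show "(\<integral>\<^sup>+t. ennreal (HP h t * g t) \<partial>unit_leb) \<le> ennreal (b * d)" by (simp add: d_def)
    qed
    obtain z where z: "associate ZY h = ennreal z" "0 \<le> z" using fin by (cases "associate ZY h") auto
    have "associate ZX (HP h) \<le> ennreal ((z + 1) * d)" using z by (intro *) (auto intro: ennreal_leI)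
    then obtain x where x: "associate ZX (HP h) = ennreal x" "0 \<le> x"
      by (cases "associate ZX (HP h)") (auto simp: top_unique)
    have "x \<le> z * d"
    proof (rule field_le_epsilon)
      fix e :: real assume e: "0 < e"
      have "associate ZX (HP h) \<le> ennreal ((z + e / d) * d)"
        using z e d by (intro *) (auto intro!: ennreal_leI add_nonneg_pos)
      then have "x \<le> (z + e / d) * d" using x z e d by (simp add: ennreal_le_iff)
      then show "x \<le> z * d + e" using d by (simp add: distrib_right)
    qed
    then show ?thesis using x z d by (simp add: ennreal_mult[symmetric] mult.commute ennreal_leI)
  qed
  with d show ?thesis by blast
qed

lemma pair_bound:
  assumes c: "0 \<le> c" and D: "\<And>k. k \<in> Mplus \<Longrightarrow> associate ZY (rearr unit_leb k) \<le> 1 \<Longrightarrow>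
      associate ZX (HP (rearr unit_leb k)) \<le> ennreal c"
    and G: "decreasing G" and F: "decreasing F" and ZF: "ZX F < \<infinity>" and d: "0 \<le> d"
    and dom: "\<And>t. t \<in> {0<..<1} \<Longrightarrow> (\<integral>\<^sup>+s. ennreal (G s * w s) * indicator {..<t} s \<partial>unit_leb) \<le>
       ennreal d * (\<integral>\<^sup>+s. ennreal (F s) * indicator {..<Psi t} s \<partial>unit_leb)"
  shows "ZY G \<le> ennreal (c * d) * ZX F"
proof (rule zy.norm_le_dual)
  note P = prob_space_unit_leb
  show "antimono_on {0<..<1} G" "\<And>t. t \<in> {0<..<1} \<Longrightarrow> 0 \<le> G t" using G by (auto simp: decreasing_def)
  fix k assume k: "k \<in> Mplus" "associate ZY (rearr unit_leb k) \<le> 1"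
  define h where "h = rearr unit_leb k"
  have km: "k \<in> borel_measurable unit_leb" using k by auto
  have h: "decreasing h" unfolding h_def by (rule decreasing_rearr[OF P km])
  have dH: "decreasing (HP h)" by (rule decreasing_HP[OF h])
  have [measurable]: "G \<in> borel_measurable unit_leb" "F \<in> borel_measurable unit_leb"
    using G F by (auto intro: decreasing_measurable)
  have [measurable]: "(\<lambda>s. F (Psi s)) \<in> borel_measurable unit_leb" "(\<lambda>s. HP h (Psi s)) \<in> borel_measurable unit_leb"
    using F dH by (auto intro!: antimono_on_unit_leb antimono_on_compose_Psi simp: decreasing_def)
  \<comment> \<open>The density whose integral up to \<open>t\<close> is, by substitution,
    \<open>d\<close> times the integral of \<open>F\<close> up to \<open>Psi t\<close>. The
    hypothesis then has the shape required by Hardy's lemma.\<close>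
  let ?b = "\<lambda>s. ennreal (d / J 1) * (ennreal (F (Psi s)) * ennreal (q s))"
  have dJ: "0 \<le> d / J 1" using d J1_pos by simp
  have dJ1: "ennreal (d / J 1) * ennreal (J 1) = ennreal d" using d J1_pos by (simp add: ennreal_mult[symmetric])
  have g2: "(\<lambda>u. F u * HP h u) \<in> borel_measurable (restrict_space borel {0<..<1})"
    by (rule borel_measurable_times[OF decreasing_borel[OF F] decreasing_borel[OF dH]])
  \<comment> \<open>At \<open>u = Psi s\<close> the supremum \<open>HP h\<close> includes
    \<open>kap h u = h s / w s\<close>. Passing to it costs nothing here and makes the second factor
    nonincreasing, which \<open>kap h\<close> alone need not be.\<close>
  have "(\<integral>\<^sup>+t. ennreal (G t) * ennreal (h t) \<partial>unit_leb) \<le> (\<integral>\<^sup>+t. ennreal (G t * w t) * ennreal (HP h (Psi t)) \<partial>unit_leb)"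
  proof (rule nn_integral_unit_leb_mono)
    fix s :: real assume s: "s \<in> {0<..<1}"
    have "h s / w s = kap h (Psi s)" using Phi_Psi[of s] s by (simp add: kap_def)
    also have "\<dots> \<le> HP h (Psi s)" using Psi_open[OF s] by (intro kap_le_HP[OF h]) auto
    finally have "h s \<le> w s * HP h (Psi s)" using w_pos[OF s] by (simp add: divide_le_eq mult.commute)
    then have "G s * h s \<le> G s * (w s * HP h (Psi s))"
      using decreasing_nonneg[OF G s] by (intro mult_left_mono) auto
    then have "G s * h s \<le> G s * w s * HP h (Psi s)" by (simp add: mult.assoc)
    then show "ennreal (G s) * ennreal (h s) \<le> ennreal (G s * w s) * ennreal (HP h (Psi s))"
      using decreasing_nonneg[OF G s] decreasing_nonneg[OF h s] w_pos[OF s] decreasing_nonneg[OF dH Psi_open[OF s]]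
      by (simp add: ennreal_mult[symmetric] ennreal_leI)
  qed
  also have "\<dots> \<le> (\<integral>\<^sup>+t. ?b t * ennreal (HP h (Psi t)) \<partial>unit_leb)"
  proof (rule hardy_lemma)
    show "antimono_on {0<..<1} (\<lambda>s. HP h (Psi s))" using dH by (intro antimono_on_compose_Psi) (simp add: decreasing_def)
    show "0 \<le> HP h (Psi t)" if "t \<in> {0<..<1}" for t by (rule decreasing_nonneg[OF dH Psi_open[OF that]])
    fix t :: real assume t: "t \<in> {0<..<1}"
    have "indicator {..<Psi t} \<in> borel_measurable (borel :: real measure)" by (rule borel_measurable_indicator) simp
    then have g1: "(\<lambda>u. F u * indicator {..<Psi t} u) \<in> borel_measurable (restrict_space borel {0<..<1})"
      by (rule borel_measurable_times[OF decreasing_borel[OF F] measurable_restrict_space1])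
    have "(\<integral>\<^sup>+s. ?b s * indicator {..<t} s \<partial>unit_leb) =
        (\<integral>\<^sup>+s. ennreal (d / J 1) * (ennreal (F (Psi s) * indicator {..<Psi t} (Psi s)) * ennreal (q s)) \<partial>unit_leb)"
      by (rule nn_integral_unit_leb_cong) (use t in \<open>auto simp: Psi_less_iff split: split_indicator\<close>)
    also have "\<dots> = ennreal (d / J 1) * (\<integral>\<^sup>+s. ennreal (F (Psi s) * indicator {..<Psi t} (Psi s)) * ennreal (q s) \<partial>unit_leb)"
    proof (rule nn_integral_cmult)
      have [measurable]: "Psi \<in> borel_measurable unit_leb" by (rule mono_on_unit_leb[OF Psi_mono])
      show "(\<lambda>s. ennreal (F (Psi s) * indicator {..<Psi t} (Psi s)) * ennreal (q s)) \<in> borel_measurable unit_leb"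
        by measurable
    qed
    also have "\<dots> = ennreal (d / J 1) * (ennreal (J 1) * (\<integral>\<^sup>+u. ennreal (F u * indicator {..<Psi t} u) \<partial>unit_leb))"
      by (simp only: nn_integral_substitution_Psi[OF g1])
    also have "\<dots> = ennreal d * (\<integral>\<^sup>+u. ennreal (F u) * indicator {..<Psi t} u \<partial>unit_leb)"
      unfolding mult.assoc[symmetric] dJ1
      by (intro arg_cong2[where f=times] refl nn_integral_cong) (auto split: split_indicator)
    finally show "(\<integral>\<^sup>+s. ennreal (G s * w s) * indicator {..<t} s \<partial>unit_leb) \<le> (\<integral>\<^sup>+s. ?b s * indicator {..<t} s \<partial>unit_leb)"
      using dom[OF t] by simp
  qed measurable
  also have "\<dots> = (\<integral>\<^sup>+t. ennreal (d / J 1) * (ennreal (F (Psi t) * HP h (Psi t)) * ennreal (q t)) \<partial>unit_leb)"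
    by (rule nn_integral_unit_leb_cong)
       (use decreasing_nonneg[OF dH Psi_open] decreasing_nonneg[OF F Psi_open] in \<open>simp add: ennreal_mult mult_ac\<close>)
  also have "\<dots> = ennreal (d / J 1) * (\<integral>\<^sup>+t. ennreal (F (Psi t) * HP h (Psi t)) * ennreal (q t) \<partial>unit_leb)"
    by (rule nn_integral_cmult) measurable
  also have "\<dots> = ennreal (d / J 1) * (ennreal (J 1) * (\<integral>\<^sup>+u. ennreal (F u * HP h u) \<partial>unit_leb))"
    by (simp only: nn_integral_substitution_Psi[OF g2])
  also have "\<dots> = ennreal d * (\<integral>\<^sup>+u. ennreal (F u) * ennreal (HP h u) \<partial>unit_leb)"
    unfolding mult.assoc[symmetric] dJ1
    by (intro arg_cong2[where f=times] refl nn_integral_unit_leb_cong)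
       (simp add: ennreal_mult decreasing_nonneg[OF dH] decreasing_nonneg[OF F])
  also have "\<dots> \<le> ennreal d * (ZX F * associate ZX (HP h))"
    by (intro mult_left_mono zx.holder decreasing_Mplus F dH ZF) auto
  also have "\<dots> \<le> ennreal d * (ZX F * ennreal c)"
    unfolding h_def by (intro mult_left_mono D k) auto
  also have "\<dots> = ennreal (c * d) * ZX F" using c d by (simp add: ennreal_mult mult_ac)
  finally show "(\<integral>\<^sup>+t. ennreal (G t) * ennreal (rearr unit_leb k t) \<partial>unit_leb) \<le> ennreal (c * d) * ZX F"
    by (simp add: h_def)
qed

end

section \<open>The tail operator\<close>

text \<open>Multiplication by a small positive or negative power makes \<open>b\<close> comparable
  with a monotone function, and each comparison is used at both \<open>r\<close> and
  \<open>s\<close>; hence the squares of the comparison constants.\<close>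

lemma slowly_varying_powr_le:
  assumes b: "slowly_varying b" and p: "0 < p"
  shows "\<exists>c\<ge>1. \<forall>r s. 0 < r \<longrightarrow> r \<le> s \<longrightarrow> s < 1 \<longrightarrow>
    b r powr p \<le> c * (s / r) powr (1/4) * b s powr p \<and> b s powr p \<le> c * (s / r) powr (1/4) * b r powr p"
proof -
  \<comment> \<open>Chosen so that the p-th power of the bound carries the exponent 1/4.\<close>
  define e where "e = 1 / (4 * p)"
  have e: "0 < e" "e * p = 1/4" using p by (auto simp: e_def)
  have pos: "0 < b t" if "t \<in> {0<..<1}" for t using b that by (simp add: slowly_varying_def)
  obtain bp bm where bp: "mono_on {0<..<1} bp" and bm: "antimono_on {0<..<1} bm"
    and "equiv_on {0<..<1} (\<lambda>t. t powr e * b t) bp" "equiv_on {0<..<1} (\<lambda>t. t powr (-e) * b t) bm"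
    using b e unfolding slowly_varying_def by blast
  then obtain c1 c2 where c: "0 < c1" "0 < c2"
    and 1: "\<And>t. t \<in> {0<..<1} \<Longrightarrow> t powr e * b t \<le> c1 * bp t \<and> bp t \<le> c1 * (t powr e * b t)"
    and 2: "\<And>t. t \<in> {0<..<1} \<Longrightarrow> t powr (-e) * b t \<le> c2 * bm t \<and> bm t \<le> c2 * (t powr (-e) * b t)"
    unfolding equiv_on_def by blast
  define d where "d = max 1 (max (c1 * c1) (c2 * c2))"
  have d: "1 \<le> d" "c1 * c1 \<le> d" "c2 * c2 \<le> d" by (auto simp: d_def)
  have step: "x powr p \<le> d powr p * (s / r) powr (1/4) * y powr p"
    if "x \<le> d * (s / r) powr e * y" "0 \<le> x" "0 \<le> y" "0 < r" "0 < s" for x y r s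
  proof -
    have "x powr p \<le> (d * (s / r) powr e * y) powr p" using that p by (intro powr_mono2) auto
    also have "\<dots> = d powr p * ((s / r) powr e) powr p * y powr p" using that d by (simp add: powr_mult)
    also have "((s / r) powr e) powr p = (s / r) powr (1/4)" by (simp add: powr_powr e)
    finally show ?thesis .
  qed
  show ?thesis
  proof (intro exI[of _ "d powr p"] conjI allI impI)
    show "1 \<le> d powr p" using d p by (simp add: ge_one_powr_ge_zero)
    fix r s :: real assume rs: "0 < r" "r \<le> s" "s < 1"
    then have R: "r \<in> {0<..<1}" and S: "s \<in> {0<..<1}" by auto
    have "r powr e * b r \<le> c1 * bp r" using 1[OF R] by blast
    also have "\<dots> \<le> c1 * bp s" using monotone_onD[OF bp R S rs(2)] c by simp
    also have "\<dots> \<le> c1 * (c1 * (s powr e * b s))" using 1[OF S] c by (intro mult_left_mono) auto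
    also have "\<dots> = (c1 * c1) * (s powr e * b s)" by simp
    also have "\<dots> \<le> d * (s powr e * b s)" using d pos[OF S] by (intro mult_right_mono) auto
    finally have "b r \<le> d * (s powr e * b s) / r powr e" using rs by (simp add: pos_le_divide_eq mult.commute)
    also have "\<dots> = d * (s / r) powr e * b s" using rs by (simp add: powr_divide)
    finally show "b r powr p \<le> d powr p * (s / r) powr (1/4) * b s powr p"
      using rs pos[OF R] pos[OF S] by (intro step) auto
    have "s powr (-e) * b s \<le> c2 * bm s" using 2[OF S] by blast
    also have "\<dots> \<le> c2 * bm r" using monotone_onD[OF bm R S rs(2)] c by simp
    also have "\<dots> \<le> c2 * (c2 * (r powr (-e) * b r))" using 2[OF R] c by (intro mult_left_mono) auto
    also have "\<dots> = (c2 * c2) * (r powr (-e) * b r)" by simp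
    also have "\<dots> \<le> d * (r powr (-e) * b r)" using d pos[OF R] by (intro mult_right_mono) auto
    finally have "b s \<le> s powr e * (d * (r powr (-e) * b r))"
      using rs by (simp add: powr_minus divide_inverse[symmetric] pos_divide_le_eq mult.commute inverse_eq_divide)
    also have "\<dots> = d * (s powr e / r powr e) * b r"
      unfolding powr_minus divide_inverse by (simp only: mult_ac)
    also have "s powr e / r powr e = (s / r) powr e" using rs by (simp add: powr_divide)
    finally show "b s powr p \<le> d powr p * (s / r) powr (1/4) * b r powr p"
      using rs pos[OF R] pos[OF S] by (intro step) auto
  qed
qed

lemma nn_integral_set_unit_leb_upper:
  assumes "0 \<le> t"
  shows "(\<integral>\<^sup>+s\<in>{t<..<1}. f s \<partial>lebesgue) = (\<integral>\<^sup>+s. f s * indicator {t<..} s \<partial>unit_leb)"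
  unfolding nn_integral_unit_leb nn_integral_completion
  by (rule nn_integral_cong) (use assms in \<open>auto split: split_indicator\<close>)

lemma class_B_weights:
  assumes p: "0 < p" and B: "(b1, b2) \<in> class_B p"
  obtains C D where "gauss_weights p b1 b2 C" "0 \<le> D"
    "\<And>t. t \<in> {0<..<1} \<Longrightarrow> ennreal (b2 t powr p) *
      (\<integral>\<^sup>+s. ennreal (1 / (s * b1 s powr p)) * indicator {t<..} s \<partial>unit_leb) \<le> ennreal D"
proof -
  have sv: "slowly_varying b1" "slowly_varying b2" and mono: "antimono_on {0<..<1} b1" "mono_on {0<..<1} b2"
    and sup: "(SUP t\<in>{0<..<1}. ennreal (b2 t powr p) *
        (\<integral>\<^sup>+s\<in>{t<..<1}. ennreal (1 / (s * b1 s powr p)) \<partial>lebesgue)) < \<infinity>" (is "?S < _")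
    using B by (auto simp: class_B_def)
  obtain c1 where c1: "1 \<le> c1" "\<And>r s. 0 < r \<Longrightarrow> r \<le> s \<Longrightarrow> s < 1 \<Longrightarrow> b1 r powr p \<le> c1 * (s / r) powr (1/4) * b1 s powr p"
    using slowly_varying_powr_le[OF sv(1) p] by blast
  obtain c2 where c2: "1 \<le> c2" "\<And>r s. 0 < r \<Longrightarrow> r \<le> s \<Longrightarrow> s < 1 \<Longrightarrow> b2 s powr p \<le> c2 * (s / r) powr (1/4) * b2 r powr p"
    using slowly_varying_powr_le[OF sv(2) p] by blast
  have le: "c * x * y \<le> max c1 c2 * x * y" if "c \<le> max c1 c2" "0 \<le> x" "0 \<le> y" for c x y :: real
    using that by (intro mult_right_mono) auto
  have "gauss_weights p b1 b2 (max c1 c2)"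
  proof
    show "b1 r powr p \<le> max c1 c2 * (s / r) powr (1/4) * b1 s powr p" if "0 < r" "r \<le> s" "s < 1" for r s
      using c1(2)[OF that] le[of c1 "(s / r) powr (1/4)" "b1 s powr p"] by simp
    show "b2 s powr p \<le> max c1 c2 * (s / r) powr (1/4) * b2 r powr p" if "0 < r" "r \<le> s" "s < 1" for r s
      using c2(2)[OF that] le[of c2 "(s / r) powr (1/4)" "b2 r powr p"] by simp
  qed (use p c1 sv mono in \<open>auto simp: slowly_varying_def\<close>)
  moreover obtain D where D: "?S = ennreal D" "0 \<le> D" using sup by (cases ?S) auto
  moreover have "ennreal (b2 t powr p) *
      (\<integral>\<^sup>+s. ennreal (1 / (s * b1 s powr p)) * indicator {t<..} s \<partial>unit_leb) \<le> ennreal D" if "t \<in> {0<..<1}" for t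
    unfolding D(1)[symmetric] using that
    by (intro SUP_upper2[of t]) (auto simp: nn_integral_set_unit_leb_upper)
  ultimately show ?thesis using that by blast
qed

lemma rearr_of_real: "rearr M (\<lambda>x. complex_of_real (g x)) = rearr M g"
  by (rule rearr_cong_distribution) simp

lemma epowr_le_cmult_imp:
  assumes "0 < p" "0 < c" and le: "epowr y p \<le> ennreal c * epowr x p"
  shows "y \<le> ennreal (c powr (1/p)) * x"
proof -
  have "epowr (epowr y p) (1/p) \<le> epowr (ennreal c * epowr x p) (1/p)"
    using le assms by (intro epowr_mono) auto
  then show ?thesis using assms by (simp add: epowr_cmult)
qed

section \<open>The kernel of the tail operator\<close>

context gauss_weights
begin

text \<open>The largest nondecreasing minorant of \<open>s * w s\<close> on the unit interval. It
  loses at most the factor \<open>C\<close>, because \<open>s * w s\<close> is almost increasing,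
  and it makes the kernel built from it exactly monotone.\<close>

definition qn :: "real \<Rightarrow> real" where "qn s = (INF r\<in>{s..<1}. r * w r)"

lemma qn_bounds:
  assumes s: "s \<in> {0<..<1}"
  shows "qn s \<le> s * w s" "s * w s / C \<le> qn s" "0 < qn s"
proof -
  have bdd: "bdd_below ((\<lambda>r. r * w r) ` {s..<1})"
    using s w_pos by (intro bdd_belowI2[of _ 0]) (auto intro!: mult_nonneg_nonneg less_imp_le)
  show "qn s \<le> s * w s" unfolding qn_def using s by (intro cINF_lower bdd) auto
  show *: "s * w s / C \<le> qn s"
    unfolding qn_def
  proof (rule cINF_greatest)
    fix r assume "r \<in> {s..<1}"
    then have "s * w s \<le> C * (r * w r)" using s by (intro w_times_almost_mono) auto
    then show "s * w s / C \<le> r * w r" using C by (simp add: pos_divide_le_eq mult.commute)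
  qed (use s in auto)
  have "0 < s * w s / C" using s w_pos[OF s] C by simp
  with * show "0 < qn s" by linarith
qed

lemma qn_mono: "s \<in> {0<..<1} \<Longrightarrow> s \<le> t \<Longrightarrow> t < 1 \<Longrightarrow> qn s \<le> qn t"
proof -
  assume s: "s \<in> {0<..<1}" and st: "s \<le> t" "t < 1"
  have "bdd_below ((\<lambda>r. r * w r) ` {s..<1})"
    using s w_pos by (intro bdd_belowI2[of _ 0]) (auto intro!: mult_nonneg_nonneg less_imp_le)
  then show ?thesis unfolding qn_def using st by (intro cINF_superset_mono) auto
qed

text \<open>The integral is split at \<open>Psi t\<close>, which is at least \<open>t\<close>. Below
  it the kernel is at most 1. Above it \<open>F\<close> is at most \<open>F (Psi t)\<close>, the
  tail of the kernel is bounded by (d), and \<open>t * q t\<close> is at most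
  \<open>J 1 * Psi t\<close>, which leaves \<open>F (Psi t) * Psi t\<close>, a lower bound for the
  integral of \<open>F\<close>.\<close>

lemma S_tail_bound:
  assumes D: "0 \<le> D" "ennreal (v t) * (\<integral>\<^sup>+s. ennreal (1 / (s * w s)) * indicator {t<..} s \<partial>unit_leb) \<le> ennreal D"
    and F: "antimono_on {0<..<1} F" "\<And>t. t \<in> {0<..<1} \<Longrightarrow> 0 \<le> F t" and t: "t \<in> {0<..<1}"
  shows "(\<integral>\<^sup>+s. ennreal (F s) * ennreal (qn (min s t) / qn s) \<partial>unit_leb) \<le>
    ennreal (1 + C * D * J 1) * (\<integral>\<^sup>+s. ennreal (F s) * indicator {..<Psi t} s \<partial>unit_leb)"
proof -
  have [measurable]: "F \<in> borel_measurable unit_leb" by (rule antimono_on_unit_leb[OF F(1)])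
  let ?I = "\<integral>\<^sup>+s. ennreal (F s) * indicator {..<Psi t} s \<partial>unit_leb"
  have Pt: "Psi t \<in> {0<..<1}" "t \<le> Psi t" using Psi_open[OF t] Psi_ge[OF t] by auto
  have FP: "0 \<le> F (Psi t)" by (rule F(2)[OF Pt(1)])
  let ?c = "F (Psi t) * (C * (t * w t))"
  have c0: "0 \<le> ?c" using FP C t w_pos[OF t] by simp
  have ae: "AE s in unit_leb. ennreal (F s) * ennreal (qn (min s t) / qn s) \<le>
      ennreal (F s) * indicator {..<Psi t} s + ennreal ?c * (ennreal (1 / (s * w s)) * indicator {t<..} s)"
    using AE_unit_leb_neq[of t] AE_space
  proof eventually_elim
    case (elim s)
    then have s: "s \<in> {0<..<1}" "s \<noteq> t" by auto
    show ?case
    proof (cases "s < Psi t")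
      case True
      have "qn (min s t) / qn s \<le> 1"
        using qn_mono[of "min s t" s] s t qn_bounds(3)[OF s(1)] by (auto simp: min_def)
      then have "ennreal (F s) * ennreal (qn (min s t) / qn s) \<le> ennreal (F s) * ennreal 1"
        by (intro mult_left_mono ennreal_leI) auto
      then show ?thesis using True by (simp add: add_increasing2)
    next
      case False
      then have st: "t < s" "Psi t \<le> s" using Pt s by auto
      have "qn t / qn s \<le> (t * w t) / (s * w s / C)"
        using qn_bounds[OF t] qn_bounds[OF s(1)] s t w_pos[OF t] w_pos[OF s(1)] C by (intro frac_le) auto
      also have "\<dots> = C * (t * w t) * (1 / (s * w s))" by simp
      finally have "F s * (qn t / qn s) \<le> F (Psi t) * (C * (t * w t) * (1 / (s * w s)))"
        using monotone_onD[OF F(1) Pt(1) s(1) st(2)] F(2)[OF s(1)] FP qn_bounds(3)[OF t] qn_bounds(3)[OF s(1)]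
        by (intro mult_mono) auto
      also have "\<dots> = ?c * (1 / (s * w s))" by simp
      finally have "ennreal (F s * (qn t / qn s)) \<le> ennreal (?c * (1 / (s * w s)))" by (rule ennreal_leI)
      then have "ennreal (F s) * ennreal (qn t / qn s) \<le> ennreal ?c * ennreal (1 / (s * w s))"
        using F(2)[OF s(1)] c0 by (simp only: ennreal_mult')
      then show ?thesis using st by (simp add: add_increasing)
    qed
  qed
  have "(\<integral>\<^sup>+s. ennreal (F s) * ennreal (qn (min s t) / qn s) \<partial>unit_leb) \<le>
      (\<integral>\<^sup>+s. ennreal (F s) * indicator {..<Psi t} s + ennreal ?c * (ennreal (1 / (s * w s)) * indicator {t<..} s) \<partial>unit_leb)"
    by (rule nn_integral_mono_AE[OF ae])
  also have "\<dots> = ?I + ennreal ?c * (\<integral>\<^sup>+s. ennreal (1 / (s * w s)) * indicator {t<..} s \<partial>unit_leb)"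
    by (subst nn_integral_add, measurable, subst nn_integral_cmult) measurable
  also have "\<dots> \<le> ?I + ennreal (C * D * J 1) * ?I"
  proof (rule add_left_mono)
    let ?T = "\<integral>\<^sup>+s. ennreal (1 / (s * w s)) * indicator {t<..} s \<partial>unit_leb"
    \<comment> \<open>Writing \<open>w\<close> as \<open>q * v\<close> supplies the factor
      \<open>v t\<close> that the hypothesis on the tail demands.\<close>
    have c_eq: "?c = F (Psi t) * C * (t * q t) * v t" using v_pos[OF t] by (simp add: q_def)
    have "ennreal ?c = ennreal (F (Psi t) * C * (t * q t)) * ennreal (v t)"
      unfolding c_eq using v_pos[OF t] by (intro ennreal_mult'') auto
    then have "ennreal ?c * ?T = ennreal (F (Psi t) * C * (t * q t)) * (ennreal (v t) * ?T)"
      by (simp only: mult.assoc)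
    also have "\<dots> \<le> ennreal (F (Psi t) * C * (t * q t)) * ennreal D" by (intro mult_left_mono D) auto
    also have "\<dots> = ennreal (F (Psi t) * C * (t * q t) * D)"
      using FP C t q_pos[OF t] D(1) by (intro ennreal_mult[symmetric]) auto
    also have "\<dots> \<le> ennreal ((C * D * J 1) * (F (Psi t) * Psi t))"
    proof (rule ennreal_leI)
      have "F (Psi t) * C * (t * q t) * D \<le> F (Psi t) * C * (J 1 * Psi t) * D"
        using Psi_lower[OF t] FP C D(1) by (intro mult_right_mono mult_left_mono) auto
      then show "F (Psi t) * C * (t * q t) * D \<le> (C * D * J 1) * (F (Psi t) * Psi t)" by (simp add: mult_ac)
    qed
    also have "\<dots> = ennreal (C * D * J 1) * ennreal (F (Psi t) * Psi t)"
      using C D(1) J1_pos by (intro ennreal_mult') auto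
    also have "ennreal (F (Psi t) * Psi t) \<le> ?I"
    proof -
      have "ennreal (F (Psi t) * (Psi t - 0)) = (\<integral>\<^sup>+r. ennreal (F (Psi t)) * indicator {0..<Psi t} r \<partial>unit_leb)"
        using FP Pt by (intro nn_integral_unit_leb_const[symmetric]) auto
      also have "\<dots> \<le> ?I"
        by (rule nn_integral_unit_leb_mono)
           (use Pt monotone_onD[OF F(1)] in \<open>auto split: split_indicator intro!: ennreal_leI\<close>)
      finally show ?thesis by simp
    qed
    finally show "ennreal ?c * ?T \<le> ennreal (C * D * J 1) * ?I" by (simp add: mult_left_mono)
  qed
  also have "\<dots> = ennreal (1 + C * D * J 1) * ?I"
    using C D(1) J1_pos by (subst ennreal_plus) (auto simp: distrib_right)
  finally show ?thesis .
qed

text \<open>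
  Interchanging the integrations turns the left-hand side into an integral of \<open>F\<close> against
  a kernel that is equivalent to a nonincreasing one, so that \<open>F\<close> may be replaced by its rearrangement.
\<close>
lemma S_domination:
  assumes D: "0 \<le> D" "ennreal (v t) * (\<integral>\<^sup>+s. ennreal (1 / (s * w s)) * indicator {t<..} s \<partial>unit_leb) \<le> ennreal D"
    and F: "F \<in> Mplus" and t: "t \<in> {0<..<1}"
  shows "(\<integral>\<^sup>+r. (\<integral>\<^sup>+s. ennreal (F s / (s * w s)) * indicator {r<..} s \<partial>unit_leb) * ennreal (w r) * indicator {..<t} r \<partial>unit_leb) \<le>
    ennreal (K * C * (1 + C * D * J 1)) * (\<integral>\<^sup>+s. ennreal (rearr unit_leb F s) * indicator {..<Psi t} s \<partial>unit_leb)"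
proof -
  note P = prob_space_unit_leb
  interpret U: prob_space unit_leb by (rule P)
  interpret UU: pair_sigma_finite unit_leb unit_leb ..
  have Fm [measurable]: "F \<in> borel_measurable unit_leb" using F by auto
  \<comment> \<open>Integrating \<open>w\<close> over \<open>r < min s t\<close> gives at most
    \<open>K * min s t * w (min s t)\<close>, and dividing by \<open>s * w s\<close> leaves at most
    \<open>K * C * e s\<close>. This kernel is 1 up to \<open>t\<close> and nonincreasing
    afterwards.\<close>
  define e where "e s = qn (min s t) / qn s" for s
  have ea: "antimono_on {0<..<1} e"
  proof (rule monotone_onI)
    fix r s :: real assume rs: "r \<in> {0<..<1}" "s \<in> {0<..<1}" "r \<le> s"
    note Q = qn_bounds(3)[OF rs(1)] qn_bounds(3)[OF rs(2)] qn_bounds(3)[OF t]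
    consider "s \<le> t" | "r \<le> t" "t < s" | "t < r" by linarith
    then show "e s \<le> e r"
    proof cases
      case 1
      then show ?thesis using rs Q by (simp add: e_def min_def)
    next
      case 2
      then show ?thesis using rs Q qn_mono[OF t, of s] by (simp add: e_def min_def)
    next
      case 3
      then show ?thesis using rs Q qn_mono[OF rs(1), of s] by (auto simp: e_def min_def intro!: divide_left_mono)
    qed
  qed
  have e0: "0 \<le> e s" if "s \<in> {0<..<1}" for s
    using qn_bounds(3)[OF that] qn_bounds(3)[OF t] by (auto simp: e_def min_def)
  have em [measurable]: "e \<in> borel_measurable unit_leb" by (rule antimono_on_unit_leb[OF ea])
  have "(\<integral>\<^sup>+r. (\<integral>\<^sup>+s. ennreal (F s / (s * w s)) * indicator {r<..} s \<partial>unit_leb) * ennreal (w r) * indicator {..<t} r \<partial>unit_leb) =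
      (\<integral>\<^sup>+r. (\<integral>\<^sup>+s. ennreal (w r) * ennreal (F s / (s * w s)) * (if r < s \<and> r < t then 1 else 0) \<partial>unit_leb) \<partial>unit_leb)"
  proof (rule nn_integral_unit_leb_cong)
    fix r :: real
    have "(\<integral>\<^sup>+s. ennreal (w r) * ennreal (F s / (s * w s)) * (if r < s \<and> r < t then 1 else 0) \<partial>unit_leb) =
        (\<integral>\<^sup>+s. (ennreal (w r) * indicator {..<t} r) * (ennreal (F s / (s * w s)) * indicator {r<..} s) \<partial>unit_leb)"
      by (rule nn_integral_unit_leb_cong) (auto split: split_indicator)
    also have "\<dots> = (ennreal (w r) * indicator {..<t} r) * (\<integral>\<^sup>+s. ennreal (F s / (s * w s)) * indicator {r<..} s \<partial>unit_leb)"
      by (rule nn_integral_cmult) measurable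
    finally show "(\<integral>\<^sup>+s. ennreal (F s / (s * w s)) * indicator {r<..} s \<partial>unit_leb) * ennreal (w r) * indicator {..<t} r =
        (\<integral>\<^sup>+s. ennreal (w r) * ennreal (F s / (s * w s)) * (if r < s \<and> r < t then 1 else 0) \<partial>unit_leb)"
      by (simp add: mult_ac)
  qed
  also have "\<dots> = (\<integral>\<^sup>+s. (\<integral>\<^sup>+r. ennreal (w r) * ennreal (F s / (s * w s)) * (if r < s \<and> r < t then 1 else 0) \<partial>unit_leb) \<partial>unit_leb)"
    by (rule UU.Fubini'[symmetric]) measurable
  also have "\<dots> \<le> (\<integral>\<^sup>+s. ennreal (K * C) * (ennreal (F s) * ennreal (e s)) \<partial>unit_leb)"
  proof (rule nn_integral_unit_leb_mono)
    fix s :: real assume s: "s \<in> {0<..<1}"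
    let ?m = "min s t"
    have m: "?m \<in> {0<..<1}" using s t by auto
    have "(\<integral>\<^sup>+r. ennreal (w r) * ennreal (F s / (s * w s)) * (if r < s \<and> r < t then 1 else 0) \<partial>unit_leb) =
        (\<integral>\<^sup>+r. ennreal (F s / (s * w s)) * (ennreal (w r) * indicator {..<?m} r) \<partial>unit_leb)"
      by (rule nn_integral_unit_leb_cong) (auto simp: mult_ac split: split_indicator)
    also have "\<dots> = ennreal (F s / (s * w s)) * (\<integral>\<^sup>+r. ennreal (w r) * indicator {..<?m} r \<partial>unit_leb)"
      by (rule nn_integral_cmult) measurable
    also have "\<dots> \<le> ennreal (F s / (s * w s)) * ennreal (K * ?m * w ?m)"
      using m by (intro mult_left_mono nn_integral_w_le) auto
    also have "\<dots> = ennreal (F s / (s * w s) * (K * ?m * w ?m))"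
      using Mplus_nonneg[OF F s] s w_pos[OF s] by (intro ennreal_mult'[symmetric]) auto
    also have "\<dots> \<le> ennreal (K * C * (F s * e s))"
    proof (rule ennreal_leI)
      have a: "?m * w ?m \<le> C * qn ?m"
        using qn_bounds(2)[OF m] C by (simp add: pos_divide_le_eq mult.commute)
      have "(?m * w ?m) / (s * w s) \<le> (C * qn ?m) / qn s"
        using a qn_bounds(1,3)[OF s] m w_pos[OF m] qn_bounds(3)[OF m] C by (intro frac_le) auto
      then have "(?m * w ?m) / (s * w s) \<le> C * e s" by (simp add: e_def)
      then have "(F s * K) * ((?m * w ?m) / (s * w s)) \<le> (F s * K) * (C * e s)"
        using Mplus_nonneg[OF F s] K_pos by (intro mult_left_mono) auto
      then show "F s / (s * w s) * (K * ?m * w ?m) \<le> K * C * (F s * e s)"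
        by (simp only: times_divide_eq_left times_divide_eq_right mult_ac)
    qed
    also have "\<dots> = ennreal (K * C) * (ennreal (F s) * ennreal (e s))"
      using Mplus_nonneg[OF F s] e0[OF s] K_pos C by (simp add: ennreal_mult)
    finally show "(\<integral>\<^sup>+r. ennreal (w r) * ennreal (F s / (s * w s)) * (if r < s \<and> r < t then 1 else 0) \<partial>unit_leb) \<le>
        ennreal (K * C) * (ennreal (F s) * ennreal (e s))" .
  qed
  also have "\<dots> = ennreal (K * C) * (\<integral>\<^sup>+s. ennreal (F s) * ennreal (e s) \<partial>unit_leb)"
    by (rule nn_integral_cmult) measurable
  also have "(\<integral>\<^sup>+s. ennreal (F s) * ennreal (e s) \<partial>unit_leb) = (\<integral>\<^sup>+s. ennreal (norm (F s)) * ennreal (norm (e s)) \<partial>unit_leb)"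
    by (rule nn_integral_unit_leb_cong) (simp add: Mplus_nonneg[OF F] e0)
  also have "\<dots> \<le> (\<integral>\<^sup>+s. ennreal (rearr unit_leb F s) * ennreal (rearr unit_leb e s) \<partial>unit_leb)"
    by (rule hardy_littlewood(1)[OF P Fm em])
  also have "\<dots> = (\<integral>\<^sup>+s. ennreal (rearr unit_leb F s) * ennreal (e s) \<partial>unit_leb)"
  proof (rule nn_integral_cong_AE)
    have "AE s in unit_leb. rearr unit_leb e s = e s" by (rule rearr_antimono_on_AE[OF ea]) (rule e0)
    then show "AE s in unit_leb. ennreal (rearr unit_leb F s) * ennreal (rearr unit_leb e s) =
        ennreal (rearr unit_leb F s) * ennreal (e s)"
      by eventually_elim simp
  qed
  also have "\<dots> \<le> ennreal (1 + C * D * J 1) * (\<integral>\<^sup>+s. ennreal (rearr unit_leb F s) * indicator {..<Psi t} s \<partial>unit_leb)"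
    unfolding e_def by (rule S_tail_bound[OF D rearr_antimono_unit[OF P Fm] _ t]) (auto intro: rearr_nonneg[OF P Fm])
  also have "ennreal (K * C) * \<dots> = ennreal (K * C * (1 + C * D * J 1)) * (\<integral>\<^sup>+s. ennreal (rearr unit_leb F s) * indicator {..<Psi t} s \<partial>unit_leb)"
    using K_pos C D(1) J1_pos by (simp add: ennreal_mult mult.assoc)
  finally show ?thesis by (simp add: mult_left_mono)
qed

end

section \<open>The equivalence\<close>

context two_spaces
begin

lemma ri_norm_powr:
  assumes "ri_axioms Z" "prob_space M" "f \<in> borel_measurable M"
  shows "epowr (ri_norm Z M f) p = root_space p Z (\<lambda>t. rearr M f t powr p)"
  unfolding ri_norm_def using root_space_powr[OF assms(1) p rearr_Mplus[OF assms(2,3)]] by simp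

text \<open>Statement (iv) on the unit ball, stripped of measurability and finiteness;
  \<open>pair_bound\<close> uses it in this form.\<close>

definition dual_bounded :: "real \<Rightarrow> bool" where
  "dual_bounded c \<longleftrightarrow> 0 < c \<and> (\<forall>k\<in>Mplus. associate ZY (rearr unit_leb k) \<le> 1 \<longrightarrow>
     associate ZX (HP (rearr unit_leb k)) \<le> ennreal c)"

lemma ri_norm_le_of_domination:
  assumes c: "dual_bounded c" and M: "prob_space M" "f \<in> borel_measurable M"
    and N: "prob_space N" "g \<in> borel_measurable N" and fin: "ri_norm X M f < \<infinity>" and d: "0 < d"
    and dom: "\<And>t. t \<in> {0<..<1} \<Longrightarrow> wint p b1 N g t \<le> ennreal d * wint p (\<lambda>_. 1) M f (Psi t)"
  shows "ri_norm Y N g \<le> ennreal ((c * d) powr (1/p)) * ri_norm X M f"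
proof (rule epowr_le_cmult_imp[OF p])
  show "0 < c * d" using c d by (simp add: dual_bounded_def)
  show "epowr (ri_norm Y N g) p \<le> ennreal (c * d) * epowr (ri_norm X M f) p"
    unfolding ri_norm_powr[OF X M] ri_norm_powr[OF Y N]
  proof (rule pair_bound)
    show "ZX (\<lambda>t. rearr M f t powr p) < \<infinity>"
      using fin by (simp add: ri_norm_powr[OF X M, symmetric])
    show "decreasing (\<lambda>t. rearr N g t powr p)" "decreasing (\<lambda>t. rearr M f t powr p)"
      by (intro decreasing_powr decreasing_rearr M N p)+
    fix t :: real assume t: "t \<in> {0<..<1}"
    have "(\<integral>\<^sup>+s. ennreal (rearr N g s powr p * w s) * indicator {..<t} s \<partial>unit_leb) = wint p b1 N g t"
      unfolding wint_def
      by (rule nn_integral_unit_leb_cong) (simp add: w_def powr_mult rearr_nonneg[OF N] b1_pos less_imp_le)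
    also have "\<dots> \<le> ennreal d * wint p (\<lambda>_. 1) M f (Psi t)" by (rule dom[OF t])
    finally show "(\<integral>\<^sup>+s. ennreal (rearr N g s powr p * w s) * indicator {..<t} s \<partial>unit_leb) \<le>
        ennreal d * (\<integral>\<^sup>+s. ennreal (rearr M f s powr p) * indicator {..<Psi t} s \<partial>unit_leb)"
      by (simp add: wint_def)
  qed (use c d in \<open>auto simp: dual_bounded_def\<close>)
qed

text \<open>(P5) for the norm of \<open>X^(1/p)\<close> is an embedding of \<open>X\<close> into
  L^p, so operators on L^p are defined on all of \<open>X\<close>.\<close>

lemma ri_space_Lp:
  assumes M: "prob_space M" and f: "f \<in> ri_space X M"
  shows "f \<in> Lp_space p M"
proof -
  have fm: "f \<in> borel_measurable M" and fin: "ri_norm X M f < \<infinity>" using f by (auto simp: ri_space_def)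
  obtain CL where CL: "0 < CL" "\<And>f. f \<in> Mplus \<Longrightarrow> (\<integral>\<^sup>+t. ennreal (f t) \<partial>unit_leb) \<le> ennreal CL * ZX f"
    using zx.Z_L1 by blast
  have "wint p (\<lambda>_. 1) M f 1 = (\<integral>\<^sup>+s. ennreal (rearr M f s powr p) \<partial>unit_leb)"
    unfolding wint_def by (rule nn_integral_unit_leb_cong) simp
  also have "\<dots> \<le> ennreal CL * epowr (ri_norm X M f) p"
    unfolding ri_norm_powr[OF X M fm] by (intro CL Mplus_powr rearr_Mplus M fm)
  also have "\<dots> < \<infinity>" using fin by (simp add: ennreal_mult_less_top)
  finally show ?thesis using Lp_space_wint[OF M fm] by simp
qed

lemma gaussible_bounded:
  assumes c: "dual_bounded c" and M: "prob_space M" and N: "prob_space N" and T: "gaussible p b1 b2 M N T"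
  shows "ri_bounded X M Y N T"
proof -
  obtain d where d: "0 < d" and op: "operator_on_Lp p M N T"
    and dom: "\<And>f t. f \<in> Lp_space p M \<Longrightarrow> t \<in> {0<..<1} \<Longrightarrow>
      wint p b1 N (T f) t \<le> ennreal d * wint p (\<lambda>_. 1) M f (Psi t)"
    using T unfolding gaussible_iff_wint[OF M] by blast
  show ?thesis
    unfolding ri_bounded_def
  proof (intro exI ballI conjI)
    fix f assume f: "f \<in> ri_space X M"
    then have fm: "f \<in> borel_measurable M" and fin: "ri_norm X M f < \<infinity>" by (auto simp: ri_space_def)
    have fL: "f \<in> Lp_space p M" by (rule ri_space_Lp[OF M f])
    show Tm: "T f \<in> borel_measurable N" using op fL by (simp add: operator_on_Lp_def)
    show "ri_norm Y N (T f) \<le> ennreal ((c * d) powr (1/p)) * ri_norm X M f"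
      by (rule ri_norm_le_of_domination[OF c M fm N Tm fin d]) (rule dom[OF fL])
  qed
qed

section \<open>Transfer between the abstract spaces and the unit interval\<close>

lemma dilated_decreasing:
  assumes "decreasing h"
  shows "decreasing (\<lambda>t. h (Psi t) / b2 t)"
  unfolding decreasing_def
proof (intro conjI monotone_onI ballI)
  fix s t :: real assume st: "s \<in> {0<..<1}" "t \<in> {0<..<1}" "s \<le> t"
  show "h (Psi t) / b2 t \<le> h (Psi s) / b2 s"
    using st decreasing_D[OF assms Psi_open[OF st(1)] Psi_open[OF st(2)]] decreasing_nonneg[OF assms Psi_open[OF st(1)]]
      b2_pos monotone_onD[OF b2_mono st] by (intro frac_le) (auto simp: Psi_le_iff)
next
  fix t :: real assume t: "t \<in> {0<..<1}"
  show "0 \<le> h (Psi t) / b2 t" using decreasing_nonneg[OF assms Psi_open[OF t]] b2_pos[OF t] by simp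
qed

lemma U_op_eq: "t \<in> {0<..<1} \<Longrightarrow> U_op p b1 b2 f t = ennreal (rearr unit_leb f (Psi t) / b2 t)"
  by (simp add: U_op_def sigma_inv_pow_eq)

lemma U_op_bounded_iff:
  "ri_bounded_ext X Y (U_op p b1 b2) \<longleftrightarrow> (\<exists>c. \<forall>f\<in>ri_space X unit_leb.
     Y (rearr unit_leb (\<lambda>t. rearr unit_leb f (Psi t) / b2 t)) \<le> ennreal c * X (rearr unit_leb f))"
proof -
  have "U_op p b1 b2 f \<in> borel_measurable unit_leb \<and> (AE t in unit_leb. U_op p b1 b2 f t < \<infinity>) \<and>
      ri_norm Y unit_leb (\<lambda>t. enn2real (U_op p b1 b2 f t)) =
        Y (rearr unit_leb (\<lambda>t. rearr unit_leb f (Psi t) / b2 t))" (is "?A \<and> ?B \<and> ?C")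
    if "f \<in> ri_space X unit_leb" for f
  proof (intro conjI)
    have f: "f \<in> borel_measurable unit_leb" using that by (simp add: ri_space_def)
    let ?k = "\<lambda>t. rearr unit_leb f (Psi t) / b2 t"
    have k: "decreasing ?k" by (intro dilated_decreasing decreasing_rearr prob_space_unit_leb f)
    note [measurable] = decreasing_measurable[OF k]
    have "(\<lambda>t. ennreal (?k t)) \<in> borel_measurable unit_leb" by measurable
    moreover have "U_op p b1 b2 f t = ennreal (?k t)" if "t \<in> space unit_leb" for t
      using that by (simp add: U_op_eq)
    ultimately show m [measurable]: ?A using measurable_cong by (metis (no_types, lifting))
    show ?B by (rule AE_unit_leb_I) (simp add: U_op_eq)
    have "rearr unit_leb (\<lambda>t. enn2real (U_op p b1 b2 f t)) = rearr unit_leb ?k"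
      by (rule rearr_cong_AE, measurable, rule AE_unit_leb_I) (simp add: U_op_eq decreasing_nonneg[OF k])
    then show ?C by (simp add: ri_norm_def)
  qed
  then show ?thesis unfolding ri_bounded_ext_def ri_norm_def by (intro ex_cong1 ball_cong refl) auto
qed

text \<open>The witness is a copy of \<open>U\<close> transported to \<open>N\<close> by a measure-preserving map.\<close>
lemma U_op_bounded:
  assumes M: "prob_space M" "nonatomic M" and N: "prob_space N" "nonatomic N"
    and all: "\<And>T. gaussible p b1 b2 M N T \<Longrightarrow> ri_bounded X M Y N T"
  shows "ri_bounded_ext X Y (U_op p b1 b2)"
proof -
  note P = prob_space_unit_leb
  \<comment> \<open>Any uniformly distributed map will do, so the factorisation is applied to the
    zero function.\<close>
  obtain s where s: "uniform_map N s"
    using nonatomic_uniform_map[OF N, of "\<lambda>_. 0 :: real"] by auto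
  obtain s' where s': "uniform_map M s'"
    using nonatomic_uniform_map[OF M, of "\<lambda>_. 0 :: real"] by auto
  define k where "k f t = rearr M f (Psi t) / b2 t" for f :: "'a \<Rightarrow> complex" and t
  define T where "T f y = complex_of_real (rearr unit_leb (k f) (s y))" for f :: "'a \<Rightarrow> complex" and y
  have k: "decreasing (k f)" if "f \<in> borel_measurable M" for f
    unfolding k_def[abs_def] by (intro dilated_decreasing decreasing_rearr M that)
  have Tm: "T f \<in> borel_measurable N" if "f \<in> borel_measurable M" for f
  proof -
    have [measurable]: "(\<lambda>y. rearr unit_leb (k f) (s y)) \<in> borel_measurable N"
      by (rule rearr_uniform_map_measurable[OF P decreasing_measurable[OF k[OF that]] s])
    show ?thesis unfolding T_def[abs_def] by measurable
  qed
  have Tr: "rearr N (T f) = rearr unit_leb (k f)" if "f \<in> borel_measurable M" for f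
    unfolding T_def[abs_def] rearr_of_real
    by (rule rearr_uniform_map[OF P decreasing_measurable[OF k[OF that]] N(1) s])
  have "gaussible p b1 b2 M N T"
    unfolding gaussible_iff_wint[OF M(1)]
  proof (intro conjI exI[of _ "J 1"] ballI)
    show "operator_on_Lp p M N T"
      unfolding operator_on_Lp_def
    proof (intro conjI ballI impI)
      fix f g assume "f \<in> Lp_space p M" "g \<in> Lp_space p M" and ae: "AE x in M. f x = g x"
      then have "rearr M f = rearr M g"
        by (intro rearr_cong_AE) (auto simp: Lp_space_def elim: eventually_mono)
      then show "AE y in N. T f y = T g y" by (simp add: T_def k_def[abs_def])
    qed (simp add: Tm Lp_space_def)
    fix f and t :: real assume f: "f \<in> Lp_space p M" and t: "t \<in> {0<..<1}"
    have fm: "f \<in> borel_measurable M" using f by (simp add: Lp_space_def)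
    have "wint p b1 N (T f) t = (\<integral>\<^sup>+s. ennreal ((k f s * b1 s) powr p) * indicator {..<t} s \<partial>unit_leb)"
      unfolding wint_def Tr[OF fm]
    proof (rule nn_integral_cong_AE)
      show "AE s in unit_leb. ennreal ((rearr unit_leb (k f) s * b1 s) powr p) * indicator {..<t} s =
          ennreal ((k f s * b1 s) powr p) * indicator {..<t} s"
        using decreasing_rearr_AE[OF k[OF fm]] by eventually_elim simp
    qed
    also have "\<dots> = (\<integral>\<^sup>+s\<in>{0<..<t}. ennreal ((rearr M f (sigma_inv_pow p b1 b2 s) * b1 s / b2 s) powr p) \<partial>lebesgue)"
      using t by (subst nn_integral_set_unit_leb) (auto intro!: nn_integral_unit_leb_cong simp: k_def sigma_inv_pow_eq)
    also have "\<dots> = ennreal (J 1) * wint p (\<lambda>_. 1) M f (Psi t)" by (rule wint_Psi[OF M(1) fm t])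
    finally show "wint p b1 N (T f) t \<le> ennreal (J 1) * wint p (\<lambda>_. 1) M f (Psi t)" by simp
  qed (rule J1_pos)
  then obtain c where c: "\<And>f. f \<in> ri_space X M \<Longrightarrow> ri_norm Y N (T f) \<le> ennreal c * ri_norm X M f"
    using all unfolding ri_bounded_def by blast
  show ?thesis
    unfolding U_op_bounded_iff
  proof (intro exI ballI)
    fix g assume g: "g \<in> ri_space X unit_leb"
    then have gm: "g \<in> borel_measurable unit_leb" by (simp add: ri_space_def)
    \<comment> \<open>Transport in the other direction: an arbitrary function on the unit interval
      gets an equimeasurable copy on \<open>M\<close>, to which the boundedness of \<open>T\<close>
      applies.\<close>
    define f where "f x = complex_of_real (rearr unit_leb g (s' x))" for x
    have fm: "f \<in> borel_measurable M"
      unfolding f_def[abs_def] using rearr_uniform_map_measurable[OF P gm s'] by measurable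
    have fr: "rearr M f = rearr unit_leb g"
      unfolding f_def[abs_def] rearr_of_real by (rule rearr_uniform_map[OF P gm M(1) s'])
    have "f \<in> ri_space X M" using g fm by (simp add: ri_space_def ri_norm_def fr)
    from c[OF this] show "Y (rearr unit_leb (\<lambda>t. rearr unit_leb g (Psi t) / b2 t)) \<le> ennreal c * X (rearr unit_leb g)"
      by (simp add: ri_norm_def Tr[OF fm] fr k_def[abs_def])
  qed
qed

lemma U_op_bounded_root:
  assumes "ri_bounded_ext X Y (U_op p b1 b2)"
  shows "\<exists>c\<ge>0. \<forall>F\<in>Mplus. ZX F < \<infinity> \<longrightarrow> ZY (\<lambda>s. rearr unit_leb F (Psi s) / v s) \<le> ennreal c * ZX F"
proof -
  note P = prob_space_unit_leb
  obtain c where c: "\<And>f. f \<in> ri_space X unit_leb \<Longrightarrow>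
      Y (rearr unit_leb (\<lambda>t. rearr unit_leb f (Psi t) / b2 t)) \<le> ennreal c * X (rearr unit_leb f)"
    using assms unfolding U_op_bounded_iff by blast
  \<comment> \<open>\<open>c\<close> is only some real number; positivity is needed for the power
    rule.\<close>
  define d where "d = max c 1"
  have "ZY (\<lambda>s. rearr unit_leb F (Psi s) / v s) \<le> ennreal (d powr p) * ZX F"
    if F: "F \<in> Mplus" and fin: "ZX F < \<infinity>" for F
  proof -
    have Fm [measurable]: "F \<in> borel_measurable unit_leb" using F by auto
    define f where "f t = complex_of_real (F t powr (1/p))" for t
    have fm [measurable]: "f \<in> borel_measurable unit_leb" unfolding f_def[abs_def] by measurable
    have fr: "rearr unit_leb f t powr p = rearr unit_leb F t" if "0 < t" for t
    proof -
      have "rearr unit_leb f = rearr unit_leb (\<lambda>t. norm (F t) powr (1/p))"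
        by (rule rearr_cong_AE, measurable, rule AE_unit_leb_I) (simp add: f_def Mplus_nonneg[OF F])
      then show ?thesis using rearr_powr[OF P Fm that, of "1/p"] p rearr_nonneg[OF P Fm, of t] that
        by (simp add: powr_powr)
    qed
    have Xf: "epowr (ri_norm X unit_leb f) p = ZX F"
    proof -
      have "epowr (ri_norm X unit_leb f) p = ZX (\<lambda>t. rearr unit_leb f t powr p)" by (rule ri_norm_powr[OF X P fm])
      also have "\<dots> = ZX (rearr unit_leb F)"
        by (rule zx.Z_cong_AE) (auto intro!: AE_unit_leb_I Mplus_powr rearr_Mplus P fm Fm simp: fr)
      also have "\<dots> = ZX F"
        by (rule zx.Z_rearr_cong[OF rearr_Mplus[OF P Fm] F]) (simp only: rearr_rearr[OF P Fm])
      finally show ?thesis .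
    qed
    let ?k = "\<lambda>t. rearr unit_leb f (Psi t) / b2 t"
    have k: "decreasing ?k" by (intro dilated_decreasing decreasing_rearr P fm)
    have km: "?k \<in> borel_measurable unit_leb" by (rule decreasing_measurable[OF k])
    have "ri_norm X unit_leb f < \<infinity>" using fin by (simp add: Xf[symmetric])
    then have "f \<in> ri_space X unit_leb" by (simp add: ri_space_def fm)
    from c[OF this] have "ri_norm Y unit_leb ?k \<le> ennreal c * ri_norm X unit_leb f" by (simp add: ri_norm_def)
    also have "\<dots> \<le> ennreal d * ri_norm X unit_leb f" by (intro mult_right_mono ennreal_leI) (auto simp: d_def)
    finally have "epowr (ri_norm Y unit_leb ?k) p \<le> epowr (ennreal d * ri_norm X unit_leb f) p"
      by (rule epowr_mono[OF _ p])
    also have "\<dots> = ennreal (d powr p) * ZX F"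
      using p by (simp add: epowr_cmult d_def Xf)
    finally have *: "epowr (ri_norm Y unit_leb ?k) p \<le> ennreal (d powr p) * ZX F" .
    have "ZY (\<lambda>s. rearr unit_leb F (Psi s) / v s) = ZY (\<lambda>t. rearr unit_leb ?k t powr p)"
    proof (rule zy.Z_cong_AE)
      have eq: "?k t powr p = rearr unit_leb F (Psi t) / v t" if "t \<in> {0<..<1}" for t
      proof -
        have "0 < Psi t" using Psi_open[OF that] by simp
        then show ?thesis
          using b2_pos[OF that] rearr_nonneg[OF P fm, of "Psi t"]
          by (simp add: powr_divide fr v_def)
      qed
      have "decreasing (\<lambda>s. rearr unit_leb F (Psi s) / v s)"
        using decreasing_powr[OF k p] by (simp add: decreasing_def monotone_on_def eq)
      then show "(\<lambda>s. rearr unit_leb F (Psi s) / v s) \<in> Mplus" by (rule decreasing_Mplus)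
      show "(\<lambda>t. rearr unit_leb ?k t powr p) \<in> Mplus" by (intro Mplus_powr rearr_Mplus P km)
      show "AE t in unit_leb. rearr unit_leb F (Psi t) / v t = rearr unit_leb ?k t powr p"
        using decreasing_rearr_AE[OF k] AE_space by eventually_elim (simp add: eq)
    qed
    then show ?thesis using * by (simp only: ri_norm_powr[OF Y P km])
  qed
  then show ?thesis by (intro exI[of _ "d powr p"]) auto
qed

lemma T_op_norm:
  assumes f: "f \<in> borel_measurable unit_leb"
  shows "T_op p b1 b2 f \<in> borel_measurable unit_leb" "AE t in unit_leb. T_op p b1 b2 f t < \<infinity>"
    "ri_norm (associate Z) unit_leb (\<lambda>t. enn2real (T_op p b1 b2 f t)) = associate Z (HP (rearr unit_leb f))"
proof -
  let ?H = "HP (rearr unit_leb f)"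
  have H: "decreasing ?H" by (intro decreasing_HP decreasing_rearr prob_space_unit_leb f)
  note [measurable] = decreasing_measurable[OF H]
  have "(\<lambda>t. ennreal (?H t)) \<in> borel_measurable unit_leb" by measurable
  moreover have "T_op p b1 b2 f t = ennreal (?H t)" if "t \<in> space unit_leb" for t
    using that by (simp add: T_op_eq[OF f])
  ultimately show m [measurable]: "T_op p b1 b2 f \<in> borel_measurable unit_leb"
    using measurable_cong by (metis (no_types, lifting))
  show "AE t in unit_leb. T_op p b1 b2 f t < \<infinity>" by (rule AE_unit_leb_I) (simp add: T_op_eq[OF f])
  have "rearr unit_leb (\<lambda>t. enn2real (T_op p b1 b2 f t)) = rearr unit_leb ?H"
    by (rule rearr_cong_AE, measurable, rule AE_unit_leb_I) (simp add: T_op_eq[OF f] decreasing_nonneg[OF H])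
  moreover have "associate Z (rearr unit_leb ?H) = associate Z ?H"
    by (rule associate_cong_AE) (rule decreasing_rearr_AE[OF H])
  ultimately show "ri_norm (associate Z) unit_leb (\<lambda>t. enn2real (T_op p b1 b2 f t)) = associate Z ?H"
    by (simp add: ri_norm_def)
qed

lemma T_op_bounded:
  assumes "ri_bounded_ext X Y (U_op p b1 b2)"
  shows "ri_bounded_ext (associate ZY) (associate ZX) (T_op p b1 b2)"
proof -
  obtain c where c: "0 \<le> c" "\<And>F. F \<in> Mplus \<Longrightarrow> ZX F < \<infinity> \<Longrightarrow>
      ZY (\<lambda>s. rearr unit_leb F (Psi s) / v s) \<le> ennreal c * ZX F"
    using U_op_bounded_root[OF assms] by blast
  obtain d where d: "\<And>h. decreasing h \<Longrightarrow> associate ZY h < \<infinity> \<Longrightarrow>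
      associate ZX (HP h) \<le> ennreal d * associate ZY h"
    using dual_bound[OF c] by blast
  show ?thesis
    unfolding ri_bounded_ext_def
  proof (intro exI ballI conjI)
    fix f assume "f \<in> ri_space (associate ZY) unit_leb"
    then have f: "f \<in> borel_measurable unit_leb" "associate ZY (rearr unit_leb f) < \<infinity>"
      by (auto simp: ri_space_def ri_norm_def)
    show "T_op p b1 b2 f \<in> borel_measurable unit_leb" "AE t in unit_leb. T_op p b1 b2 f t < \<infinity>"
      by (rule T_op_norm[OF f(1)])+
    show "ri_norm (associate ZX) unit_leb (\<lambda>t. enn2real (T_op p b1 b2 f t)) \<le>
        ennreal d * ri_norm (associate ZY) unit_leb f"
      unfolding T_op_norm(3)[OF f(1)] ri_norm_def[of "associate ZY"]
      by (rule d[OF decreasing_rearr[OF prob_space_unit_leb f(1)] f(2)])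
  qed
qed

lemma dual_bounded_of_T_op:
  assumes "ri_bounded_ext (associate ZY) (associate ZX) (T_op p b1 b2)"
  shows "\<exists>c. dual_bounded c"
proof -
  obtain c where c: "\<And>f. f \<in> ri_space (associate ZY) unit_leb \<Longrightarrow>
      ri_norm (associate ZX) unit_leb (\<lambda>t. enn2real (T_op p b1 b2 f t)) \<le> ennreal c * ri_norm (associate ZY) unit_leb f"
    using assms unfolding ri_bounded_ext_def by blast
  have "dual_bounded (max c 1)"
    unfolding dual_bounded_def
  proof (intro conjI ballI impI)
    fix k assume k: "k \<in> Mplus" and le: "associate ZY (rearr unit_leb k) \<le> 1"
    have [measurable]: "k \<in> borel_measurable unit_leb" using k by auto
    let ?f = "\<lambda>t. complex_of_real (k t)"
    have fm: "?f \<in> borel_measurable unit_leb" by measurable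
    have "?f \<in> ri_space (associate ZY) unit_leb"
      using fm le by (auto simp: ri_space_def ri_norm_def rearr_of_real intro: le_less_trans)
    from c[OF this] have "associate ZX (HP (rearr unit_leb k)) \<le> ennreal c * associate ZY (rearr unit_leb k)"
      unfolding T_op_norm(3)[OF fm] by (simp add: ri_norm_def rearr_of_real)
    also have "\<dots> \<le> ennreal (max c 1) * 1" using le by (intro mult_mono ennreal_leI) auto
    finally show "associate ZX (HP (rearr unit_leb k)) \<le> ennreal (max c 1)" by simp
  qed simp
  then show ?thesis by blast
qed

lemma S_op_bounded:
  assumes c: "dual_bounded c" and D: "0 \<le> D"
    "\<And>t. t \<in> {0<..<1} \<Longrightarrow> ennreal (v t) *
      (\<integral>\<^sup>+s. ennreal (1 / (s * w s)) * indicator {t<..} s \<partial>unit_leb) \<le> ennreal D"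
  shows "ri_bounded_ext X Y (S_op p b1)"
proof -
  note P = prob_space_unit_leb
  obtain CL where CL: "0 < CL" "\<And>f. f \<in> Mplus \<Longrightarrow> (\<integral>\<^sup>+t. ennreal (f t) \<partial>unit_leb) \<le> ennreal CL * ZX f"
    using zx.Z_L1 by blast
  define d where "d = K * C * (1 + C * D * J 1)"
  have "0 \<le> C * D * J 1" using C D(1) J1_pos by simp
  then have d: "0 < d" unfolding d_def using K_pos C by (intro mult_pos_pos) auto
  show ?thesis
    unfolding ri_bounded_ext_def
  proof (rule exI[of _ "(c * d) powr (1/p)"], rule ballI)
    fix f assume "f \<in> ri_space X unit_leb"
    then have fm [measurable]: "f \<in> borel_measurable unit_leb" and fin: "ri_norm X unit_leb f < \<infinity>"
      by (auto simp: ri_space_def)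
    define F where "F t = norm (f t) powr p" for t
    have Fm [measurable]: "F \<in> borel_measurable unit_leb" unfolding F_def[abs_def] by measurable
    have F: "F \<in> Mplus" by (rule MplusI) (simp_all add: F_def)
    have Fr: "rearr unit_leb F t = rearr unit_leb f t powr p" if "0 < t" for t
      unfolding F_def[abs_def] by (rule rearr_powr[OF P fm that p])
    have ZF: "ZX (\<lambda>t. rearr unit_leb f t powr p) = ZX F"
    proof -
      have "ZX (\<lambda>t. rearr unit_leb f t powr p) = ZX (rearr unit_leb F)"
        by (rule zx.Z_cong_AE) (auto intro!: AE_unit_leb_I Mplus_powr rearr_Mplus P simp: Fr)
      also have "\<dots> = ZX F"
        by (rule zx.Z_rearr_cong[OF rearr_Mplus[OF P Fm] F]) (simp only: rearr_rearr[OF P Fm])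
      finally show ?thesis .
    qed
    have Ffin: "ZX F < \<infinity>" using fin by (simp add: ZF[symmetric] ri_norm_powr[OF X P fm, symmetric])
    define SG where "SG r = (\<integral>\<^sup>+s. ennreal (F s / (s * w s)) * indicator {r<..} s \<partial>unit_leb)" for r
    \<comment> \<open>On the right of \<open>r\<close> the factor \<open>1 / (s * w s)\<close> is at
      most \<open>C / (r * w r)\<close>, and \<open>F\<close> is integrable by (P5) for
      \<open>X^(1/p)\<close>. So the tail integral is finite at every point, which is part of the
      claim.\<close>
    have SG_fin: "SG r < top" if r: "r \<in> {0<..<1}" for r
    proof -
      have rw: "0 < r * w r" using r w_pos[OF r] by simp
      have "SG r \<le> (\<integral>\<^sup>+s. ennreal (C / (r * w r)) * ennreal (F s) \<partial>unit_leb)"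
        unfolding SG_def
      proof (rule nn_integral_unit_leb_mono)
        fix s :: real assume s: "s \<in> {0<..<1}"
        show "ennreal (F s / (s * w s)) * indicator {r<..} s \<le> ennreal (C / (r * w r)) * ennreal (F s)"
        proof (cases "r < s")
          case True
          have "r * w r \<le> C * (s * w s)" using True r s by (intro w_times_almost_mono) auto
          moreover have "0 < s * w s" using s w_pos[OF s] by simp
          ultimately have "1 / (s * w s) \<le> C / (r * w r)" using rw by (simp add: field_simps)
          then have "F s * (1 / (s * w s)) \<le> F s * (C / (r * w r))" by (intro mult_left_mono) (simp_all add: F_def)
          then have "ennreal (F s / (s * w s)) \<le> ennreal (C / (r * w r) * F s)"
            by (intro ennreal_leI) (simp add: mult.commute)
          also have "\<dots> = ennreal (C / (r * w r)) * ennreal (F s)" by (rule ennreal_mult'') (simp add: F_def)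
          finally show ?thesis using True by simp
        qed simp
      qed
      also have "\<dots> = ennreal (C / (r * w r)) * (\<integral>\<^sup>+s. ennreal (F s) \<partial>unit_leb)" by (rule nn_integral_cmult) measurable
      also have "\<dots> \<le> ennreal (C / (r * w r)) * (ennreal CL * ZX F)" by (intro mult_left_mono CL F) simp
      also have "\<dots> < top" using Ffin by (simp add: ennreal_mult_less_top)
      finally show ?thesis .
    qed
    define G where "G r = enn2real (SG r)" for r
    have SG: "SG r = ennreal (G r)" if "r \<in> {0<..<1}" for r using SG_fin[OF that] by (simp add: G_def)
    have G: "decreasing G"
      unfolding decreasing_def
    proof (intro conjI monotone_onI ballI)
      fix r t :: real assume rt: "r \<in> {0<..<1}" "t \<in> {0<..<1}" "r \<le> t"
      have "SG t \<le> SG r" unfolding SG_def using rt by (intro nn_integral_mono) (auto split: split_indicator)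
      then show "G t \<le> G r" unfolding G_def using SG_fin[OF rt(1)] by (intro enn2real_mono) auto
    qed (simp add: G_def)
    have Gp: "decreasing (\<lambda>t. G t powr (1/p))" using p by (intro decreasing_powr G) simp
    note Gpm [measurable] = decreasing_measurable[OF Gp]
    have S: "S_op p b1 f t = ennreal (G t powr (1/p))" if t: "t \<in> {0<..<1}" for t
    proof -
      have "(\<integral>\<^sup>+s\<in>{t<..<1}. ennreal (norm (f s) powr p / (s * b1 s powr p)) \<partial>lebesgue) = SG t"
        unfolding SG_def F_def w_def using t by (intro nn_integral_set_unit_leb_upper) auto
      then show ?thesis using decreasing_nonneg[OF G t] by (simp add: S_op_def SG[OF t] epowr_ennreal)
    qed
    have "(\<lambda>t. ennreal (G t powr (1/p))) \<in> borel_measurable unit_leb" by measurable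
    moreover have "S_op p b1 f t = ennreal (G t powr (1/p))" if "t \<in> space unit_leb" for t
      using that by (simp add: S)
    ultimately have Sm [measurable]: "S_op p b1 f \<in> borel_measurable unit_leb"
      using measurable_cong by (metis (no_types, lifting))
    have Sf: "AE t in unit_leb. S_op p b1 f t < \<infinity>" by (rule AE_unit_leb_I) (simp add: S)
    have "rearr unit_leb (\<lambda>t. enn2real (S_op p b1 f t)) = rearr unit_leb (\<lambda>t. G t powr (1/p))"
      by (rule rearr_cong_AE, measurable, rule AE_unit_leb_I) (simp add: S)
    then have Sn: "ri_norm Y unit_leb (\<lambda>t. enn2real (S_op p b1 f t)) = ri_norm Y unit_leb (\<lambda>t. G t powr (1/p))"
      by (simp add: ri_norm_def)
    have "epowr (ri_norm Y unit_leb (\<lambda>t. G t powr (1/p))) p = ZY G"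
    proof -
      have "epowr (ri_norm Y unit_leb (\<lambda>t. G t powr (1/p))) p = ZY (\<lambda>t. rearr unit_leb (\<lambda>t. G t powr (1/p)) t powr p)"
        by (rule ri_norm_powr[OF Y P Gpm])
      also have "\<dots> = ZY G"
      proof (rule zy.Z_cong_AE[OF _ decreasing_Mplus[OF G]])
        show "(\<lambda>t. rearr unit_leb (\<lambda>t. G t powr (1/p)) t powr p) \<in> Mplus" by (intro Mplus_powr rearr_Mplus P Gpm)
        show "AE t in unit_leb. rearr unit_leb (\<lambda>t. G t powr (1/p)) t powr p = G t"
          using decreasing_rearr_AE[OF Gp] AE_space
          by eventually_elim (use p decreasing_nonneg[OF G] in \<open>simp add: powr_powr\<close>)
      qed
      finally show ?thesis .
    qed
    also have "ZY G \<le> ennreal (c * d) * ZX (\<lambda>t. rearr unit_leb f t powr p)"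
    proof (rule pair_bound)
      show "decreasing (\<lambda>t. rearr unit_leb f t powr p)" by (intro decreasing_powr decreasing_rearr P fm p)
      fix t :: real assume t: "t \<in> {0<..<1}"
      have "(\<integral>\<^sup>+r. ennreal (G r * w r) * indicator {..<t} r \<partial>unit_leb) =
          (\<integral>\<^sup>+r. SG r * ennreal (w r) * indicator {..<t} r \<partial>unit_leb)"
        by (rule nn_integral_unit_leb_cong) (simp add: SG ennreal_mult decreasing_nonneg[OF G] less_imp_le[OF w_pos])
      also have "\<dots> \<le> ennreal d * (\<integral>\<^sup>+s. ennreal (rearr unit_leb F s) * indicator {..<Psi t} s \<partial>unit_leb)"
        unfolding SG_def d_def by (rule S_domination[OF D(1) D(2)[OF t] F t])
      also have "(\<integral>\<^sup>+s. ennreal (rearr unit_leb F s) * indicator {..<Psi t} s \<partial>unit_leb) =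
          (\<integral>\<^sup>+s. ennreal (rearr unit_leb f s powr p) * indicator {..<Psi t} s \<partial>unit_leb)"
        by (rule nn_integral_unit_leb_cong) (simp add: Fr)
      finally show "(\<integral>\<^sup>+r. ennreal (G r * w r) * indicator {..<t} r \<partial>unit_leb) \<le>
          ennreal d * (\<integral>\<^sup>+s. ennreal (rearr unit_leb f s powr p) * indicator {..<Psi t} s \<partial>unit_leb)" .
    qed (use c d G ZF Ffin in \<open>auto simp: dual_bounded_def\<close>)
    finally have "epowr (ri_norm Y unit_leb (\<lambda>t. G t powr (1/p))) p \<le> ennreal (c * d) * epowr (ri_norm X unit_leb f) p"
      by (simp only: ri_norm_powr[OF X P fm])
    then have "ri_norm Y unit_leb (\<lambda>t. G t powr (1/p)) \<le> ennreal ((c * d) powr (1/p)) * ri_norm X unit_leb f"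
      by (rule epowr_le_cmult_imp[OF p, rotated]) (use c d in \<open>simp add: dual_bounded_def\<close>)
    then show "S_op p b1 f \<in> borel_measurable unit_leb \<and> (AE t in unit_leb. S_op p b1 f t < \<infinity>) \<and>
        ri_norm Y unit_leb (\<lambda>t. enn2real (S_op p b1 f t)) \<le> ennreal ((c * d) powr (1/p)) * ri_norm X unit_leb f"
      using Sm Sf Sn by simp
  qed
qed

end

theorem theorem3p11:
  fixes M :: "'a measure" and N :: "'b measure"
    and p :: real and b1 b2 :: "real \<Rightarrow> real"
    and X Y :: functional
  assumes "prob_space M" and "nonatomic M"
    and "prob_space N" and "nonatomic N"
    and "0 < p" and "(b1, b2) \<in> class_B p"
    and "ri_quasi_norm X" and "p_convex p X"
    and "ri_quasi_norm Y" and "p_convex p Y"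
  shows
    "((\<forall>T. gaussible p b1 b2 M N T \<longrightarrow> ri_bounded X M Y N T) \<longleftrightarrow>
      (\<forall>T. operator_on_Lp p M N T \<and> K_dominated p b1 b2 M N T \<longrightarrow> ri_bounded X M Y N T))
     \<and>
     ((\<forall>T. operator_on_Lp p M N T \<and> K_dominated p b1 b2 M N T \<longrightarrow> ri_bounded X M Y N T) \<longleftrightarrow>
      (ri_bounded_ext X Y (U_op p b1 b2) \<and> ri_bounded_ext X Y (S_op p b1)))
     \<and>
     ((ri_bounded_ext X Y (U_op p b1 b2) \<and> ri_bounded_ext X Y (S_op p b1)) \<longleftrightarrow>
      ri_bounded_ext (associate (root_space p Y)) (associate (root_space p X)) (T_op p b1 b2))"
proof -
  note M = assms(1,2) and N = assms(3,4)
  obtain C D where "gauss_weights p b1 b2 C" and D: "0 \<le> D"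
    "\<And>t. t \<in> {0<..<1} \<Longrightarrow> ennreal (b2 t powr p) *
      (\<integral>\<^sup>+s. ennreal (1 / (s * b1 s powr p)) * indicator {t<..} s \<partial>unit_leb) \<le> ennreal D"
    using class_B_weights[OF assms(5,6)] by blast
  then interpret gauss_weights p b1 b2 C by simp
  interpret two_spaces p b1 b2 C X Y
    by unfold_locales (use assms in \<open>auto simp: ri_quasi_norm_def p_convex_def\<close>)
  let ?i = "\<forall>T. gaussible p b1 b2 M N T \<longrightarrow> ri_bounded X M Y N T"
  let ?U = "ri_bounded_ext X Y (U_op p b1 b2)" and ?S = "ri_bounded_ext X Y (S_op p b1)"
  let ?T = "ri_bounded_ext (associate ZY) (associate ZX) (T_op p b1 b2)"
  have ii: "gaussible p b1 b2 M N T \<longleftrightarrow> operator_on_Lp p M N T \<and> K_dominated p b1 b2 M N T" for T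
    by (rule gaussible_iff_K_dominated[OF M(1) N(1)])
  have "?i \<Longrightarrow> ?U" by (rule U_op_bounded[OF M N]) blast
  moreover have "?U \<Longrightarrow> ?T" by (rule T_op_bounded)
  moreover have "?i" "?S" if T: "?T"
  proof -
    obtain c where c: "dual_bounded c" using dual_bounded_of_T_op[OF T] by blast
    show "?i" using gaussible_bounded[OF c M(1) N(1)] by blast
    show "?S" by (rule S_op_bounded[OF c D(1)]) (use D(2) in \<open>simp add: v_def w_def\<close>)
  qed
  ultimately show ?thesis unfolding ii[symmetric] by blast
qed

end
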